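(* There exists $\varepsilon_0>0$ such that for every $\varepsilon\in(0,\varepsilon_0]$ there exists $Y^{\mathrm{ms}}<0$ such that the unique solution $(d,w,\chi)$ to the initial value problem (EXT) of the context exists on the interval $(Y^{\mathrm{ms}},0]$, and \[\lim_{Y\to (Y^{\mathrm{ms}})^+}w(Y)=\lim_{Y\to (Y^{\mathrm{ms}})^+}d(Y)=\infty,\qquad \chi(Y)>0\ \text{ for } Y\in(Y^{\mathrm{ms}},0],\qquad \lim_{Y\to (Y^{\mathrm{ms}})^+}\chi(Y)=0.\]
   Context: Fix small $\varepsilon>0$, $\eta=\frac{2\varepsilon}{1-\varepsilon}$. The self-similar Einstein--Euler system for $D>0$ and $W$ as functions of $x>0$ is \[D'=-\frac{2x(1-\varepsilon)D(W+\varepsilon)(D-W)}{B},\quad W'=\frac{1-3W}{x}+\frac{2x(1+\varepsilon)W(W+\varepsilon)(D-W)}{B},\quad B=D^{-\eta}-[(W+\varepsilon)^2-\varepsilon(W-1)^2+4\varepsilon DW]x^2.\] RLP-type solutions. Given $x_*$, put $z=x/x_*$, $\mathcal R(z)=D(x)$, $\mathcal W(z)=W(x)$, $\delta z=z-1$. Formal series $\mathcal R=\sum_{N\ge0}\mathcal R_N(\delta z)^N$, $\mathcal W=\sum_{N\ge0}\mathcal W_N(\delta z)^N$ are of relativistic Larson--Penston (RLP) type if: (1) $\mathcal R_0=\mathcal W_0=\omega$, where $\omega=\omega(\varepsilon;x_* )>0$ is the branch, $C^1$ in $\varepsilon$ near $0$ with $\omega(0;x_* )=1/x_*$, of solutions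 of $[(1+3\varepsilon)\omega^2+4\varepsilon\omega+\varepsilon(\varepsilon-1)]\omega^{\eta}=x_*^{-2}$; (2) as formal power series in $\delta z$, $\mathcal B\mathcal R'+2x_*^2(1-\varepsilon)z\mathcal R(\mathcal W+\varepsilon)(\mathcal R-\mathcal W)=0$ and $\mathcal B\mathcal W'-\frac{(1-3\mathcal W)\mathcal B}{z}-2x_*^2(1+\varepsilon)z\mathcal W(\mathcal W+\varepsilon)(\mathcal R-\mathcal W)=0$, with $\mathcal B=\mathcal R^{-\eta}-[(\mathcal W+\varepsilon)^2-\varepsilon(\mathcal W-1)^2+4\varepsilon\mathcal R\mathcal W]x_*^2z^2$; (3) with $H_0=(1+3\varepsilon)\omega^2+4\varepsilon\omega+\varepsilon^2-\varepsilon$, $a=\omega(\omega+\varepsilon)$, $b=\frac{\varepsilon}{1-\varepsilon}\frac{H_0}{\omega}+2\varepsilon\omega$, $c=3\omega-1$, $\mathfrak d=(1+\varepsilon)\omega+2\varepsilon$, $e=(3+5\varepsilon)\omega^2-(1-8\varepsilon+\varepsilon^2)\omega-(3\varepsilon-\varepsilon^2)$, $f=(1-\varepsilon)a-H_0$, $h=(1+\varepsilon)a+bc$, and $a_3=\mathfrak d(\mathfrak dh-be)-b(f\mathfrak d+(1-\varepsilon)ab)$, $a_2=-[bc\mathfrak dH_0-e(\mathfrak dh-be)+h(f\mathfrak d+(1-\varepsilon)ab)+b(fe+(1-\varepsilon)ah)]$, $a_1=-[bceH_0-cH_0(\mathfrak dh-be)+bcfH_0+h(fe+(1-\varepsilon)ah)]$,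 $a_0=-cH_0(bcH_0+fh)$, let $\mathcal W_1^{\mathrm{gh}}(\varepsilon)$ be the real root of $X^3+\frac{a_2}{a_3}X^2+\frac{a_1}{a_3}X+\frac{a_0}{a_3}$ depending continuously on $\varepsilon$ with value $-1/x_*$ at $\varepsilon=0$; then $\mathcal W_1=\frac12\big(-[\frac{a_2}{a_3}+\mathcal W_1^{\mathrm{gh}}]+\sqrt{\Delta_Q}\big)$, $\Delta_Q=(\frac{a_2}{a_3}+\mathcal W_1^{\mathrm{gh}})^2+\frac{4a_0}{a_3\mathcal W_1^{\mathrm{gh}}}$, and $\mathcal R_1=-\frac{\mathfrak d\mathcal W_1^2+e\mathcal W_1+cH_0}{h+b\mathcal W_1}$. Coefficients with $N\ge2$ are then uniquely determined by (2). For small $\varepsilon$ the series converge near $z=1$ and define a real-analytic solution $(D(\cdot;x_* ),W(\cdot;x_* ))$ near $x=x_*$, the RLP-type solution associated with $x_*$. Sonic window. $x_{\max}(\varepsilon)$ is defined by $\omega(\varepsilon;x_{\max})=\frac13$. $x_{\mathrm{crit}}(\varepsilon)=2+O(\sqrt\varepsilon)>2$ is the largest zero of $\Delta_Q(\varepsilon;\cdot)$ below $x_{\max}$. $x_{\min}=2+\delta_0>x_{\mathrm{crit}}$, where $\delta_0>0$ is a fixed small constant, independent of $\varepsilon$, such that for all sufficiently small $\varepsilon$ the RLP-type solution with $x_*=2+\delta_0$ satisfies $\mathcal W(z_0)>\frac1{2-2\eta}$ for some $z_0\in(0,1)$. Critical point. For $x_*\in[x_{\min},x_{\max}]$ the sonic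 time $s(x_* )$ is the infimum of all $x\in(0,x_*]$ such that the RLP-type solution extends to a solution on $[x,x_* )$ with $B>0$ on $[x,x_* )$. Let $\mathcal X_{1/3}=\{x_*\in[x_{\min},x_{\max}]:\exists x\in(s(x_* ),x_*]\text{ with }W(x;x_* )=\frac13\}$, $X=\{x_*\in[x_{\min},x_{\max}]:\tilde x_*\in\mathcal X_{1/3}\ \forall\tilde x_*\in[x_*,x_{\max}]\}$ and $\bar x_*=\inf X$. For small $\varepsilon$ the RLP-type solution $(D,W)=(D(\cdot;\bar x_* ),W(\cdot;\bar x_* ))$ exists on $[0,\infty)$, and the limits $d_2:=\lim_{x\to\infty}x^{2/(1+\eta)}D(x)>0$, $w_1:=-\lim_{x\to\infty}x^{1/(1+\eta)}(1-W(x))<0$ exist. Initial value problem (EXT): for functions $d,w,\chi$ of $Y$ near $0$, \[d'=\frac{2\chi^2}{Y}\frac{d(w+\varepsilon)^2(d-w)}{\mathcal C},\quad w'=-\frac{(w+\varepsilon)(1-3w)}{(1-\varepsilon)Y}-\frac{2(1+\varepsilon)\chi^2}{(1-\varepsilon)Y}\frac{w(w+\varepsilon)^2(d-w)}{\mathcal C},\quad \chi'=\frac{1-w}{(1-\varepsilon)Y}\chi,\] \[\mathcal C=(dY^{-2})^{-\eta}Y^2-\chi^2[(w+\varepsilon)^2-\varepsilon(w-1)^2+4\varepsilon wd],\] with $\lim_{Y\to0}d(Y)/Y^2=d_2$, $w(0)=1$, $w'(0)=w_1$, $\chi(0)=1$. "The unique solution" is the unique solution that is real-analytic in $Y$ near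 $Y=0$, continued to negative $Y$. *)

theory Defs
  imports
    "HOL-Analysis.Analysis"
    "HOL-Computational_Algebra.Formal_Power_Series"
begin

definition eta :: "real \<Rightarrow> real" where
  "eta \<epsilon> = 2 * \<epsilon> / (1 - \<epsilon>)"

section \<open>The self-similar Einstein--Euler system\<close>

definition ss_B :: "real \<Rightarrow> real \<Rightarrow> real \<Rightarrow> real \<Rightarrow> real" where
  "ss_B \<epsilon> x D W = D powr (- eta \<epsilon>)
     - ((W + \<epsilon>)^2 - \<epsilon> * (W - 1)^2 + 4 * \<epsilon> * D * W) * x^2"

text \<open>The quotients below are meant only where \<open>ss_B\<close> is nonzero and \<open>D > 0\<close>; every solution
  notion built on \<open>ss_ode\<close> demands this explicitly.\<close>

definition ss_ode ::
    "real \<Rightarrow> (real \<Rightarrow> real) \<Rightarrow> (real \<Rightarrow> real) \<Rightarrow> real \<Rightarrow> real set \<Rightarrow> bool" where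
  "ss_ode \<epsilon> D W x S \<longleftrightarrow>
     (D has_real_derivative
        - (2 * x * (1 - \<epsilon>) * D x * (W x + \<epsilon>) * (D x - W x) / ss_B \<epsilon> x (D x) (W x)))
        (at x within S) \<and>
     (W has_real_derivative
        (1 - 3 * W x) / x
        + 2 * x * (1 + \<epsilon>) * W x * (W x + \<epsilon>) * (D x - W x) / ss_B \<epsilon> x (D x) (W x))
        (at x within S)"

section \<open>Sonic value and first Taylor coefficients\<close>

definition H0 :: "real \<Rightarrow> real \<Rightarrow> real" where
  "H0 \<epsilon> \<omega> = (1 + 3 * \<epsilon>) * \<omega>^2 + 4 * \<epsilon> * \<omega> + \<epsilon>^2 - \<epsilon>"

text \<open>\<open>\<Omega>\<close> is the branch \<open>\<epsilon> \<mapsto> \<omega>(\<epsilon>; x)\<close> on a neighbourhood \<open>(-\<delta>, \<delta>)\<close> of \<open>0\<close>.\<close>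

definition omega_branch :: "real \<Rightarrow> real \<Rightarrow> (real \<Rightarrow> real) \<Rightarrow> bool" where
  "omega_branch x \<delta> \<Omega> \<longleftrightarrow>
     0 < x \<and> 0 < \<delta> \<and> \<Omega> C1_differentiable_on {-\<delta><..<\<delta>} \<and> \<Omega> 0 = 1 / x \<and>
     (\<forall>e\<in>{-\<delta><..<\<delta>}. 0 < \<Omega> e \<and>
        ((1 + 3 * e) * (\<Omega> e)^2 + 4 * e * \<Omega> e + e * (e - 1)) * \<Omega> e powr eta e = 1 / x^2)"

text \<open>Values taken along branches are expressed as relations rather than as functions of
  \<open>(\<epsilon>, x)\<close>, so that parameters for which the branch does not reach \<open>\<epsilon>\<close> contribute no value
  at all.\<close>

definition omega_value :: "real \<Rightarrow> real \<Rightarrow> real \<Rightarrow> bool" where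
  "omega_value \<epsilon> x \<omega> \<longleftrightarrow>
     (\<exists>\<delta> \<Omega>. omega_branch x \<delta> \<Omega> \<and> \<epsilon> \<in> {-\<delta><..<\<delta>} \<and> \<Omega> \<epsilon> = \<omega>)"

definition ca :: "real \<Rightarrow> real \<Rightarrow> real" where
  "ca \<epsilon> \<omega> = \<omega> * (\<omega> + \<epsilon>)"

definition cb :: "real \<Rightarrow> real \<Rightarrow> real" where
  "cb \<epsilon> \<omega> = \<epsilon> / (1 - \<epsilon>) * (H0 \<epsilon> \<omega> / \<omega>) + 2 * \<epsilon> * \<omega>"

definition cc :: "real \<Rightarrow> real" where
  "cc \<omega> = 3 * \<omega> - 1"

definition cd :: "real \<Rightarrow> real \<Rightarrow> real" where
  "cd \<epsilon> \<omega> = (1 + \<epsilon>) * \<omega> + 2 * \<epsilon>"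

definition ce :: "real \<Rightarrow> real \<Rightarrow> real" where
  "ce \<epsilon> \<omega> = (3 + 5 * \<epsilon>) * \<omega>^2 - (1 - 8 * \<epsilon> + \<epsilon>^2) * \<omega> - (3 * \<epsilon> - \<epsilon>^2)"

definition cf :: "real \<Rightarrow> real \<Rightarrow> real" where
  "cf \<epsilon> \<omega> = (1 - \<epsilon>) * ca \<epsilon> \<omega> - H0 \<epsilon> \<omega>"

definition ch :: "real \<Rightarrow> real \<Rightarrow> real" where
  "ch \<epsilon> \<omega> = (1 + \<epsilon>) * ca \<epsilon> \<omega> + cb \<epsilon> \<omega> * cc \<omega>"

definition a3 :: "real \<Rightarrow> real \<Rightarrow> real" where
  "a3 \<epsilon> \<omega> = (let H = H0 \<epsilon> \<omega>; a = ca \<epsilon> \<omega>; b = cb \<epsilon> \<omega>; c = cc \<omega>; d = cd \<epsilon> \<omega>;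
      e = ce \<epsilon> \<omega>; f = cf \<epsilon> \<omega>; h = ch \<epsilon> \<omega>
    in d * (d * h - b * e) - b * (f * d + (1 - \<epsilon>) * a * b))"

definition a2 :: "real \<Rightarrow> real \<Rightarrow> real" where
  "a2 \<epsilon> \<omega> = (let H = H0 \<epsilon> \<omega>; a = ca \<epsilon> \<omega>; b = cb \<epsilon> \<omega>; c = cc \<omega>; d = cd \<epsilon> \<omega>;
      e = ce \<epsilon> \<omega>; f = cf \<epsilon> \<omega>; h = ch \<epsilon> \<omega>
    in - (b * c * d * H - e * (d * h - b * e) + h * (f * d + (1 - \<epsilon>) * a * b)
          + b * (f * e + (1 - \<epsilon>) * a * h)))"

definition a1 :: "real \<Rightarrow> real \<Rightarrow> real" where
  "a1 \<epsilon> \<omega> = (let H = H0 \<epsilon> \<omega>; a = ca \<epsilon> \<omega>; b = cb \<epsilon> \<omega>; c = cc \<omega>; d = cd \<epsilon> \<omega>;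
      e = ce \<epsilon> \<omega>; f = cf \<epsilon> \<omega>; h = ch \<epsilon> \<omega>
    in - (b * c * e * H - c * H * (d * h - b * e) + b * c * f * H
          + h * (f * e + (1 - \<epsilon>) * a * h)))"

definition a0 :: "real \<Rightarrow> real \<Rightarrow> real" where
  "a0 \<epsilon> \<omega> = (let H = H0 \<epsilon> \<omega>; b = cb \<epsilon> \<omega>; c = cc \<omega>; f = cf \<epsilon> \<omega>; h = ch \<epsilon> \<omega>
    in - (c * H * (b * c * H + f * h)))"

text \<open>\<open>g\<close> is the value at \<open>\<epsilon>\<close> of the ghost root \<open>\<W>\<^sub>1\<^sup>g\<^sup>h\<close>, followed continuously
  from \<open>-1/x\<close> at \<open>\<epsilon> = 0\<close>.\<close>

definition ghost_value :: "real \<Rightarrow> real \<Rightarrow> real \<Rightarrow> bool" where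
  "ghost_value \<epsilon> x g \<longleftrightarrow>
     (\<exists>\<delta> \<Omega> G. omega_branch x \<delta> \<Omega> \<and> \<epsilon> \<in> {-\<delta><..<\<delta>} \<and>
        continuous_on {-\<delta><..<\<delta>} G \<and> G 0 = - 1 / x \<and>
        (\<forall>e\<in>{-\<delta><..<\<delta>}. (G e)^3 + a2 e (\<Omega> e) / a3 e (\<Omega> e) * (G e)^2
            + a1 e (\<Omega> e) / a3 e (\<Omega> e) * G e + a0 e (\<Omega> e) / a3 e (\<Omega> e) = 0) \<and>
        G \<epsilon> = g)"

definition Delta_Q :: "real \<Rightarrow> real \<Rightarrow> real \<Rightarrow> real" where
  "Delta_Q \<epsilon> \<omega> g = (a2 \<epsilon> \<omega> / a3 \<epsilon> \<omega> + g)^2 + 4 * a0 \<epsilon> \<omega> / (a3 \<epsilon> \<omega> * g)"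

definition W1_coeff :: "real \<Rightarrow> real \<Rightarrow> real \<Rightarrow> real" where
  "W1_coeff \<epsilon> \<omega> g = (1/2) * (- (a2 \<epsilon> \<omega> / a3 \<epsilon> \<omega> + g) + sqrt (Delta_Q \<epsilon> \<omega> g))"

definition R1_coeff :: "real \<Rightarrow> real \<Rightarrow> real \<Rightarrow> real" where
  "R1_coeff \<epsilon> \<omega> v =
     - ((cd \<epsilon> \<omega> * v^2 + ce \<epsilon> \<omega> * v + cc \<omega> * H0 \<epsilon> \<omega>) / (ch \<epsilon> \<omega> + cb \<epsilon> \<omega> * v))"

section \<open>RLP-type series and solutions\<close>

text \<open>Real power of a formal series with positive constant term, by the binomial series.\<close>

definition fps_rpow :: "real fps \<Rightarrow> real \<Rightarrow> real fps" where
  "fps_rpow F p = fps_const (fps_nth F 0 powr p)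
     * (fps_binomial p oo (fps_const (1 / fps_nth F 0) * F - 1))"

text \<open>The formal variable is \<open>\<delta>z\<close>, so \<open>z\<close> is the series \<open>1 + fps_X\<close>.\<close>

definition fps_B :: "real \<Rightarrow> real \<Rightarrow> real fps \<Rightarrow> real fps \<Rightarrow> real fps" where
  "fps_B \<epsilon> xs R V = fps_rpow R (- eta \<epsilon>)
     - ((V + fps_const \<epsilon>)^2 - fps_const \<epsilon> * (V - 1)^2 + fps_const (4 * \<epsilon>) * R * V)
       * fps_const (xs^2) * (1 + fps_X)^2"

definition rlp_series :: "real \<Rightarrow> real \<Rightarrow> real fps \<Rightarrow> real fps \<Rightarrow> bool" where
  "rlp_series \<epsilon> xs R V \<longleftrightarrow>
     (\<exists>\<omega> g. omega_value \<epsilon> xs \<omega> \<and> ghost_value \<epsilon> xs g \<and>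
        fps_nth R 0 = \<omega> \<and> fps_nth V 0 = \<omega> \<and>
        fps_nth V 1 = W1_coeff \<epsilon> \<omega> g \<and>
        fps_nth R 1 = R1_coeff \<epsilon> \<omega> (fps_nth V 1)) \<and>
     fps_B \<epsilon> xs R V * fps_deriv R
       + fps_const (2 * xs^2 * (1 - \<epsilon>)) * (1 + fps_X) * R * (V + fps_const \<epsilon>) * (R - V) = 0 \<and>
     fps_B \<epsilon> xs R V * fps_deriv V
       - (1 - fps_const 3 * V) * fps_B \<epsilon> xs R V * inverse (1 + fps_X)
       - fps_const (2 * xs^2 * (1 + \<epsilon>)) * (1 + fps_X) * V * (V + fps_const \<epsilon>) * (R - V) = 0"

definition rlp_germ :: "real \<Rightarrow> real \<Rightarrow> (real \<Rightarrow> real) \<Rightarrow> (real \<Rightarrow> real) \<Rightarrow> bool" where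
  "rlp_germ \<epsilon> xs D W \<longleftrightarrow>
     (\<exists>R V. rlp_series \<epsilon> xs R V \<and>
        (\<lambda>t. D (xs * (1 + t))) has_fps_expansion R \<and>
        (\<lambda>t. W (xs * (1 + t))) has_fps_expansion V)"

text \<open>Extension of the RLP-type solution to \<open>[x, xs)\<close> with \<open>B > 0\<close> there. At the sonic point
  \<open>xs\<close> itself (where \<open>B = 0\<close>) the solution is given by its series.\<close>

definition rlp_extension ::
    "real \<Rightarrow> real \<Rightarrow> real \<Rightarrow> (real \<Rightarrow> real) \<Rightarrow> (real \<Rightarrow> real) \<Rightarrow> bool" where
  "rlp_extension \<epsilon> xs x D W \<longleftrightarrow>
     rlp_germ \<epsilon> xs D W \<and>
     (\<forall>y\<in>{x..<xs}. 0 < D y \<and> 0 < ss_B \<epsilon> y (D y) (W y) \<and> ss_ode \<epsilon> D W y {x..<xs})"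

text \<open>At \<open>x = 0\<close>, where the system has the singular term \<open>(1 - 3 W) / x\<close>, the solution is
  required to be continuous.\<close>

definition rlp_global :: "real \<Rightarrow> real \<Rightarrow> (real \<Rightarrow> real) \<Rightarrow> (real \<Rightarrow> real) \<Rightarrow> bool" where
  "rlp_global \<epsilon> xs D W \<longleftrightarrow>
     rlp_germ \<epsilon> xs D W \<and>
     continuous_on {0..} D \<and> continuous_on {0..} W \<and> (\<forall>x\<ge>0. 0 < D x) \<and>
     (\<forall>x>0. x \<noteq> xs \<longrightarrow> ss_B \<epsilon> x (D x) (W x) \<noteq> 0 \<and> ss_ode \<epsilon> D W x UNIV)"

section \<open>Sonic window and critical point\<close>

definition xmax :: "real \<Rightarrow> real" where
  "xmax \<epsilon> = (THE x. omega_value \<epsilon> x (1/3))"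

definition xcrit :: "real \<Rightarrow> real" where
  "xcrit \<epsilon> = (GREATEST x. x < xmax \<epsilon> \<and>
     (\<exists>\<omega> g. omega_value \<epsilon> x \<omega> \<and> ghost_value \<epsilon> x g \<and> Delta_Q \<epsilon> \<omega> g = 0))"

text \<open>The constraints on the fixed constant \<open>\<delta>\<^sub>0\<close> in \<open>x\<^sub>m\<^sub>i\<^sub>n = 2 + \<delta>\<^sub>0\<close>. Smallness of \<open>\<delta>\<^sub>0\<close> is
  only needed to keep \<open>x\<^sub>m\<^sub>i\<^sub>n\<close> below \<open>x\<^sub>m\<^sub>a\<^sub>x\<close>, which tends to \<open>3\<close> as \<open>\<epsilon>\<close> tends to \<open>0\<close>.\<close>

definition admissible_delta0 :: "real \<Rightarrow> bool" where
  "admissible_delta0 \<delta>0 \<longleftrightarrow> 0 < \<delta>0 \<and>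
     (\<forall>\<^sub>F \<epsilon> in at_right 0.
        xcrit \<epsilon> < 2 + \<delta>0 \<and> 2 + \<delta>0 < xmax \<epsilon> \<and>
        (\<exists>z0\<in>{0<..<1}. \<exists>D W. rlp_extension \<epsilon> (2 + \<delta>0) (z0 * (2 + \<delta>0)) D W \<and>
            W (z0 * (2 + \<delta>0)) > 1 / (2 - 2 * eta \<epsilon>)))"

definition sonic_time :: "real \<Rightarrow> real \<Rightarrow> real" where
  "sonic_time \<epsilon> xs = Inf {x. 0 < x \<and> x \<le> xs \<and> (\<exists>D W. rlp_extension \<epsilon> xs x D W)}"

definition X_third :: "real \<Rightarrow> real \<Rightarrow> real set" where
  "X_third \<delta>0 \<epsilon> = {xs\<in>{2 + \<delta>0..xmax \<epsilon>}.
     \<exists>x\<in>{sonic_time \<epsilon> xs<..xs}. \<exists>D W. rlp_extension \<epsilon> xs x D W \<and> W x = 1/3}"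

definition X_set :: "real \<Rightarrow> real \<Rightarrow> real set" where
  "X_set \<delta>0 \<epsilon> = {xs\<in>{2 + \<delta>0..xmax \<epsilon>}. \<forall>x\<in>{xs..xmax \<epsilon>}. x \<in> X_third \<delta>0 \<epsilon>}"

definition xbar :: "real \<Rightarrow> real \<Rightarrow> real" where
  "xbar \<delta>0 \<epsilon> = Inf (X_set \<delta>0 \<epsilon>)"

section \<open>The extended problem\<close>

definition ext_C :: "real \<Rightarrow> real \<Rightarrow> real \<Rightarrow> real \<Rightarrow> real \<Rightarrow> real" where
  "ext_C \<epsilon> Y d w chi = (d / Y^2) powr (- eta \<epsilon>) * Y^2
     - chi^2 * ((w + \<epsilon>)^2 - \<epsilon> * (w - 1)^2 + 4 * \<epsilon> * w * d)"

definition ext_ode ::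
    "real \<Rightarrow> (real \<Rightarrow> real) \<Rightarrow> (real \<Rightarrow> real) \<Rightarrow> (real \<Rightarrow> real) \<Rightarrow> real \<Rightarrow> bool" where
  "ext_ode \<epsilon> d w chi Y \<longleftrightarrow>
     0 < d Y \<and> ext_C \<epsilon> Y (d Y) (w Y) (chi Y) \<noteq> 0 \<and>
     (d has_real_derivative
        2 * (chi Y)^2 / Y * (d Y * (w Y + \<epsilon>)^2 * (d Y - w Y) / ext_C \<epsilon> Y (d Y) (w Y) (chi Y)))
        (at Y) \<and>
     (w has_real_derivative
        - ((w Y + \<epsilon>) * (1 - 3 * w Y) / ((1 - \<epsilon>) * Y))
        - 2 * (1 + \<epsilon>) * (chi Y)^2 / ((1 - \<epsilon>) * Y)
          * (w Y * (w Y + \<epsilon>)^2 * (d Y - w Y) / ext_C \<epsilon> Y (d Y) (w Y) (chi Y)))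
        (at Y) \<and>
     (chi has_real_derivative (1 - w Y) / ((1 - \<epsilon>) * Y) * chi Y) (at Y)"

text \<open>A solution of the initial value problem that is real-analytic near \<open>Y = 0\<close>, continued to
  \<open>(Y0, 0]\<close>.\<close>

definition ext_solution ::
    "real \<Rightarrow> real \<Rightarrow> real \<Rightarrow> real \<Rightarrow> (real \<Rightarrow> real) \<Rightarrow> (real \<Rightarrow> real) \<Rightarrow> (real \<Rightarrow> real) \<Rightarrow> bool"
  where
  "ext_solution \<epsilon> d2 w1 Y0 d w chi \<longleftrightarrow>
     (\<exists>F. d has_fps_expansion F) \<and> (\<exists>F. w has_fps_expansion F) \<and> (\<exists>F. chi has_fps_expansion F) \<and>
     ((\<lambda>Y. d Y / Y^2) \<longlongrightarrow> d2) (at 0) \<and> w 0 = 1 \<and> (w has_real_derivative w1) (at 0) \<and> chi 0 = 1 \<and>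
     (\<forall>\<^sub>F Y in at 0. ext_ode \<epsilon> d w chi Y) \<and>
     (\<forall>Y\<in>{Y0<..<0}. ext_ode \<epsilon> d w chi Y)"

end

theory Submission
  imports Defs
begin

text \<open>
  Write \<open>v = D\<^sup>-\<^sup>\<eta> / x\<^sup>2\<close> and \<open>K = - B / x\<^sup>2\<close>. With respect to \<open>x d/dx\<close> the triple \<open>(D, W, v)\<close> satisfies an
  autonomous system, polynomial in \<open>D\<close>, \<open>W\<close>, \<open>v\<close> and \<open>(W - D) / K\<close>, and two ratios are monotone along it: \<open>Q = (1 - W) / sqrt v\<close> and
  \<open>M = W D / v\<close>. Beyond the sonic point \<open>K > 0\<close>, the sign of \<open>Q'\<close> is that of
  \<open>N = W K - (W + \<epsilon>)\<^sup>2 (W - D)\<close>, and \<open>N\<close> vanishes at the sonic point with positive derivative and cannot vanish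
  again. Hence \<open>- w1 d2\<^sup>\<eta>\<^sup>/\<^sup>2 = Q(\<infinity>) \<ge> (1 - \<omega>) / sqrt H0\<close>, which stays above a constant \<open>q > 1\<close> because
  \<open>x\<^sub>* \<ge> 2 + \<delta>0\<close>, and \<open>d2\<^sup>1\<^sup>+\<^sup>\<eta> = M(\<infinity>)\<close> stays above a constant greater than \<open>1\<close>.

  In the variables \<open>d = Y\<^sup>2 \<delta>\<close>, \<open>w = 1 + Y \<omega>\<close>, \<open>\<mu> = \<delta>\<^sup>-\<^sup>\<eta> / \<chi>\<^sup>2\<close> the extended problem is an ordinary differential equation
  that is analytic at \<open>Y = 0\<close>. For \<open>Y < 0\<close> the bounds on \<open>w1\<close> and \<open>d2\<close> turn into \<open>(w - 1) / sqrt v > q\<close>, which is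
  preserved since \<open>M\<close> increases. It forces \<open>d < w\<close> and \<open>K \<ge> c w\<^sup>2\<close>, so \<open>v\<close> obeys a Riccati-type
  inequality and blows up at a finite \<open>Y\<close>, and \<open>w\<close>, \<open>d\<close> and \<open>1 / \<chi>\<close> blow up with it.

  The window \<open>x\<^sub>* \<in> [2 + \<delta>0, xmax]\<close> for \<open>x\<^sub>* = xbar\<close> needs \<open>X_set\<close> to be nonempty. It contains \<open>xmax\<close>, where \<open>\<omega> = 1/3\<close>
  and the Taylor coefficients at the sonic point are explicit; convergence of the series follows by
  majorants.
\<close>

text \<open>At \<open>\<epsilon> = 0\<close> the sonic data are
  \<open>\<omega> = 1 / x\<^sub>*\<close> and \<open>H0 = \<omega>\<^sup>2\<close>, so
  \<open>(1 - \<omega>) / sqrt H0 = x\<^sub>* - 1\<close>, and the window puts it above 1 by a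
  margin independent of \<open>\<epsilon>\<close>. The margin serves for negative \<open>Y\<close>:
  \<open>K\<close> is at least about \<open>(1 - \<epsilon>) w\<^sup>2 - v\<close>, and
  \<open>v \<le> (w - 1)\<^sup>2 / q\<^sup>2\<close> makes this comparable to
  \<open>w\<^sup>2\<close> only if \<open>1 / q\<^sup>2 < 1 - \<epsilon>\<close>. The sonic value of
  \<open>M\<close>, \<open>\<omega>\<^sup>2 / H0\<close>, equals 1 at \<open>\<epsilon> = 0\<close>
  and gives no margin; that one comes from integrating the logarithmic derivative of
  \<open>M\<close> up to infinity, which contributes the factor \<open>exp (1 - \<omega>)\<close>.
  Smallness of \<open>\<epsilon>\<close> enters through strict inequalities between explicit
  functions of the sonic data, which hold at \<open>\<epsilon> = 0\<close> on compact sets and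
  persist by uniform continuity. The flow estimates are differential inequalities at fixed
  \<open>\<epsilon>\<close>, without comparison to a limiting flow. Sonic value and ghost root are
  given as relations, so every admissible value has to be confined.\<close>

section \<open>Majorants and fixed points of power series\<close>

text \<open>The weights \<open>1 / (n + 1)\<^sup>2\<close> reproduce themselves under convolution up to the factor \<open>16\<close>, so majorants
  survive multiplication.\<close>

definition maj :: "real \<Rightarrow> real \<Rightarrow> real fps \<Rightarrow> bool" where
  "maj r C F \<longleftrightarrow> (\<forall>n. \<bar>fps_nth F n\<bar> \<le> C * r ^ n / (real n + 1)^2)"

lemma majD: "maj r C F \<Longrightarrow> \<bar>fps_nth F n\<bar> \<le> C * r ^ n / (real n + 1)^2"
  by (simp add: maj_def)

lemma maj_nonneg: "maj r C F \<Longrightarrow> 0 \<le> C"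
  using majD[of r C F 0] by simp

lemma maj_mono: "maj r C F \<Longrightarrow> C \<le> C' \<Longrightarrow> 0 \<le> r \<Longrightarrow> maj r C' F"
  unfolding maj_def
  by (meson divide_right_mono mult_right_mono order_trans zero_le_power zero_le_power2)

lemma maj_const: "\<bar>c\<bar> \<le> C \<Longrightarrow> 0 \<le> r \<Longrightarrow> maj r C (fps_const c)"
  by (auto simp: maj_def intro!: divide_nonneg_nonneg mult_nonneg_nonneg order_trans[OF abs_ge_zero])

lemma maj_add: "maj r A F \<Longrightarrow> maj r B G \<Longrightarrow> maj r (A + B) (F + G)"
  unfolding maj_def by (auto simp: distrib_right add_divide_distrib intro!: order_trans[OF abs_triangle_ineq] add_mono)

lemma maj_minus: "maj r A F \<Longrightarrow> maj r A (- F)"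
  unfolding maj_def by simp

text \<open>The subtracted \<open>1 / (n + 1)\<close> makes the induction close:
  \<open>1 / (n + 2)\<^sup>2\<close> is below the telescoping difference
  \<open>1 / (n + 1) - 1 / (n + 2)\<close>.\<close>

lemma sum_inverse_squares_le: "(\<Sum>i\<le>n. 1 / (real i + 1)^2) \<le> 2 - 1 / (real n + 1)"
proof (induction n)
  case (Suc n)
  have "1 / (real n + 2)^2 \<le> 1 / (real n + 1) - 1 / (real n + 2)"
    by (simp add: divide_simps power2_eq_square)
  with Suc show ?case by (simp add: add.commute)
qed simp

text \<open>With \<open>a = i + 1\<close> and \<open>b = n - i + 1\<close> one has \<open>(n +
  1)\<^sup>2 \<le> (a + b)\<^sup>2 \<le> 4 (a\<^sup>2 + b\<^sup>2)\<close>. Division by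
  \<open>a\<^sup>2 b\<^sup>2 (n + 1)\<^sup>2\<close> splits each product into two inverse squares
  whose sums are at most 2; hence \<open>16 = 4 * (2 + 2)\<close>.\<close>

lemma convolution_inverse_squares_le:
  "(\<Sum>i=0..n. 1 / (real i + 1)^2 * (1 / (real (n - i) + 1)^2)) \<le> 16 / (real n + 1)^2"
proof -
  have le: "1 / (real i + 1)^2 * (1 / (real (n - i) + 1)^2)
      \<le> 4 / (real n + 1)^2 * (1 / (real i + 1)^2 + 1 / (real (n - i) + 1)^2)" if "i \<le> n" for i
  proof -
    define a where "a = real i + 1"
    define b where "b = real (n - i) + 1"
    have ab: "0 < a" "0 < b" "real n + 1 \<le> a + b" "0 < real n + 1"
      using that by (auto simp: a_def b_def of_nat_diff)
    have "(real n + 1)^2 \<le> (a + b)^2" using ab by (intro power_mono) auto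
    also have "\<dots> \<le> 4 * (a^2 + b^2)"
    proof -
      have "4 * (a^2 + b^2) - (a + b)^2 = (a - b)^2 + 2 * (a^2 + b^2)"
        by (simp add: power2_eq_square algebra_simps)
      moreover have "0 \<le> (a - b)^2 + 2 * (a^2 + b^2)" by simp
      ultimately show ?thesis by linarith
    qed
    finally have "1 \<le> 4 * (a^2 + b^2) / (real n + 1)^2" using ab by simp
    then have "1 / (a^2 * b^2) * 1 \<le> 1 / (a^2 * b^2) * (4 * (a^2 + b^2) / (real n + 1)^2)"
      by (intro mult_left_mono) auto
    also have "\<dots> = 4 / (real n + 1)^2 * (1 / a^2 + 1 / b^2)"
      using ab by (simp add: field_simps)
    finally show ?thesis by (simp add: a_def b_def)
  qed
  have "(\<Sum>i=0..n. 1 / (real i + 1)^2 * (1 / (real (n - i) + 1)^2))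
      \<le> (\<Sum>i=0..n. 4 / (real n + 1)^2 * (1 / (real i + 1)^2 + 1 / (real (n - i) + 1)^2))"
    by (intro sum_mono le) auto
  also have "\<dots> = 4 / (real n + 1)^2 * ((\<Sum>i=0..n. 1 / (real i + 1)^2) + (\<Sum>i=0..n. 1 / (real (n - i) + 1)^2))"
    by (simp only: sum_distrib_left [symmetric] sum.distrib)
  also have "(\<Sum>i=0..n. 1 / (real (n - i) + 1)^2) = (\<Sum>i=0..n. 1 / (real i + 1)^2)"
    by (subst sum.atLeastAtMost_rev) simp
  also have "4 / (real n + 1)^2 * ((\<Sum>i=0..n. 1 / (real i + 1)^2) + (\<Sum>i=0..n. 1 / (real i + 1)^2))
      \<le> 4 / (real n + 1)^2 * (2 + 2)"
    using sum_inverse_squares_le[of n]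
    by (intro mult_left_mono add_mono) (auto simp: atMost_atLeast0 intro: order_trans)
  finally show ?thesis by simp
qed

lemma maj_mult:
  assumes F: "maj r A F" and G: "maj r B G" and r: "0 \<le> r"
  shows "maj r (16 * A * B) (F * G)"
  unfolding maj_def
proof
  fix n
  have A: "0 \<le> A" and B: "0 \<le> B" using F G maj_nonneg by auto
  have "\<bar>fps_nth (F * G) n\<bar> \<le> (\<Sum>i=0..n. \<bar>fps_nth F i\<bar> * \<bar>fps_nth G (n - i)\<bar>)"
    unfolding fps_mult_nth by (rule order_trans[OF sum_abs]) (simp add: abs_mult)
  also have "\<dots> \<le> (\<Sum>i=0..n. (A * r ^ i / (real i + 1)^2) * (B * r ^ (n - i) / (real (n - i) + 1)^2))"
    by (intro sum_mono mult_mono majD[OF F] majD[OF G] divide_nonneg_nonneg mult_nonneg_nonneg A) (auto simp: r)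
  also have "\<dots> = (\<Sum>i=0..n. A * B * r ^ n * (1 / (real i + 1)^2 * (1 / (real (n - i) + 1)^2)))"
  proof (intro sum.cong refl)
    fix i assume "i \<in> {0..n}"
    then have "r ^ n = r ^ i * r ^ (n - i)" by (simp add: power_add [symmetric])
    then show "(A * r ^ i / (real i + 1)^2) * (B * r ^ (n - i) / (real (n - i) + 1)^2)
       = A * B * r ^ n * (1 / (real i + 1)^2 * (1 / (real (n - i) + 1)^2))" by simp
  qed
  also have "\<dots> = A * B * r ^ n * (\<Sum>i=0..n. 1 / (real i + 1)^2 * (1 / (real (n - i) + 1)^2))"
    by (simp add: sum_distrib_left)
  also have "\<dots> \<le> A * B * r ^ n * (16 / (real n + 1)^2)"
    using A B r by (intro mult_left_mono convolution_inverse_squares_le) auto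
  finally show "\<bar>fps_nth (F * G) n\<bar> \<le> 16 * A * B * r ^ n / (real n + 1)^2" by (simp add: algebra_simps)
qed

text \<open>Since \<open>n + 1 \<le> 2 n\<close> for positive \<open>n\<close>, shifting the index
  by one costs a factor 4 in the weight and gains \<open>1 / r\<close>. Large \<open>r\<close>
  therefore makes multiplication by \<open>fps_X\<close> and integration small operations.\<close>

lemma maj_shift_aux:
  fixes C r :: real
  assumes "0 \<le> C" "0 < r" "0 < n"
  shows "C * r ^ (n - 1) / (real (n - 1) + 1)^2 \<le> 4 * C / r * r ^ n / (real n + 1)^2"
proof -
  have "(real n + 1)^2 \<le> 4 * (real n)^2"
    using assms(3) power_mono[of "real n + 1" "2 * real n" 2] by simp
  then have "1 / (real n)^2 \<le> 4 / (real n + 1)^2"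
    using assms(3) by (simp add: field_simps)
  then have "C * r ^ (n - 1) * (1 / (real n)^2) \<le> C * r ^ (n - 1) * (4 / (real n + 1)^2)"
    using assms by (intro mult_left_mono) auto
  moreover have "r ^ n = r * r ^ (n - 1)" using assms(3) by (cases n) auto
  ultimately show ?thesis using assms by (simp add: of_nat_diff field_simps)
qed

lemma maj_X_mult:
  assumes "maj r C F" "0 < r" shows "maj r (4 * C / r) (fps_X * F)"
  unfolding maj_def
proof
  fix n
  show "\<bar>fps_nth (fps_X * F) n\<bar> \<le> 4 * C / r * r ^ n / (real n + 1)^2"
    using maj_shift_aux[of C r n] majD[OF assms(1), of "n - 1"] maj_nonneg[OF assms(1)] assms(2)
    by (cases "n = 0") auto
qed

lemma maj_integral:
  assumes "maj r C F" "0 < r" shows "maj r (4 * C / r) (fps_integral0 F)"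
  unfolding maj_def
proof
  fix n
  show "\<bar>fps_nth (fps_integral0 F) n\<bar> \<le> 4 * C / r * r ^ n / (real n + 1)^2"
  proof (cases "n = 0")
    case False
    have "\<bar>fps_nth (fps_integral0 F) n\<bar> = \<bar>fps_nth F (n - 1)\<bar> / real n"
      using False by (simp add: fps_integral_def field_simps)
    also have "\<dots> \<le> \<bar>fps_nth F (n - 1)\<bar>" using False by (simp add: divide_le_eq mult_le_cancel_left1)
    finally show ?thesis
      using maj_shift_aux[of C r n] majD[OF assms(1), of "n - 1"] maj_nonneg[OF assms(1)] assms(2) False
      by auto
  qed (use maj_nonneg[OF assms(1)] assms(2) in auto)
qed

text \<open>\<open>G = 1 - F G\<close> determines each coefficient of the inverse from earlier ones,
  because \<open>F\<close> has no constant term. Under the inductive bound 2 the convolution is at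
  most \<open>16 * C * 2 = 32 C\<close>, so the bound reproduces itself.\<close>

lemma maj_inverse_one_plus:
  assumes F: "maj r C F" and C: "32 * C \<le> 1" and r: "0 < r" and F0: "fps_nth F 0 = 0"
  shows "maj r 2 (inverse (1 + F))"
proof -
  define G where "G = inverse (1 + F)"
  have "(1 + F) * G = 1" unfolding G_def by (intro inverse_mult_eq_1') (simp add: F0)
  then have G: "G = 1 - F * G" by (simp add: algebra_simps)
  have G0: "fps_nth G 0 = 1" unfolding G_def by (simp add: F0)
  have C0: "0 \<le> C" using F maj_nonneg by auto
  have "\<bar>fps_nth G n\<bar> \<le> 2 * r ^ n / (real n + 1)^2" for n
  proof (induction n rule: less_induct)
    case (less n)
    show ?case
    proof (cases "n = 0")
      case False
      have "fps_nth G n = fps_nth (1 - F * G) n" using G by simp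
      also have "\<dots> = - (\<Sum>i=0..n. fps_nth F i * fps_nth G (n - i))"
        using False by (simp add: fps_mult_nth)
      finally have "\<bar>fps_nth G n\<bar> = \<bar>\<Sum>i=0..n. fps_nth F i * fps_nth G (n - i)\<bar>" by simp
      also have "\<dots> \<le> (\<Sum>i=0..n. \<bar>fps_nth F i\<bar> * \<bar>fps_nth G (n - i)\<bar>)"
        by (rule order_trans[OF sum_abs]) (simp add: abs_mult)
      also have "\<dots> \<le> (\<Sum>i=0..n. (C * r ^ i / (real i + 1)^2) * (2 * r ^ (n - i) / (real (n - i) + 1)^2))"
      proof (intro sum_mono)
        fix i assume i: "i \<in> {0..n}"
        show "\<bar>fps_nth F i\<bar> * \<bar>fps_nth G (n - i)\<bar>
          \<le> (C * r ^ i / (real i + 1)^2) * (2 * r ^ (n - i) / (real (n - i) + 1)^2)"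
        proof (cases "i = 0")
          case False
          then show ?thesis using i r C0 \<open>n \<noteq> 0\<close>
            by (intro mult_mono majD[OF F] less divide_nonneg_nonneg) auto
        qed (use F0 C0 r in auto)
      qed
      also have "\<dots> = (\<Sum>i=0..n. 2 * C * r ^ n * (1 / (real i + 1)^2 * (1 / (real (n - i) + 1)^2)))"
      proof (intro sum.cong refl)
        fix i assume "i \<in> {0..n}"
        then have "r ^ n = r ^ i * r ^ (n - i)" by (simp add: power_add [symmetric])
        then show "(C * r ^ i / (real i + 1)^2) * (2 * r ^ (n - i) / (real (n - i) + 1)^2)
           = 2 * C * r ^ n * (1 / (real i + 1)^2 * (1 / (real (n - i) + 1)^2))" by simp
      qed
      also have "\<dots> = 2 * C * r ^ n * (\<Sum>i=0..n. 1 / (real i + 1)^2 * (1 / (real (n - i) + 1)^2))"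
        by (simp add: sum_distrib_left)
      also have "\<dots> \<le> 2 * C * r ^ n * (16 / (real n + 1)^2)"
        using C0 r by (intro mult_left_mono convolution_inverse_squares_le) auto
      also have "\<dots> = (32 * C) * r ^ n / (real n + 1)^2" by simp
      also have "\<dots> \<le> 2 * r ^ n / (real n + 1)^2"
        using C r by (intro divide_right_mono mult_right_mono) auto
      finally show ?thesis .
    qed (simp add: G0)
  qed
  then show ?thesis by (simp add: maj_def G_def)
qed

lemma maj_conv_radius:
  assumes "maj r C F" "0 < r" shows "fps_conv_radius F > 0"
proof -
  have "summable (\<lambda>n. fps_nth F n * (1 / (2 * r)) ^ n)"
  proof (rule summable_comparison_test)
    show "\<exists>N. \<forall>n\<ge>N. norm (fps_nth F n * (1 / (2 * r)) ^ n) \<le> C * (1/2) ^ n"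
    proof (intro exI allI impI)
      fix n
      have "\<bar>fps_nth F n\<bar> \<le> C * r ^ n / 1"
        using majD[OF assms(1), of n] maj_nonneg[OF assms(1)] assms(2)
        by (elim order_trans) (intro divide_left_mono, auto simp: one_le_power)
      then have "\<bar>fps_nth F n\<bar> * (1 / (2 * r)) ^ n \<le> C * r ^ n * (1 / (2 * r)) ^ n"
        using assms(2) by (intro mult_right_mono) auto
      also have "\<dots> = C * (1/2) ^ n" using assms(2) by (simp add: power_divide power_mult_distrib)
      finally show "norm (fps_nth F n * (1 / (2 * r)) ^ n) \<le> C * (1/2) ^ n"
        using assms(2) by (simp add: abs_mult)
    qed
    show "summable (\<lambda>n. C * (1/2) ^ n :: real)" by (intro summable_mult summable_geometric) auto
  qed
  then have "conv_radius (fps_nth F) \<ge> norm (1 / (2 * r))" by (rule conv_radius_geI)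
  moreover have "ereal (norm (1 / (2 * r))) > 0" using assms(2) by simp
  ultimately show ?thesis unfolding fps_conv_radius_def by (meson less_le_trans)
qed

section \<open>Order-by-order fixed points of maps between power series\<close>

definition agree :: "nat \<Rightarrow> real fps \<Rightarrow> real fps \<Rightarrow> bool" where
  "agree n F G \<longleftrightarrow> (\<forall>k<n. fps_nth F k = fps_nth G k)"

lemma agree_refl [simp]: "agree n F F" by (simp add: agree_def)

lemma agree_add: "agree n F F' \<Longrightarrow> agree n G G' \<Longrightarrow> agree n (F + G) (F' + G')"
  and agree_minus: "agree n F F' \<Longrightarrow> agree n (- F) (- F')"
  by (simp_all add: agree_def)

lemma agree_mult: "agree n F F' \<Longrightarrow> agree n G G' \<Longrightarrow> agree n (F * G) (F' * G')"
  by (auto simp: agree_def fps_mult_nth intro!: sum.cong)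

text \<open>Index 0 of the first factor contributes nothing, so the coefficient of order
  \<open>n\<close> of the product uses the second factor only below order \<open>n\<close>.\<close>

lemma agree_Suc_mult1:
  assumes "agree (Suc n) F F'" "agree n G G'" "fps_nth F 0 = 0"
  shows "agree (Suc n) (F * G) (F' * G')"
  unfolding agree_def fps_mult_nth
proof (intro allI impI sum.cong refl)
  fix k i assume k: "k < Suc n" and i: "i \<in> {0..k}"
  have "fps_nth F' 0 = 0" using assms by (simp add: agree_def)
  with assms k i show "fps_nth F i * fps_nth G (k - i) = fps_nth F' i * fps_nth G' (k - i)"
    by (cases "i = 0") (auto simp: agree_def)
qed

text \<open>Both extreme terms of the convolution vanish, so order \<open>n\<close> of the product
  uses only orders below \<open>n\<close> of either factor.\<close>

lemma agree_Suc_mult2: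
  assumes "agree n F F'" "agree n G G'"
    "fps_nth F 0 = 0" "fps_nth G 0 = 0" "fps_nth F' 0 = 0" "fps_nth G' 0 = 0"
  shows "agree (Suc n) (F * G) (F' * G')"
  unfolding agree_def fps_mult_nth
proof (intro allI impI sum.cong refl)
  fix k i assume k: "k < Suc n" and i: "i \<in> {0..k}"
  with assms show "fps_nth F i * fps_nth G (k - i) = fps_nth F' i * fps_nth G' (k - i)"
    by (cases "i = 0 \<or> i = k") (auto simp: agree_def)
qed

lemma agree_integral: "agree n F G \<Longrightarrow> agree (Suc n) (fps_integral0 F) (fps_integral0 G)"
  by (auto simp: agree_def fps_integral_def)

lemma agree_inverse:
  assumes "agree n F G" "fps_nth F 0 \<noteq> 0" "fps_nth G 0 = fps_nth F 0"
  shows "agree n (inverse F) (inverse G)"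
proof -
  have *: "fps_nth (inverse H) k
      = (if k = 0 then inverse (fps_nth H 0) else - inverse (fps_nth H 0) * (\<Sum>i=1..k. fps_nth H i * fps_nth (inverse H) (k - i)))"
    if "fps_nth H 0 \<noteq> 0" for H :: "real fps" and k
    using that by (cases k) (auto simp: fps_inverse_def)
  have "fps_nth (inverse F) k = fps_nth (inverse G) k" if "k < n" for k
    using that
  proof (induction k rule: less_induct)
    case (less k)
    have "(\<Sum>i=1..k. fps_nth F i * fps_nth (inverse F) (k - i)) = (\<Sum>i=1..k. fps_nth G i * fps_nth (inverse G) (k - i))"
      using less assms(1) by (intro sum.cong) (auto simp: agree_def)
    then show ?case using *[of F k] *[of G k] assms by simp
  qed
  then show ?thesis by (simp add: agree_def)
qed

text \<open>A state has one component that is determined coefficientwise, at index \<open>0\<close>, and components that are integrals,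
  at positive indices. The latter gain a factor \<open>1 / r\<close>, which is why they get the weight \<open>\<kappa>\<^sup>2\<close> where the former
  has \<open>\<kappa>\<close>.\<close>

definition null_states :: "(nat \<Rightarrow> real fps) set" where
  "null_states = {y. \<forall>i. fps_nth (y i) 0 = 0}"

definition small_states :: "real \<Rightarrow> real \<Rightarrow> (nat \<Rightarrow> real fps) set" where
  "small_states \<kappa> r = {y \<in> null_states. maj r \<kappa> (y 0) \<and> (\<forall>i>0. maj r (\<kappa>^2) (y i))}"

lemma small_imp_null: "y \<in> small_states \<kappa> r \<Longrightarrow> y \<in> null_states"
  by (simp add: small_states_def)

text \<open>The weight counts powers of \<open>\<kappa>\<close>, uniformly in \<open>r\<close>. The
  condition \<open>1 / \<kappa>\<^sup>2 \<le> r\<close> is what gives \<open>fps_X\<close>, whose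
  majorant is proportional to \<open>1 / r\<close>, the weight 2.\<close>

definition weight_bounded :: "nat \<Rightarrow> ((nat \<Rightarrow> real fps) \<Rightarrow> real fps) \<Rightarrow> bool" where
  "weight_bounded k G \<longleftrightarrow> (\<exists>C\<ge>0. \<exists>\<kappa>0>0. \<forall>\<kappa> r y. 0 < \<kappa> \<and> \<kappa> \<le> \<kappa>0 \<and> 1 / \<kappa>^2 \<le> r \<and> y \<in> small_states \<kappa> r
      \<longrightarrow> maj r (C * \<kappa>^k) (G y))"

text \<open>The third clause makes a term of weight \<open>2\<close> admissible as right-hand side of the equation for component
  \<open>0\<close>: its coefficient of order \<open>n\<close> must not involve the coefficient of the same order.\<close>

definition causal :: "nat \<Rightarrow> ((nat \<Rightarrow> real fps) \<Rightarrow> real fps) \<Rightarrow> bool" where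
  "causal k G \<longleftrightarrow>
     (\<forall>n. \<forall>y\<in>null_states. \<forall>y'\<in>null_states. (\<forall>i. agree n (y i) (y' i)) \<longrightarrow> agree n (G y) (G y')) \<and>
     (k \<ge> 1 \<longrightarrow> (\<forall>y\<in>null_states. fps_nth (G y) 0 = 0)) \<and>
     (k \<ge> 2 \<longrightarrow> (\<forall>n. \<forall>y\<in>null_states. \<forall>y'\<in>null_states.
         agree n (y 0) (y' 0) \<longrightarrow> (\<forall>i>0. agree (Suc n) (y i) (y' i)) \<longrightarrow> agree (Suc n) (G y) (G y')))"

definition nice :: "nat \<Rightarrow> ((nat \<Rightarrow> real fps) \<Rightarrow> real fps) \<Rightarrow> bool" where
  "nice k G \<longleftrightarrow> weight_bounded k G \<and> causal k G"

lemma weight_boundedI: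
  fixes C \<kappa>0 :: real and G :: "(nat \<Rightarrow> real fps) \<Rightarrow> real fps"
  assumes "0 \<le> C" "0 < \<kappa>0"
    "\<And>\<kappa> r y. 0 < \<kappa> \<Longrightarrow> \<kappa> \<le> \<kappa>0 \<Longrightarrow> 1 / \<kappa>^2 \<le> r \<Longrightarrow> 0 < r \<Longrightarrow> y \<in> small_states \<kappa> r \<Longrightarrow> maj r (C * \<kappa>^k) (G y)"
  shows "weight_bounded k G"
proof -
  have main: "maj r (C * \<kappa>^k) (G y)"
    if *: "0 < \<kappa>" "\<kappa> \<le> \<kappa>0" "1 / \<kappa>^2 \<le> r" "y \<in> small_states \<kappa> r" for \<kappa> r y
  proof -
    have "0 < 1 / \<kappa>^2" using *(1) by simp
    with *(3) have "0 < r" by linarith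
    with * show "maj r (C * \<kappa>^k) (G y)" by (intro assms(3))
  qed
  show ?thesis unfolding weight_bounded_def
    by (rule exI[of _ C], rule conjI[OF assms(1)], rule exI[of _ \<kappa>0], rule conjI[OF assms(2)]) (simp add: main)
qed

lemma weight_boundedE:
  assumes "weight_bounded k G"
  obtains C \<kappa>0 where "0 \<le> C" "0 < \<kappa>0"
    "\<And>\<kappa> r y. 0 < \<kappa> \<Longrightarrow> \<kappa> \<le> \<kappa>0 \<Longrightarrow> 1 / \<kappa>^2 \<le> r \<Longrightarrow> y \<in> small_states \<kappa> r \<Longrightarrow> maj r (C * \<kappa>^k) (G y)"
  using assms unfolding weight_bounded_def by blast

lemma niceE:
  assumes "nice k G"
  obtains C \<kappa>0 where "0 \<le> C" "0 < \<kappa>0"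
    "\<And>\<kappa> r y. 0 < \<kappa> \<Longrightarrow> \<kappa> \<le> \<kappa>0 \<Longrightarrow> 1 / \<kappa>^2 \<le> r \<Longrightarrow> y \<in> small_states \<kappa> r \<Longrightarrow> maj r (C * \<kappa>^k) (G y)"
  by (rule weight_boundedE[OF conjunct1[OF assms[unfolded nice_def]]]) (rule that)

lemma causalD0:
  "causal k G \<Longrightarrow> y \<in> null_states \<Longrightarrow> y' \<in> null_states \<Longrightarrow> (\<And>i. agree n (y i) (y' i)) \<Longrightarrow> agree n (G y) (G y')"
  and causalD1: "causal k G \<Longrightarrow> k \<ge> 1 \<Longrightarrow> y \<in> null_states \<Longrightarrow> fps_nth (G y) 0 = 0"
  and causalD2: "causal k G \<Longrightarrow> k \<ge> 2 \<Longrightarrow> y \<in> null_states \<Longrightarrow> y' \<in> null_states \<Longrightarrow> agree n (y 0) (y' 0) \<Longrightarrow>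
     (\<And>i. i > 0 \<Longrightarrow> agree (Suc n) (y i) (y' i)) \<Longrightarrow> agree (Suc n) (G y) (G y')"
  unfolding causal_def by blast+

lemma causalI:
  assumes "\<And>n y y'. y \<in> null_states \<Longrightarrow> y' \<in> null_states \<Longrightarrow> (\<And>i. agree n (y i) (y' i)) \<Longrightarrow> agree n (G y) (G y')"
    "\<And>y. k \<ge> 1 \<Longrightarrow> y \<in> null_states \<Longrightarrow> fps_nth (G y) 0 = 0"
    "\<And>n y y'. k \<ge> 2 \<Longrightarrow> y \<in> null_states \<Longrightarrow> y' \<in> null_states \<Longrightarrow> agree n (y 0) (y' 0) \<Longrightarrow>
      (\<And>i. i > 0 \<Longrightarrow> agree (Suc n) (y i) (y' i)) \<Longrightarrow> agree (Suc n) (G y) (G y')"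
  shows "causal k G"
  unfolding causal_def by (simp add: assms)

lemma nice_nth_0: "nice k G \<Longrightarrow> k \<ge> 1 \<Longrightarrow> y \<in> null_states \<Longrightarrow> fps_nth (G y) 0 = 0"
  by (auto simp: nice_def dest: causalD1)

lemma agree_le: "agree n F G \<Longrightarrow> m \<le> n \<Longrightarrow> agree m F G"
  by (auto simp: agree_def)

lemma nice_add:
  assumes "nice k F" "nice k G" shows "nice k (\<lambda>y. F y + G y)"
proof -
  obtain A a where A: "0 \<le> A" "0 < a"
    "\<And>\<kappa> r y. 0 < \<kappa> \<Longrightarrow> \<kappa> \<le> a \<Longrightarrow> 1 / \<kappa>^2 \<le> r \<Longrightarrow> y \<in> small_states \<kappa> r \<Longrightarrow> maj r (A * \<kappa>^k) (F y)"
    by (rule niceE[OF assms(1)]) (rule that)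
  obtain B b where B: "0 \<le> B" "0 < b"
    "\<And>\<kappa> r y. 0 < \<kappa> \<Longrightarrow> \<kappa> \<le> b \<Longrightarrow> 1 / \<kappa>^2 \<le> r \<Longrightarrow> y \<in> small_states \<kappa> r \<Longrightarrow> maj r (B * \<kappa>^k) (G y)"
    by (rule niceE[OF assms(2)]) (rule that)
  have "weight_bounded k (\<lambda>y. F y + G y)"
  proof (rule weight_boundedI[of "A + B" "min a b"])
    fix \<kappa> r :: real and y
    assume *: "0 < \<kappa>" "\<kappa> \<le> min a b" "1 / \<kappa>^2 \<le> r" "y \<in> small_states \<kappa> r"
    show "maj r ((A + B) * \<kappa>^k) (F y + G y)"
      unfolding distrib_right using * by (intro maj_add A(3) B(3)) simp_all
  qed (use A(1,2) B(1,2) in simp_all)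
  moreover have "causal k (\<lambda>y. F y + G y)"
  proof -
    have F: "causal k F" and G: "causal k G" using assms by (simp_all add: nice_def)
    show ?thesis
      by (rule causalI) (simp_all add: agree_add causalD0[OF F] causalD0[OF G] causalD1[OF F] causalD1[OF G]
          causalD2[OF F] causalD2[OF G])
  qed
  ultimately show ?thesis by (simp add: nice_def)
qed

lemma nice_minus: assumes "nice k F" shows "nice k (\<lambda>y. - F y)"
proof -
  obtain A a where A: "0 \<le> A" "0 < a"
    "\<And>\<kappa> r y. 0 < \<kappa> \<Longrightarrow> \<kappa> \<le> a \<Longrightarrow> 1 / \<kappa>^2 \<le> r \<Longrightarrow> y \<in> small_states \<kappa> r \<Longrightarrow> maj r (A * \<kappa>^k) (F y)"
    by (rule niceE[OF assms]) (rule that)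
  have "weight_bounded k (\<lambda>y. - F y)"
    by (rule weight_boundedI[of A a]) (simp_all add: A maj_minus)
  moreover have "causal k (\<lambda>y. - F y)"
  proof -
    have F: "causal k F" using assms by (simp add: nice_def)
    show ?thesis
      by (rule causalI) (simp_all add: agree_minus causalD0[OF F] causalD1[OF F] causalD2[OF F])
  qed
  ultimately show ?thesis by (simp add: nice_def)
qed

lemma nice_diff: "nice k F \<Longrightarrow> nice k G \<Longrightarrow> nice k (\<lambda>y. F y - G y)"
  using nice_add[of k F "\<lambda>y. - G y"] nice_minus[of k G] by simp

lemma nice_mono:
  assumes "nice j F" "k \<le> j" shows "nice k F"
proof -
  obtain A a where A: "0 \<le> A" "0 < a"
    "\<And>\<kappa> r y. 0 < \<kappa> \<Longrightarrow> \<kappa> \<le> a \<Longrightarrow> 1 / \<kappa>^2 \<le> r \<Longrightarrow> y \<in> small_states \<kappa> r \<Longrightarrow> maj r (A * \<kappa>^j) (F y)"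
    by (rule niceE[OF assms(1)]) (rule that)
  have "weight_bounded k F"
  proof (rule weight_boundedI[of A "min a 1"])
    fix \<kappa> r :: real and y
    assume *: "0 < \<kappa>" "\<kappa> \<le> min a 1" "1 / \<kappa>^2 \<le> r" "0 < r" "y \<in> small_states \<kappa> r"
    have "A * \<kappa>^j \<le> A * \<kappa>^k" using A * assms(2) by (intro mult_left_mono power_decreasing) auto
    then show "maj r (A * \<kappa>^k) (F y)" using A(3)[of \<kappa> r y] * by (auto intro: maj_mono)
  qed (use A in auto)
  moreover have "causal k F"
  proof -
    have F: "causal j F" using assms by (simp add: nice_def)
    show ?thesis using assms(2)
      by (intro causalI) (simp_all add: causalD0[OF F] causalD1[OF F] causalD2[OF F])
  qed
  ultimately show ?thesis by (simp add: nice_def)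
qed

text \<open>Weights add. For the clause on coefficients of the same order there are two ways to
  reach weight 2: one factor already has it and, lacking a constant term, shifts the other; or both
  have weight 1 and lack a constant term.\<close>

lemma nice_mult:
  assumes "nice j F" "nice k G" shows "nice (j + k) (\<lambda>y. F y * G y)"
proof -
  obtain A a where A: "0 \<le> A" "0 < a"
    "\<And>\<kappa> r y. 0 < \<kappa> \<Longrightarrow> \<kappa> \<le> a \<Longrightarrow> 1 / \<kappa>^2 \<le> r \<Longrightarrow> y \<in> small_states \<kappa> r \<Longrightarrow> maj r (A * \<kappa>^j) (F y)"
    by (rule niceE[OF assms(1)]) (rule that)
  obtain B b where B: "0 \<le> B" "0 < b"
    "\<And>\<kappa> r y. 0 < \<kappa> \<Longrightarrow> \<kappa> \<le> b \<Longrightarrow> 1 / \<kappa>^2 \<le> r \<Longrightarrow> y \<in> small_states \<kappa> r \<Longrightarrow> maj r (B * \<kappa>^k) (G y)"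
    by (rule niceE[OF assms(2)]) (rule that)
  have "weight_bounded (j + k) (\<lambda>y. F y * G y)"
  proof (rule weight_boundedI[of "16 * A * B" "min a b"])
    fix \<kappa> r :: real and y
    assume *: "0 < \<kappa>" "\<kappa> \<le> min a b" "1 / \<kappa>^2 \<le> r" "0 < r" "y \<in> small_states \<kappa> r"
    have "maj r (16 * (A * \<kappa>^j) * (B * \<kappa>^k)) (F y * G y)"
      using * by (intro maj_mult A B) auto
    then show "maj r (16 * A * B * \<kappa>^(j + k)) (F y * G y)" by (simp add: power_add algebra_simps)
  qed (use A B in auto)
  moreover have "causal (j + k) (\<lambda>y. F y * G y)"
  proof -
    have F: "causal j F" and G: "causal k G" using assms by (auto simp: nice_def)
    have c0: "agree n (F y * G y) (F y' * G y')"
      if "y \<in> null_states" "y' \<in> null_states" "\<And>i. agree n (y i) (y' i)" for n y y'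
      using that by (intro agree_mult causalD0[OF F] causalD0[OF G])
    have c1: "fps_nth (F y * G y) 0 = 0" if "j + k \<ge> 1" "y \<in> null_states" for y
      using that causalD1[OF F, of y] causalD1[OF G, of y] by (cases "j = 0") auto
    have c2: "agree (Suc n) (F y * G y) (F y' * G y')"
      if jk: "j + k \<ge> 2" and y: "y \<in> null_states" and y': "y' \<in> null_states"
        and a: "agree n (y 0) (y' 0)" "\<And>i. i > 0 \<Longrightarrow> agree (Suc n) (y i) (y' i)" for n y y'
    proof -
      have "agree n (y i) (y' i)" for i
        using a(1) agree_le[OF a(2)[of i], of n] by (cases "i = 0") auto
      then have n: "agree n (F y) (F y')" "agree n (G y) (G y')"
        using causalD0[OF F y y'] causalD0[OF G y y'] by auto
      consider "j \<ge> 2" | "k \<ge> 2" | "j = 1" "k = 1" using jk by linarith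
      then show ?thesis
      proof cases
        case 1
        then show ?thesis
          by (intro agree_Suc_mult1 n causalD2[OF F _ y y'] a causalD1[OF F _ y]) auto
      next
        case 2
        then have "agree (Suc n) (G y * F y) (G y' * F y')"
          by (intro agree_Suc_mult1 n causalD2[OF G _ y y'] a causalD1[OF G _ y]) auto
        then show ?thesis by (simp add: mult.commute)
      next
        case 3
        then show ?thesis
          by (intro agree_Suc_mult2 n causalD1[OF F _ y] causalD1[OF F _ y'] causalD1[OF G _ y] causalD1[OF G _ y']) auto
      qed
    qed
    show ?thesis by (rule causalI) (fact c0 c1 c2)+
  qed
  ultimately show ?thesis by (simp add: nice_def)
qed

lemma nice_const: "nice 0 (\<lambda>y. fps_const c)"
proof -
  have "weight_bounded 0 (\<lambda>y. fps_const c)"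
    by (rule weight_boundedI[of "\<bar>c\<bar>" 1]) (auto intro: maj_const)
  then show ?thesis by (simp add: nice_def causal_def)
qed

lemma nice_X: "nice 2 (\<lambda>y. fps_X)"
proof -
  have "weight_bounded 2 (\<lambda>y. fps_X)"
  proof (rule weight_boundedI[of 4 1])
    fix \<kappa> r :: real assume *: "0 < \<kappa>" "1 / \<kappa>^2 \<le> r" "0 < r"
    have "maj r (4 * 1 / r) (fps_X * fps_const 1)" using * by (intro maj_X_mult maj_const) auto
    moreover have "4 * 1 / r \<le> 4 * \<kappa>^2" using * by (simp add: field_simps)
    ultimately show "maj r (4 * \<kappa>^2) (fps_X :: real fps)"
      using * by (auto intro: maj_mono)
  qed auto
  then show ?thesis by (simp add: nice_def causal_def)
qed

lemma nice_var0: "nice 1 (\<lambda>y. y 0)"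
proof -
  have "weight_bounded 1 (\<lambda>y. y 0)"
    by (rule weight_boundedI[of 1 1]) (auto simp: small_states_def)
  then show ?thesis by (auto simp: nice_def causal_def null_states_def)
qed

lemma nice_var: assumes "i > 0" shows "nice 2 (\<lambda>y. y i)"
proof -
  have "weight_bounded 2 (\<lambda>y. y i)"
    by (rule weight_boundedI[of 1 1]) (use assms in \<open>auto simp: small_states_def\<close>)
  then show ?thesis using assms by (auto simp: nice_def causal_def null_states_def)
qed

text \<open>The average of \<open>F\<close> over the interval from 0 to the variable, that is, the
  integral divided by \<open>fps_X\<close>. It arises when the factor \<open>fps_X\<close> common to
  numerator and denominator at the sonic point is cancelled.\<close>

definition fps_mean :: "real fps \<Rightarrow> real fps" where
  "fps_mean F = Abs_fps (\<lambda>n. fps_nth F n / (real n + 1))"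

lemma fps_mean_nth [simp]: "fps_nth (fps_mean F) n = fps_nth F n / (real n + 1)"
  by (simp add: fps_mean_def)

lemma fps_integral0_eq_X_mean: "fps_integral0 F = fps_X * fps_mean F"
  by (rule fps_ext) (auto simp: fps_integral_def of_nat_diff field_simps)

lemma maj_mean: assumes "maj r C F" shows "maj r C (fps_mean F)"
  unfolding maj_def
proof
  fix n
  have "\<bar>fps_nth (fps_mean F) n\<bar> = \<bar>fps_nth F n\<bar> / (real n + 1)" by simp
  also have "\<dots> \<le> \<bar>fps_nth F n\<bar>" by (simp add: divide_le_eq mult_le_cancel_left1)
  finally show "\<bar>fps_nth (fps_mean F) n\<bar> \<le> C * r ^ n / (real n + 1)^2" using majD[OF assms, of n] by linarith
qed

lemma agree_mean: "agree n F G \<Longrightarrow> agree n (fps_mean F) (fps_mean G)"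
  by (simp add: agree_def)

lemma nice_mean: assumes "nice k G" shows "nice k (\<lambda>y. fps_mean (G y))"
proof -
  obtain A a where A: "0 \<le> A" "0 < a"
    "\<And>\<kappa> r y. 0 < \<kappa> \<Longrightarrow> \<kappa> \<le> a \<Longrightarrow> 1 / \<kappa>^2 \<le> r \<Longrightarrow> y \<in> small_states \<kappa> r \<Longrightarrow> maj r (A * \<kappa>^k) (G y)"
    by (rule niceE[OF assms]) (rule that)
  have "weight_bounded k (\<lambda>y. fps_mean (G y))"
    by (rule weight_boundedI[of A a]) (simp_all add: A maj_mean)
  moreover have "causal k (\<lambda>y. fps_mean (G y))"
  proof -
    have F: "causal k G" using assms by (simp add: nice_def)
    show ?thesis
      by (rule causalI) (simp_all add: agree_mean causalD0[OF F] causalD1[OF F] causalD2[OF F])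
  qed
  ultimately show ?thesis by (simp add: nice_def)
qed

lemma nice_inverse:
  assumes G: "nice 1 G" and c: "c \<noteq> 0"
  shows "nice 0 (\<lambda>y. inverse (fps_const c + G y))"
proof -
  obtain A a where A: "0 \<le> A" "0 < a"
    "\<And>\<kappa> r y. 0 < \<kappa> \<Longrightarrow> \<kappa> \<le> a \<Longrightarrow> 1 / \<kappa>^2 \<le> r \<Longrightarrow> y \<in> small_states \<kappa> r \<Longrightarrow> maj r (A * \<kappa>^1) (G y)"
    by (rule niceE[OF assms(1)]) (rule that)
  \<comment> \<open>For \<open>\<kappa> \<le> 1 / B\<close> the series divided by \<open>c\<close>
    meets the smallness condition of \<open>maj_inverse_one_plus\<close>; the summand 1 keeps
    \<open>B\<close> positive.\<close>
  define B where "B = 32 * (16 * \<bar>1 / c\<bar> * A) + 1"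
  have B: "B > 0" using A by (auto simp: B_def intro!: add_nonneg_pos)
  have "weight_bounded 0 (\<lambda>y. inverse (fps_const c + G y))"
  proof (rule weight_boundedI[of "16 * \<bar>1 / c\<bar> * 2" "min a (1 / B)"])
    fix \<kappa> r :: real and y
    assume *: "0 < \<kappa>" "\<kappa> \<le> min a (1 / B)" "1 / \<kappa>^2 \<le> r" "0 < r" "y \<in> small_states \<kappa> r"
    have "maj r (16 * \<bar>1 / c\<bar> * (A * \<kappa>)) (fps_const (1 / c) * G y)"
      using A(3)[of \<kappa> r y] * by (intro maj_mult maj_const) auto
    moreover have "32 * (16 * \<bar>1 / c\<bar> * (A * \<kappa>)) \<le> 1"
    proof -
      have "32 * (16 * \<bar>1 / c\<bar> * (A * \<kappa>)) \<le> B * \<kappa>" using * by (simp add: B_def algebra_simps)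
      also have "\<dots> \<le> 1" using * B by (simp add: field_simps)
      finally show ?thesis .
    qed
    moreover have "fps_nth (G y) 0 = 0" using nice_nth_0[OF G _ small_imp_null[OF *(5)]] by simp
    ultimately have "maj r 2 (inverse (1 + fps_const (1 / c) * G y))"
      using * by (intro maj_inverse_one_plus) auto
    then have "maj r (16 * \<bar>1 / c\<bar> * 2) (fps_const (1 / c) * inverse (1 + fps_const (1 / c) * G y))"
      using * by (intro maj_mult maj_const) auto
    also have "fps_const (1 / c) * inverse (1 + fps_const (1 / c) * G y) = inverse (fps_const c + G y)"
    proof -
      have "fps_const c + G y = fps_const c * (1 + fps_const (1 / c) * G y)"
        using c by (simp add: distrib_left mult.assoc [symmetric])
      then show ?thesis using c by (simp add: fps_inverse_mult fps_const_inverse divide_inverse)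
    qed
    finally show "maj r (16 * \<bar>1 / c\<bar> * 2 * \<kappa>^0) (inverse (fps_const c + G y))" by simp
  qed (use A B in auto)
  moreover have "causal 0 (\<lambda>y. inverse (fps_const c + G y))"
  proof -
    have "agree n (inverse (fps_const c + G y)) (inverse (fps_const c + G y'))"
      if "y \<in> null_states" "y' \<in> null_states" "\<And>i. agree n (y i) (y' i)" for n y y'
      using that nice_nth_0[OF G] c G unfolding nice_def
      by (intro agree_inverse agree_add causalD0[of 1 G]) auto
    then show ?thesis by (auto simp: causal_def)
  qed
  ultimately show ?thesis by (simp add: nice_def)
qed

lemma agree_sym: "agree n F G \<Longrightarrow> agree n G F"
  by (simp add: agree_def)

lemma agree_trans: "agree n F G \<Longrightarrow> agree n G H \<Longrightarrow> agree n F H"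
  by (simp add: agree_def)

lemma agree_all_imp_eq: "(\<And>n. agree n F G) \<Longrightarrow> F = G"
  by (rule fps_ext) (auto simp: agree_def)

lemma nice_uniform_bound:
  fixes m :: nat
  assumes "\<And>i. i > 0 \<Longrightarrow> nice 0 (G i)"
  shows "\<exists>C\<ge>0. \<exists>\<kappa>0>0. \<forall>i\<in>{1..m}. \<forall>\<kappa> r y. 0 < \<kappa> \<longrightarrow> \<kappa> \<le> \<kappa>0 \<longrightarrow> 1 / \<kappa>^2 \<le> r \<longrightarrow> 0 < r
     \<longrightarrow> y \<in> small_states \<kappa> r \<longrightarrow> maj r C (G i y)"
proof (induction m)
  case 0
  show ?case by (intro exI[of _ 0] exI[of _ 1] conjI) simp_all
next
  case (Suc m)
  then obtain A a where A0: "0 \<le> A" "0 < a"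
    "\<forall>i\<in>{1..m}. \<forall>\<kappa> r y. 0 < \<kappa> \<longrightarrow> \<kappa> \<le> a \<longrightarrow> 1 / \<kappa>^2 \<le> r \<longrightarrow> 0 < r
     \<longrightarrow> y \<in> small_states \<kappa> r \<longrightarrow> maj r A (G i y)" by (elim exE conjE) (rule that)
  note A = A0(1,2) A0(3)[rule_format]
  obtain B b where B: "0 \<le> B" "0 < b"
    "\<And>\<kappa> r y. 0 < \<kappa> \<Longrightarrow> \<kappa> \<le> b \<Longrightarrow> 1 / \<kappa>^2 \<le> r \<Longrightarrow> y \<in> small_states \<kappa> r \<Longrightarrow> maj r (B * \<kappa>^0) (G (Suc m) y)"
    by (rule niceE[OF assms[of "Suc m"]]) (simp, rule that)
  show ?case
  proof (rule exI[of _ "A + B"], rule conjI, rule add_nonneg_nonneg[OF A(1) B(1)],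
      rule exI[of _ "min a b"], rule conjI, use A(2) B(2) in simp, intro ballI allI impI)
    fix i and \<kappa> r :: real and y
    assume *: "i \<in> {1..Suc m}" "0 < \<kappa>" "\<kappa> \<le> min a b" "1 / \<kappa>^2 \<le> r" "0 < r" "y \<in> small_states \<kappa> r"
    show "maj r (A + B) (G i y)"
    proof (cases "i = Suc m")
      case True
      have "maj r (B * \<kappa>^0) (G i y)" unfolding True using * by (intro B(3)) simp_all
      then show ?thesis using * A(1) by (intro maj_mono[where C = "B * \<kappa>^0" and C' = "A + B"]) simp_all
    next
      case False
      then have "maj r A (G i y)" using * by (intro A(3)[where \<kappa> = \<kappa>]) simp_all
      then show ?thesis using * B(1) by (intro maj_mono[where C = A and C' = "A + B"]) simp_all
    qed
  qed
qed

text \<open>Iteration from zero: every step settles one more coefficient, and every iterate stays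
  among the small states, so the formal limit exists and converges at once. The lower bound on
  \<open>\<tau>\<close> excludes resonances and small divisors alike.\<close>

theorem fps_fixed_point:
  fixes G :: "nat \<Rightarrow> (nat \<Rightarrow> real fps) \<Rightarrow> real fps" and \<tau> :: "nat \<Rightarrow> real"
  assumes G: "\<And>i. i > 0 \<Longrightarrow> nice 0 (G i)" and m: "\<And>i. i > m \<Longrightarrow> G i = (\<lambda>_. 0)"
    and Q: "nice 2 Q" and \<tau>: "0 < c" "\<And>n. n \<ge> 1 \<Longrightarrow> c \<le> \<bar>\<tau> n\<bar>"
  obtains y where "y \<in> null_states" "\<And>i. fps_conv_radius (y i) > 0"
    "\<And>i. i > 0 \<Longrightarrow> y i = fps_integral0 (G i y)"
    "\<And>n. n \<ge> 1 \<Longrightarrow> \<tau> n * fps_nth (y 0) n = fps_nth (Q y) n"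
proof -
  have ub: "\<exists>C\<ge>0. \<exists>\<kappa>0>0. \<forall>i\<in>{1..m}. \<forall>\<kappa> r y. 0 < \<kappa> \<longrightarrow> \<kappa> \<le> \<kappa>0 \<longrightarrow> 1 / \<kappa>^2 \<le> r \<longrightarrow> 0 < r
     \<longrightarrow> y \<in> small_states \<kappa> r \<longrightarrow> maj r C (G i y)"
    by (rule nice_uniform_bound) (rule G)
  obtain A a where A0: "0 \<le> A" "0 < a"
    "\<forall>i\<in>{1..m}. \<forall>\<kappa> r y. 0 < \<kappa> \<longrightarrow> \<kappa> \<le> a \<longrightarrow> 1 / \<kappa>^2 \<le> r \<longrightarrow> 0 < r
     \<longrightarrow> y \<in> small_states \<kappa> r \<longrightarrow> maj r A (G i y)" using ub by (elim exE conjE) (rule that)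
  note A = A0(1,2) A0(3)[rule_format]
  obtain B b where B: "0 \<le> B" "0 < b"
    "\<And>\<kappa> r y. 0 < \<kappa> \<Longrightarrow> \<kappa> \<le> b \<Longrightarrow> 1 / \<kappa>^2 \<le> r \<Longrightarrow> y \<in> small_states \<kappa> r \<Longrightarrow> maj r (B * \<kappa>^2) (Q y)"
    by (rule niceE[OF Q]) (rule that)
  \<comment> \<open>Chosen so that dividing by \<open>\<tau>\<close> returns a series of size at
    most \<open>\<kappa>\<close>, that is, \<open>B \<kappa>\<^sup>2 / c \<le> \<kappa>\<close>.
    Only afterwards is \<open>r\<close> taken large enough for the integrals to have size
    \<open>\<kappa>\<^sup>2\<close>.\<close>
  define \<kappa> where "\<kappa> = min (min a b) (c / (B + 1))"
  have \<kappa>: "0 < \<kappa>" "\<kappa> \<le> a" "\<kappa> \<le> b" using A B \<tau> by (simp_all add: \<kappa>_def)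
  have "\<kappa> * (B + 1) \<le> c" using B \<open>0 < c\<close> using mult_right_mono[of \<kappa> "c / (B + 1)" "B + 1"] by (simp add: \<kappa>_def)
  then have \<kappa>B: "\<kappa> * B \<le> c" using \<kappa> by (simp add: algebra_simps)
  define r where "r = (4 * A + 1) / \<kappa>^2"
  have r: "1 / \<kappa>^2 \<le> r" "0 < r"
    using A \<kappa> by (auto simp: r_def intro!: divide_right_mono divide_pos_pos)
  have Ar: "4 * A / r \<le> \<kappa>^2" using A \<kappa> by (simp add: r_def field_simps)
  define T where "T F = Abs_fps (\<lambda>n. if n = 0 then 0 else fps_nth F n / \<tau> n)" for F
  have majT: "maj r (C / c) (T F)" if F: "maj r C F" for C F
    unfolding maj_def
  proof
    fix n
    show "\<bar>fps_nth (T F) n\<bar> \<le> C / c * r ^ n / (real n + 1)^2"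
    proof (cases "n = 0")
      case False
      have "\<bar>fps_nth (T F) n\<bar> = \<bar>fps_nth F n\<bar> / \<bar>\<tau> n\<bar>" using False by (simp add: T_def)
      also have "\<dots> \<le> (C * r ^ n / (real n + 1)^2) / c"
        using False \<tau> majD[OF F, of n] by (intro frac_le) auto
      finally show ?thesis by (simp add: field_simps)
    qed (use maj_nonneg[OF F] \<open>0 < c\<close> in \<open>simp add: T_def\<close>)
  qed
  have agrT: "agree n (T F) (T F')" if "agree n F F'" for n F F'
    using that by (simp add: agree_def T_def)
  \<comment> \<open>The integrals are updated before component 0, because the right-hand side
    \<open>Q\<close> may involve their coefficients of the same order.\<close>
  define upd where "upd y = (\<lambda>i. if i = 0 then y 0 else fps_integral0 (G i y))" for y
  define step where "step y = (upd y)(0 := T (Q (upd y)))" for y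
  have upd0: "upd y 0 = y 0" for y by (simp add: upd_def)
  have updi: "upd y i = fps_integral0 (G i y)" if "i > 0" for y i using that by (simp add: upd_def)
  have step0: "step y 0 = T (Q (upd y))" for y by (simp add: step_def)
  have stepi: "step y i = fps_integral0 (G i y)" if "i > 0" for y i using that by (simp add: step_def upd_def)
  have null_upd: "upd y \<in> null_states" if "y \<in> null_states" for y
    using that by (auto simp: null_states_def upd_def fps_integral_def)
  have null_step: "step y \<in> null_states" if "y \<in> null_states" for y
    using null_upd[OF that] by (auto simp: null_states_def step_def T_def)
  have maji: "maj r (\<kappa>^2) (fps_integral0 (G i y))" if y: "y \<in> small_states \<kappa> r" and i: "i > 0" for y i
  proof -
    have "maj r A (G i y)"
    proof (cases "i \<le> m")
      case True
      then show ?thesis using i y \<kappa> r by (intro A(3)[where \<kappa> = \<kappa>]) simp_all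
    next
      case False
      then show ?thesis using m[of i] A(1) r by (simp add: maj_def)
    qed
    then have "maj r (4 * A / r) (fps_integral0 (G i y))" by (rule maj_integral) (rule r)
    then show ?thesis by (rule maj_mono) (use Ar r in auto)
  qed
  have small_upd: "upd y \<in> small_states \<kappa> r" if y: "y \<in> small_states \<kappa> r" for y
    using null_upd[OF small_imp_null[OF y]] y maji[OF y] by (simp add: small_states_def upd_def)
  have small_step: "step y \<in> small_states \<kappa> r" if y: "y \<in> small_states \<kappa> r" for y
  proof -
    have "maj r (B * \<kappa>^2) (Q (upd y))" by (intro B(3) \<kappa> r small_upd y)
    then have "maj r (B * \<kappa>^2 / c) (step y 0)" unfolding step0 by (rule majT)
    moreover have "B * \<kappa>^2 / c \<le> \<kappa>"
    proof -
      have "\<kappa> * (\<kappa> * B) \<le> \<kappa> * c" using \<kappa>B \<kappa>(1) by (intro mult_left_mono) simp_all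
      then show ?thesis using \<open>0 < c\<close> by (simp add: divide_le_eq power2_eq_square mult_ac)
    qed
    ultimately have "maj r \<kappa> (step y 0)" using r(2) by (intro maj_mono[where C' = \<kappa>]) simp_all
    then show ?thesis
      using null_step[OF small_imp_null[OF y]] maji[OF y] by (simp add: small_states_def stepi)
  qed
  have contract: "agree (Suc n) (step y i) (step y' i)"
    if y: "y \<in> null_states" and y': "y' \<in> null_states" and a: "\<And>i. agree n (y i) (y' i)" for n y y' i
  proof -
    have pos: "agree (Suc n) (fps_integral0 (G i y)) (fps_integral0 (G i y'))" if "i > 0" for i
      by (rule agree_integral, rule causalD0[OF conjunct2[OF G[OF that, unfolded nice_def]] y y' a])
    show ?thesis
    proof (cases "i = 0")
      case True
      have "agree (Suc n) (Q (upd y)) (Q (upd y'))"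
        by (rule causalD2[OF conjunct2[OF Q[unfolded nice_def]] _ null_upd[OF y] null_upd[OF y']])
          (simp_all only: upd0 updi a pos order_refl)
      then show ?thesis unfolding True step0 by (rule agrT)
    next
      case False
      then show ?thesis using pos[of i] by (simp only: stepi)
    qed
  qed
  define z where "z k = (step ^^ k) (\<lambda>_. 0)" for k
  have zSuc: "z (Suc k) = step (z k)" for k by (simp add: z_def)
  have zsmall: "z k \<in> small_states \<kappa> r" for k
  proof (induction k)
    case 0
    show ?case using \<kappa> r by (simp add: z_def small_states_def null_states_def maj_def)
  qed (simp add: zSuc small_step)
  then have znull: "z k \<in> null_states" for k by (rule small_imp_null)
  have zS: "agree k (z k i) (z (Suc k) i)" for k i
  proof (induction k arbitrary: i)
    case 0
    show ?case by (simp add: agree_def)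
  next
    case (Suc k)
    have "agree (Suc k) (step (z k) i) (step (z (Suc k)) i)" by (intro contract znull Suc)
    then show ?case by (simp only: zSuc)
  qed
  have zz: "agree k (z k i) (z (k + j) i)" for k i j
  proof (induction j)
    case (Suc j)
    have "agree k (z (k + j) i) (z (Suc (k + j)) i)" by (rule agree_le[OF zS]) simp
    from agree_trans[OF Suc this] show ?case by simp
  qed simp
  \<comment> \<open>Diagonal limit: the coefficient of order \<open>n\<close> no longer changes from
    iterate \<open>n + 1\<close> on.\<close>
  define y where "y i = Abs_fps (\<lambda>n. fps_nth (z (Suc n) i) n)" for i
  have yz: "agree k (y i) (z k i)" for k i
    unfolding agree_def
  proof (intro allI impI)
    fix n assume "n < k"
    then have "z k i = z (Suc n + (k - Suc n)) i" by simp
    then show "fps_nth (y i) n = fps_nth (z k i) n"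
      using zz[of "Suc n" i "k - Suc n"] by (simp add: y_def agree_def)
  qed
  have ymaj: "maj r C (y i)" if "\<And>k. maj r C (z k i)" for C i
    using that by (auto simp: maj_def y_def)
  have ynull: "y \<in> null_states"
    using znull[of 1] by (simp add: null_states_def y_def)
  have ysmall: "y \<in> small_states \<kappa> r"
    using ynull zsmall by (auto simp: small_states_def intro!: ymaj)
  have fp: "step y i = y i" for i
  proof (rule agree_all_imp_eq)
    fix n
    have "agree (Suc n) (step y i) (step (z n) i)" by (intro contract ynull znull yz)
    from agree_trans[OF this[folded zSuc] agree_sym[OF yz]]
    have "agree (Suc n) (step y i) (y i)" .
    then show "agree n (step y i) (y i)" by (rule agree_le) simp
  qed
  have yi: "y i = fps_integral0 (G i y)" if "i > 0" for i
    by (rule trans[OF fp [symmetric] stepi[OF that]])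
  have updy: "upd y = y"
    unfolding upd_def using yi [symmetric] by (intro ext) simp
  have "fps_nth (y 0) n = fps_nth (T (Q y)) n" for n using fp[of 0] by (simp add: step0 updy)
  then have y0: "\<tau> n * fps_nth (y 0) n = fps_nth (Q y) n" if "n \<ge> 1" for n
    using that \<tau>(1) \<tau>(2)[OF that] by (auto simp: T_def)
  have rad: "fps_conv_radius (y i) > 0" for i
    using ysmall r(2) by (cases "i = 0") (auto simp: small_states_def intro: maj_conv_radius)
  show ?thesis by (rule that[OF ynull rad yi y0])
qed

section \<open>Ordinary differential equations\<close>

definition loc_lipschitz :: "('a::euclidean_space \<Rightarrow> 'b::real_normed_vector) \<Rightarrow> 'a set \<Rightarrow> bool" where
  "loc_lipschitz f U \<longleftrightarrow> (\<forall>x\<in>U. \<exists>r>0. \<exists>L. cball x r \<subseteq> U \<and> L-lipschitz_on (cball x r) f)"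

lemma loc_lipschitzE:
  assumes "loc_lipschitz f U" "x \<in> U"
  obtains r L where "0 < r" "cball x r \<subseteq> U" "L-lipschitz_on (cball x r) f"
  using assms unfolding loc_lipschitz_def by meson

lemma loc_lipschitzI:
  assumes "\<And>x. x \<in> U \<Longrightarrow> \<exists>r L. 0 < r \<and> cball x r \<subseteq> U \<and> L-lipschitz_on (cball x r) f"
  shows "loc_lipschitz f U"
  using assms unfolding loc_lipschitz_def by meson

lemma loc_lipschitz_const:
  assumes "open U" shows "loc_lipschitz (\<lambda>x. c) U"
proof (rule loc_lipschitzI)
  fix x assume "x \<in> U"
  then obtain r where "0 < r" "cball x r \<subseteq> U" using assms open_contains_cball by blast
  with lipschitz_on_constant[of "cball x r" c]
  show "\<exists>r L. 0 < r \<and> cball x r \<subseteq> U \<and> L-lipschitz_on (cball x r) (\<lambda>x. c)" by blast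
qed

lemma loc_lipschitz_bounded_linear:
  assumes "open U" "bounded_linear f" shows "loc_lipschitz f U"
proof (rule loc_lipschitzI)
  fix x assume "x \<in> U"
  then obtain r where r: "0 < r" "cball x r \<subseteq> U" using assms(1) open_contains_cball by blast
  obtain B where "B-lipschitz_on (cball x r) f" using bounded_linear.lipschitz_boundE[OF assms(2)] by blast
  with r show "\<exists>r L. 0 < r \<and> cball x r \<subseteq> U \<and> L-lipschitz_on (cball x r) f" by blast
qed

lemma loc_lipschitz_combine:
  assumes f: "loc_lipschitz f U" and g: "loc_lipschitz g U" and x: "x \<in> U"
  obtains r L M where "0 < r" "cball x r \<subseteq> U" "L-lipschitz_on (cball x r) f" "M-lipschitz_on (cball x r) g"
proof -
  obtain r L where r: "0 < r" "cball x r \<subseteq> U" "L-lipschitz_on (cball x r) f"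
    by (rule loc_lipschitzE[OF f x])
  obtain s M where s: "0 < s" "cball x s \<subseteq> U" "M-lipschitz_on (cball x s) g"
    by (rule loc_lipschitzE[OF g x])
  have sub: "cball x (min r s) \<subseteq> cball x r" "cball x (min r s) \<subseteq> cball x s" by auto
  show ?thesis
    by (rule that[of "min r s" L M])
      (use r s sub in \<open>auto intro: lipschitz_on_subset\<close>)
qed

lemma loc_lipschitz_add:
  assumes "loc_lipschitz f U" "loc_lipschitz g U" shows "loc_lipschitz (\<lambda>x. f x + g x) U"
proof (rule loc_lipschitzI)
  fix x assume x: "x \<in> U"
  obtain r L M where r: "0 < r" "cball x r \<subseteq> U" "L-lipschitz_on (cball x r) f" "M-lipschitz_on (cball x r) g"
    by (rule loc_lipschitz_combine[OF assms x])
  from lipschitz_on_add[OF r(3,4)] r(1,2)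
  show "\<exists>r L. 0 < r \<and> cball x r \<subseteq> U \<and> L-lipschitz_on (cball x r) (\<lambda>x. f x + g x)" by blast
qed

lemma loc_lipschitz_Pair:
  assumes "loc_lipschitz f U" "loc_lipschitz g U" shows "loc_lipschitz (\<lambda>x. (f x, g x)) U"
proof (rule loc_lipschitzI)
  fix x assume x: "x \<in> U"
  obtain r L M where r: "0 < r" "cball x r \<subseteq> U" "L-lipschitz_on (cball x r) f" "M-lipschitz_on (cball x r) g"
    by (rule loc_lipschitz_combine[OF assms x])
  from lipschitz_on_Pair[OF r(3,4)] r(1,2)
  show "\<exists>r L. 0 < r \<and> cball x r \<subseteq> U \<and> L-lipschitz_on (cball x r) (\<lambda>x. (f x, g x))" by blast
qed

lemma lipschitz_on_cball_bound:
  fixes f :: "'a::euclidean_space \<Rightarrow> 'b::real_normed_vector"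
  assumes "L-lipschitz_on (cball x r) f" "y \<in> cball x r" "0 < r"
  shows "norm (f y) \<le> norm (f x) + L * r"
proof -
  have "norm (f y - f x) \<le> L * norm (y - x)"
    using lipschitz_on_normD[OF assms(1,2), of x] assms(3) by simp
  also have "\<dots> \<le> L * r"
    using assms lipschitz_on_nonneg[OF assms(1)] by (intro mult_left_mono) (auto simp: dist_norm norm_minus_commute)
  finally show ?thesis using norm_triangle_sub[of "f y" "f x"] by linarith
qed

lemma loc_lipschitz_mult:
  fixes f g :: "'a::euclidean_space \<Rightarrow> real"
  assumes "loc_lipschitz f U" "loc_lipschitz g U" shows "loc_lipschitz (\<lambda>x. f x * g x) U"
proof (rule loc_lipschitzI)
  fix x assume x: "x \<in> U"
  obtain r L M where r: "0 < r" "cball x r \<subseteq> U" "L-lipschitz_on (cball x r) f" "M-lipschitz_on (cball x r) g"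
    by (rule loc_lipschitz_combine[OF assms x])
  define A where "A = norm (f x) + L * r"
  define B where "B = norm (g x) + M * r"
  have L: "0 \<le> L" and M: "0 \<le> M" using r lipschitz_on_nonneg by auto
  have AB: "0 \<le> A" "0 \<le> B" using L M r by (auto simp: A_def B_def)
  have "(A * M + B * L)-lipschitz_on (cball x r) (\<lambda>x. f x * g x)"
  proof (rule lipschitz_onI)
    fix y z assume yz: "y \<in> cball x r" "z \<in> cball x r"
    have "f y * g y - f z * g z = f y * (g y - g z) + g z * (f y - f z)" by (simp add: algebra_simps)
    then have "\<bar>f y * g y - f z * g z\<bar> \<le> \<bar>f y\<bar> * \<bar>g y - g z\<bar> + \<bar>g z\<bar> * \<bar>f y - f z\<bar>"
      using abs_triangle_ineq[of "f y * (g y - g z)" "g z * (f y - f z)"] by (simp only: abs_mult)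
    also have "\<dots> \<le> A * (M * dist y z) + B * (L * dist y z)"
    proof -
      have "\<bar>f y\<bar> \<le> A" "\<bar>g z\<bar> \<le> B"
        using lipschitz_on_cball_bound[OF r(3) yz(1) r(1)] lipschitz_on_cball_bound[OF r(4) yz(2) r(1)]
        by (simp_all only: A_def B_def real_norm_def)
      moreover have "\<bar>g y - g z\<bar> \<le> M * dist y z" "\<bar>f y - f z\<bar> \<le> L * dist y z"
        using lipschitz_onD[OF r(3) yz] lipschitz_onD[OF r(4) yz] by (simp_all only: dist_real_def)
      ultimately show ?thesis using AB by (intro add_mono mult_mono) simp_all
    qed
    finally show "dist (f y * g y) (f z * g z) \<le> (A * M + B * L) * dist y z"
      by (simp add: dist_real_def algebra_simps)
  qed (use AB L M in auto)
  with r show "\<exists>r L. 0 < r \<and> cball x r \<subseteq> U \<and> L-lipschitz_on (cball x r) (\<lambda>x. f x * g x)" by blast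
qed

lemma loc_lipschitz_minus:
  fixes f :: "'a::euclidean_space \<Rightarrow> 'b::real_normed_vector"
  assumes "loc_lipschitz f U" shows "loc_lipschitz (\<lambda>x. - f x) U"
  using assms unfolding loc_lipschitz_def by simp

lemma loc_lipschitz_diff:
  assumes "loc_lipschitz f U" "loc_lipschitz g U" shows "loc_lipschitz (\<lambda>x. f x - g x) U"
  using loc_lipschitz_add[OF assms(1) loc_lipschitz_minus[OF assms(2)]] by simp

lemma loc_lipschitz_inverse:
  fixes f :: "'a::euclidean_space \<Rightarrow> real"
  assumes "loc_lipschitz f U" "\<And>x. x \<in> U \<Longrightarrow> f x \<noteq> 0" shows "loc_lipschitz (\<lambda>x. inverse (f x)) U"
proof (rule loc_lipschitzI)
  fix x assume x: "x \<in> U"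
  obtain r L where r: "0 < r" "cball x r \<subseteq> U" "L-lipschitz_on (cball x r) f"
    by (rule loc_lipschitzE[OF assms(1) x])
  have L: "0 \<le> L" by (rule lipschitz_on_nonneg[OF r(3)])
  define c where "c = \<bar>f x\<bar> / 2"
  have c: "0 < c" using assms(2)[OF x] by (simp add: c_def)
  define s where "s = min r (c / (L + 1))"
  have s: "0 < s" "s \<le> r" using r c L by (auto simp: s_def)
  have "L * s \<le> c"
  proof -
    have "L * s \<le> L * (c / (L + 1))" using L by (intro mult_left_mono) (auto simp: s_def)
    also have "\<dots> \<le> c" using L c by (simp add: field_simps)
    finally show ?thesis .
  qed
  have sub: "cball x s \<subseteq> cball x r" using s by auto
  have lip: "L-lipschitz_on (cball x s) f" by (rule lipschitz_on_subset[OF r(3) sub])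
  have ge: "c \<le> \<bar>f y\<bar>" if "y \<in> cball x s" for y
  proof -
    have "dist (f y) (f x) \<le> L * dist y x" using that s by (intro lipschitz_onD[OF lip]) auto
    also have "\<dots> \<le> L * s" using that L by (intro mult_left_mono) (auto simp: dist_commute)
    finally show ?thesis using \<open>L * s \<le> c\<close> by (simp add: dist_real_def c_def)
  qed
  have "(L / (c * c))-lipschitz_on (cball x s) (\<lambda>x. inverse (f x))"
  proof (rule lipschitz_onI)
    fix y z assume yz: "y \<in> cball x s" "z \<in> cball x s"
    have nz: "f y \<noteq> 0" "f z \<noteq> 0" using ge[OF yz(1)] ge[OF yz(2)] c by auto
    have "dist (inverse (f y)) (inverse (f z)) = \<bar>f y - f z\<bar> / (\<bar>f y\<bar> * \<bar>f z\<bar>)"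
    proof -
      have "inverse (f y) - inverse (f z) = (f z - f y) / (f y * f z)" using nz by (simp add: field_simps)
      then show ?thesis by (simp only: dist_real_def abs_divide abs_mult abs_minus_commute)
    qed
    also have "\<dots> \<le> (L * dist y z) / (c * c)"
      using ge[OF yz(1)] ge[OF yz(2)] c L lipschitz_onD[OF lip yz, unfolded dist_real_def]
      by (intro frac_le mult_mono) simp_all
    finally show "dist (inverse (f y)) (inverse (f z)) \<le> L / (c * c) * dist y z" by simp
  qed (use L c in auto)
  with s sub r(2) show "\<exists>r La. 0 < r \<and> cball x r \<subseteq> U \<and> La-lipschitz_on (cball x r) (\<lambda>x. inverse (f x))"
    by (intro exI[of _ s] exI[of _ "L / (c * c)"]) auto
qed

lemma loc_lipschitz_power:
  fixes f :: "'a::euclidean_space \<Rightarrow> real"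
  assumes "loc_lipschitz f U" "open U" shows "loc_lipschitz (\<lambda>x. f x ^ n) U"
proof (induction n)
  case 0
  show ?case using loc_lipschitz_const[OF assms(2), of 1] by simp
next
  case (Suc n)
  show ?case using loc_lipschitz_mult[OF assms(1) Suc] by simp
qed

lemma loc_lipschitz_divide:
  fixes f g :: "'a::euclidean_space \<Rightarrow> real"
  assumes "loc_lipschitz f U" "loc_lipschitz g U" "\<And>x. x \<in> U \<Longrightarrow> g x \<noteq> 0"
  shows "loc_lipschitz (\<lambda>x. f x / g x) U"
  unfolding divide_inverse by (intro loc_lipschitz_mult loc_lipschitz_inverse assms)

text \<open>The step \<open>h\<close> must be common to all starting points near \<open>x0\<close>.
  Composing \<open>f\<close> with the nearest-point projection onto a ball gives a bounded, globally
  Lipschitz field, so the integral operator acts on all bounded continuous functions; its fixed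
  point stays in the ball, where the projection is the identity.\<close>

lemma picard_local:
  fixes f :: "'a::euclidean_space \<Rightarrow> 'a"
  assumes "loc_lipschitz f U" "x0 \<in> U"
  shows "\<exists>h>0. \<exists>r>0. \<forall>x1\<in>ball x0 r. \<exists>z. z 0 = x1 \<and>
    (\<forall>t\<in>{-h<..<h}. z t \<in> U \<and> (z has_vector_derivative f (z t)) (at t))"
proof -
  obtain R L where R: "0 < R" "cball x0 R \<subseteq> U" "L-lipschitz_on (cball x0 R) f"
    by (rule loc_lipschitzE[OF assms])
  have L: "0 \<le> L" by (rule lipschitz_on_nonneg[OF R(3)])
  define M where "M = norm (f x0) + L * R"
  have M: "0 \<le> M" using L R by (simp add: M_def)
  define r where "r = R / 2"
  have r: "0 < r" using R by (simp add: r_def)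
  \<comment> \<open>The first bound makes the operator a contraction by 1/2, the second keeps its
    fixed point in the ball of radius \<open>r\<close>. Both act through \<open>4 * h\<close>, which
    bounds the total length of the two integration intervals in \<open>I\<close>.\<close>
  define h where "h = min (1 / (8 * (L + 1))) (r / (4 * (M + 1)))"
  have h: "0 < h" using L M r by (simp add: h_def)
  have "h * (8 * (L + 1)) \<le> 1"
    using mult_right_mono[of h "1 / (8 * (L + 1))" "8 * (L + 1)"] L by (simp add: h_def)
  then have hL: "4 * h * L \<le> 1 / 2" using h L by (simp add: algebra_simps)
  have "h * (4 * (M + 1)) \<le> r"
    using mult_right_mono[of h "r / (4 * (M + 1))" "4 * (M + 1)"] M by (simp add: h_def)
  then have hM: "4 * h * M \<le> r" using h M by (simp add: algebra_simps)
  have "\<exists>z. z 0 = x1 \<and> (\<forall>t\<in>{-h<..<h}. z t \<in> U \<and> (z has_vector_derivative f (z t)) (at t))"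
    if x1: "x1 \<in> ball x0 r" for x1
  proof -
    have sub: "cball x1 r \<subseteq> cball x0 R"
    proof
      fix y assume "y \<in> cball x1 r"
      then show "y \<in> cball x0 R" using x1 dist_triangle[of x0 y x1] by (auto simp: r_def)
    qed
    have lip: "L-lipschitz_on (cball x1 r) f" by (rule lipschitz_on_subset[OF R(3) sub])
    define P where "P = closest_point (cball x1 r)"
    have Pin: "P y \<in> cball x1 r" for y unfolding P_def using r by (intro closest_point_in_set) auto
    have Plip: "dist (P y) (P z) \<le> dist y z" for y z
      unfolding P_def using r by (intro closest_point_lipschitz) auto
    have Pid: "P y = y" if "y \<in> cball x1 r" for y unfolding P_def by (rule closest_point_self[OF that])
    define g where "g y = f (P y)" for y
    have glip: "dist (g y) (g z) \<le> L * dist y z" for y z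
      using lipschitz_onD[OF lip Pin Pin, of y z] mult_left_mono[OF Plip L, of y z] by (simp add: g_def)
    have gb: "norm (g y) \<le> M" for y
      using lipschitz_on_cball_bound[OF R(3) _ R(1), of "P y"] Pin[of y] sub by (auto simp: g_def M_def)
    have gcont: "continuous_on S g" for S
      by (rule lipschitz_on_continuous_on[of L]) (auto intro!: lipschitz_onI glip L)
    \<comment> \<open>Clamping time to \<open>[-h, h]\<close> keeps the integral operator bounded on
      the whole line; the difference of two integrals from \<open>-h\<close> in \<open>I\<close>
      serves as the integral from 0 to \<open>t\<close> for either sign of \<open>t\<close>.\<close>
    define c where "c t = max (-h) (min h t)" for t
    have c: "c t \<in> {-h..h}" for t using h by (auto simp: c_def)
    have ccont: "continuous_on UNIV c" unfolding c_def by (intro continuous_intros)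
    define I where "I v t = integral {-h..c t} v - integral {-h..0} v" for v :: "real \<Rightarrow> 'a" and t
    have Icont: "continuous_on UNIV (I v)" if v: "continuous_on UNIV v" for v
    proof -
      have "continuous_on {-h..h} (\<lambda>x. integral {-h..x} v)"
        by (intro indefinite_integral_continuous_1 integrable_continuous_real continuous_on_subset[OF v]) auto
      then have "continuous_on UNIV (\<lambda>t. integral {-h..c t} v)"
        by (rule continuous_on_compose2[OF _ ccont]) (use c in auto)
      then show ?thesis unfolding I_def by (intro continuous_intros)
    qed
    have Ibound: "norm (I v t) \<le> 4 * h * B" if v: "continuous_on UNIV v" and b: "\<And>s. norm (v s) \<le> B" for v B t
    proof -
      have B: "0 \<le> B" using b[of 0] norm_ge_zero order_trans by blast
      have *: "norm (integral {-h..s} v) \<le> B * (2 * h)" if "s \<in> {-h..h}" for s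
      proof -
        have "norm (integral {-h..s} v) \<le> B * (s - (-h))"
          using that b by (intro integral_bound continuous_on_subset[OF v]) auto
        also have "\<dots> \<le> B * (2 * h)" using that B by (intro mult_left_mono) auto
        finally show ?thesis .
      qed
      show ?thesis unfolding I_def
        using norm_triangle_ineq4[of "integral {-h..c t} v" "integral {-h..0} v"] *[OF c[of t]] *[of 0] h
        by (simp add: algebra_simps)
    qed
    have Idiff: "I v t - I w t = I (\<lambda>s. v s - w s) t" if "continuous_on UNIV v" "continuous_on UNIV w" for v w t
      unfolding I_def
      by (subst (1 2) integral_diff) (auto intro!: integrable_continuous_real continuous_on_subset[OF that(1)] continuous_on_subset[OF that(2)])
    have gu: "continuous_on UNIV (\<lambda>s. g (apply_bcontfun u s))" for u :: "real \<Rightarrow>\<^sub>C 'a"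
      by (rule continuous_on_compose2[OF gcont[of UNIV]]) (auto intro: continuous_on_apply_bcontfun)
    define T where "T u = Bcontfun (\<lambda>t. x1 + I (\<lambda>s. g (apply_bcontfun u s)) t)" for u :: "real \<Rightarrow>\<^sub>C 'a"
    have bc: "(\<lambda>t. x1 + I (\<lambda>s. g (apply_bcontfun u s)) t) \<in> bcontfun" for u
    proof (rule bcontfun_normI)
      show "continuous_on UNIV (\<lambda>t. x1 + I (\<lambda>s. g (apply_bcontfun u s)) t)"
        by (intro continuous_intros Icont gu)
      show "norm (x1 + I (\<lambda>s. g (apply_bcontfun u s)) t) \<le> norm x1 + 4 * h * M" for t
        by (rule order_trans[OF norm_triangle_ineq add_left_mono[OF Ibound[OF gu gb]]])
    qed
    have T: "apply_bcontfun (T u) t = x1 + I (\<lambda>s. g (apply_bcontfun u s)) t" for u t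
      unfolding T_def by (simp add: Bcontfun_inverse[OF bc])
    have "\<exists>!u. T u = u"
    proof (rule banach_fix_type[of "1/2"])
      show "\<forall>u v. dist (T u) (T v) \<le> 1 / 2 * dist u v"
      proof (intro allI dist_bound)
        fix u v :: "real \<Rightarrow>\<^sub>C 'a" and t
        have "dist (apply_bcontfun (T u) t) (apply_bcontfun (T v) t)
            = norm (I (\<lambda>s. g (apply_bcontfun u s) - g (apply_bcontfun v s)) t)"
          by (simp add: T dist_norm Idiff[OF gu gu])
        also have "\<dots> \<le> 4 * h * (L * dist u v)"
        proof (rule Ibound)
          show "continuous_on UNIV (\<lambda>s. g (apply_bcontfun u s) - g (apply_bcontfun v s))"
            by (intro continuous_intros gu)
          show "norm (g (apply_bcontfun u s) - g (apply_bcontfun v s)) \<le> L * dist u v" for s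
            using glip[of "apply_bcontfun u s" "apply_bcontfun v s"] mult_left_mono[OF dist_bounded L, of u s v]
            by (simp add: dist_norm)
        qed
        also have "\<dots> \<le> 1 / 2 * dist u v"
          using mult_right_mono[OF hL, of "dist u v"] by (simp add: algebra_simps)
        finally show "dist (apply_bcontfun (T u) t) (apply_bcontfun (T v) t) \<le> 1 / 2 * dist u v" .
      qed
    qed auto
    then obtain u where u: "T u = u" by blast
    define z where "z = apply_bcontfun u"
    have z: "z t = x1 + I (\<lambda>s. g (z s)) t" for t using T[of u t] u by (simp add: z_def)
    have zc: "continuous_on UNIV (\<lambda>s. g (z s))" unfolding z_def by (rule gu)
    have zin: "z t \<in> cball x1 r" for t
      unfolding mem_cball dist_norm by (subst z) (use Ibound[OF zc gb, of t] hM in simp)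
    have "z 0 = x1" by (subst z) (use h in \<open>simp add: I_def c_def\<close>)
    moreover have "z t \<in> U" for t using zin[of t] sub R by blast
    moreover have "(z has_vector_derivative f (z t)) (at t)" if t: "t \<in> {-h<..<h}" for t
    proof -
      have "((\<lambda>s. integral {-h..s} (\<lambda>s. g (z s))) has_vector_derivative g (z t)) (at t within {-h..h})"
        using t by (intro integral_has_vector_derivative continuous_on_subset[OF zc]) auto
      then have "((\<lambda>s. integral {-h..s} (\<lambda>s. g (z s))) has_vector_derivative g (z t)) (at t)"
        using t by (simp add: at_within_Icc_at)
      then have "((\<lambda>s. x1 + (integral {-h..s} (\<lambda>s. g (z s)) - integral {-h..0} (\<lambda>s. g (z s)))) has_vector_derivative g (z t)) (at t)"
        by (auto intro!: derivative_eq_intros)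
      then have "(z has_vector_derivative g (z t)) (at t)"
      proof (rule has_vector_derivative_transform_within_open[where S = "{-h<..<h}"])
        fix s assume "s \<in> {-h<..<h}"
        then show "x1 + (integral {-h..s} (\<lambda>s. g (z s)) - integral {-h..0} (\<lambda>s. g (z s))) = z s"
          by (subst (3) z) (simp add: I_def c_def)
      qed (use t in auto)
      then show ?thesis using Pid[OF zin] by (simp add: g_def)
    qed
    ultimately show ?thesis by blast
  qed
  with h r show ?thesis by blast
qed

section \<open>Uniqueness and continuation of solutions\<close>

lemma ode_unique:
  fixes f :: "'a::euclidean_space \<Rightarrow> 'a"
  assumes lip: "loc_lipschitz f U"
    and cx: "continuous_on {a..<b} x" and cy: "continuous_on {a..<b} y" and init: "x a = y a"
    and xU: "\<And>t. t \<in> {a..<b} \<Longrightarrow> x t \<in> U"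
    and dx: "\<And>t. t \<in> {a<..<b} \<Longrightarrow> (x has_vector_derivative f (x t)) (at t)"
    and dy: "\<And>t. t \<in> {a<..<b} \<Longrightarrow> y t \<in> U \<Longrightarrow> (y has_vector_derivative f (y t)) (at t)"
    and t: "t \<in> {a..<b}"
  shows "x t = y t"
proof (rule ccontr)
  assume ne: "x t \<noteq> y t"
  \<comment> \<open>Past the first time \<open>c\<close> of disagreement both curves stay for a
    while in a ball around \<open>x c\<close> on which \<open>f\<close> is Lipschitz. The second
    curve is known to solve the equation only while it lies in \<open>U\<close>, and this ball puts
    it there.\<close>
  define S where "S = {s\<in>{a..<b}. x s \<noteq> y s}"
  define c where "c = Inf S"
  have S: "t \<in> S" "S \<noteq> {}" "bdd_below S" using ne t by (auto simp: S_def bdd_below_def)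
  have ct: "c \<le> t" unfolding c_def by (rule cInf_lower[OF S(1,3)])
  have ac: "a \<le> c" unfolding c_def by (rule cInf_greatest[OF S(2)]) (auto simp: S_def)
  have cab: "c \<in> {a..<b}" using ct ac t by auto
  have agr: "x s = y s" if "s \<in> {a..<c}" for s
  proof (rule ccontr)
    assume "x s \<noteq> y s"
    then have "s \<in> S" using that cab by (auto simp: S_def)
    then have "c \<le> s" unfolding c_def by (rule cInf_lower[OF _ S(3)])
    with that show False by simp
  qed
  have agc: "x c = y c"
  proof (cases "c = a")
    case False
    with ac have "a < c" by simp
    have "continuous_on {a..c} (\<lambda>s. x s - y s)"
      using cab by (intro continuous_intros continuous_on_subset[OF cx] continuous_on_subset[OF cy]) auto
    then have "closed ({a..c} \<inter> (\<lambda>s. x s - y s) -` {0})"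
      by (rule continuous_closed_preimage) auto
    moreover have "{a..<c} \<subseteq> {a..c} \<inter> (\<lambda>s. x s - y s) -` {0}" using agr by auto
    ultimately have "closure {a..<c} \<subseteq> {a..c} \<inter> (\<lambda>s. x s - y s) -` {0}" by (intro closure_minimal)
    moreover have "c \<in> closure {a..<c}" using \<open>a < c\<close> by simp
    ultimately have "c \<in> {a..c} \<inter> (\<lambda>s. x s - y s) -` {0}" by (rule subsetD)
    then show ?thesis by simp
  qed (use init in simp)
  obtain r L where r: "0 < r" "cball (x c) r \<subseteq> U" "L-lipschitz_on (cball (x c) r) f"
    by (rule loc_lipschitzE[OF lip xU[OF cab]])
  have "\<exists>d>0. \<forall>s\<in>{a..<b}. dist s c < d \<longrightarrow> dist (x s) (x c) < r" "\<exists>d>0. \<forall>s\<in>{a..<b}. dist s c < d \<longrightarrow> dist (y s) (y c) < r"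
    using cx cy cab r(1) unfolding continuous_on_iff by blast+
  then obtain d1 d2 where d: "0 < d1" "0 < d2"
    "\<And>s. s \<in> {a..<b} \<Longrightarrow> dist s c < d1 \<Longrightarrow> dist (x s) (x c) < r"
    "\<And>s. s \<in> {a..<b} \<Longrightarrow> dist s c < d2 \<Longrightarrow> dist (y s) (y c) < r" by blast
  define e where "e = c + min (min d1 d2) (b - c) / 2"
  have e: "c < e" "e < b" "e - c < d1" "e - c < d2" using d(1,2) cab by (auto simp: e_def min_def field_simps)
  have inr: "x s \<in> cball (x c) r" "y s \<in> cball (x c) r" if "s \<in> {c..e}" for s
    using d(3)[of s] d(4)[of s] that e cab agc by (auto simp: dist_real_def dist_commute less_imp_le)
  \<comment> \<open>The exponential weight compensates the growth that the Lipschitz constant allows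
    to the squared distance, so \<open>\<phi>\<close> decreases from
    \<open>\<phi> c = 0\<close>.\<close>
  define \<phi> where "\<phi> s = exp (- 2 * L * s) * ((x s - y s) \<bullet> (x s - y s))" for s
  have "x s = y s" if s: "s \<in> {c..e}" for s
  proof -
    have "\<phi> s \<le> \<phi> c"
    proof (rule DERIV_nonpos_imp_decreasing_open[of c s \<phi>])
      show "c \<le> s" using s by simp
      show "continuous_on {c..s} \<phi>" unfolding \<phi>_def
        using s e cab by (intro continuous_intros continuous_on_subset[OF cx] continuous_on_subset[OF cy]) auto
      fix u assume u: "c < u" "u < s"
      then have ui: "u \<in> {c..e}" "u \<in> {a<..<b}" using s e cab by auto
      have X: "(x has_vector_derivative f (x u)) (at u)" by (rule dx[OF ui(2)])
      have Y: "(y has_vector_derivative f (y u)) (at u)" using dy[OF ui(2)] inr(2)[OF ui(1)] r(2) by auto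
      have "((\<lambda>s. (x s - y s) \<bullet> (x s - y s)) has_vector_derivative
          ((x u - y u) \<bullet> (f (x u) - f (y u)) + (f (x u) - f (y u)) \<bullet> (x u - y u))) (at u)"
        by (rule bounded_bilinear.has_vector_derivative[OF bounded_bilinear_inner
              has_vector_derivative_diff[OF X Y] has_vector_derivative_diff[OF X Y]])
      then have D: "((\<lambda>s. (x s - y s) \<bullet> (x s - y s)) has_real_derivative 2 * ((x u - y u) \<bullet> (f (x u) - f (y u)))) (at u)"
        by (simp add: has_real_derivative_iff_has_vector_derivative inner_commute)
      define D' where "D' = exp (- 2 * L * u) * (2 * ((x u - y u) \<bullet> (f (x u) - f (y u))) - 2 * L * ((x u - y u) \<bullet> (x u - y u)))"
      have "(\<phi> has_real_derivative D') (at u)"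
        unfolding \<phi>_def D'_def by (rule derivative_eq_intros D refl | simp add: algebra_simps)+
      moreover have "D' \<le> 0"
      proof -
        have "(x u - y u) \<bullet> (f (x u) - f (y u)) \<le> norm (x u - y u) * norm (f (x u) - f (y u))"
          by (rule norm_cauchy_schwarz)
        also have "\<dots> \<le> norm (x u - y u) * (L * norm (x u - y u))"
          by (intro mult_left_mono lipschitz_on_normD[OF r(3)] inr ui) simp
        also have "\<dots> = L * ((x u - y u) \<bullet> (x u - y u))" by (simp add: power2_norm_eq_inner[symmetric] power2_eq_square)
        finally show ?thesis unfolding D'_def by (intro mult_nonneg_nonpos) simp_all
      qed
      ultimately show "\<exists>y. DERIV \<phi> u :> y \<and> y \<le> 0" by blast
    qed
    also have "\<phi> c = 0" by (simp add: \<phi>_def agc)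
    finally have "(x s - y s) \<bullet> (x s - y s) \<le> 0" by (simp add: \<phi>_def mult_le_0_iff)
    then have "x s - y s = 0" using inner_gt_zero_iff[of "x s - y s"] by (auto simp del: inner_gt_zero_iff)
    then show ?thesis by simp
  qed
  note agre = this
  have "e \<le> s" if "s \<in> S" for s
    using that agr[of s] agre[of s] by (cases "s < c"; cases "s \<le> e") (auto simp: S_def)
  then have "e \<le> c" unfolding c_def by (intro cInf_greatest S(2))
  with e show False by simp
qed

definition solves :: "('a::euclidean_space \<Rightarrow> 'a) \<Rightarrow> 'a set \<Rightarrow> 'a \<Rightarrow> real \<Rightarrow> (real \<Rightarrow> 'a) \<Rightarrow> bool" where
  "solves f U x0 T x \<longleftrightarrow> continuous_on {0..<T} x \<and> x 0 = x0 \<and> (\<forall>t\<in>{0..<T}. x t \<in> U) \<and>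
     (\<forall>t\<in>{0<..<T}. (x has_vector_derivative f (x t)) (at t))"

lemma solves_unique:
  assumes "loc_lipschitz f U" "solves f U x0 T x" "solves f U x0 T' y" "0 \<le> t" "t < T" "t < T'"
  shows "x t = y t"
proof (rule ode_unique[OF assms(1)])
  show "continuous_on {0..<min T T'} x" "continuous_on {0..<min T T'} y"
    using assms(2,3) unfolding solves_def by (auto intro: continuous_on_subset)
qed (use assms in \<open>auto simp: solves_def\<close>)

text \<open>The step in \<open>picard_local\<close> is uniform on a ball, so a finite subcover
  yields a common one.\<close>

lemma picard_compact:
  fixes f :: "'a::euclidean_space \<Rightarrow> 'a"
  assumes "loc_lipschitz f U" "compact C" "C \<subseteq> U"
  shows "\<exists>h>0. \<forall>x1\<in>C. \<exists>z. z 0 = x1 \<and> (\<forall>t\<in>{-h<..<h}. z t \<in> U \<and> (z has_vector_derivative f (z t)) (at t))"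
proof -
  have "\<forall>p\<in>C. \<exists>h r. 0 < h \<and> 0 < r \<and> (\<forall>x1\<in>ball p r. \<exists>z. z 0 = x1 \<and>
    (\<forall>t\<in>{-h<..<h}. z t \<in> U \<and> (z has_vector_derivative f (z t)) (at t)))"
  proof
    fix p assume "p \<in> C"
    with assms(3) have "p \<in> U" by blast
    from picard_local[OF assms(1) this] show "\<exists>h r. 0 < h \<and> 0 < r \<and> (\<forall>x1\<in>ball p r. \<exists>z. z 0 = x1 \<and>
      (\<forall>t\<in>{-h<..<h}. z t \<in> U \<and> (z has_vector_derivative f (z t)) (at t)))" by (elim exE conjE) (intro exI conjI)
  qed
  from bchoice[OF this] obtain h where "\<forall>p\<in>C. \<exists>r. 0 < h p \<and> 0 < r \<and> (\<forall>x1\<in>ball p r. \<exists>z. z 0 = x1 \<and>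
    (\<forall>t\<in>{-h p<..<h p}. z t \<in> U \<and> (z has_vector_derivative f (z t)) (at t)))" by (elim exE) (rule that)
  from bchoice[OF this] obtain r where hr: "\<forall>p\<in>C. 0 < h p \<and> 0 < r p \<and> (\<forall>x1\<in>ball p (r p). \<exists>z. z 0 = x1 \<and>
    (\<forall>t\<in>{-h p<..<h p}. z t \<in> U \<and> (z has_vector_derivative f (z t)) (at t)))" by (elim exE) (rule that)
  have "\<exists>C'\<subseteq>C. finite C' \<and> C \<subseteq> (\<Union>p\<in>C'. ball p (r p))"
  proof (rule compactE_image[OF assms(2), of C "\<lambda>p. ball p (r p)"])
    show "C \<subseteq> (\<Union>p\<in>C. ball p (r p))" using hr by force
  qed auto
  then obtain C' where C': "C' \<subseteq> C" "finite C'" "C \<subseteq> (\<Union>p\<in>C'. ball p (r p))" by blast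
  \<comment> \<open>The inserted 1 keeps the minimum defined when the subcover is empty.\<close>
  define H where "H = Min (insert 1 (h ` C'))"
  have H: "0 < H" "\<And>p. p \<in> C' \<Longrightarrow> H \<le> h p" using C' hr by (auto simp: H_def)
  have "\<exists>z. z 0 = x1 \<and> (\<forall>t\<in>{-H<..<H}. z t \<in> U \<and> (z has_vector_derivative f (z t)) (at t))" if "x1 \<in> C" for x1
  proof -
    have "x1 \<in> (\<Union>p\<in>C'. ball p (r p))" by (rule subsetD[OF C'(3) that])
    then obtain p where p: "p \<in> C'" "x1 \<in> ball p (r p)" by blast
    then have "p \<in> C" using C'(1) by blast
    with hr p(2) obtain z where "z 0 = x1" "\<forall>t\<in>{-h p<..<h p}. z t \<in> U \<and> (z has_vector_derivative f (z t)) (at t)"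
      by blast
    then show ?thesis using H(2)[OF p(1)] by (intro exI[of _ z]) auto
  qed
  with H(1) show ?thesis by blast
qed

text \<open>Lifetimes are assumed bounded, so their supremum \<open>T\<close> is finite and all
  solutions unite on \<open>[0, T)\<close>. If this solution stayed in a compact set up to
  \<open>T\<close>, the common step of \<open>picard_compact\<close> would continue it beyond
  \<open>T\<close>.\<close>

theorem maximal_solution:
  fixes f :: "'a::euclidean_space \<Rightarrow> 'a"
  assumes lip: "loc_lipschitz f U" and x0: "x0 \<in> U"
    and bound: "\<And>T x. solves f U x0 T x \<Longrightarrow> T \<le> Tm"
  obtains T x where "0 < T" "solves f U x0 T x"
    "\<And>C t0. compact C \<Longrightarrow> C \<subseteq> U \<Longrightarrow> t0 < T \<Longrightarrow> \<exists>t\<in>{0..<T}. t0 < t \<and> x t \<notin> C"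
proof -
  define S where "S = {T. 0 < T \<and> (\<exists>x. solves f U x0 T x)}"
  obtain h z where hz: "0 < h" "z 0 = x0" "\<And>t. t \<in> {-h<..<h} \<Longrightarrow> z t \<in> U \<and> (z has_vector_derivative f (z t)) (at t)"
    using picard_compact[OF lip, of "{x0}"] x0 by auto
  have "solves f U x0 h z" unfolding solves_def
  proof (intro conjI ballI)
    show "continuous_on {0..<h} z"
    proof (intro continuous_at_imp_continuous_on ballI)
      fix t assume "t \<in> {0..<h}"
      then show "continuous (at t) z" using hz(3)[of t] hz(1)
        by (intro has_vector_derivative_continuous[of z "f (z t)"]) simp
    qed
  qed (use hz in auto)
  with hz have hS: "h \<in> S" by (auto simp: S_def)
  have bdd: "bdd_above S" unfolding bdd_above_def S_def using bound by blast
  define T where "T = Sup S"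
  have hT: "h \<le> T" unfolding T_def by (rule cSup_upper[OF hS bdd])
  have "\<exists>T' y. t < T' \<and> solves f U x0 T' y" if "t < T" for t
  proof -
    have "S \<noteq> {}" using hS by blast
    from less_cSup_iff[OF this bdd, of t] that obtain T' where "T' \<in> S" "t < T'" by (auto simp: T_def)
    then show ?thesis unfolding S_def by blast
  qed
  then obtain R Y where RY: "\<And>t. t < T \<Longrightarrow> t < R t \<and> solves f U x0 (R t) (Y t)" by metis
  define x where "x t = Y t t" for t
  have xy: "x s = y s" if "solves f U x0 T' y" "0 \<le> s" "s < T'" "s < T" for y T' s
    unfolding x_def using RY[OF that(4)] that(2,3)
    by (intro solves_unique[OF lip _ that(1), where T = "R s"]) simp_all
  have sol: "solves f U x0 T x" unfolding solves_def
  proof (intro conjI ballI)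
    show "x 0 = x0" using xy[of h z 0] \<open>solves f U x0 h z\<close> hz hT by simp
    show U: "x t \<in> U" if "t \<in> {0..<T}" for t
      using that RY[of t] by (auto simp: x_def solves_def)
    show der: "(x has_vector_derivative f (x t)) (at t)" if t: "t \<in> {0<..<T}" for t
    proof -
      have R: "t < R t" "solves f U x0 (R t) (Y t)" using RY[of t] t by auto
      then have "(Y t has_vector_derivative f (x t)) (at t)" using t by (auto simp: solves_def x_def)
      then show ?thesis
      proof (rule has_vector_derivative_transform_within_open[where S = "{0<..<min T (R t)}"])
        show "Y t s = x s" if "s \<in> {0<..<min T (R t)}" for s using xy[OF R(2), of s] that by simp
      qed (use t R in auto)
    qed
    show "continuous_on {0..<T} x"
      unfolding continuous_on_eq_continuous_within
    proof
      fix t assume t: "t \<in> {0..<T}"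
      show "continuous (at t within {0..<T}) x"
      proof (cases "t = 0")
        case False
        then have "continuous (at t) x" using der[of t] t by (auto intro: has_vector_derivative_continuous)
        then show ?thesis by (rule continuous_at_imp_continuous_at_within)
      next
        case True
        have "continuous (at 0) z" using hz by (intro has_vector_derivative_continuous[of z "f (z 0)"]) auto
        then have "continuous (at 0 within {0..<T}) z" by (rule continuous_at_imp_continuous_at_within)
        then have "continuous (at 0 within {0..<T}) x"
          by (rule continuous_transform_within[of 0 "{0..<T}" z h x])
            (use hz hT xy[OF \<open>solves f U x0 h z\<close>] in \<open>auto simp: dist_real_def\<close>)
        with True show ?thesis by simp
      qed
    qed
  qed
  have T0: "0 < T" using hT hz by simp
  have leave: "\<exists>t\<in>{0..<T}. t0 < t \<and> x t \<notin> C" if C: "compact C" "C \<subseteq> U" and t0: "t0 < T" for C t0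
  proof (rule ccontr)
    assume "\<not> (\<exists>t\<in>{0..<T}. t0 < t \<and> x t \<notin> C)"
    then have inC: "x t \<in> C" if "0 \<le> t" "t < T" "t0 < t" for t using that by auto
    obtain H where H: "0 < H" "\<And>x1. x1 \<in> C \<Longrightarrow> \<exists>z. z 0 = x1 \<and> (\<forall>t\<in>{-H<..<H}. z t \<in> U \<and> (z has_vector_derivative f (z t)) (at t))"
      using picard_compact[OF lip C] by blast
    \<comment> \<open>Midway between \<open>T\<close> and the largest of \<open>t0\<close>, 0 and
      \<open>T - H\<close>: late enough for a step of length \<open>H\<close> to pass
      \<open>T\<close>.\<close>
    define t1 where "t1 = max (max t0 0) (T - H) / 2 + T / 2"
    have t1: "0 < t1" "t0 < t1" "t1 < T" "T < t1 + H"
      using T0 t0 H(1) by (auto simp: t1_def max_def field_simps split: if_splits)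
    obtain w where w: "w 0 = x t1" "\<And>t. t \<in> {-H<..<H} \<Longrightarrow> w t \<in> U \<and> (w has_vector_derivative f (w t)) (at t)"
      using H(2)[OF inC[of t1]] t1 by auto
    define v where "v t = w (t - t1)" for t
    have v: "v t \<in> U" "(v has_vector_derivative f (v t)) (at t)" if "t \<in> {t1 - H<..<t1 + H}" for t
    proof -
      have *: "t - t1 \<in> {-H<..<H}" using that by auto
      show "v t \<in> U" using w(2)[OF *] by (simp add: v_def)
      have "((\<lambda>s. w (s - t1)) has_vector_derivative (1 *\<^sub>R f (w (t - t1)))) (at t)"
        using vector_diff_chain_at[of "\<lambda>s. s - t1" 1 t w "f (w (t - t1))"] w(2)[OF *]
          has_vector_derivative_diff[OF has_vector_derivative_id[of "at t"] has_vector_derivative_const[of t1]]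
        by (simp add: o_def)
      then show "(v has_vector_derivative f (v t)) (at t)" by (simp add: v_def[abs_def])
    qed
    have xv: "x t = v t" if "t \<in> {t1..<T}" for t
    proof (rule ode_unique[OF lip, of t1 T x v])
      show "continuous_on {t1..<T} x" using sol t1 unfolding solves_def by (auto intro: continuous_on_subset)
      show "continuous_on {t1..<T} v"
      proof (intro continuous_at_imp_continuous_on ballI)
        fix s assume "s \<in> {t1..<T}"
        then show "continuous (at s) v" using v(2)[of s] t1 H(1)
          by (intro has_vector_derivative_continuous[of v "f (v s)"]) simp
      qed
    qed (use that w(1) v sol t1 H in \<open>auto simp: v_def solves_def\<close>)
    define u where "u t = (if t < T then x t else v t)" for t
    have uv: "u t = v t" if "t1 \<le> t" for t using xv[of t] that by (simp add: u_def)
    have "solves f U x0 (t1 + H) u" unfolding solves_def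
    proof (intro conjI ballI)
      show "u 0 = x0" using sol T0 by (simp add: u_def solves_def)
      show "u t \<in> U" if "t \<in> {0..<t1 + H}" for t
        using that sol v(1)[of t] t1 H by (auto simp: u_def solves_def)
      show du: "(u has_vector_derivative f (u t)) (at t)" if t: "t \<in> {0<..<t1 + H}" for t
      proof (cases "t < T")
        case True
        have "(x has_vector_derivative f (u t)) (at t)" using t True sol by (auto simp: u_def solves_def)
        then show ?thesis
          by (rule has_vector_derivative_transform_within_open[where S = "{..<T}"]) (use True in \<open>auto simp: u_def\<close>)
      next
        case False
        have "(v has_vector_derivative f (u t)) (at t)" using t False v[of t] H t1 by (auto simp: u_def)
        then show ?thesis
          by (rule has_vector_derivative_transform_within_open[where S = "{t1<..}"]) (use False t1 uv in auto)
      qed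
      show "continuous_on {0..<t1 + H} u"
        unfolding continuous_on_eq_continuous_within
      proof
        fix t assume t: "t \<in> {0..<t1 + H}"
        show "continuous (at t within {0..<t1 + H}) u"
        proof (cases "t = 0")
          case False
          then have "continuous (at t) u" using du[of t] t by (auto intro: has_vector_derivative_continuous)
          then show ?thesis by (rule continuous_at_imp_continuous_at_within)
        next
          case True
          have "continuous (at 0 within {0..<T}) x"
            using sol T0 by (auto simp: solves_def continuous_on_eq_continuous_within)
          moreover have "at 0 within {0..<T} = at 0 within {0..<t1 + H}"
            by (rule at_within_nhd[where S = "{..<T}"]) (use T0 t1 in auto)
          ultimately have "continuous (at 0 within {0..<t1 + H}) x" by simp
          then have "continuous (at 0 within {0..<t1 + H}) u"
            by (rule continuous_transform_within[of 0 "{0..<t1 + H}" x T u])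
              (use T0 t1 H in \<open>auto simp: dist_real_def u_def\<close>)
          with True show ?thesis by simp
        qed
      qed
    qed
    then have "t1 + H \<in> S" using t1 H by (auto simp: S_def)
    then have "t1 + H \<le> T" unfolding T_def by (rule cSup_upper[OF _ bdd])
    with t1 show False by simp
  qed
  show ?thesis by (rule that[OF T0 sol leave])
qed

section \<open>Regular form of the extended problem\<close>

text \<open>With \<open>d = Y\<^sup>2 \<delta>\<close>, \<open>w = 1 + Y \<omega>\<close> and \<open>\<mu> = \<delta>\<^sup>-\<^sup>\<eta> / \<chi>\<^sup>2\<close>, \<open>reg_K\<close> is \<open>- ext_C / \<chi>\<^sup>2\<close>, and \<open>reg_L\<close>, \<open>reg_W\<close> are
  the numerators that remain after the factor \<open>1 / Y\<close> has cancelled.\<close>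

definition reg_K :: "'a::comm_ring_1 \<Rightarrow> 'a \<Rightarrow> 'a \<Rightarrow> 'a \<Rightarrow> 'a \<Rightarrow> 'a" where
  "reg_K e Y \<delta> \<omega> \<mu> = (1 + Y * \<omega> + e)^2 - e * (Y * \<omega>)^2 + Y^2 * (4 * e * (1 + Y * \<omega>) * \<delta> - \<mu>)"

definition reg_L :: "'a::comm_ring_1 \<Rightarrow> 'a \<Rightarrow> 'a \<Rightarrow> 'a \<Rightarrow> 'a \<Rightarrow> 'a" where
  "reg_L e Y \<delta> \<omega> \<mu> = (let w = 1 + Y * \<omega> in
     2 * (\<omega> * ((w + e)^2 + e * (w - 1)) - Y * (\<delta> * (w + e)^2 + 4 * e * w * \<delta> - \<mu>)))"

definition reg_W :: "'a::comm_ring_1 \<Rightarrow> 'a \<Rightarrow> 'a \<Rightarrow> 'a \<Rightarrow> 'a \<Rightarrow> 'a" where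
  "reg_W e Y \<delta> \<omega> \<mu> = (let w = 1 + Y * \<omega> in
     \<omega> * (\<omega> * ((1 - 5 * e) * w^2 + (4 * e - 8 * e^2) * w - e + 3 * e^2 - 2 * e^3) - (1 - e) * Y * (4 * e * w * \<delta> - \<mu>))
     + (w + e) * ((3 * w - 1) * (4 * e * w * \<delta> - \<mu>) + 2 * (1 + e) * w * (w + e) * \<delta>))"

text \<open>At \<open>Y = 0\<close>, where \<open>w = 1\<close> and \<open>d = 0\<close>, both
  \<open>(w + e)\<^sup>2 (w - d)\<close> and \<open>reg_K\<close> equal
  \<open>(1 + e)\<^sup>2\<close>; their difference therefore carries the factor \<open>Y\<close>
  that cancels the singular coefficient.\<close>

lemma reg_L_identity:
  fixes Y :: real
  assumes "w = 1 + Y * \<omega>" "d = Y^2 * \<delta>"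
  shows "Y * reg_L e Y \<delta> \<omega> \<mu> = 2 * ((w + e)^2 * (w - d) - reg_K e Y \<delta> \<omega> \<mu>)"
  unfolding reg_L_def reg_K_def Let_def assms by algebra

text \<open>One factor \<open>Y\<close> cancels the singular coefficient of the equation for
  \<open>w\<close>, the other comes from \<open>\<omega> = (w - 1) / Y\<close>; the last term is
  what the quotient rule adds for that division.\<close>

lemma reg_W_identity:
  fixes Y :: real
  assumes "w = 1 + Y * \<omega>" "d = Y^2 * \<delta>"
  shows "Y^2 * reg_W e Y \<delta> \<omega> \<mu> =
     (w + e) * ((3 * w - 1) * reg_K e Y \<delta> \<omega> \<mu> - 2 * (1 + e) * w * (w + e) * (w - d))
     - (1 - e) * (w - 1) * reg_K e Y \<delta> \<omega> \<mu>"
  unfolding reg_W_def reg_K_def Let_def assms by algebra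

lemma reg_K_identity:
  fixes Y :: real
  assumes "w = 1 + Y * \<omega>" "d = Y^2 * \<delta>"
  shows "reg_K \<epsilon> Y \<delta> \<omega> \<mu> = (w + \<epsilon>)^2 - \<epsilon> * (w - 1)^2 + 4 * \<epsilon> * w * d - \<mu> * Y^2"
  unfolding reg_K_def assms by algebra

definition reg_ode :: "real \<Rightarrow> (real \<Rightarrow> real) \<Rightarrow> (real \<Rightarrow> real) \<Rightarrow> (real \<Rightarrow> real) \<Rightarrow> (real \<Rightarrow> real) \<Rightarrow> real \<Rightarrow> bool" where
  "reg_ode \<epsilon> \<delta> \<omega> \<mu> chi Y \<longleftrightarrow>
     (let L = reg_L \<epsilon> Y (\<delta> Y) (\<omega> Y) (\<mu> Y) / reg_K \<epsilon> Y (\<delta> Y) (\<omega> Y) (\<mu> Y) in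
     (\<delta> has_real_derivative \<delta> Y * L) (at Y) \<and>
     (\<omega> has_real_derivative reg_W \<epsilon> Y (\<delta> Y) (\<omega> Y) (\<mu> Y) / ((1 - \<epsilon>) * reg_K \<epsilon> Y (\<delta> Y) (\<omega> Y) (\<mu> Y))) (at Y) \<and>
     (\<mu> has_real_derivative \<mu> Y * (2 * \<omega> Y / (1 - \<epsilon>) - eta \<epsilon> * L)) (at Y) \<and>
     (chi has_real_derivative - (\<omega> Y * chi Y) / (1 - \<epsilon>)) (at Y))"

lemma ext_C_eq:
  assumes "d = Y^2 * \<delta>" "w = 1 + Y * \<omega>" "\<mu> = \<delta> powr (- eta \<epsilon>) / chi^2" "Y \<noteq> 0" "chi \<noteq> 0"
  shows "ext_C \<epsilon> Y d w chi = - (chi^2) * reg_K \<epsilon> Y \<delta> \<omega> \<mu>"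
proof -
  have "d / Y^2 = \<delta>" using assms by simp
  then have "(d / Y^2) powr (- eta \<epsilon>) = chi^2 * \<mu>" using assms by simp
  then have "ext_C \<epsilon> Y d w chi = chi^2 * \<mu> * Y^2 - chi^2 * ((w + \<epsilon>)^2 - \<epsilon> * (w - 1)^2 + 4 * \<epsilon> * w * d)"
    unfolding ext_C_def by simp
  also have "\<dots> = - (chi^2) * reg_K \<epsilon> Y \<delta> \<omega> \<mu>"
    unfolding reg_K_identity[OF assms(2,1)] by algebra
  finally show ?thesis .
qed

lemma reg_imp_ext_ode:
  fixes \<delta> \<omega> \<mu> chi :: "real \<Rightarrow> real"
  assumes \<epsilon>: "0 < \<epsilon>" "\<epsilon> < 1" and Y: "Y \<noteq> 0" and reg: "reg_ode \<epsilon> \<delta> \<omega> \<mu> chi Y"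
    and \<mu>: "\<mu> Y = \<delta> Y powr (- eta \<epsilon>) / (chi Y)^2" and pos: "0 < \<delta> Y" "0 < chi Y"
    and K: "reg_K \<epsilon> Y (\<delta> Y) (\<omega> Y) (\<mu> Y) > 0"
  shows "ext_ode \<epsilon> (\<lambda>Y. Y^2 * \<delta> Y) (\<lambda>Y. 1 + Y * \<omega> Y) chi Y"
proof -
  define k where "k = reg_K \<epsilon> Y (\<delta> Y) (\<omega> Y) (\<mu> Y)"
  define w where "w = 1 + Y * \<omega> Y"
  define d where "d = Y^2 * \<delta> Y"
  have k: "k > 0" using K by (simp add: k_def)
  have C: "ext_C \<epsilon> Y (Y^2 * \<delta> Y) (1 + Y * \<omega> Y) (chi Y) = - ((chi Y)^2) * k"
    unfolding k_def by (rule ext_C_eq) (use \<mu> Y pos in auto)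
  have L: "reg_L \<epsilon> Y (\<delta> Y) (\<omega> Y) (\<mu> Y) = 2 * ((w + \<epsilon>)^2 * (w - d) - k) / Y"
    using reg_L_identity[OF w_def d_def, of \<epsilon> "\<mu> Y"] Y by (simp add: k_def field_simps)
  have W: "reg_W \<epsilon> Y (\<delta> Y) (\<omega> Y) (\<mu> Y) = ((w + \<epsilon>) * ((3 * w - 1) * k - 2 * (1 + \<epsilon>) * w * (w + \<epsilon>) * (w - d))
     - (1 - \<epsilon>) * (w - 1) * k) / Y^2"
    using reg_W_identity[OF w_def d_def, of \<epsilon> "\<mu> Y"] Y by (simp add: k_def field_simps)
  have D: "(\<delta> has_real_derivative \<delta> Y * (2 * ((w + \<epsilon>)^2 * (w - d) - k) / Y / k)) (at Y)"
    "(\<omega> has_real_derivative ((w + \<epsilon>) * ((3 * w - 1) * k - 2 * (1 + \<epsilon>) * w * (w + \<epsilon>) * (w - d))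
     - (1 - \<epsilon>) * (w - 1) * k) / Y^2 / ((1 - \<epsilon>) * k)) (at Y)"
    "(chi has_real_derivative - (\<omega> Y * chi Y) / (1 - \<epsilon>)) (at Y)"
    using reg unfolding reg_ode_def Let_def L W k_def[symmetric] by auto
  have \<omega>Y: "\<omega> Y = (w - 1) / Y" using Y by (simp add: w_def)
  have \<delta>Y: "\<delta> Y = d / Y^2" using Y by (simp add: d_def)
  have d: "0 < d" using pos Y by (simp add: d_def)
  have "((\<lambda>Y. Y^2 * \<delta> Y) has_real_derivative
      2 * Y * \<delta> Y + Y^2 * (\<delta> Y * (2 * ((w + \<epsilon>)^2 * (w - d) - k) / Y / k))) (at Y)"
    by (rule derivative_eq_intros D(1) refl | simp)+
  also have "2 * Y * \<delta> Y + Y^2 * (\<delta> Y * (2 * ((w + \<epsilon>)^2 * (w - d) - k) / Y / k))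
     = 2 * (chi Y)^2 / Y * (d * (w + \<epsilon>)^2 * (d - w) / (- ((chi Y)^2) * k))"
    unfolding \<delta>Y using Y k pos by (simp add: divide_simps) algebra
  finally have 1: "((\<lambda>Y. Y^2 * \<delta> Y) has_real_derivative
     2 * (chi Y)^2 / Y * (d * (w + \<epsilon>)^2 * (d - w) / (- ((chi Y)^2) * k))) (at Y)" .
  have "((\<lambda>Y. 1 + Y * \<omega> Y) has_real_derivative
      \<omega> Y + Y * (((w + \<epsilon>) * ((3 * w - 1) * k - 2 * (1 + \<epsilon>) * w * (w + \<epsilon>) * (w - d))
     - (1 - \<epsilon>) * (w - 1) * k) / Y^2 / ((1 - \<epsilon>) * k))) (at Y)"
    by (rule derivative_eq_intros D(2) refl | simp)+
  also have "\<omega> Y + Y * (((w + \<epsilon>) * ((3 * w - 1) * k - 2 * (1 + \<epsilon>) * w * (w + \<epsilon>) * (w - d))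
     - (1 - \<epsilon>) * (w - 1) * k) / Y^2 / ((1 - \<epsilon>) * k)) =
      - ((w + \<epsilon>) * (1 - 3 * w) / ((1 - \<epsilon>) * Y))
        - 2 * (1 + \<epsilon>) * (chi Y)^2 / ((1 - \<epsilon>) * Y) * (w * (w + \<epsilon>)^2 * (d - w) / (- ((chi Y)^2) * k))"
    unfolding \<omega>Y using Y k pos \<epsilon> by (simp add: divide_simps) algebra
  finally have 2: "((\<lambda>Y. 1 + Y * \<omega> Y) has_real_derivative
      - ((w + \<epsilon>) * (1 - 3 * w) / ((1 - \<epsilon>) * Y))
        - 2 * (1 + \<epsilon>) * (chi Y)^2 / ((1 - \<epsilon>) * Y) * (w * (w + \<epsilon>)^2 * (d - w) / (- ((chi Y)^2) * k))) (at Y)" .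
  have 3: "(chi has_real_derivative (1 - w) / ((1 - \<epsilon>) * Y) * chi Y) (at Y)"
  proof -
    have "- (\<omega> Y * chi Y) / (1 - \<epsilon>) = (1 - w) / ((1 - \<epsilon>) * Y) * chi Y"
      using Y \<epsilon> by (simp add: w_def)
    with D(3) show ?thesis by simp
  qed
  show ?thesis unfolding ext_ode_def C
    using 1 2 3 d k pos by (simp add: w_def[symmetric] d_def[symmetric])
qed

text \<open>The divided variables are given values at 0 so that they can be made continuous there
  later; away from 0 they coincide locally with the quotients, and it is these that are
  differentiated.\<close>

lemma ext_ode_imp_reg:
  fixes d w chi :: "real \<Rightarrow> real"
  assumes \<epsilon>: "0 < \<epsilon>" "\<epsilon> < 1" and Y: "Y \<noteq> 0" and ext: "ext_ode \<epsilon> d w chi Y" and pos: "0 < chi Y"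
    and \<delta>: "\<And>y. \<delta> y = (if y = 0 then \<delta>0 else d y / y^2)" and \<omega>: "\<And>y. \<omega> y = (if y = 0 then \<omega>0 else (w y - 1) / y)"
    and \<mu>: "\<And>y. \<mu> y = \<delta> y powr (- eta \<epsilon>) / (chi y)^2"
  shows "reg_ode \<epsilon> \<delta> \<omega> \<mu> chi Y"
proof -
  have dY: "d Y = Y^2 * \<delta> Y" and wY: "w Y = 1 + Y * \<omega> Y" using Y by (simp_all add: \<delta> \<omega>)
  have d: "0 < d Y" and Cn: "ext_C \<epsilon> Y (d Y) (w Y) (chi Y) \<noteq> 0"
    and Dd: "(d has_real_derivative 2 * (chi Y)^2 / Y * (d Y * (w Y + \<epsilon>)^2 * (d Y - w Y) / ext_C \<epsilon> Y (d Y) (w Y) (chi Y))) (at Y)"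
    and Dw: "(w has_real_derivative - ((w Y + \<epsilon>) * (1 - 3 * w Y) / ((1 - \<epsilon>) * Y))
        - 2 * (1 + \<epsilon>) * (chi Y)^2 / ((1 - \<epsilon>) * Y)
          * (w Y * (w Y + \<epsilon>)^2 * (d Y - w Y) / ext_C \<epsilon> Y (d Y) (w Y) (chi Y))) (at Y)"
    and Dc: "(chi has_real_derivative (1 - w Y) / ((1 - \<epsilon>) * Y) * chi Y) (at Y)"
    using ext unfolding ext_ode_def by blast+
  have \<delta>pos: "0 < \<delta> Y" using d Y by (simp add: \<delta>)
  define k where "k = reg_K \<epsilon> Y (\<delta> Y) (\<omega> Y) (\<mu> Y)"
  have C: "ext_C \<epsilon> Y (d Y) (w Y) (chi Y) = - ((chi Y)^2) * k"
    unfolding k_def by (rule ext_C_eq[OF dY wY \<mu> Y]) (use pos in auto)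
  with Cn pos have k: "k \<noteq> 0" by auto
  define wv where "wv = w Y"
  define dv where "dv = d Y"
  have L: "reg_L \<epsilon> Y (\<delta> Y) (\<omega> Y) (\<mu> Y) = 2 * ((wv + \<epsilon>)^2 * (wv - dv) - k) / Y"
    using reg_L_identity[OF wY dY, of \<epsilon> "\<mu> Y"] Y by (simp add: k_def wv_def dv_def field_simps)
  have W: "reg_W \<epsilon> Y (\<delta> Y) (\<omega> Y) (\<mu> Y) = ((wv + \<epsilon>) * ((3 * wv - 1) * k - 2 * (1 + \<epsilon>) * wv * (wv + \<epsilon>) * (wv - dv))
     - (1 - \<epsilon>) * (wv - 1) * k) / Y^2"
    using reg_W_identity[OF wY dY, of \<epsilon> "\<mu> Y"] Y by (simp add: k_def wv_def dv_def field_simps)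
  define L' where "L' = 2 * ((wv + \<epsilon>)^2 * (wv - dv) - k) / Y / k"
  have nhd: "eventually (\<lambda>y. y \<noteq> 0) (nhds Y)"
    using Y by (intro t1_space_nhds)
  have "((\<lambda>y. d y / y^2) has_real_derivative \<delta> Y * L') (at Y)"
  proof -
    have "((\<lambda>y. d y / y^2) has_real_derivative
       (2 * (chi Y)^2 / Y * (dv * (wv + \<epsilon>)^2 * (dv - wv) / (- ((chi Y)^2) * k)) * Y^2 - dv * (2 * Y)) / (Y^2 * Y^2)) (at Y)"
      using Y Dd[unfolded C] unfolding dv_def wv_def by (auto intro!: derivative_eq_intros)
    also have "(2 * (chi Y)^2 / Y * (dv * (wv + \<epsilon>)^2 * (dv - wv) / (- ((chi Y)^2) * k)) * Y^2 - dv * (2 * Y)) / (Y^2 * Y^2)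
      = dv / Y^2 * L'"
      unfolding L'_def using Y k pos by (simp add: divide_simps) algebra
    finally show ?thesis using Y by (simp add: \<delta> dv_def)
  qed
  then have 1: "(\<delta> has_real_derivative \<delta> Y * L') (at Y)"
    by (subst DERIV_cong_ev[OF refl _ refl, of _ "\<lambda>y. d y / y^2"]) (rule eventually_mono[OF nhd], simp add: \<delta>)
  have "((\<lambda>y. (w y - 1) / y) has_real_derivative ((wv + \<epsilon>) * ((3 * wv - 1) * k - 2 * (1 + \<epsilon>) * wv * (wv + \<epsilon>) * (wv - dv))
     - (1 - \<epsilon>) * (wv - 1) * k) / Y^2 / ((1 - \<epsilon>) * k)) (at Y)"
  proof -
    have "((\<lambda>y. (w y - 1) / y) has_real_derivative
       ((- ((wv + \<epsilon>) * (1 - 3 * wv) / ((1 - \<epsilon>) * Y))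
        - 2 * (1 + \<epsilon>) * (chi Y)^2 / ((1 - \<epsilon>) * Y)
          * (wv * (wv + \<epsilon>)^2 * (dv - wv) / (- ((chi Y)^2) * k))) * Y - (wv - 1)) / (Y * Y)) (at Y)"
      using Y Dw[unfolded C] unfolding dv_def wv_def by (auto intro!: derivative_eq_intros)
    also have "((- ((wv + \<epsilon>) * (1 - 3 * wv) / ((1 - \<epsilon>) * Y))
        - 2 * (1 + \<epsilon>) * (chi Y)^2 / ((1 - \<epsilon>) * Y)
          * (wv * (wv + \<epsilon>)^2 * (dv - wv) / (- ((chi Y)^2) * k))) * Y - (wv - 1)) / (Y * Y)
      = ((wv + \<epsilon>) * ((3 * wv - 1) * k - 2 * (1 + \<epsilon>) * wv * (wv + \<epsilon>) * (wv - dv))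
     - (1 - \<epsilon>) * (wv - 1) * k) / Y^2 / ((1 - \<epsilon>) * k)"
      using Y k pos \<epsilon> by (simp add: divide_simps) algebra
    finally show ?thesis .
  qed
  then have 2: "(\<omega> has_real_derivative ((wv + \<epsilon>) * ((3 * wv - 1) * k - 2 * (1 + \<epsilon>) * wv * (wv + \<epsilon>) * (wv - dv))
     - (1 - \<epsilon>) * (wv - 1) * k) / Y^2 / ((1 - \<epsilon>) * k)) (at Y)"
    by (subst DERIV_cong_ev[OF refl _ refl, of _ "\<lambda>y. (w y - 1) / y"]) (rule eventually_mono[OF nhd], simp add: \<omega>)
  have 3: "(chi has_real_derivative - (\<omega> Y * chi Y) / (1 - \<epsilon>)) (at Y)"
  proof -
    have "(1 - w Y) / ((1 - \<epsilon>) * Y) * chi Y = - (\<omega> Y * chi Y) / (1 - \<epsilon>)"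
      using Y \<epsilon> by (simp add: wY)
    with Dc show ?thesis by simp
  qed
  have "((\<lambda>y. \<delta> y powr (- eta \<epsilon>) / (chi y)^2) has_real_derivative
      \<mu> Y * (2 * \<omega> Y / (1 - \<epsilon>) - eta \<epsilon> * L')) (at Y)"
  proof -
    have p: "((\<lambda>y. \<delta> y powr (- eta \<epsilon>)) has_real_derivative (- eta \<epsilon>) * L' * \<delta> Y powr (- eta \<epsilon>)) (at Y)"
    proof -
      have "((\<lambda>y. \<delta> y powr (- eta \<epsilon>)) has_real_derivative
          \<delta> Y powr (- eta \<epsilon>) * (0 * ln (\<delta> Y) + \<delta> Y * L' * (- eta \<epsilon>) / \<delta> Y)) (at Y)"
        by (rule DERIV_powr[OF 1 \<delta>pos DERIV_const])
      moreover have "\<delta> Y powr (- eta \<epsilon>) * (0 * ln (\<delta> Y) + \<delta> Y * L' * (- eta \<epsilon>) / \<delta> Y)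
          = (- eta \<epsilon>) * L' * \<delta> Y powr (- eta \<epsilon>)" using \<delta>pos by simp
      ultimately show ?thesis by (simp only:)
    qed
    have "((\<lambda>y. \<delta> y powr (- eta \<epsilon>) / (chi y)^2) has_real_derivative
      (((- eta \<epsilon>) * L' * \<delta> Y powr (- eta \<epsilon>)) * (chi Y)^2 - \<delta> Y powr (- eta \<epsilon>) * (2 * chi Y * (- (\<omega> Y * chi Y) / (1 - \<epsilon>)))) / ((chi Y)^2 * (chi Y)^2)) (at Y)"
    proof (rule DERIV_divide[OF p])
      show "((\<lambda>y. (chi y)^2) has_real_derivative 2 * chi Y * (- (\<omega> Y * chi Y) / (1 - \<epsilon>))) (at Y)"
        by (rule derivative_eq_intros 3 refl | simp)+
    qed (use pos in simp)
    also have "(((- eta \<epsilon>) * L' * \<delta> Y powr (- eta \<epsilon>)) * (chi Y)^2 - \<delta> Y powr (- eta \<epsilon>) * (2 * chi Y * (- (\<omega> Y * chi Y) / (1 - \<epsilon>)))) / ((chi Y)^2 * (chi Y)^2)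
      = \<mu> Y * (2 * \<omega> Y / (1 - \<epsilon>) - eta \<epsilon> * L')"
      unfolding \<mu> using pos \<epsilon> by (simp add: divide_simps) algebra
    finally show ?thesis .
  qed
  then have 4: "(\<mu> has_real_derivative \<mu> Y * (2 * \<omega> Y / (1 - \<epsilon>) - eta \<epsilon> * L')) (at Y)"
    unfolding \<mu>[abs_def] .
  show ?thesis unfolding reg_ode_def Let_def L W k_def[symmetric]
    using 1 2 3 4 by (simp add: L'_def)
qed

lemma nice0_add: "nice 0 F \<Longrightarrow> nice 0 G \<Longrightarrow> nice 0 (\<lambda>y. F y + G y)"
  and nice0_diff: "nice 0 F \<Longrightarrow> nice 0 G \<Longrightarrow> nice 0 (\<lambda>y. F y - G y)"
  and nice0_minus: "nice 0 F \<Longrightarrow> nice 0 (\<lambda>y. - F y)"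
  by (rule nice_add nice_diff nice_minus; assumption)+

lemma nice0_mult: "nice 0 F \<Longrightarrow> nice 0 G \<Longrightarrow> nice 0 (\<lambda>y. F y * G y)"
  using nice_mult[of 0 F 0 G] by simp

lemma nice0_numeral: "nice 0 (\<lambda>y. numeral k)"
  using nice_const[of "numeral k"] by (simp add: numeral_fps_const)

lemma nice0_one: "nice 0 (\<lambda>y. 1)"
  using nice_const[of 1] by simp

lemma nice0_power:
  assumes "nice 0 F" shows "nice 0 (\<lambda>y. F y ^ k)"
proof (induction k)
  case 0
  show ?case using nice0_one by simp
next
  case (Suc k)
  show ?case using nice0_mult[OF assms Suc] by simp
qed

lemma nice0_X: "nice 0 (\<lambda>y. fps_X)"
  by (rule nice_mono[OF nice_X]) simp

lemma nice0_var: "nice 0 (\<lambda>y. y i)"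
proof (cases "i = 0")
  case True
  then show ?thesis using nice_mono[OF nice_var0] by simp
next
  case False
  then show ?thesis using nice_mono[OF nice_var] by simp
qed

lemmas nice0_intros = nice0_add nice0_diff nice0_minus nice0_mult nice0_numeral nice0_one nice0_power
  nice0_X nice0_var nice_const

lemma nice_mult_left: "nice k F \<Longrightarrow> nice 0 G \<Longrightarrow> nice k (\<lambda>y. F y * G y)"
  using nice_mult[of k F 0 G] by simp

lemma has_fps_expansion_pow [fps_expansion_intros]:
  fixes f :: "'a::{banach, real_normed_field} \<Rightarrow> 'a"
  assumes "f has_fps_expansion F"
  shows "(\<lambda>x. f x ^ n) has_fps_expansion F ^ n"
  by (induction n) (auto intro: fps_expansion_intros assms)

lemma has_fps_expansion_unique_ev:
  assumes "f has_fps_expansion F" "g has_fps_expansion F"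
  shows "eventually (\<lambda>z. f z = g z) (nhds 0)"
  using assms unfolding has_fps_expansion_def by (auto elim: eventually_elim2)

lemma has_fps_expansion_imp_DERIV:
  fixes f :: "real \<Rightarrow> real"
  assumes "f has_fps_expansion F"
  shows "eventually (\<lambda>z. (f has_real_derivative deriv f z) (at z)) (nhds 0)"
proof -
  have "eventually (\<lambda>z. z \<in> eball 0 (fps_conv_radius F)) (nhds 0)"
    using assms by (intro eventually_nhds_in_open) (auto simp: has_fps_expansion_def zero_ereal_def)
  moreover from assms have "eventually (\<lambda>z. eventually (\<lambda>w. eval_fps F w = f w) (nhds z)) (nhds 0)"
    unfolding eventually_eventually by (simp add: has_fps_expansion_def)
  ultimately show ?thesis
  proof eventually_elim
    case (elim z)
    have "(eval_fps F has_real_derivative eval_fps (fps_deriv F) z) (at z)"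
      using elim(1) by (intro has_field_derivative_eval_fps) auto
    then have "(f has_real_derivative eval_fps (fps_deriv F) z) (at z)"
      by (subst (asm) DERIV_cong_ev[OF refl elim(2) refl])
    then show ?case using DERIV_imp_deriv by fastforce
  qed
qed

lemma has_fps_expansion_ode:
  fixes f g :: "real \<Rightarrow> real"
  assumes "f has_fps_expansion F" "g has_fps_expansion fps_deriv F"
  shows "eventually (\<lambda>z. (f has_real_derivative g z) (at z)) (nhds 0)"
  using has_fps_expansion_imp_DERIV[OF assms(1)]
    has_fps_expansion_unique_ev[OF has_fps_expansion_deriv[OF assms(1)] assms(2)]
  by eventually_elim simp

lemma reg_analytic_solution:
  assumes \<epsilon>: "0 < \<epsilon>" "\<epsilon> < 1"
  obtains \<delta> \<omega> \<mu> chi :: "real \<Rightarrow> real" and r :: real and F1 F2 F4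
  where "0 < r" "\<delta> has_fps_expansion F1" "\<omega> has_fps_expansion F2" "chi has_fps_expansion F4"
    "\<delta> 0 = d0" "\<omega> 0 = w1" "\<mu> 0 = m0" "chi 0 = 1"
    "\<And>Y. \<bar>Y\<bar> < r \<Longrightarrow> reg_ode \<epsilon> \<delta> \<omega> \<mu> chi Y"
proof -
  define E where "E = fps_const \<epsilon>"
  define D where "D y = fps_const d0 + y 1" for y :: "nat \<Rightarrow> real fps"
  define O' where "O' y = fps_const w1 + y 2" for y :: "nat \<Rightarrow> real fps"
  define M where "M y = fps_const m0 + y 3" for y :: "nat \<Rightarrow> real fps"
  define C where "C y = fps_const 1 + y 4" for y :: "nat \<Rightarrow> real fps"
  define K where "K y = reg_K E fps_X (D y) (O' y) (M y)" for y
  define L where "L y = reg_L E fps_X (D y) (O' y) (M y)" for y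
  define V where "V y = reg_W E fps_X (D y) (O' y) (M y)" for y
  define p where "p = fps_const (1 / (1 - \<epsilon>))"
  \<comment> \<open>\<open>reg_K\<close> minus its value \<open>(1 + \<epsilon>)\<^sup>2\<close> at
    \<open>Y = 0\<close>, written with an explicit factor \<open>fps_X\<close>, so that
    \<open>nice_inverse\<close> covers the reciprocal.\<close>
  define K1 where "K1 y = fps_X * (O' y * (2 * (1 + E) + (1 - E) * (fps_X * O' y)) + fps_X * (4 * E * (1 + fps_X * O' y) * D y - M y))" for y
  have KK1: "K y = fps_const ((1 + \<epsilon>)^2) + K1 y" for y
  proof -
    have "fps_const ((1 + \<epsilon>)^2) = (1 + E)^2"
      unfolding E_def by (simp add: fps_const_power [symmetric] fps_const_add [symmetric] del: fps_const_power fps_const_add)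
    then show ?thesis unfolding K_def K1_def reg_K_def by (simp add: algebra_simps power2_eq_square)
  qed
  have nD: "nice 0 D" "nice 0 O'" "nice 0 M" "nice 0 C"
    unfolding D_def[abs_def] O'_def[abs_def] M_def[abs_def] C_def[abs_def] by (intro nice0_intros)+
  have nE: "nice 0 (\<lambda>y. E)" unfolding E_def by (rule nice_const)
  have "nice 2 K1" unfolding K1_def[abs_def]
    by (rule nice_mult_left[OF nice_X]) (intro nice0_intros nD nE)
  then have "nice 1 K1" by (rule nice_mono) simp
  then have nK: "nice 0 (\<lambda>y. inverse (K y))" unfolding KK1 using \<epsilon> by (intro nice_inverse) auto
  have nL: "nice 0 L" unfolding L_def[abs_def] reg_L_def Let_def by (intro nice0_intros nD nE)
  have nV: "nice 0 V" unfolding V_def[abs_def] reg_W_def Let_def by (intro nice0_intros nD nE)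
  have np: "nice 0 (\<lambda>y. p)" unfolding p_def by (rule nice_const)
  define G where "G i = (if i = 1 then (\<lambda>y. D y * (L y * inverse (K y)))
     else if i = 2 then (\<lambda>y. p * V y * inverse (K y))
     else if i = 3 then (\<lambda>y. M y * (2 * p * O' y - fps_const (eta \<epsilon>) * (L y * inverse (K y))))
     else if i = 4 then (\<lambda>y. - (p * O' y * C y)) else (\<lambda>y. 0))" for i :: nat
  have nG: "nice 0 (G i)" for i
  proof -
    have "nice 0 (\<lambda>y. D y * (L y * inverse (K y)))" "nice 0 (\<lambda>y. p * V y * inverse (K y))"
      "nice 0 (\<lambda>y. M y * (2 * p * O' y - fps_const (eta \<epsilon>) * (L y * inverse (K y))))"
      "nice 0 (\<lambda>y. - (p * O' y * C y))" "nice 0 (\<lambda>y. 0)"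
      using nice_const[of 0] by (intro nice0_intros nD nE nK nL nV np, simp)+
    then show ?thesis unfolding G_def by (auto split: if_splits)
  qed
  obtain y where y: "y \<in> null_states" "\<And>i. fps_conv_radius (y i) > 0"
    "\<And>i. i > 0 \<Longrightarrow> y i = fps_integral0 (G i y)"
  \<comment> \<open>All four unknowns are of integral type, with components 1 to 4 as their
    increments. The algebraic component 0 is filled by a dummy equation with
    \<open>\<tau> = 1\<close> and right-hand side \<open>fps_X\<close>.\<close>
  proof (rule fps_fixed_point[of G 4 "\<lambda>y. fps_X" 1 "\<lambda>n. 1"])
    show "G i = (\<lambda>_. 0)" if "i > 4" for i using that by (simp add: G_def)
  qed (auto intro: nG nice_X)
  define F1 where "F1 = D y"
  define F2 where "F2 = O' y"
  define F3 where "F3 = M y"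
  define F4 where "F4 = C y"
  have dF: "fps_deriv F1 = G 1 y" "fps_deriv F2 = G 2 y" "fps_deriv F3 = G 3 y" "fps_deriv F4 = G 4 y"
    using y(3)[of 1] y(3)[of 2] y(3)[of 3] y(3)[of 4] fps_deriv_fps_integral[of _ 0]
    unfolding F1_def F2_def F3_def F4_def D_def O'_def M_def C_def by (simp_all only: fps_deriv_add fps_deriv_const) simp_all
  have rad: "fps_conv_radius F1 > 0" "fps_conv_radius F2 > 0" "fps_conv_radius F3 > 0" "fps_conv_radius F4 > 0"
    using y(2)[of 1] y(2)[of 2] y(2)[of 3] y(2)[of 4] unfolding F1_def F2_def F3_def F4_def D_def O'_def M_def C_def
    by (auto intro!: less_le_trans[OF _ fps_conv_radius_add])
  define \<delta> where "\<delta> = eval_fps F1"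
  define \<omega> where "\<omega> = eval_fps F2"
  define \<mu> where "\<mu> = eval_fps F3"
  define chi where "chi = eval_fps F4"
  have ex: "\<delta> has_fps_expansion F1" "\<omega> has_fps_expansion F2" "\<mu> has_fps_expansion F3" "chi has_fps_expansion F4"
    unfolding \<delta>_def \<omega>_def \<mu>_def chi_def by (intro eval_fps_has_fps_expansion rad)+
  have init: "\<delta> 0 = d0" "\<omega> 0 = w1" "\<mu> 0 = m0" "chi 0 = 1"
    using y(1) unfolding \<delta>_def \<omega>_def \<mu>_def chi_def F1_def F2_def F3_def F4_def D_def O'_def M_def C_def
    by (simp_all add: eval_fps_at_0 null_states_def)
  have eE: "(\<lambda>_. \<epsilon>) has_fps_expansion E" unfolding E_def by (rule has_fps_expansion_const)
  have exK: "(\<lambda>Y. reg_K \<epsilon> Y (\<delta> Y) (\<omega> Y) (\<mu> Y)) has_fps_expansion K y"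
    unfolding K_def reg_K_def F1_def[symmetric] F2_def[symmetric] F3_def[symmetric]
    by (intro fps_expansion_intros ex eE)
  have exL: "(\<lambda>Y. reg_L \<epsilon> Y (\<delta> Y) (\<omega> Y) (\<mu> Y)) has_fps_expansion L y"
    unfolding L_def reg_L_def Let_def F1_def[symmetric] F2_def[symmetric] F3_def[symmetric]
    by (intro fps_expansion_intros ex eE)
  have exV: "(\<lambda>Y. reg_W \<epsilon> Y (\<delta> Y) (\<omega> Y) (\<mu> Y)) has_fps_expansion V y"
    unfolding V_def reg_W_def Let_def F1_def[symmetric] F2_def[symmetric] F3_def[symmetric]
    by (intro fps_expansion_intros ex eE)
  have "fps_nth (K y) 0 = (1 + \<epsilon>)^2" unfolding KK1 by (simp add: K1_def)
  then have K0: "fps_nth (K y) 0 \<noteq> 0" using \<epsilon> by simp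
  have exI: "(\<lambda>Y. inverse (reg_K \<epsilon> Y (\<delta> Y) (\<omega> Y) (\<mu> Y))) has_fps_expansion inverse (K y)"
    by (rule has_fps_expansion_inverse[OF exK K0])
  have ep: "(\<lambda>_. 1 / (1 - \<epsilon>)) has_fps_expansion p" unfolding p_def by (rule has_fps_expansion_const)
  let ?I = "\<lambda>Y. inverse (reg_K \<epsilon> Y (\<delta> Y) (\<omega> Y) (\<mu> Y))"
  have "eventually (\<lambda>Y. (\<delta> has_real_derivative \<delta> Y * (reg_L \<epsilon> Y (\<delta> Y) (\<omega> Y) (\<mu> Y) * ?I Y)) (at Y)) (nhds 0)"
    by (rule has_fps_expansion_ode[OF ex(1)])
      (simp only: dF G_def if_True if_False refl, unfold F1_def[symmetric], intro fps_expansion_intros ex exL exI)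
  moreover have "eventually (\<lambda>Y. (\<omega> has_real_derivative (1 / (1 - \<epsilon>)) * reg_W \<epsilon> Y (\<delta> Y) (\<omega> Y) (\<mu> Y) * ?I Y) (at Y)) (nhds 0)"
  proof (rule has_fps_expansion_ode[OF ex(2)])
    have "fps_deriv F2 = p * V y * inverse (K y)" unfolding dF by (simp add: G_def)
    then show "(\<lambda>Y. (1 / (1 - \<epsilon>)) * reg_W \<epsilon> Y (\<delta> Y) (\<omega> Y) (\<mu> Y) * ?I Y) has_fps_expansion fps_deriv F2"
      by (simp only:) (intro fps_expansion_intros ex exV exI ep)
  qed
  moreover have "eventually (\<lambda>Y. (\<mu> has_real_derivative \<mu> Y * (2 * (1 / (1 - \<epsilon>)) * \<omega> Y - eta \<epsilon> * (reg_L \<epsilon> Y (\<delta> Y) (\<omega> Y) (\<mu> Y) * ?I Y))) (at Y)) (nhds 0)"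
  proof (rule has_fps_expansion_ode[OF ex(3)])
    have "fps_deriv F3 = F3 * (2 * p * F2 - fps_const (eta \<epsilon>) * (L y * inverse (K y)))" unfolding dF by (simp add: G_def F3_def F2_def)
    then show "(\<lambda>Y. \<mu> Y * (2 * (1 / (1 - \<epsilon>)) * \<omega> Y - eta \<epsilon> * (reg_L \<epsilon> Y (\<delta> Y) (\<omega> Y) (\<mu> Y) * ?I Y))) has_fps_expansion fps_deriv F3"
      by (simp only:) (intro fps_expansion_intros ex exL exI ep)
  qed
  moreover have "eventually (\<lambda>Y. (chi has_real_derivative - ((1 / (1 - \<epsilon>)) * \<omega> Y * chi Y)) (at Y)) (nhds 0)"
  proof (rule has_fps_expansion_ode[OF ex(4)])
    have "fps_deriv F4 = - (p * F2 * F4)" unfolding dF by (simp add: G_def F4_def F2_def)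
    then show "(\<lambda>Y. - ((1 / (1 - \<epsilon>)) * \<omega> Y * chi Y)) has_fps_expansion fps_deriv F4"
      by (simp only:) (intro fps_expansion_intros ex ep)
  qed
  ultimately have "eventually (\<lambda>Y. reg_ode \<epsilon> \<delta> \<omega> \<mu> chi Y) (nhds 0)"
    by eventually_elim (simp add: reg_ode_def Let_def divide_inverse mult_ac)
  then obtain r where "0 < r" "\<And>Y. dist Y 0 < r \<Longrightarrow> reg_ode \<epsilon> \<delta> \<omega> \<mu> chi Y"
    unfolding eventually_nhds_metric by blast
  then show ?thesis
    using that[of r \<delta> F1 \<omega> F2 chi F4 \<mu>, OF _ ex(1,2,4) init] by (simp add: dist_real_def)
qed

section \<open>Blow-up for negative time\<close>

text \<open>At its first zero \<open>c\<close> the function arrives from positive values, so a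
  positive derivative there is contradictory. The condition at \<open>c\<close> may use positivity
  on all of \<open>(a, c)\<close>, which is how estimates integrated from the start enter.\<close>

lemma first_zero_barrier:
  fixes f f' :: "real \<Rightarrow> real"
  assumes deriv: "\<And>t. a < t \<Longrightarrow> t < b \<Longrightarrow> (f has_real_derivative f' t) (at t)"
    and ev: "eventually (\<lambda>t. f t > 0) (at_right a)"
    and zero: "\<And>c. a < c \<Longrightarrow> c < b \<Longrightarrow> f c = 0 \<Longrightarrow> (\<And>t. a < t \<Longrightarrow> t < c \<Longrightarrow> f t > 0) \<Longrightarrow> f' c > 0"
    and t: "a < t" "t < b"
  shows "f t > 0"
proof (rule ccontr)
  assume "\<not> f t > 0"
  obtain r where r: "a < r" "\<And>s. a < s \<Longrightarrow> s < r \<Longrightarrow> f s > 0"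
    using ev unfolding eventually_at_right_field by blast
  define S where "S = {s\<in>{r..t}. f s \<le> 0}"
  have rt: "r \<le> t" using \<open>\<not> f t > 0\<close> r(2)[of t] t by force
  have tS: "t \<in> S" using \<open>\<not> f t > 0\<close> rt by (simp add: S_def)
  have cont: "continuous_on {r..t} f"
    using deriv r t by (intro DERIV_continuous_on[of _ _ f']) (auto intro: has_field_derivative_at_within)
  have "closed S"
  proof -
    have "S = {r..t} \<inter> f -` {..0}" by (auto simp: S_def)
    then show ?thesis using continuous_closed_preimage[OF cont] by simp
  qed
  have bdd: "bdd_below S" unfolding S_def by (rule bdd_belowI[of _ r]) simp
  define c where "c = Inf S"
  have cS: "c \<in> S" unfolding c_def by (rule closed_contains_Inf) (use tS bdd \<open>closed S\<close> in auto)
  then have c: "a < c" "c < b" "f c \<le> 0" "r \<le> c" using r t by (auto simp: S_def)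
  have before: "f s > 0" if "a < s" "s < c" for s
  proof (cases "s < r")
    case False
    show ?thesis
    proof (rule ccontr)
      assume "\<not> f s > 0"
      then have "s \<in> S" using that False cS by (auto simp: S_def)
      then have "c \<le> s" unfolding c_def by (rule cInf_lower[OF _ bdd])
      with that show False by simp
    qed
  qed (use r that in auto)
  have "f c = 0"
  proof (rule ccontr)
    assume "f c \<noteq> 0"
    with c have neg: "f c < 0" by simp
    have "isCont f c" using deriv[OF c(1,2)] by (rule DERIV_isCont)
    then have "eventually (\<lambda>s. f s < 0) (at c)"
      using neg unfolding isCont_def by (rule order_tendstoD)
    then have "eventually (\<lambda>s. f s < 0) (at_left c)" by (simp add: eventually_at_split)
    moreover have "eventually (\<lambda>s. s \<in> {a<..<c}) (at_left c)" using c(1) by (rule eventually_at_left_real)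
    ultimately have "eventually (\<lambda>s. False) (at_left c)" by eventually_elim (use before in force)
    then show False by simp
  qed
  then have "f' c > 0" using zero[OF c(1,2)] before by simp
  from DERIV_pos_inc_left[OF deriv[OF c(1,2)] this] obtain d where d: "d > 0" "\<And>h. 0 < h \<Longrightarrow> h < d \<Longrightarrow> f (c - h) < f c" by blast
  define h where "h = min d (c - a) / 2"
  have "0 < h" "h < d" "h < c - a" using d c by (auto simp: h_def min_def)
  with d(2)[of h] before[of "c - h"] \<open>f c = 0\<close> show False by simp
qed

lemma DERIV_ge0_mono:
  fixes f f' :: "real \<Rightarrow> real"
  assumes "\<And>t. a < t \<Longrightarrow> t < b \<Longrightarrow> (f has_real_derivative f' t) (at t)"
    and "\<And>t. a < t \<Longrightarrow> t < b \<Longrightarrow> 0 \<le> f' t" and "a < s" "s \<le> t" "t < b"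
  shows "f s \<le> f t"
proof (rule DERIV_nonneg_imp_nondecreasing[of s t f])
  fix x assume "s \<le> x" "x \<le> t"
  then show "\<exists>y. DERIV f x :> y \<and> 0 \<le> y" using assms(1)[of x] assms(2)[of x] assms(3,5) by auto
qed (rule assms(4))

lemma DERIV_ge0_limit_le:
  fixes f f' :: "real \<Rightarrow> real"
  assumes "\<And>t. a < t \<Longrightarrow> t < b \<Longrightarrow> (f has_real_derivative f' t) (at t)"
    and "\<And>t. a < t \<Longrightarrow> t < b \<Longrightarrow> 0 \<le> f' t" and "(f \<longlongrightarrow> l) (at_right a)" and "a < t" "t < b"
  shows "l \<le> f t"
proof (rule tendsto_upperbound[OF assms(3)])
  have "eventually (\<lambda>s. s \<in> {a<..<t}) (at_right a)" using assms(4) by (rule eventually_at_right_real)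
  then show "\<forall>\<^sub>F s in at_right a. f s \<le> f t"
    by eventually_elim (use DERIV_ge0_mono[OF assms(1,2)] assms(5) in auto)
qed simp

text \<open>Here \<open>t = - Y\<close>, \<open>v = (d / Y\<^sup>2)\<^sup>-\<^sup>\<eta> Y\<^sup>2 / \<chi>\<^sup>2\<close> and \<open>k = - ext_C / \<chi>\<^sup>2\<close>; dividing by \<open>s\<close> makes the system
  autonomous.\<close>

locale blowup =
  fixes \<epsilon> q T P0 M0 :: real and d w v k s :: "real \<Rightarrow> real"
  assumes \<epsilon>: "0 < \<epsilon>" "\<epsilon> < 1" "\<epsilon> \<le> 1/4" and q: "1 < q" "8 * \<epsilon> \<le> 1 - \<epsilon> - 1 / q^2"
    and T: "0 < T"
    and s: "\<And>t. s t = (w t + \<epsilon>) / ((1 - \<epsilon>) * t)"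
    and k: "\<And>t. k t = (w t + \<epsilon>)^2 - \<epsilon> * (w t - 1)^2 + 4 * \<epsilon> * w t * d t - v t"
    and pos: "\<And>t. 0 < t \<Longrightarrow> t < T \<Longrightarrow> 0 < d t" "\<And>t. 0 < t \<Longrightarrow> t < T \<Longrightarrow> 0 < v t" "\<And>t. 0 < t \<Longrightarrow> t < T \<Longrightarrow> 0 < k t"
    and dd: "\<And>t. 0 < t \<Longrightarrow> t < T \<Longrightarrow> (d has_real_derivative s t * (2 * (1 - \<epsilon>) * d t * (w t + \<epsilon>) * (w t - d t) / k t)) (at t)"
    and dw: "\<And>t. 0 < t \<Longrightarrow> t < T \<Longrightarrow> (w has_real_derivative s t * (3 * w t - 1 - 2 * (1 + \<epsilon>) * w t * (w t + \<epsilon>) * (w t - d t) / k t)) (at t)"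
    and dv: "\<And>t. 0 < t \<Longrightarrow> t < T \<Longrightarrow> (v has_real_derivative s t * (v t * (2 - 4 * \<epsilon> * (w t + \<epsilon>) * (w t - d t) / k t))) (at t)"
    and lim: "((\<lambda>t. (w t - 1) / sqrt (v t)) \<longlongrightarrow> P0) (at_right 0)" "((\<lambda>t. w t * d t / v t) \<longlongrightarrow> M0) (at_right 0)"
      "(w \<longlongrightarrow> 1) (at_right 0)" "(d \<longlongrightarrow> 0) (at_right 0)"
    and P0: "q < P0" and M0: "1 + \<epsilon> * q^2 < (1 + 4 * \<epsilon>) * M0"
begin

text \<open>In the sum of logarithmic derivatives of \<open>w\<close> and \<open>d\<close> minus
  that of \<open>v\<close> the quotient terms cancel, as
  \<open>- 2 (1 + \<epsilon>) + 2 (1 - \<epsilon>) + 4 \<epsilon> = 0\<close>; what remains is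
  \<open>s (3 - 1 / w - 2) = s (w - 1) / w\<close>.\<close>

lemma has_derivative_M:
  assumes t: "0 < t" "t < T"
  shows "((\<lambda>t. w t * d t / v t) has_real_derivative s t * (d t / v t * (w t - 1))) (at t)"
proof -
  have nz: "v t \<noteq> 0" "k t \<noteq> 0" using pos(2,3)[OF t] by auto
  have "((\<lambda>t. w t * d t / v t) has_real_derivative
     ((s t * (3 * w t - 1 - 2 * (1 + \<epsilon>) * w t * (w t + \<epsilon>) * (w t - d t) / k t) * d t
      + w t * (s t * (2 * (1 - \<epsilon>) * d t * (w t + \<epsilon>) * (w t - d t) / k t))) * v t
      - w t * d t * (s t * (v t * (2 - 4 * \<epsilon> * (w t + \<epsilon>) * (w t - d t) / k t)))) / (v t * v t)) (at t)"
    using nz by (auto intro!: derivative_eq_intros dd[OF t] dw[OF t] dv[OF t])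
  also have "((s t * (3 * w t - 1 - 2 * (1 + \<epsilon>) * w t * (w t + \<epsilon>) * (w t - d t) / k t) * d t
      + w t * (s t * (2 * (1 - \<epsilon>) * d t * (w t + \<epsilon>) * (w t - d t) / k t))) * v t
      - w t * d t * (s t * (v t * (2 - 4 * \<epsilon> * (w t + \<epsilon>) * (w t - d t) / k t)))) / (v t * v t)
    = s t * (d t / v t * (w t - 1))"
    using nz by (simp add: divide_simps) algebra
  finally show ?thesis .
qed

text \<open>At a first contact \<open>p = w - 1 = q sqrt v\<close> the derivative of the difference
  has the sign of \<open>((1 + 4 \<epsilon>) w\<^sup>2 + 2 \<epsilon> w + \<epsilon>\<^sup>2) d - w
  (v + \<epsilon> p\<^sup>2)\<close>. With \<open>p\<^sup>2 = q\<^sup>2 v\<close> this is positive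
  as soon as \<open>(1 + 4 \<epsilon>) w d / v > 1 + \<epsilon> q\<^sup>2\<close>. The ratio
  \<open>w d / v\<close> starts with this bound and has only increased, because \<open>w > 1\<close>
  before the contact.\<close>

lemma ratio_above_threshold:
  assumes t: "0 < t" "t < T" shows "q * sqrt (v t) < w t - 1"
proof -
  define h where "h t = w t - 1 - q * sqrt (v t)" for t
  define h' where "h' t = s t * (3 * w t - 1 - 2 * (1 + \<epsilon>) * w t * (w t + \<epsilon>) * (w t - d t) / k t)
      - q * (s t * (v t * (2 - 4 * \<epsilon> * (w t + \<epsilon>) * (w t - d t) / k t)) / (2 * sqrt (v t)))" for t
  have "h t > 0"
  proof (rule first_zero_barrier[of 0 T h h'])
    fix t assume t: "0 < t" "t < T"
    show "(h has_real_derivative h' t) (at t)"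
      unfolding h_def h'_def using pos(2)[OF t]
      by (auto intro!: derivative_eq_intros dw[OF t] dv[OF t] simp: field_simps)
  next
    have "eventually (\<lambda>t. q < (w t - 1) / sqrt (v t)) (at_right 0)"
      using lim(1) P0 by (rule order_tendstoD)
    moreover have "eventually (\<lambda>t. t \<in> {0<..<T}) (at_right 0)" using T by (rule eventually_at_right_real)
    ultimately show "eventually (\<lambda>t. h t > 0) (at_right 0)"
      by eventually_elim (use pos(2) in \<open>auto simp: h_def pos_less_divide_eq\<close>)
  next
    fix c assume c: "0 < c" "c < T" "h c = 0" and before: "\<And>t. 0 < t \<Longrightarrow> t < c \<Longrightarrow> h t > 0"
    have vc: "0 < v c" "0 < d c" "0 < k c" using pos c by auto
    have w1: "w t > 1" if "0 < t" "t < c" for t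
    proof -
      have "0 < q * sqrt (v t)" using q pos(2)[of t] that c by simp
      with before[OF that] show ?thesis by (simp add: h_def)
    qed
    \<comment> \<open>Since \<open>w > 1\<close> before \<open>c\<close>, the ratio increases on
      \<open>(0, c)\<close>; the bound then passes to \<open>c\<close> by continuity.\<close>
    have "M0 \<le> w t * d t / v t" if t: "0 < t" "t < c" for t
    proof (rule DERIV_ge0_limit_le[OF _ _ lim(2), of c])
      fix u assume u: "0 < u" "u < c"
      show "((\<lambda>t. w t * d t / v t) has_real_derivative s u * (d u / v u * (w u - 1))) (at u)"
        using u c by (intro has_derivative_M) auto
      show "0 \<le> s u * (d u / v u * (w u - 1))"
        using w1[OF u] pos[of u] u c \<epsilon> by (auto simp: s intro!: mult_nonneg_nonneg divide_nonneg_nonneg)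
    qed (use t in auto)
    moreover have "isCont (\<lambda>t. w t * d t / v t) c" by (rule DERIV_isCont[OF has_derivative_M]) (use c in auto)
    then have "((\<lambda>t. w t * d t / v t) \<longlongrightarrow> w c * d c / v c) (at_left c)"
      unfolding isCont_def by (simp add: filterlim_at_split)
    ultimately have Mc: "M0 \<le> w c * d c / v c"
      by (intro tendsto_lowerbound[of _ _ "at_left c" M0])
         (auto intro!: eventually_mono[OF eventually_at_left_real[OF c(1)]])
    define p where "p = w c - 1"
    have p: "p = q * sqrt (v c)" using c(3) by (simp add: p_def h_def)
    then have p0: "0 < p" and p2: "p^2 = q^2 * v c" using q vc by (auto simp: power_mult_distrib)
    have wc: "1 < w c" using p0 by (simp add: p_def)
    have dc: "M0 * v c \<le> w c * d c" using Mc vc by (simp add: field_simps)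
    have "w c * (w c * d c) * (1 + 4 * \<epsilon>) \<ge> w c * (M0 * v c) * (1 + 4 * \<epsilon>)"
      using dc wc \<epsilon> by (intro mult_right_mono mult_left_mono) auto
    moreover have "w c * v c * ((1 + 4 * \<epsilon>) * M0) > w c * v c * (1 + \<epsilon> * q^2)"
      using M0 wc vc by (intro mult_strict_left_mono) auto
    ultimately have "(1 + 4 * \<epsilon>) * (w c)^2 * d c > w c * v c + \<epsilon> * w c * p^2"
      unfolding p2 by (simp add: power2_eq_square algebra_simps)
    moreover have "0 < (2 * \<epsilon> * w c + \<epsilon>^2) * d c" using wc vc \<epsilon> by (intro mult_pos_pos add_pos_pos) auto
    ultimately have N: "0 < ((1 + 4 * \<epsilon>) * (w c)^2 + 2 * \<epsilon> * w c + \<epsilon>^2) * d c - w c * (v c + \<epsilon> * p^2)"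
      by (simp add: algebra_simps)
    have qv: "q * (v c / (2 * sqrt (v c))) = p / 2"
      unfolding p using vc by (simp add: real_div_sqrt field_simps)
    have "h' c = s c * (3 * w c - 1 - 2 * (1 + \<epsilon>) * w c * (w c + \<epsilon>) * (w c - d c) / k c)
       - s c * (q * (v c / (2 * sqrt (v c)))) * (2 - 4 * \<epsilon> * (w c + \<epsilon>) * (w c - d c) / k c)"
      by (simp add: h'_def)
    also have "\<dots> = s c * ((3 * w c - 1) * k c - 2 * (1 + \<epsilon>) * w c * (w c + \<epsilon>) * (w c - d c)
        - p * (k c - 2 * \<epsilon> * (w c + \<epsilon>) * (w c - d c))) / k c"
      unfolding qv using vc by (simp add: field_simps)
    also have "(3 * w c - 1) * k c - 2 * (1 + \<epsilon>) * w c * (w c + \<epsilon>) * (w c - d c)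
        - p * (k c - 2 * \<epsilon> * (w c + \<epsilon>) * (w c - d c))
       = 2 * (((1 + 4 * \<epsilon>) * (w c)^2 + 2 * \<epsilon> * w c + \<epsilon>^2) * d c - w c * (v c + \<epsilon> * p^2))"
      unfolding k p_def by algebra
    finally have "h' c = s c * (2 * (((1 + 4 * \<epsilon>) * (w c)^2 + 2 * \<epsilon> * w c + \<epsilon>^2) * d c - w c * (v c + \<epsilon> * p^2))) / k c" .
    moreover have "s c > 0" using wc c \<epsilon> by (auto simp: s intro!: divide_pos_pos mult_pos_pos)
    ultimately show "h' c > 0" using N vc by simp
  qed (use t in auto)
  then show ?thesis by (simp add: h_def)
qed

lemma w_gt_1: assumes t: "0 < t" "t < T" shows "1 < w t"
proof -
  have "0 < q * sqrt (v t)" using q pos(2)[OF t] by simp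
  with ratio_above_threshold[OF t] show ?thesis by simp
qed

lemma s_pos: assumes t: "0 < t" "t < T" shows "0 < s t"
  using w_gt_1[OF t] t \<epsilon> by (auto simp: s intro!: divide_pos_pos mult_pos_pos)

text \<open>Where \<open>d = w\<close> all quotient terms drop out, and the difference has the
  derivative \<open>s (3 w - 1)\<close>, positive because \<open>w > 1\<close>.\<close>

lemma d_less_w: assumes t: "0 < t" "t < T" shows "d t < w t"
proof -
  define h' where "h' t = s t * (3 * w t - 1 - 2 * (1 + \<epsilon>) * w t * (w t + \<epsilon>) * (w t - d t) / k t)
      - s t * (2 * (1 - \<epsilon>) * d t * (w t + \<epsilon>) * (w t - d t) / k t)" for t
  have "w t - d t > 0"
  proof (rule first_zero_barrier[of 0 T "\<lambda>t. w t - d t" h'])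
    fix t assume t: "0 < t" "t < T"
    show "((\<lambda>t. w t - d t) has_real_derivative h' t) (at t)"
      unfolding h'_def by (intro DERIV_diff dd dw t)
  next
    have "((\<lambda>t. w t - d t) \<longlongrightarrow> 1 - 0) (at_right 0)" by (intro tendsto_diff lim)
    then show "eventually (\<lambda>t. w t - d t > 0) (at_right 0)" by (rule order_tendstoD) simp
  next
    fix c assume c: "0 < c" "c < T" "w c - d c = 0"
    have "h' c = s c * (3 * w c - 1)" unfolding h'_def c(3) by simp
    then show "h' c > 0" using s_pos[OF c(1,2)] w_gt_1[OF c(1,2)] by simp
  qed (use t in auto)
  then show ?thesis by simp
qed

lemma v_le: assumes t: "0 < t" "t < T" shows "v t \<le> (w t - 1)^2 / q^2"
proof -
  have "(q * sqrt (v t))^2 \<le> (w t - 1)^2"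
    using ratio_above_threshold[OF t] q pos(2)[OF t] by (intro power_mono) auto
  then show ?thesis using pos(2)[OF t] q by (simp add: power_mult_distrib field_simps)
qed

text \<open>In powers of \<open>p = w - 1\<close>, \<open>k\<close> is at least \<open>(1 +
  \<epsilon>)\<^sup>2 + 2 (1 + \<epsilon>) p + c p\<^sup>2\<close> with
  \<open>c = 1 - \<epsilon> - 1 / q\<^sup>2\<close>. As \<open>c \<le> 1\<close>, this dominates
  \<open>c (1 + p)\<^sup>2\<close> coefficient by coefficient.\<close>

lemma k_ge: assumes t: "0 < t" "t < T" shows "(1 - \<epsilon> - 1 / q^2) * (w t)^2 \<le> k t"
proof -
  define c where "c = 1 - \<epsilon> - 1 / q^2"
  have "0 \<le> 1 / q^2" by simp
  then have c1: "c \<le> 1" using \<epsilon>(1) unfolding c_def by linarith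
  define p where "p = w t - 1"
  have p: "0 \<le> p" using w_gt_1[OF t] by (simp add: p_def)
  have "0 \<le> 4 * \<epsilon> * w t * d t" using w_gt_1[OF t] pos(1)[OF t] \<epsilon> by simp
  then have "k t \<ge> (1 + \<epsilon>)^2 + 2 * (1 + \<epsilon>) * p + (1 - \<epsilon>) * p^2 - p^2 / q^2"
    using v_le[OF t] unfolding k p_def by (simp add: power2_eq_square algebra_simps)
  also have "(1 + \<epsilon>)^2 + 2 * (1 + \<epsilon>) * p + (1 - \<epsilon>) * p^2 - p^2 / q^2 = (1 + \<epsilon>)^2 + 2 * (1 + \<epsilon>) * p + c * p^2"
    by (simp add: c_def algebra_simps)
  finally have "k t \<ge> (1 + \<epsilon>)^2 + 2 * (1 + \<epsilon>) * p + c * p^2" .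
  moreover have "(1 + \<epsilon>)^2 \<ge> c"
  proof -
    have "1 \<le> (1 + \<epsilon>)^2" using \<epsilon> by (intro one_le_power) simp
    with c1 show ?thesis by simp
  qed
  moreover have "2 * (1 + \<epsilon>) * p \<ge> c * (2 * p)"
  proof -
    have "c * (2 * p) \<le> (1 + \<epsilon>) * (2 * p)" using c1 p \<epsilon> by (intro mult_right_mono) auto
    then show ?thesis by (simp only: mult_ac)
  qed
  moreover have "c * (w t)^2 = c + c * (2 * p) + c * p^2" by (simp add: p_def power2_eq_square algebra_simps)
  ultimately show ?thesis unfolding c_def by linarith
qed

text \<open>The numerator is at most \<open>8 \<epsilon> w\<^sup>2\<close>, and the relation between
  \<open>\<epsilon>\<close> and \<open>q\<close> in the locale compares this with
  \<open>k_ge\<close>. Consequently the logarithmic derivative of \<open>v\<close>, divided by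
  \<open>s\<close>, lies between 1 and 2.\<close>

lemma ratio_bound:
  assumes t: "0 < t" "t < T" shows "0 \<le> 4 * \<epsilon> * (w t + \<epsilon>) * (w t - d t) / k t" "4 * \<epsilon> * (w t + \<epsilon>) * (w t - d t) / k t \<le> 1"
proof -
  have w: "1 < w t" "d t < w t" "0 < d t" "0 < k t" using w_gt_1 d_less_w pos t by auto
  show "0 \<le> 4 * \<epsilon> * (w t + \<epsilon>) * (w t - d t) / k t" using w \<epsilon> by simp
  have "4 * \<epsilon> * (w t + \<epsilon>) * (w t - d t) \<le> 4 * \<epsilon> * (2 * w t) * w t"
    using w \<epsilon> by (intro mult_mono) auto
  also have "\<dots> = (8 * \<epsilon>) * (w t)^2" by (simp add: power2_eq_square)
  also have "\<dots> \<le> (1 - \<epsilon> - 1 / q^2) * (w t)^2" by (rule mult_right_mono[OF q(2)]) simp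
  also have "\<dots> \<le> k t" by (rule k_ge[OF t])
  finally show "4 * \<epsilon> * (w t + \<epsilon>) * (w t - d t) / k t \<le> 1" using w by simp
qed

lemma v_mono: assumes "0 < t" "t \<le> t'" "t' < T" shows "v t \<le> v t'"
proof (rule DERIV_ge0_mono[OF dv])
  fix u assume u: "0 < u" "u < T"
  show "0 \<le> s u * (v u * (2 - 4 * \<epsilon> * (w u + \<epsilon>) * (w u - d u) / k u))"
    using s_pos[OF u] pos(2)[OF u] ratio_bound[OF u] by (intro mult_nonneg_nonneg) auto
qed (use assms in auto)

lemma d_mono: assumes "0 < t" "t \<le> t'" "t' < T" shows "d t \<le> d t'"
proof (rule DERIV_ge0_mono[OF dd])
  fix u assume u: "0 < u" "u < T"
  show "0 \<le> s u * (2 * (1 - \<epsilon>) * d u * (w u + \<epsilon>) * (w u - d u) / k u)"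
    using s_pos[OF u] pos[OF u] w_gt_1[OF u] d_less_w[OF u] \<epsilon> by (intro mult_nonneg_nonneg divide_nonneg_nonneg) auto
qed (use assms in auto)

text \<open>From \<open>s \<ge> w / t\<close> and \<open>w > 1 + q sqrt v\<close> one gets
  \<open>v' \<ge> v (1 + q sqrt v) / t\<close>. In terms of \<open>u = sqrt t / sqrt v\<close> this
  reads \<open>u' \<le> - q / (2 sqrt t)\<close>, so \<open>u + q sqrt t\<close> does not increase;
  as \<open>u\<close> stays nonnegative, \<open>sqrt t\<close> is bounded.\<close>

lemma time_bound:
  assumes t: "0 < t" "t < T" shows "sqrt T \<le> sqrt t + sqrt t / (sqrt (v t) * q)"
proof -
  define g where "g t = - (sqrt t / sqrt (v t) + q * sqrt t)" for t
  define g' where "g' t = - ((1 / (2 * sqrt t) * sqrt (v t)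
     - sqrt t * (s t * (v t * (2 - 4 * \<epsilon> * (w t + \<epsilon>) * (w t - d t) / k t)) / (2 * sqrt (v t)))) / (sqrt (v t) * sqrt (v t)) + q / (2 * sqrt t))" for t
  have mono: "g t \<le> g t'" if "t \<le> t'" "t' < T" for t'
  proof (rule DERIV_ge0_mono[of 0 T g g'])
    fix u assume u: "0 < u" "u < T"
    have vu: "0 < v u" by (rule pos(2)[OF u])
    show "(g has_real_derivative g' u) (at u)"
      unfolding g_def g'_def using u vu by (auto intro!: derivative_eq_intros dv[OF u] simp: field_simps)
    have "w u / u \<le> s u"
    proof -
      have "w u * (1 - \<epsilon>) \<le> w u + \<epsilon>" using w_gt_1[OF u] \<epsilon> by (simp add: algebra_simps)
      then have "w u * (1 - \<epsilon>) / ((1 - \<epsilon>) * u) \<le> (w u + \<epsilon>) / ((1 - \<epsilon>) * u)"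
        using u \<epsilon> by (intro divide_right_mono) auto
      then show ?thesis unfolding s using u \<epsilon> by simp
    qed
    also have "s u \<le> s u * (2 - 4 * \<epsilon> * (w u + \<epsilon>) * (w u - d u) / k u)"
      using s_pos[OF u] ratio_bound[OF u] by simp
    finally have S: "w u / u \<le> s u * (2 - 4 * \<epsilon> * (w u + \<epsilon>) * (w u - d u) / k u)" .
    have "(1 + q * sqrt (v u)) / u \<le> w u / u"
      using ratio_above_threshold[OF u] u by (intro divide_right_mono) auto
    also note S
    finally have S': "(1 + q * sqrt (v u)) / u \<le> s u * (2 - 4 * \<epsilon> * (w u + \<epsilon>) * (w u - d u) / k u)" (is "_ \<le> ?A") .
    define r where "r = sqrt u"
    define y where "y = sqrt (v u)"
    have ry: "0 < r" "0 < y" "u = r^2" "v u = y^2" using u vu by (auto simp: r_def y_def)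
    have "g' u = - ((1 / (2 * r) * y - r * (y^2 * ?A / (2 * y))) / (y * y) + q / (2 * r))"
      unfolding g'_def unfolding r_def[symmetric] y_def[symmetric] unfolding ry(4) by (simp add: mult_ac)
    also have "\<dots> = (r * ?A - 1 / r - q * y / r) / (2 * y)"
      using ry by (simp add: field_simps power2_eq_square)
    also have "\<dots> = r * (?A - (1 + q * y) / u) / (2 * y)"
      using ry(1,2) unfolding ry(3) by (simp add: field_simps power2_eq_square)
    also have "\<dots> \<ge> 0" using S' ry by (intro divide_nonneg_nonneg mult_nonneg_nonneg) (auto simp: y_def)
    finally show "0 \<le> g' u" .
  qed (use t that in auto)
  have "q * sqrt t' \<le> sqrt t / sqrt (v t) + q * sqrt t" if "t \<le> t'" "t' < T" for t'
  proof -
    have "0 \<le> sqrt t' / sqrt (v t')" using that t pos(2)[of t'] by simp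
    with mono[OF that] show ?thesis by (simp add: g_def)
  qed
  then have le: "sqrt t' \<le> sqrt t + sqrt t / (sqrt (v t) * q)" if "t \<le> t'" "t' < T" for t'
  proof -
    have "sqrt t' \<le> (sqrt t / sqrt (v t) + q * sqrt t) / q"
      using that q \<open>\<And>t'. t \<le> t' \<Longrightarrow> t' < T \<Longrightarrow> q * sqrt t' \<le> sqrt t / sqrt (v t) + q * sqrt t\<close>[of t']
      by (simp add: pos_le_divide_eq mult.commute)
    also have "\<dots> = sqrt t + sqrt t / (sqrt (v t) * q)" using q by (simp add: add_divide_distrib)
    finally show ?thesis .
  qed
  have "((\<lambda>t'. sqrt t') \<longlongrightarrow> sqrt T) (at_left T)" by (intro tendsto_intros)
  then show ?thesis
    by (rule tendsto_upperbound) (auto intro!: eventually_mono[OF eventually_at_left_real[OF t(2)]] le)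
qed

text \<open>Relative to \<open>s\<close>, the logarithmic derivative of \<open>w\<close> is at most
  3 and that of \<open>v\<close> at least 1, so \<open>3 ln v - ln w\<close> does not
  decrease.\<close>

lemma w_le:
  assumes "0 < t" "t \<le> t'" "t' < T" shows "w t' \<le> w t * (v t' / v t)^3"
proof -
  define g where "g t = 3 * ln (v t) - ln (w t)" for t
  define g' where "g' t = 3 * (s t * (2 - 4 * \<epsilon> * (w t + \<epsilon>) * (w t - d t) / k t))
     - s t * (3 * w t - 1 - 2 * (1 + \<epsilon>) * w t * (w t + \<epsilon>) * (w t - d t) / k t) / w t" for t
  have "g t \<le> g t'"
  proof (rule DERIV_ge0_mono[of 0 T g g'])
    fix u assume u: "0 < u" "u < T"
    have vu: "0 < v u" "0 < w u" "0 < k u" using pos[OF u] w_gt_1[OF u] by auto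
    show "(g has_real_derivative g' u) (at u)"
      unfolding g_def g'_def using vu by (auto intro!: derivative_eq_intros dv[OF u] dw[OF u] simp: field_simps)
    have "0 \<le> 2 * (1 + \<epsilon>) * w u * (w u + \<epsilon>) * (w u - d u) / k u" using vu d_less_w[OF u] \<epsilon> by simp
    then have "(3 * w u - 1 - 2 * (1 + \<epsilon>) * w u * (w u + \<epsilon>) * (w u - d u) / k u) / w u \<le> 3"
      using vu by (simp add: divide_le_eq)
    then have "s u * ((3 * w u - 1 - 2 * (1 + \<epsilon>) * w u * (w u + \<epsilon>) * (w u - d u) / k u) / w u) \<le> s u * 3"
      using s_pos[OF u] by (intro mult_left_mono) auto
    moreover have "s u * 1 \<le> s u * (2 - 4 * \<epsilon> * (w u + \<epsilon>) * (w u - d u) / k u)"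
      using s_pos[OF u] ratio_bound[OF u] by (intro mult_left_mono) auto
    ultimately show "0 \<le> g' u" unfolding g'_def by simp
  qed (use assms in auto)
  moreover have p: "0 < v t" "0 < v t'" "0 < w t" "0 < w t'" using pos assms w_gt_1[of t] w_gt_1[of t'] by auto
  ultimately have "ln (w t') \<le> ln (w t) + 3 * (ln (v t') - ln (v t))" by (simp add: g_def)
  also have "\<dots> = ln (w t * (v t' / v t)^3)" using p by (simp add: ln_mult ln_realpow ln_div)
  finally show ?thesis using p by simp
qed

text \<open>\<open>w\<close> dominates \<open>sqrt v\<close>. If \<open>d\<close> stayed below some
  \<open>Z\<close>, then eventually \<open>w \<ge> 2 Z\<close>, hence
  \<open>w - d \<ge> w / 2\<close>, while \<open>k \<le> 8 (w + \<epsilon>) (w / 2)\<close>. The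
  logarithmic derivative of \<open>d\<close> would be at least \<open>s / 8\<close>, that of
  \<open>v\<close> is at most \<open>2 s\<close>, and \<open>16 ln d - ln v\<close> would not
  decrease, contradicting the growth of \<open>v\<close>.\<close>

lemma v_unbounded_limits:
  assumes lv: "filterlim v at_top (at_left T)"
  shows "filterlim w at_top (at_left T)" "filterlim d at_top (at_left T)"
proof -
  have sv: "filterlim (\<lambda>t. sqrt (v t)) at_top (at_left T)"
    by (rule filterlim_compose[OF sqrt_at_top lv])
  have ev: "eventually (\<lambda>t. t \<in> {0<..<T}) (at_left T)" using T by (rule eventually_at_left_real)
  show lw: "filterlim w at_top (at_left T)"
  proof (rule filterlim_at_top_mono[OF sv])
    show "eventually (\<lambda>t. sqrt (v t) \<le> w t) (at_left T)"
      using ev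
    proof eventually_elim
      case (elim t)
      have "1 * sqrt (v t) \<le> q * sqrt (v t)" using q pos(2)[of t] elim by (intro mult_right_mono) auto
      with ratio_above_threshold[of t] elim show ?case by auto
    qed
  qed
  show "filterlim d at_top (at_left T)"
    unfolding filterlim_at_top
  proof (rule allI, rule ccontr)
    fix Z assume Z: "\<not> eventually (\<lambda>t. Z \<le> d t) (at_left T)"
    have dZ: "d t \<le> Z" if "0 < t" "t < T" for t
    proof (rule ccontr)
      assume "\<not> d t \<le> Z"
      then have "Z \<le> d t'" if "t' \<in> {t<..<T}" for t' using d_mono[of t t'] that \<open>0 < t\<close> by auto
      then have "eventually (\<lambda>t. Z \<le> d t) (at_left T)"
        by (rule eventually_mono[OF eventually_at_left_real[OF \<open>t < T\<close>]])
      with Z show False by contradiction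
    qed
    have "eventually (\<lambda>t. 2 * Z \<le> w t) (at_left T)" using lw unfolding filterlim_at_top by blast
    then obtain t1 where t1: "t1 < T" "\<And>t. t1 < t \<Longrightarrow> t < T \<Longrightarrow> 2 * Z \<le> w t"
      unfolding eventually_at_left_field by blast
    define t0 where "t0 = max t1 0"
    have t0: "0 \<le> t0" "t1 \<le> t0" "t0 < T" using t1 T by (auto simp: t0_def)
    define g where "g t = 16 * ln (d t) - ln (v t)" for t
    define g' where "g' t = 16 * (s t * (2 * (1 - \<epsilon>) * (w t + \<epsilon>) * (w t - d t) / k t))
       - s t * (2 - 4 * \<epsilon> * (w t + \<epsilon>) * (w t - d t) / k t)" for t
    have mono: "g t \<le> g t'" if "t0 < t" "t \<le> t'" "t' < T" for t t'
    proof (rule DERIV_ge0_mono[of t0 T g g'])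
      fix u assume u0: "t0 < u" "u < T"
      then have u: "0 < u" "u < T" using t0 by auto
      have vu: "0 < v u" "0 < d u" "0 < k u" "1 < w u" "d u < w u" using pos[OF u] w_gt_1[OF u] d_less_w[OF u] by auto
      show "(g has_real_derivative g' u) (at u)"
        unfolding g_def g'_def using vu by (auto intro!: derivative_eq_intros dv[OF u] dd[OF u] simp: field_simps)
      have half: "w u / 2 \<le> w u - d u" using dZ[OF u] t1(2)[of u] u0 t0 by auto
      have "k u \<le> (w u + \<epsilon>)^2 + 4 * \<epsilon> * w u * d u" 
      proof -
        have "0 \<le> \<epsilon> * (w u - 1)^2" using \<epsilon> by simp
        then show ?thesis unfolding k using vu(1) by linarith
      qed
      also have "4 * \<epsilon> * w u * d u \<le> 1 * (w u + \<epsilon>) * (w u + \<epsilon>)"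
        using vu \<epsilon> by (intro mult_mono) auto
      finally have "k u \<le> 2 * (w u + \<epsilon>)^2" by (simp add: power2_eq_square)
      also have "(w u + \<epsilon>)^2 \<le> (w u + \<epsilon>) * (2 * w u)"
        unfolding power2_eq_square using vu \<epsilon> by (intro mult_left_mono) auto
      finally have "k u \<le> 2 * ((w u + \<epsilon>) * (2 * w u))" by simp
      also have "\<dots> = 8 * ((w u + \<epsilon>) * (w u / 2))" by simp
      finally have "k u \<le> 8 * ((w u + \<epsilon>) * (w u / 2))" .
      also have "\<dots> \<le> 8 * ((w u + \<epsilon>) * (w u - d u))"
        using half vu \<epsilon> by (intro mult_left_mono) auto
      finally have "1 / 8 \<le> (w u + \<epsilon>) * (w u - d u) / k u" using vu by (simp add: field_simps)
      moreover have "1 \<le> 2 * (1 - \<epsilon>)" using \<epsilon> by simp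
      ultimately have "1 * (1 / 8) \<le> 2 * (1 - \<epsilon>) * ((w u + \<epsilon>) * (w u - d u) / k u)"
        by (intro mult_mono) auto
      moreover have "16 * (2 * (1 - \<epsilon>) * (w u + \<epsilon>) * (w u - d u) / k u)
          = 16 * (2 * (1 - \<epsilon>) * ((w u + \<epsilon>) * (w u - d u) / k u))" by simp
      ultimately have "2 \<le> 16 * (2 * (1 - \<epsilon>) * (w u + \<epsilon>) * (w u - d u) / k u)" by linarith
      then have "s u * 2 \<le> s u * (16 * (2 * (1 - \<epsilon>) * (w u + \<epsilon>) * (w u - d u) / k u))"
        using s_pos[OF u] by (intro mult_left_mono) auto
      moreover have "s u * (2 - 4 * \<epsilon> * (w u + \<epsilon>) * (w u - d u) / k u) \<le> s u * 2"
        using s_pos[OF u] ratio_bound(1)[OF u] by (intro mult_left_mono) auto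
      ultimately show "0 \<le> g' u" unfolding g'_def by (simp add: mult_ac)
    qed (use that in auto)
    define t2 where "t2 = (t0 + T) / 2"
    have t2: "t0 < t2" "t2 < T" "0 < t2" using t0 by (auto simp: t2_def)
    have vb: "v t \<le> exp (16 * ln (max Z 1) - g t2)" if "t2 \<le> t" "t < T" for t
    proof -
      have t: "0 < t" "t < T" using that t2 by auto
      have "ln (d t) \<le> ln (max Z 1)" using dZ[OF t] pos(1)[OF t] by simp
      then have "ln (v t) \<le> 16 * ln (max Z 1) - g t2" using mono[of t2 t] t2 that by (simp add: g_def)
      then show ?thesis using pos(2)[OF t] by (metis exp_le_cancel_iff exp_ln)
    qed
    have "eventually (\<lambda>t. exp (16 * ln (max Z 1) - g t2) + 1 \<le> v t) (at_left T)"
      using lv unfolding filterlim_at_top by blast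
    moreover have "eventually (\<lambda>t. t \<in> {t2<..<T}) (at_left T)" using t2(2) by (rule eventually_at_left_real)
    ultimately have "eventually (\<lambda>t. False) (at_left T)"
    proof eventually_elim
      case (elim t)
      then show ?case using vb[of t] by auto
    qed
    then show False by simp
  qed
qed

end

section \<open>Flow of the regularized system backwards in \<open>Y\<close>\<close>

definition ext_field :: "real \<Rightarrow> real \<times> real \<times> real \<times> real \<times> real \<Rightarrow> real \<times> real \<times> real \<times> real \<times> real" where
  "ext_field \<epsilon> = (\<lambda>(Y, \<delta>, \<omega>, \<mu>, c). (- 1, - (\<delta> * (reg_L \<epsilon> Y \<delta> \<omega> \<mu> / reg_K \<epsilon> Y \<delta> \<omega> \<mu>)),
     - (reg_W \<epsilon> Y \<delta> \<omega> \<mu> / ((1 - \<epsilon>) * reg_K \<epsilon> Y \<delta> \<omega> \<mu>)),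
     - (\<mu> * (2 * \<omega> / (1 - \<epsilon>) - eta \<epsilon> * (reg_L \<epsilon> Y \<delta> \<omega> \<mu> / reg_K \<epsilon> Y \<delta> \<omega> \<mu>))), \<omega> * c / (1 - \<epsilon>)))"

definition ext_dom :: "real \<Rightarrow> (real \<times> real \<times> real \<times> real \<times> real) set" where
  "ext_dom \<epsilon> = {(Y, \<delta>, \<omega>, \<mu>, c). 0 < \<delta> \<and> 0 < \<mu> \<and> 0 < c \<and> 0 < reg_K \<epsilon> Y \<delta> \<omega> \<mu>}"

lemma continuous_on_reg_K [continuous_intros]:
  fixes f g h l :: "'a::topological_space \<Rightarrow> real"
  assumes "continuous_on S f" "continuous_on S g" "continuous_on S h" "continuous_on S l"
  shows "continuous_on S (\<lambda>p. reg_K \<epsilon> (f p) (g p) (h p) (l p))"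
  unfolding reg_K_def by (intro continuous_intros assms)

lemma open_ext_dom: "open (ext_dom \<epsilon>)"
proof -
  have "ext_dom \<epsilon> = {p. 0 < fst (snd p)} \<inter> {p. 0 < fst (snd (snd (snd p)))} \<inter> {p. 0 < snd (snd (snd (snd p)))}
     \<inter> {p. 0 < reg_K \<epsilon> (fst p) (fst (snd p)) (fst (snd (snd p))) (fst (snd (snd (snd p))))}"
    by (auto simp: ext_dom_def)
  then show ?thesis
    by (auto intro!: open_Int open_Collect_less continuous_intros)
qed

lemma loc_lipschitz_ext_field:
  assumes "\<epsilon> < 1" shows "loc_lipschitz (ext_field \<epsilon>) (ext_dom \<epsilon>)"
proof -
  note op = open_ext_dom[of \<epsilon>]
  let ?U = "ext_dom \<epsilon>"
  have c: "loc_lipschitz (\<lambda>p. a) ?U" for a :: real by (rule loc_lipschitz_const[OF op])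
  have v: "loc_lipschitz (\<lambda>p. fst p) ?U" "loc_lipschitz (\<lambda>p. fst (snd p)) ?U" "loc_lipschitz (\<lambda>p. fst (snd (snd p))) ?U"
    "loc_lipschitz (\<lambda>p. fst (snd (snd (snd p)))) ?U" "loc_lipschitz (\<lambda>p. snd (snd (snd (snd p)))) ?U"
    by (rule loc_lipschitz_bounded_linear[OF op];
        intro bounded_linear_fst bounded_linear_snd bounded_linear_fst_comp bounded_linear_snd_comp bounded_linear_ident)+
  note rules = loc_lipschitz_add loc_lipschitz_diff loc_lipschitz_mult loc_lipschitz_minus loc_lipschitz_power[OF _ op] v c
  have K: "loc_lipschitz (\<lambda>p. reg_K \<epsilon> (fst p) (fst (snd p)) (fst (snd (snd p))) (fst (snd (snd (snd p))))) ?U"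
    unfolding reg_K_def by (intro rules)
  have L: "loc_lipschitz (\<lambda>p. reg_L \<epsilon> (fst p) (fst (snd p)) (fst (snd (snd p))) (fst (snd (snd (snd p))))) ?U"
    unfolding reg_L_def Let_def by (intro rules)
  have W: "loc_lipschitz (\<lambda>p. reg_W \<epsilon> (fst p) (fst (snd p)) (fst (snd (snd p))) (fst (snd (snd (snd p))))) ?U"
    unfolding reg_W_def Let_def by (intro rules)
  have K0: "reg_K \<epsilon> (fst p) (fst (snd p)) (fst (snd (snd p))) (fst (snd (snd (snd p)))) \<noteq> 0" if "p \<in> ?U" for p
    using that by (auto simp: ext_dom_def)
  have LK: "loc_lipschitz (\<lambda>p. reg_L \<epsilon> (fst p) (fst (snd p)) (fst (snd (snd p))) (fst (snd (snd (snd p))))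
      / reg_K \<epsilon> (fst p) (fst (snd p)) (fst (snd (snd p))) (fst (snd (snd (snd p))))) ?U"
    by (rule loc_lipschitz_divide[OF L K K0])
  have "loc_lipschitz (\<lambda>p. (1 - \<epsilon>) * reg_K \<epsilon> (fst p) (fst (snd p)) (fst (snd (snd p))) (fst (snd (snd (snd p))))) ?U"
    by (intro loc_lipschitz_mult c K)
  then have WK: "loc_lipschitz (\<lambda>p. reg_W \<epsilon> (fst p) (fst (snd p)) (fst (snd (snd p))) (fst (snd (snd (snd p))))
      / ((1 - \<epsilon>) * reg_K \<epsilon> (fst p) (fst (snd p)) (fst (snd (snd p))) (fst (snd (snd (snd p)))))) ?U"
    by (rule loc_lipschitz_divide[OF W]) (use K0 assms in auto)
  have d: "loc_lipschitz (\<lambda>p. g p / (1 - \<epsilon>)) ?U" if "loc_lipschitz g ?U" for g :: "_ \<Rightarrow> real"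
    by (rule loc_lipschitz_divide[OF that c]) (use assms in auto)
  show ?thesis
    unfolding ext_field_def case_prod_beta
    by (intro loc_lipschitz_Pair rules LK WK d)
qed

lemma reg_ode_imp_vector:
  assumes "reg_ode \<epsilon> \<delta> \<omega> \<mu> c (- t)"
  shows "((\<lambda>t. (- t, \<delta> (- t), \<omega> (- t), \<mu> (- t), c (- t))) has_vector_derivative
     ext_field \<epsilon> (- t, \<delta> (- t), \<omega> (- t), \<mu> (- t), c (- t))) (at t)"
proof -
  have m: "((\<lambda>t. f (- t)) has_vector_derivative - y) (at t)" if "(f has_real_derivative y) (at (- t))" for f y
    using that[unfolded DERIV_mirror] by (simp only: has_real_derivative_iff_has_vector_derivative)
  have c: "- (- (\<omega> (- t) * c (- t)) / (1 - \<epsilon>)) = \<omega> (- t) * c (- t) / (1 - \<epsilon>)" by simp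
  show ?thesis
    using assms unfolding reg_ode_def Let_def ext_field_def prod.case
    by (intro has_vector_derivative_Pair m m[of c, unfolded c])
       (auto intro!: derivative_eq_intros m[of c "- (\<omega> (- t) * c (- t)) / (1 - \<epsilon>)", unfolded c])
qed

text \<open>Trajectories run in the time \<open>t = - Y\<close>; these are their last four
  coordinates, read as functions of \<open>Y\<close>.\<close>

definition comp1 :: "(real \<Rightarrow> real \<times> real \<times> real \<times> real \<times> real) \<Rightarrow> real \<Rightarrow> real" where
  "comp1 x Y = fst (snd (x (- Y)))"
definition comp2 :: "(real \<Rightarrow> real \<times> real \<times> real \<times> real \<times> real) \<Rightarrow> real \<Rightarrow> real" where
  "comp2 x Y = fst (snd (snd (x (- Y))))"
definition comp3 :: "(real \<Rightarrow> real \<times> real \<times> real \<times> real \<times> real) \<Rightarrow> real \<Rightarrow> real" where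
  "comp3 x Y = fst (snd (snd (snd (x (- Y)))))"
definition comp4 :: "(real \<Rightarrow> real \<times> real \<times> real \<times> real \<times> real) \<Rightarrow> real \<Rightarrow> real" where
  "comp4 x Y = snd (snd (snd (snd (x (- Y)))))"

lemmas comp_defs = comp1_def comp2_def comp3_def comp4_def

lemma solves_time:
  assumes "solves (ext_field \<epsilon>) U (0, r) T x" "0 \<le> t" "t < T"
  shows "fst (x t) = - t"
proof (cases "t = 0")
  case True
  then show ?thesis using assms by (simp add: solves_def)
next
  case False
  have "(\<lambda>t. fst (x t) + t) t = (\<lambda>t. fst (x t) + t) 0"
  proof (rule DERIV_isconst2[of 0 t])
    have cx: "continuous_on {0..t} x" using assms unfolding solves_def by (auto intro: continuous_on_subset)
    show "continuous_on {0..t} (\<lambda>t. fst (x t) + t)" by (intro continuous_intros cx)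
    fix u assume u: "0 < u" "u < t"
    then have "(x has_vector_derivative ext_field \<epsilon> (x u)) (at u)" using assms by (auto simp: solves_def)
    from bounded_linear.has_vector_derivative[OF bounded_linear_fst this]
    have "((\<lambda>t. fst (x t)) has_real_derivative - 1) (at u)"
      by (simp add: ext_field_def case_prod_beta has_real_derivative_iff_has_vector_derivative)
    then show "DERIV (\<lambda>t. fst (x t) + t) u :> 0" by (auto intro!: derivative_eq_intros)
  qed (use False assms in auto)
  then show ?thesis using assms by (simp add: solves_def)
qed

lemma solves_imp_reg:
  assumes "solves (ext_field \<epsilon>) U (0, r) T x" "0 < t" "t < T"
  shows "reg_ode \<epsilon> (comp1 x) (comp2 x) (comp3 x) (comp4 x) (- t)"
proof -
  have X: "(x has_vector_derivative ext_field \<epsilon> (x t)) (at t)" using assms by (auto simp: solves_def)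
  have Y: "fst (x t) = - t" using assms by (intro solves_time) auto
  have m: "((\<lambda>Y. f (- Y)) has_real_derivative y) (at (- t))" if "(f has_vector_derivative - y) (at t)" for f y
    unfolding DERIV_mirror minus_minus using that by (simp only: has_real_derivative_iff_has_vector_derivative)
  note X1 = bounded_linear.has_vector_derivative[OF bounded_linear_snd X]
  note X2 = bounded_linear.has_vector_derivative[OF bounded_linear_snd X1]
  note X3 = bounded_linear.has_vector_derivative[OF bounded_linear_snd X2]
  note X4 = bounded_linear.has_vector_derivative[OF bounded_linear_snd X3]
  note D = bounded_linear.has_vector_derivative[OF bounded_linear_fst X1]
    bounded_linear.has_vector_derivative[OF bounded_linear_fst X2]
    bounded_linear.has_vector_derivative[OF bounded_linear_fst X3] X4
  note D' = D[unfolded ext_field_def case_prod_beta fst_conv snd_conv Y]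
  show ?thesis
    unfolding reg_ode_def Let_def comp_defs minus_minus
  proof (intro conjI m)
    show "((\<lambda>t. snd (snd (snd (snd (x t))))) has_vector_derivative
      - (- (fst (snd (snd (x t))) * snd (snd (snd (snd (x t))))) / (1 - \<epsilon>))) (at t)"
      using D'(4) by simp
  qed (fact D')+
qed

lemma DERIV_neg_arg: "(f has_real_derivative y) (at (- t)) \<Longrightarrow> ((\<lambda>t. f (- t)) has_real_derivative - y) (at t)" for f :: "real \<Rightarrow> real"
  by (simp add: DERIV_mirror)

text \<open>The powers of \<open>t\<close> cancel in both ratios:
  \<open>(w - 1) / sqrt v = - \<omega> / sqrt \<mu>\<close> and
  \<open>w d / v = w \<delta> / \<mu>\<close>. Their limits at 0 are therefore read off from the
  regular initial data.\<close>

lemma reg_blowup: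
  fixes \<delta> \<omega> \<mu> c :: "real \<Rightarrow> real"
  assumes \<epsilon>: "0 < \<epsilon>" "\<epsilon> \<le> 1/4" and q: "1 < q" "8 * \<epsilon> \<le> 1 - \<epsilon> - 1 / q^2" and T: "0 < T"
    and reg: "\<And>t. 0 < t \<Longrightarrow> t < T \<Longrightarrow> reg_ode \<epsilon> \<delta> \<omega> \<mu> c (- t)"
    and pos: "\<And>t. 0 < t \<Longrightarrow> t < T \<Longrightarrow> 0 < \<delta> (- t) \<and> 0 < \<mu> (- t) \<and> 0 < reg_K \<epsilon> (- t) (\<delta> (- t)) (\<omega> (- t)) (\<mu> (- t))"
    and lim: "((\<lambda>t. \<delta> (- t)) \<longlongrightarrow> d2) (at_right 0)" "((\<lambda>t. \<omega> (- t)) \<longlongrightarrow> w1) (at_right 0)" "((\<lambda>t. \<mu> (- t)) \<longlongrightarrow> m0) (at_right 0)"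
    and m0: "0 < m0" and P0: "q < - w1 / sqrt m0" and M0: "1 + \<epsilon> * q^2 < (1 + 4 * \<epsilon>) * (d2 / m0)"
  shows "blowup \<epsilon> q T (- w1 / sqrt m0) (d2 / m0) (\<lambda>t. t^2 * \<delta> (- t)) (\<lambda>t. 1 - t * \<omega> (- t)) (\<lambda>t. \<mu> (- t) * t^2)
     (\<lambda>t. reg_K \<epsilon> (- t) (\<delta> (- t)) (\<omega> (- t)) (\<mu> (- t))) (\<lambda>t. (1 - t * \<omega> (- t) + \<epsilon>) / ((1 - \<epsilon>) * t))"
proof -
  define k where "k t = reg_K \<epsilon> (- t) (\<delta> (- t)) (\<omega> (- t)) (\<mu> (- t))" for t
  define w where "w t = 1 - t * \<omega> (- t)" for t
  define d where "d t = t^2 * \<delta> (- t)" for t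
  define v where "v t = \<mu> (- t) * t^2" for t
  define s where "s t = (w t + \<epsilon>) / ((1 - \<epsilon>) * t)" for t
  have "blowup \<epsilon> q T (- w1 / sqrt m0) (d2 / m0) d w v k s"
  proof unfold_locales
    show "0 < \<epsilon>" "\<epsilon> < 1" "\<epsilon> \<le> 1 / 4" "1 < q" "8 * \<epsilon> \<le> 1 - \<epsilon> - 1 / q^2" "0 < T" using \<epsilon> q T by auto
    show "s t = (w t + \<epsilon>) / ((1 - \<epsilon>) * t)" for t by (simp add: s_def)
    show "k t = (w t + \<epsilon>)^2 - \<epsilon> * (w t - 1)^2 + 4 * \<epsilon> * w t * d t - v t" for t
      unfolding k_def v_def by (subst reg_K_identity[of "w t" "- t" "\<omega> (- t)" "d t"]) (auto simp: w_def d_def)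
    show "0 < d t" "0 < v t" "0 < k t" if "0 < t" "t < T" for t
      using pos[OF that] that by (auto simp: d_def v_def k_def)
    fix t assume t: "0 < t" "t < T"
    have kp: "0 < k t" using pos[OF t] by (simp add: k_def)
    have wt: "w t = 1 + (- t) * \<omega> (- t)" and dt: "d t = (- t)^2 * \<delta> (- t)" by (simp_all add: w_def d_def)
    have L: "reg_L \<epsilon> (- t) (\<delta> (- t)) (\<omega> (- t)) (\<mu> (- t)) = - 2 * ((w t + \<epsilon>)^2 * (w t - d t) - k t) / t"
      using reg_L_identity[OF wt dt, of \<epsilon> "\<mu> (- t)"] t by (simp add: k_def field_simps)
    have W: "reg_W \<epsilon> (- t) (\<delta> (- t)) (\<omega> (- t)) (\<mu> (- t)) = ((w t + \<epsilon>) * ((3 * w t - 1) * k t - 2 * (1 + \<epsilon>) * w t * (w t + \<epsilon>) * (w t - d t))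
     - (1 - \<epsilon>) * (w t - 1) * k t) / t^2"
      using reg_W_identity[OF wt dt, of \<epsilon> "\<mu> (- t)"] t by (simp add: k_def field_simps)
    note D = reg[OF t, unfolded reg_ode_def Let_def L W k_def[symmetric]]
    have \<delta>t: "\<delta> (- t) = d t / t^2" and \<omega>t: "\<omega> (- t) = (1 - w t) / t" and \<mu>t: "\<mu> (- t) = v t / t^2"
      using t by (simp_all add: d_def w_def v_def)
    have D1: "((\<lambda>t. \<delta> (- t)) has_real_derivative - (\<delta> (- t) * (- 2 * ((w t + \<epsilon>)^2 * (w t - d t) - k t) / t / k t))) (at t)"
      and D2: "((\<lambda>t. \<omega> (- t)) has_real_derivative - (((w t + \<epsilon>) * ((3 * w t - 1) * k t - 2 * (1 + \<epsilon>) * w t * (w t + \<epsilon>) * (w t - d t))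
     - (1 - \<epsilon>) * (w t - 1) * k t) / t^2 / ((1 - \<epsilon>) * k t))) (at t)"
      and D3: "((\<lambda>t. \<mu> (- t)) has_real_derivative - (\<mu> (- t) * (2 * \<omega> (- t) / (1 - \<epsilon>) - eta \<epsilon> * (- 2 * ((w t + \<epsilon>)^2 * (w t - d t) - k t) / t / k t)))) (at t)"
      using D by (blast intro: DERIV_neg_arg)+
    have "(d has_real_derivative 2 * t * \<delta> (- t) + t^2 * - (\<delta> (- t) * (- 2 * ((w t + \<epsilon>)^2 * (w t - d t) - k t) / t / k t))) (at t)"
      unfolding d_def[abs_def] by (rule derivative_eq_intros D1[unfolded d_def] refl | simp)+
    also have "2 * t * \<delta> (- t) + t^2 * - (\<delta> (- t) * (- 2 * ((w t + \<epsilon>)^2 * (w t - d t) - k t) / t / k t))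
       = s t * (2 * (1 - \<epsilon>) * d t * (w t + \<epsilon>) * (w t - d t) / k t)"
      unfolding \<delta>t s_def using t kp \<epsilon> by (simp add: divide_simps) algebra
    finally show "(d has_real_derivative s t * (2 * (1 - \<epsilon>) * d t * (w t + \<epsilon>) * (w t - d t) / k t)) (at t)" .
    have "(w has_real_derivative - (\<omega> (- t) + t * - (((w t + \<epsilon>) * ((3 * w t - 1) * k t - 2 * (1 + \<epsilon>) * w t * (w t + \<epsilon>) * (w t - d t))
     - (1 - \<epsilon>) * (w t - 1) * k t) / t^2 / ((1 - \<epsilon>) * k t)))) (at t)"
      unfolding w_def[abs_def] by (rule derivative_eq_intros D2[unfolded w_def] refl | simp)+
    also have "- (\<omega> (- t) + t * - (((w t + \<epsilon>) * ((3 * w t - 1) * k t - 2 * (1 + \<epsilon>) * w t * (w t + \<epsilon>) * (w t - d t))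
     - (1 - \<epsilon>) * (w t - 1) * k t) / t^2 / ((1 - \<epsilon>) * k t)))
       = s t * (3 * w t - 1 - 2 * (1 + \<epsilon>) * w t * (w t + \<epsilon>) * (w t - d t) / k t)"
      unfolding \<omega>t s_def using t kp \<epsilon> by (simp add: divide_simps) algebra
    finally show "(w has_real_derivative s t * (3 * w t - 1 - 2 * (1 + \<epsilon>) * w t * (w t + \<epsilon>) * (w t - d t) / k t)) (at t)" .
    have "(v has_real_derivative - (\<mu> (- t) * (2 * \<omega> (- t) / (1 - \<epsilon>) - eta \<epsilon> * (- 2 * ((w t + \<epsilon>)^2 * (w t - d t) - k t) / t / k t))) * t^2
        + \<mu> (- t) * (2 * t)) (at t)"
      unfolding v_def[abs_def] by (rule derivative_eq_intros D3 refl | simp)+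
    also have "- (\<mu> (- t) * (2 * \<omega> (- t) / (1 - \<epsilon>) - eta \<epsilon> * (- 2 * ((w t + \<epsilon>)^2 * (w t - d t) - k t) / t / k t))) * t^2
        + \<mu> (- t) * (2 * t) = s t * (v t * (2 - 4 * \<epsilon> * (w t + \<epsilon>) * (w t - d t) / k t))"
      unfolding \<omega>t \<mu>t s_def eta_def using t kp \<epsilon> by (simp add: divide_simps) algebra
    finally show "(v has_real_derivative s t * (v t * (2 - 4 * \<epsilon> * (w t + \<epsilon>) * (w t - d t) / k t))) (at t)" .
  next
    have t0: "((\<lambda>t. t) \<longlongrightarrow> (0::real)) (at_right 0)" by (rule tendsto_ident_at)
    have ev: "eventually (\<lambda>t. t \<in> {0<..<T}) (at_right 0)" using T by (rule eventually_at_right_real)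
    have "((\<lambda>t. 1 - t * \<omega> (- t)) \<longlongrightarrow> 1 - 0 * w1) (at_right 0)" by (intro tendsto_intros lim)
    then show wl: "(w \<longlongrightarrow> 1) (at_right 0)" by (simp add: w_def[abs_def])
    have "((\<lambda>t. t^2 * \<delta> (- t)) \<longlongrightarrow> 0^2 * d2) (at_right 0)" by (intro tendsto_intros lim)
    then show "(d \<longlongrightarrow> 0) (at_right 0)" by (simp add: d_def[abs_def])
    have "((\<lambda>t. - \<omega> (- t) / sqrt (\<mu> (- t))) \<longlongrightarrow> - w1 / sqrt m0) (at_right 0)" by (intro tendsto_intros lim) (use m0 in auto)
    then show "((\<lambda>t. (w t - 1) / sqrt (v t)) \<longlongrightarrow> - w1 / sqrt m0) (at_right 0)"
      by (rule Lim_transform_eventually) (use ev in \<open>eventually_elim, auto simp: w_def v_def real_sqrt_mult\<close>)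
    have "((\<lambda>t. w t * (\<delta> (- t) / \<mu> (- t))) \<longlongrightarrow> 1 * (d2 / m0)) (at_right 0)" by (intro tendsto_intros lim wl) (use m0 in auto)
    then have "((\<lambda>t. w t * (\<delta> (- t) / \<mu> (- t))) \<longlongrightarrow> d2 / m0) (at_right 0)" by simp
    then show "((\<lambda>t. w t * d t / v t) \<longlongrightarrow> d2 / m0) (at_right 0)"
      by (rule Lim_transform_eventually) (use ev in \<open>eventually_elim, auto simp: d_def v_def\<close>)
  qed (use P0 M0 in auto)
  then show ?thesis unfolding d_def[abs_def] w_def[abs_def] v_def[abs_def] k_def[abs_def] s_def[abs_def] .
qed

lemma solves_props:
  assumes "solves (ext_field \<epsilon>) (ext_dom \<epsilon>) (0, d2, w1, m0, 1) T x" "0 \<le> t" "t < T"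
  shows "0 < comp1 x (- t)" "0 < comp3 x (- t)" "0 < comp4 x (- t)"
    "0 < reg_K \<epsilon> (- t) (comp1 x (- t)) (comp2 x (- t)) (comp3 x (- t))"
    "x t = (- t, comp1 x (- t), comp2 x (- t), comp3 x (- t), comp4 x (- t))"
proof -
  have U: "x t \<in> ext_dom \<epsilon>" using assms by (auto simp: solves_def)
  have Y: "fst (x t) = - t" by (rule solves_time[OF assms])
  show "x t = (- t, comp1 x (- t), comp2 x (- t), comp3 x (- t), comp4 x (- t))"
    unfolding comp_defs minus_minus using Y by (intro prod_eqI) simp_all
  with U show "0 < comp1 x (- t)" "0 < comp3 x (- t)" "0 < comp4 x (- t)"
    "0 < reg_K \<epsilon> (- t) (comp1 x (- t)) (comp2 x (- t)) (comp3 x (- t))"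
    by (auto simp: ext_dom_def)
qed

lemma solves_limits:
  assumes "solves (ext_field \<epsilon>) (ext_dom \<epsilon>) (0, d2, w1, m0, 1) T x" "0 < T"
  shows "((\<lambda>t. comp1 x (- t)) \<longlongrightarrow> d2) (at_right 0)" "((\<lambda>t. comp2 x (- t)) \<longlongrightarrow> w1) (at_right 0)"
    "((\<lambda>t. comp3 x (- t)) \<longlongrightarrow> m0) (at_right 0)"
proof -
  have "continuous (at 0 within {0..<T}) x" "x 0 = (0, d2, w1, m0, 1)"
    using assms by (auto simp: solves_def continuous_on_eq_continuous_within)
  then have "(x \<longlongrightarrow> (0, d2, w1, m0, 1)) (at 0 within {0..<T})"
    by (simp add: continuous_within)
  moreover have "at 0 within {0..<T} = at_right 0"
  proof -
    have "at 0 within {0..<T} = at 0 within {0..}"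
      by (rule at_within_nhd[where S = "{..<T}"]) (use assms in auto)
    also have "\<dots> = at_right (0::real)"
      by (rule at_within_nhd[where S = UNIV]) auto
    finally show ?thesis .
  qed
  ultimately have X: "(x \<longlongrightarrow> (0, d2, w1, m0, 1)) (at_right 0)" by simp
  note X1 = tendsto_snd[OF X] note X2 = tendsto_snd[OF X1] note X3 = tendsto_snd[OF X2]
  show "((\<lambda>t. comp1 x (- t)) \<longlongrightarrow> d2) (at_right 0)" "((\<lambda>t. comp2 x (- t)) \<longlongrightarrow> w1) (at_right 0)"
    "((\<lambda>t. comp3 x (- t)) \<longlongrightarrow> m0) (at_right 0)"
    using tendsto_fst[OF X1] tendsto_fst[OF X2] tendsto_fst[OF X3] by (simp_all add: comp_defs)
qed

lemma solves_blowup: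
  assumes "solves (ext_field \<epsilon>) (ext_dom \<epsilon>) (0, d2, w1, m0, 1) T x" "0 < T"
    and "0 < \<epsilon>" "\<epsilon> \<le> 1/4" "1 < q" "8 * \<epsilon> \<le> 1 - \<epsilon> - 1 / q^2"
    and "0 < m0" "q < - w1 / sqrt m0" "1 + \<epsilon> * q^2 < (1 + 4 * \<epsilon>) * (d2 / m0)"
  shows "blowup \<epsilon> q T (- w1 / sqrt m0) (d2 / m0) (\<lambda>t. t^2 * comp1 x (- t)) (\<lambda>t. 1 - t * comp2 x (- t)) (\<lambda>t. comp3 x (- t) * t^2)
     (\<lambda>t. reg_K \<epsilon> (- t) (comp1 x (- t)) (comp2 x (- t)) (comp3 x (- t))) (\<lambda>t. (1 - t * comp2 x (- t) + \<epsilon>) / ((1 - \<epsilon>) * t))"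
  by (rule reg_blowup[OF assms(3-6,2) solves_imp_reg[OF assms(1)] _ solves_limits[OF assms(1,2)] assms(7-9)])
    (use solves_props[OF assms(1)] in auto)

text \<open>Keeping \<open>\<mu>\<close> as an independent unknown makes the system free of real powers; this invariant recovers its meaning.\<close>

lemma reg_conserved:
  assumes "reg_ode \<epsilon> \<delta> \<omega> \<mu> c Y" "0 < \<delta> Y" "\<epsilon> < 1"
  shows "((\<lambda>Y. \<mu> Y * \<delta> Y powr eta \<epsilon> * (c Y)^2) has_real_derivative 0) (at Y)"
proof -
  define L where "L = reg_L \<epsilon> Y (\<delta> Y) (\<omega> Y) (\<mu> Y) / reg_K \<epsilon> Y (\<delta> Y) (\<omega> Y) (\<mu> Y)"
  have D: "(\<delta> has_real_derivative \<delta> Y * L) (at Y)"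
     "(\<mu> has_real_derivative \<mu> Y * (2 * \<omega> Y / (1 - \<epsilon>) - eta \<epsilon> * L)) (at Y)"
     "(c has_real_derivative - (\<omega> Y * c Y) / (1 - \<epsilon>)) (at Y)"
    using assms(1) by (simp_all add: reg_ode_def Let_def L_def)
  have p: "((\<lambda>Y. \<delta> Y powr eta \<epsilon>) has_real_derivative \<delta> Y powr eta \<epsilon> * (0 * ln (\<delta> Y) + \<delta> Y * L * eta \<epsilon> / \<delta> Y)) (at Y)"
    by (rule DERIV_powr[OF D(1) assms(2) DERIV_const])
  have c2: "((\<lambda>Y. (c Y)^2) has_real_derivative 2 * c Y * (- (\<omega> Y * c Y) / (1 - \<epsilon>))) (at Y)"
    by (rule derivative_eq_intros D(3) refl | simp)+
  have "((\<lambda>Y. \<mu> Y * \<delta> Y powr eta \<epsilon> * (c Y)^2) has_real_derivative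
     (\<mu> Y * (2 * \<omega> Y / (1 - \<epsilon>) - eta \<epsilon> * L) * \<delta> Y powr eta \<epsilon>
       + \<delta> Y powr eta \<epsilon> * (0 * ln (\<delta> Y) + \<delta> Y * L * eta \<epsilon> / \<delta> Y) * \<mu> Y) * (c Y)^2
      + 2 * c Y * (- (\<omega> Y * c Y) / (1 - \<epsilon>)) * (\<mu> Y * \<delta> Y powr eta \<epsilon>)) (at Y)"
    by (rule DERIV_mult[OF DERIV_mult[OF D(2) p] c2])
  moreover have "(\<mu> Y * (2 * \<omega> Y / (1 - \<epsilon>) - eta \<epsilon> * L) * \<delta> Y powr eta \<epsilon>
       + \<delta> Y powr eta \<epsilon> * (0 * ln (\<delta> Y) + \<delta> Y * L * eta \<epsilon> / \<delta> Y) * \<mu> Y) * (c Y)^2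
      + 2 * c Y * (- (\<omega> Y * c Y) / (1 - \<epsilon>)) * (\<mu> Y * \<delta> Y powr eta \<epsilon>) = 0"
    using assms(2,3) by (simp add: divide_simps) algebra
  ultimately show ?thesis by (simp only:)
qed

lemma conserved_imp_eq:
  fixes \<mu> \<delta> c e :: real
  assumes "\<mu> * \<delta> powr e * c^2 = 1" "0 < \<delta>" "c \<noteq> 0"
  shows "\<mu> = \<delta> powr (- e) / c^2"
  using assms by (simp add: powr_minus field_simps)

text \<open>The initial value of the fourth coordinate is the one for which the invariant of
  \<open>reg_conserved\<close> starts at 1.\<close>

lemma solves_mu:
  assumes sol: "solves (ext_field \<epsilon>) (ext_dom \<epsilon>) (0, d2, w1, d2 powr (- eta \<epsilon>), 1) T x"
    and t: "0 \<le> t" "t < T" and \<epsilon>: "\<epsilon> < 1" and d2: "0 < d2"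
  shows "comp3 x (- t) = comp1 x (- t) powr (- eta \<epsilon>) / (comp4 x (- t))^2"
proof (rule conserved_imp_eq)
  define g where "g t = comp3 x (- t) * comp1 x (- t) powr eta \<epsilon> * (comp4 x (- t))^2" for t
  have g0: "g 0 = 1" using sol d2 by (simp add: solves_def g_def comp_defs powr_add[symmetric])
  have "g t = g 0"
  proof (cases "t = 0")
    case False
    show ?thesis
    proof (rule DERIV_isconst2[of 0 t])
      have cx: "continuous_on {0..t} x" using sol t unfolding solves_def by (auto intro: continuous_on_subset)
      have P: "0 < fst (snd (x u))" if "u \<in> {0..t}" for u
        using solves_props(1)[OF sol, of u] that t by (simp add: comp_defs)
      show "continuous_on {0..t} g" unfolding g_def comp_defs minus_minus
        by (intro continuous_intros cx) (use P in force)
      fix u assume u: "0 < u" "u < t"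
      have "reg_ode \<epsilon> (comp1 x) (comp2 x) (comp3 x) (comp4 x) (- u)"
        using u t by (intro solves_imp_reg[OF sol]) auto
      from DERIV_neg_arg[OF reg_conserved[OF this _ \<epsilon>]] solves_props(1)[OF sol, of u] u t
      show "DERIV g u :> 0" by (simp add: g_def[abs_def])
    qed (use False t in auto)
  qed simp
  with g0 show "comp3 x (- t) * comp1 x (- t) powr eta \<epsilon> * (comp4 x (- t))^2 = 1" by (simp add: g_def)
  show "0 < comp1 x (- t)" "comp4 x (- t) \<noteq> 0" using solves_props[OF sol t] by auto
qed

lemma ext_ode_cong:
  assumes "ext_ode \<epsilon> d w c Y" "eventually (\<lambda>y. d y = d' y) (nhds Y)" "eventually (\<lambda>y. w y = w' y) (nhds Y)"
    "eventually (\<lambda>y. c y = c' y) (nhds Y)"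
  shows "ext_ode \<epsilon> d' w' c' Y"
proof -
  have e: "d Y = d' Y" "w Y = w' Y" "c Y = c' Y" using assms(2-4) by (auto dest: eventually_nhds_x_imp_x)
  show ?thesis using assms(1) unfolding ext_ode_def e
    DERIV_cong_ev[OF refl assms(2) refl] DERIV_cong_ev[OF refl assms(3) refl] DERIV_cong_ev[OF refl assms(4) refl] .
qed

lemma has_fps_expansion_ev_cong:
  assumes "f has_fps_expansion F" "eventually (\<lambda>y. f y = g y) (nhds 0)"
  shows "g has_fps_expansion F"
  using assms unfolding has_fps_expansion_def by (auto elim: eventually_elim2)

section \<open>The maximal solution and its singular time\<close>

context
  fixes \<epsilon> q d2 w1 m0 :: real
  assumes \<epsilon>: "0 < \<epsilon>" "\<epsilon> \<le> 1/4" and q: "1 < q" "8 * \<epsilon> \<le> 1 - \<epsilon> - 1 / q^2"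
    and d2: "0 < d2" and m0: "m0 = d2 powr (- eta \<epsilon>)"
    and P0: "q < - w1 / sqrt m0" and M0: "1 + \<epsilon> * q^2 < (1 + 4 * \<epsilon>) * (d2 / m0)"
begin

lemma m0_pos: "0 < m0" using d2 by (simp add: m0)

lemma init_in_dom: "(0, d2, w1, m0, 1) \<in> ext_dom \<epsilon>"
proof -
  have "reg_K \<epsilon> 0 d2 w1 m0 = (1 + \<epsilon>)^2" by (simp add: reg_K_def)
  then have "0 < reg_K \<epsilon> 0 d2 w1 m0" using \<epsilon> by simp
  then show ?thesis using d2 m0_pos by (simp only: ext_dom_def mem_Collect_eq prod.case) simp
qed

text \<open>By uniqueness all solutions that reach a fixed time \<open>t\<close> of a reference
  solution have the same value there, and \<open>time_bound\<close> at \<open>t\<close> limits their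
  lifetimes by the same number.\<close>

lemma solves_time_bound:
  "\<exists>Tm. \<forall>T x. solves (ext_field \<epsilon>) (ext_dom \<epsilon>) (0, d2, w1, m0, 1) T x \<longrightarrow> T \<le> Tm"
proof (cases "\<exists>T0 z. 0 < T0 \<and> solves (ext_field \<epsilon>) (ext_dom \<epsilon>) (0, d2, w1, m0, 1) T0 z")
  case True
  then obtain T0 z where z: "0 < T0" "solves (ext_field \<epsilon>) (ext_dom \<epsilon>) (0, d2, w1, m0, 1) T0 z" by blast
  define t where "t = T0 / 2"
  have t: "0 < t" "t < T0" using z by (auto simp: t_def)
  define B where "B = sqrt t + sqrt t / (sqrt (comp3 z (- t) * t^2) * q)"
  have "T \<le> max t (B^2)" if sol: "solves (ext_field \<epsilon>) (ext_dom \<epsilon>) (0, d2, w1, m0, 1) T x" for T x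
  proof (cases "T \<le> t")
    case False
    then have TT: "0 < T" "t < T" using t by auto
    have eq: "x t = z t"
      using solves_unique[OF loc_lipschitz_ext_field sol z(2)] \<epsilon> t TT by simp
    interpret blowup \<epsilon> q T "- w1 / sqrt m0" "d2 / m0" "\<lambda>t. t^2 * comp1 x (- t)" "\<lambda>t. 1 - t * comp2 x (- t)" "\<lambda>t. comp3 x (- t) * t^2"
     "\<lambda>t. reg_K \<epsilon> (- t) (comp1 x (- t)) (comp2 x (- t)) (comp3 x (- t))" "\<lambda>t. (1 - t * comp2 x (- t) + \<epsilon>) / ((1 - \<epsilon>) * t)"
      by (rule solves_blowup[OF sol TT(1) \<epsilon> q m0_pos P0 M0])
    have "sqrt T \<le> B" using time_bound[OF t(1) TT(2)] by (simp add: B_def comp_defs eq)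
    then have "(sqrt T)^2 \<le> B^2" using TT by (intro power_mono) simp_all
    then have "T \<le> B^2" using TT by simp
    then show ?thesis by simp
  qed auto
  then show ?thesis by (intro exI[of _ "max t (B^2)"] allI impI)
next
  case False
  have "T \<le> 0" if "solves (ext_field \<epsilon>) (ext_dom \<epsilon>) (0, d2, w1, m0, 1) T x" for T x
  proof (rule ccontr)
    assume "\<not> T \<le> 0"
    then have "0 < T" by simp
    with that False show False by blast
  qed
  then show ?thesis by (intro exI[of _ 0] allI impI)
qed

text \<open>If \<open>v\<close> stayed bounded, \<open>w_le\<close> would bound \<open>w\<close>,
  hence \<open>d\<close>, and \<open>k_ge\<close> would keep the trajectory away from the zero set
  of \<open>reg_K\<close>: it would remain in a compact part of the domain up to its lifetime. So
  the monotone \<open>v\<close> tends to infinity and takes the other unknowns with it.\<close>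

lemma maximal_blowup:
  obtains T x where "0 < T" "solves (ext_field \<epsilon>) (ext_dom \<epsilon>) (0, d2, w1, m0, 1) T x"
    "filterlim (\<lambda>t. 1 - t * comp2 x (- t)) at_top (at_left T)"
    "filterlim (\<lambda>t. t^2 * comp1 x (- t)) at_top (at_left T)"
    "((\<lambda>t. comp4 x (- t)) \<longlongrightarrow> 0) (at_left T)"
proof -
  obtain Tm where Tm0: "\<forall>T x. solves (ext_field \<epsilon>) (ext_dom \<epsilon>) (0, d2, w1, m0, 1) T x \<longrightarrow> T \<le> Tm"
    using solves_time_bound by (elim exE) (rule that)
  note Tm = Tm0[rule_format]
  have lip: "loc_lipschitz (ext_field \<epsilon>) (ext_dom \<epsilon>)" using \<epsilon> by (intro loc_lipschitz_ext_field) simp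
  obtain T x where Tp: "0 < T" and sol: "solves (ext_field \<epsilon>) (ext_dom \<epsilon>) (0, d2, w1, m0, 1) T x"
    and leave: "\<And>C t0. compact C \<Longrightarrow> C \<subseteq> ext_dom \<epsilon> \<Longrightarrow> t0 < T \<Longrightarrow> \<exists>t\<in>{0..<T}. t0 < t \<and> x t \<notin> C"
  proof (rule maximal_solution[of "ext_field \<epsilon>" "ext_dom \<epsilon>" "(0, d2, w1, m0, 1)" Tm])
    show "loc_lipschitz (ext_field \<epsilon>) (ext_dom \<epsilon>)" by (rule lip)
    show "(0, d2, w1, m0, 1) \<in> ext_dom \<epsilon>" by (rule init_in_dom)
    show "T \<le> Tm" if "solves (ext_field \<epsilon>) (ext_dom \<epsilon>) (0, d2, w1, m0, 1) T x" for T x by (rule Tm[OF that])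
  qed (rule that)
  define d where "d t = t^2 * comp1 x (- t)" for t
  define w where "w t = 1 - t * comp2 x (- t)" for t
  define v where "v t = comp3 x (- t) * t^2" for t
  define k where "k t = reg_K \<epsilon> (- t) (comp1 x (- t)) (comp2 x (- t)) (comp3 x (- t))" for t
  interpret blowup \<epsilon> q T "- w1 / sqrt m0" "d2 / m0" d w v k "\<lambda>t. (w t + \<epsilon>) / ((1 - \<epsilon>) * t)"
    using solves_blowup[OF sol Tp \<epsilon> q m0_pos P0 M0]
    unfolding d_def[abs_def, symmetric] w_def[abs_def, symmetric] v_def[abs_def, symmetric] k_def[abs_def, symmetric] w_def[symmetric] .
  note props = solves_props[OF sol]
  have e0: "0 < eta \<epsilon>" using \<epsilon> by (simp add: eta_def)
  have mu: "comp3 x (- t) = comp1 x (- t) powr (- eta \<epsilon>) / (comp4 x (- t))^2" if "0 \<le> t" "t < T" for t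
    using solves_mu[OF sol[unfolded m0] that _ d2] \<epsilon> by simp
  have chi2: "(comp4 x (- t))^2 = comp1 x (- t) powr (- eta \<epsilon>) / comp3 x (- t)" if "0 \<le> t" "t < T" for t
    using mu[OF that] props[OF that] by (simp add: field_simps)
  \<comment> \<open>Bounds on the second half of the interval are enough, since every compact set is
    left at arbitrarily late times.\<close>
  define th where "th = T / 2"
  have th: "0 < th" "th < T" using T by (auto simp: th_def)
  have unb: "\<exists>t\<in>{th..<T}. V < v t" for V
  proof (rule ccontr)
    assume "\<not> (\<exists>t\<in>{th..<T}. V < v t)"
    then have vV: "v t \<le> V" if "th \<le> t" "t < T" for t using that by force
    define Wb where "Wb = w th * (V / v th)^3"
    have b: "0 < v th" "1 < w th" "0 < d th" using pos[OF th] w_gt_1[OF th] by auto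
    have V: "0 < V" using vV[of th] b th by simp
    have wW: "w t \<le> Wb" if "th \<le> t" "t < T" for t
    proof -
      have "w t \<le> w th * (v t / v th)^3" using w_le[of th t] that th by simp
      also have "\<dots> \<le> Wb" unfolding Wb_def using that th b vV[OF that] pos(2)[of t]
        by (intro mult_left_mono power_mono divide_right_mono) auto
      finally show ?thesis .
    qed
    define kc where "kc = 1 - \<epsilon> - 1 / q^2"
    have kc: "0 < kc" using q \<epsilon> by (simp add: kc_def)
    define D1 where "D1 = d th / T^2"
    define D2 where "D2 = Wb / th^2"
    define M1 where "M1 = v th / T^2"
    define M2 where "M2 = V / th^2"
    define C1 where "C1 = sqrt (D2 powr (- eta \<epsilon>) / M2)"
    define C2 where "C2 = sqrt (D1 powr (- eta \<epsilon>) / M1)"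
    define O1 where "O1 = (1 - Wb) / th"
    have Wb: "1 < Wb" using wW[of th] b th by simp
    have cpos: "0 < D1" "0 < D2" "0 < M1" "0 < M2" using b Wb V T th by (auto simp: D1_def D2_def M1_def M2_def)
    have C1: "0 < C1" using cpos by (simp add: C1_def)
    \<comment> \<open>The sides of the box come from monotonicity of \<open>d\<close> and
      \<open>v\<close>, from \<open>w \<le> Wb\<close>, and for the last coordinate from its
      expression through \<open>\<delta>\<close> and \<open>\<mu>\<close>; the intersection keeps
      \<open>reg_K\<close> above \<open>kc\<close>.\<close>
    define C where "C = ({-T..-th} \<times> {D1..D2} \<times> {O1..0} \<times> {M1..M2} \<times> {C1..C2})
      \<inter> {p. kc \<le> reg_K \<epsilon> (fst p) (fst (snd p)) (fst (snd (snd p))) (fst (snd (snd (snd p))))}"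
    have "compact C" unfolding C_def
      by (intro compact_Int_closed compact_Times compact_Icc closed_Collect_le continuous_intros)
    moreover have "C \<subseteq> ext_dom \<epsilon>" using cpos C1 kc by (auto simp: C_def ext_dom_def)
    ultimately obtain t where t: "t \<in> {0..<T}" "th < t" "x t \<notin> C" using leave[of C th] th by blast
    have t': "0 < t" "t < T" "th \<le> t" using t th by auto
    have tt: "th^2 \<le> t^2" "t^2 \<le> T^2" using t' th by (auto intro!: power_mono)
    have wt: "1 < w t" "w t \<le> Wb" "d t < w t" "d th \<le> d t" "v th \<le> v t" "v t \<le> V"
      using w_gt_1[OF t'(1,2)] wW[OF t'(3,2)] d_less_w[OF t'(1,2)] d_mono[of th t] v_mono[of th t] vV[OF t'(3,2)] t' th by auto
    have c1: "comp1 x (- t) = d t / t^2" "comp3 x (- t) = v t / t^2" "comp2 x (- t) = (1 - w t) / t"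
      using t' by (simp_all add: d_def v_def w_def)
    have i1: "D1 \<le> comp1 x (- t)" "comp1 x (- t) \<le> D2" "M1 \<le> comp3 x (- t)" "comp3 x (- t) \<le> M2"
      unfolding c1 D1_def D2_def M1_def M2_def using wt tt t' th b by (auto intro!: frac_le)
    have i2: "O1 \<le> comp2 x (- t)" "comp2 x (- t) \<le> 0"
    proof -
      have "(w t - 1) / t \<le> (Wb - 1) / th" using wt t' th by (intro frac_le) auto
      then show "O1 \<le> comp2 x (- t)" unfolding c1 O1_def by (simp add: diff_divide_distrib)
      show "comp2 x (- t) \<le> 0" unfolding c1 using wt t' by (simp add: divide_le_0_iff)
    qed
    have p4: "0 < comp4 x (- t)" "0 < comp3 x (- t)" "0 < comp1 x (- t)" using props t' by auto
    then have c4: "comp4 x (- t) = sqrt (comp1 x (- t) powr (- eta \<epsilon>) / comp3 x (- t))"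
      using chi2[of t] t' by (metis less_imp_le real_sqrt_unique)
    have i4: "C1 \<le> comp4 x (- t)" "comp4 x (- t) \<le> C2"
      unfolding c4 C1_def C2_def using i1 cpos p4 e0
      by (auto intro!: real_sqrt_le_mono frac_le powr_mono2')
    have ik: "kc \<le> k t"
    proof -
      have "kc * 1 \<le> kc * (w t)^2" using kc wt by (intro mult_left_mono one_le_power) auto
      with k_ge[OF t'(1,2)] show ?thesis by (simp add: kc_def)
    qed
    have "x t \<in> C" unfolding C_def
      using i1 i2 i4 ik t' th props(5)[of t] by (simp add: k_def)
    with t show False by simp
  qed
  have lv: "filterlim v at_top (at_left T)"
    unfolding filterlim_at_top
  proof
    fix Z
    obtain t where t: "t \<in> {th..<T}" "Z < v t" using unb by blast
    then have "t < T" by simp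
    show "eventually (\<lambda>t. Z \<le> v t) (at_left T)"
    proof (rule eventually_mono[OF eventually_at_left_real[OF \<open>t < T\<close>]])
      fix t' assume "t' \<in> {t<..<T}"
      then show "Z \<le> v t'" using v_mono[of t t'] t th by simp
    qed
  qed
  have lw: "filterlim (\<lambda>t. 1 - t * comp2 x (- t)) at_top (at_left T)"
    using v_unbounded_limits(1)[OF lv] unfolding w_def[abs_def] .
  have ld: "filterlim (\<lambda>t. t^2 * comp1 x (- t)) at_top (at_left T)"
    using v_unbounded_limits(2)[OF lv] unfolding d_def[abs_def] .
  have lc: "((\<lambda>t. comp4 x (- t)) \<longlongrightarrow> 0) (at_left T)"
  proof (rule tendsto_sandwich[OF _ _ tendsto_const])
    \<comment> \<open>\<open>chi\<^sup>2\<close> equals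
      \<open>(d / t\<^sup>2) powr (- eta \<epsilon>) * t\<^sup>2 / v\<close>, where the factor in
      front of \<open>1 / v\<close> is bounded because \<open>d\<close> increases.\<close>
    define K where "K = sqrt ((d th / T^2) powr (- eta \<epsilon>) * T^2)"
    have ev: "eventually (\<lambda>t. t \<in> {th<..<T}) (at_left T)" using th(2) by (rule eventually_at_left_real)
    show "eventually (\<lambda>t. 0 \<le> comp4 x (- t)) (at_left T)"
      using ev by eventually_elim (use props(3) th in \<open>auto intro: less_imp_le\<close>)
    show "eventually (\<lambda>t. comp4 x (- t) \<le> K / sqrt (v t)) (at_left T)"
      using ev
    proof eventually_elim
      case (elim t)
      then have t': "0 < t" "t < T" "th \<le> t" using th by auto
      have c1: "comp1 x (- t) = d t / t^2" "comp3 x (- t) = v t / t^2" using t' by (simp_all add: d_def v_def)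
      have tt: "t^2 \<le> T^2" using t' by (auto intro!: power_mono)
      have dd: "0 < d th" "0 < d t" "d th \<le> d t" "0 < v t" using pos[OF th] pos[OF t'(1,2)] d_mono[of th t] t' th by auto
      have "(comp4 x (- t))^2 = (d t / t^2) powr (- eta \<epsilon>) * t^2 / v t" using chi2[of t] t' by (simp add: c1)
      also have "\<dots> \<le> (d th / T^2) powr (- eta \<epsilon>) * T^2 / v t"
        using dd tt t' e0 T by (intro divide_right_mono mult_mono powr_mono2' frac_le) auto
      finally have "sqrt ((comp4 x (- t))^2) \<le> K / sqrt (v t)"
        unfolding K_def by (subst real_sqrt_divide[symmetric]) (rule real_sqrt_le_mono)
      then show ?case using props(3)[of t] t' by simp
    qed
    have "filterlim (\<lambda>t. sqrt (v t)) at_top (at_left T)" by (rule filterlim_compose[OF sqrt_at_top lv])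
    then show "((\<lambda>t. K / sqrt (v t)) \<longlongrightarrow> 0) (at_left T)"
      by (intro tendsto_divide_0[OF tendsto_const] filterlim_at_top_imp_at_infinity)
  qed
  show ?thesis by (rule that[OF Tp sol lw ld lc])
qed

end

lemma isCont_eventually_gt:
  fixes f :: "real \<Rightarrow> real"
  assumes "isCont f 0" "0 < f 0" shows "eventually (\<lambda>y. 0 < f y) (nhds 0)"
proof -
  have "(f \<longlongrightarrow> f 0) (nhds 0)" using assms(1) by (simp add: continuous_at tendsto_at_iff_tendsto_nhds isCont_def)
  then show ?thesis using assms(2) by (rule order_tendstoD)
qed

lemma isCont_neg_arg:
  fixes f :: "real \<Rightarrow> real"
  assumes "isCont f (- u)" shows "isCont (\<lambda>u. f (- u)) u"
  using isCont_o2[where f = uminus and g = f and a = u] assms by simp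

text \<open>The analytic germ supplies \<open>Y \<ge> 0\<close>, the maximal trajectory
  \<open>Y < 0\<close>, and uniqueness of the flow makes them coincide near 0. The same uniqueness
  treats an arbitrary competitor after it has been divided down to the regular variables.\<close>

theorem ext_problem_blowup:
  fixes \<epsilon> q d2 w1 :: real
  assumes \<epsilon>: "0 < \<epsilon>" "\<epsilon> \<le> 1/4" and q: "1 < q" "8 * \<epsilon> \<le> 1 - \<epsilon> - 1 / q^2"
    and d2: "0 < d2" and P0: "q < - w1 * d2 powr (eta \<epsilon> / 2)"
    and M0: "1 + \<epsilon> * q^2 < (1 + 4 * \<epsilon>) * d2 powr (1 + eta \<epsilon>)"
  shows "\<exists>Yms<0. \<exists>d w chi.
       ext_solution \<epsilon> d2 w1 Yms d w chi \<and>
       (\<forall>Y0<0. \<forall>d' w' chi'. ext_solution \<epsilon> d2 w1 Y0 d' w' chi' \<longrightarrow>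
          (\<forall>Y\<in>{max Yms Y0<..0}. d' Y = d Y \<and> w' Y = w Y \<and> chi' Y = chi Y)) \<and>
       filterlim w at_top (at_right Yms) \<and>
       filterlim d at_top (at_right Yms) \<and>
       (\<forall>Y\<in>{Yms<..0}. 0 < chi Y) \<and>
       (chi \<longlongrightarrow> 0) (at_right Yms)"
proof -
  define m0 where "m0 = d2 powr (- eta \<epsilon>)"
  have m0: "0 < m0" using d2 by (simp add: m0_def)
  have P0': "q < - w1 / sqrt m0"
  proof -
    have "sqrt m0 = d2 powr (- eta \<epsilon> / 2)" using d2 unfolding m0_def by (simp add: powr_half_sqrt[symmetric] powr_powr)
    then have "- w1 / sqrt m0 = - w1 * d2 powr (eta \<epsilon> / 2)" by (simp add: powr_minus field_simps)
    with P0 show ?thesis by simp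
  qed
  have M0': "1 + \<epsilon> * q^2 < (1 + 4 * \<epsilon>) * (d2 / m0)"
  proof -
    have "d2 / m0 = d2 powr (1 + eta \<epsilon>)" using d2 by (simp add: m0_def powr_add powr_minus field_simps)
    with M0 show ?thesis by simp
  qed
  have \<epsilon>1: "\<epsilon> < 1" using \<epsilon> by simp
  have lip: "loc_lipschitz (ext_field \<epsilon>) (ext_dom \<epsilon>)" by (rule loc_lipschitz_ext_field[OF \<epsilon>1])
  obtain T x where T: "0 < T" and sol: "solves (ext_field \<epsilon>) (ext_dom \<epsilon>) (0, d2, w1, m0, 1) T x"
    and lw: "filterlim (\<lambda>t. 1 - t * comp2 x (- t)) at_top (at_left T)"
    and ld: "filterlim (\<lambda>t. t^2 * comp1 x (- t)) at_top (at_left T)"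
    and lc: "((\<lambda>t. comp4 x (- t)) \<longlongrightarrow> 0) (at_left T)"
    by (rule maximal_blowup[OF \<epsilon> q d2 m0_def P0' M0']) (rule that)
  note props = solves_props[OF sol]
  have x0: "x 0 = (0, d2, w1, m0, 1)" and xdom: "\<And>t. t \<in> {0..<T} \<Longrightarrow> x t \<in> ext_dom \<epsilon>"
    and xcont: "continuous_on {0..<T} x"
    and xder: "\<And>t. t \<in> {0<..<T} \<Longrightarrow> (x has_vector_derivative ext_field \<epsilon> (x t)) (at t)"
    using sol by (auto simp: solves_def)
  have mu: "comp3 x (- t) = comp1 x (- t) powr (- eta \<epsilon>) / (comp4 x (- t))^2" if "0 \<le> t" "t < T" for t
    by (rule solves_mu[OF sol[unfolded m0_def] that \<epsilon>1 d2])
  obtain \<delta> \<omega> \<mu> c :: "real \<Rightarrow> real" and r F1 F2 F4 where r: "0 < r"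
    and fps: "\<delta> has_fps_expansion F1" "\<omega> has_fps_expansion F2" "c has_fps_expansion F4"
    and init: "\<delta> 0 = d2" "\<omega> 0 = w1" "\<mu> 0 = m0" "c 0 = 1"
    and reg: "\<And>Y. \<bar>Y\<bar> < r \<Longrightarrow> reg_ode \<epsilon> \<delta> \<omega> \<mu> c Y"
    by (rule reg_analytic_solution[OF \<epsilon>(1) \<epsilon>1, of d2 w1 m0]) (rule that)
  have regD: "isCont \<delta> Y" "isCont \<omega> Y" "isCont \<mu> Y" "isCont c Y" if "\<bar>Y\<bar> < r" for Y
    using reg[OF that] by (auto simp: reg_ode_def Let_def intro: DERIV_isCont)
  have "eventually (\<lambda>Y. 0 < \<delta> Y) (nhds 0)" "eventually (\<lambda>Y. 0 < \<mu> Y) (nhds 0)" "eventually (\<lambda>Y. 0 < c Y) (nhds 0)"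
    using regD[of 0] r init d2 m0 by (auto intro!: isCont_eventually_gt)
  moreover have "eventually (\<lambda>Y. 0 < reg_K \<epsilon> Y (\<delta> Y) (\<omega> Y) (\<mu> Y)) (nhds 0)"
  proof (rule isCont_eventually_gt)
    show "isCont (\<lambda>Y. reg_K \<epsilon> Y (\<delta> Y) (\<omega> Y) (\<mu> Y)) 0"
      unfolding reg_K_def using r by (intro continuous_intros regD) auto
    have "reg_K \<epsilon> 0 (\<delta> 0) (\<omega> 0) (\<mu> 0) = (1 + \<epsilon>)^2" by (simp add: reg_K_def)
    then show "0 < reg_K \<epsilon> 0 (\<delta> 0) (\<omega> 0) (\<mu> 0)" using \<epsilon> by simp
  qed
  ultimately have "eventually (\<lambda>Y. 0 < \<delta> Y \<and> 0 < \<mu> Y \<and> 0 < c Y \<and> 0 < reg_K \<epsilon> Y (\<delta> Y) (\<omega> Y) (\<mu> Y)) (nhds 0)"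
    by eventually_elim simp
  then obtain s where s: "0 < s" and spos': "\<And>Y. dist Y 0 < s \<Longrightarrow> 0 < \<delta> Y \<and> 0 < \<mu> Y \<and> 0 < c Y \<and> 0 < reg_K \<epsilon> Y (\<delta> Y) (\<omega> Y) (\<mu> Y)"
    unfolding eventually_nhds_metric by blast
  define b where "b = min (min r s) T"
  have b: "0 < b" "b \<le> r" "b \<le> s" "b \<le> T" using r s T by (auto simp: b_def)
  have spos: "0 < \<delta> Y" "0 < \<mu> Y" "0 < c Y" "0 < reg_K \<epsilon> Y (\<delta> Y) (\<omega> Y) (\<mu> Y)" if "\<bar>Y\<bar> < b" for Y
    using spos'[of Y] that b by auto
  have amu: "\<mu> Y = \<delta> Y powr (- eta \<epsilon>) / (c Y)^2" if Y: "\<bar>Y\<bar> < b" for Y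
  proof (rule conserved_imp_eq)
    define g where "g Y = \<mu> Y * \<delta> Y powr eta \<epsilon> * (c Y)^2" for Y
    have "\<exists>k. \<forall>Y\<in>{-b<..<b}. g Y = k"
    proof (rule has_field_derivative_zero_constant)
      fix Y assume "Y \<in> {-b<..<b}"
      then have Y: "\<bar>Y\<bar> < b" by auto
      have "(g has_real_derivative 0) (at Y)" unfolding g_def
        by (rule reg_conserved[OF reg spos(1)[OF Y] \<epsilon>1]) (use Y b in simp)
      then show "(g has_real_derivative 0) (at Y within {-b<..<b})" by (rule has_field_derivative_at_within)
    qed simp
    then obtain k where k: "\<And>Y. Y \<in> {-b<..<b} \<Longrightarrow> g Y = k" by blast
    have "Y \<in> {-b<..<b}" "0 \<in> {-b<..<b}" using Y b by (auto simp: abs_less_iff)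
    then have "g Y = g 0" using k by simp
    also have "g 0 = 1" using d2 by (simp add: g_def init m0_def powr_add[symmetric])
    finally show "\<mu> Y * \<delta> Y powr eta \<epsilon> * (c Y)^2 = 1" by (simp add: g_def)
  qed (use spos[OF Y] in auto)
  have xa: "x t = (- t, \<delta> (- t), \<omega> (- t), \<mu> (- t), c (- t))" if "t \<in> {0..<b}" for t
  proof (rule ode_unique[OF lip _ _ _ _ _ _ that, of x "\<lambda>t. (- t, \<delta> (- t), \<omega> (- t), \<mu> (- t), c (- t))"])
    show "continuous_on {0..<b} x" by (rule continuous_on_subset[OF xcont]) (use b in auto)
    have "continuous (at t) (\<lambda>t. (- t, \<delta> (- t), \<omega> (- t), \<mu> (- t), c (- t)))" if "t \<in> {0..<b}" for t
      by (rule has_vector_derivative_continuous[OF reg_ode_imp_vector[OF reg]]) (use that b in auto)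
    then show "continuous_on {0..<b} (\<lambda>t. (- t, \<delta> (- t), \<omega> (- t), \<mu> (- t), c (- t)))"
      by (intro continuous_at_imp_continuous_on ballI)
    show "x 0 = (- 0, \<delta> (- 0), \<omega> (- 0), \<mu> (- 0), c (- 0))" by (simp add: x0 init)
    show "x t \<in> ext_dom \<epsilon>" if "t \<in> {0..<b}" for t using xdom[of t] that b by auto
    show "(x has_vector_derivative ext_field \<epsilon> (x t)) (at t)" if "t \<in> {0<..<b}" for t using xder[of t] that b by auto
    show "((\<lambda>t. (- t, \<delta> (- t), \<omega> (- t), \<mu> (- t), c (- t))) has_vector_derivative
       ext_field \<epsilon> (- t, \<delta> (- t), \<omega> (- t), \<mu> (- t), c (- t))) (at t)" if "t \<in> {0<..<b}" for t
      by (rule reg_ode_imp_vector[OF reg]) (use that b in auto)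
  qed
  \<comment> \<open>The trajectory describes only \<open>Y \<le> 0\<close>, the germ only a
    neighbourhood of 0; where both apply they agree, so analyticity at 0 is inherited from the
    germ.\<close>
  define dF where "dF Y = (if Y < 0 then Y^2 * comp1 x Y else Y^2 * \<delta> Y)" for Y
  define wF where "wF Y = (if Y < 0 then 1 + Y * comp2 x Y else 1 + Y * \<omega> Y)" for Y
  define cF where "cF Y = (if Y < 0 then comp4 x Y else c Y)" for Y
  have Fa: "dF Y = Y^2 * \<delta> Y" "wF Y = 1 + Y * \<omega> Y" "cF Y = c Y" if "\<bar>Y\<bar> < b" for Y
    using xa[of "- Y"] that by (auto simp: dF_def wF_def cF_def comp_defs)
  have evb: "eventually (\<lambda>y. \<bar>y\<bar> < b) (nhds Y)" if "\<bar>Y\<bar> < b" for Y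
  proof -
    have "eventually (\<lambda>y. y \<in> {-b<..<b}) (nhds Y)" by (rule eventually_nhds_in_open) (use that in auto)
    then show ?thesis by eventually_elim auto
  qed
  have Fev: "eventually (\<lambda>y. y^2 * \<delta> y = dF y) (nhds Y)" "eventually (\<lambda>y. 1 + y * \<omega> y = wF y) (nhds Y)"
    "eventually (\<lambda>y. c y = cF y) (nhds Y)" if "\<bar>Y\<bar> < b" for Y
    by (rule eventually_mono[OF evb[OF that]], simp add: Fa)+
  have Fneg: "eventually (\<lambda>y. y^2 * comp1 x y = dF y) (nhds Y)" "eventually (\<lambda>y. 1 + y * comp2 x y = wF y) (nhds Y)"
    "eventually (\<lambda>y. comp4 x y = cF y) (nhds Y)" if "Y < 0" for Y
    by (rule eventually_mono[OF eventually_nhds_in_open[of "{..<0}"]]; use that in \<open>simp add: dF_def wF_def cF_def\<close>)+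
  have b0: "\<bar>0::real\<bar> < b" using b by simp
  have S: "ext_solution \<epsilon> d2 w1 (- T) dF wF cF"
    unfolding ext_solution_def
  proof (intro conjI ballI)
    show "\<exists>F. dF has_fps_expansion F"
      by (intro exI[of _ "fps_X^2 * F1"] has_fps_expansion_ev_cong[OF _ Fev(1)[OF b0]] fps_expansion_intros fps)
    show "\<exists>F. wF has_fps_expansion F"
      by (intro exI[of _ "1 + fps_X * F2"] has_fps_expansion_ev_cong[OF _ Fev(2)[OF b0]] fps_expansion_intros fps)
    show "\<exists>F. cF has_fps_expansion F"
      by (intro exI[of _ F4] has_fps_expansion_ev_cong[OF _ Fev(3)[OF b0]] fps)
    have "(\<delta> \<longlongrightarrow> d2) (at 0)" using regD(1)[of 0] r init by (simp add: isCont_def)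
    moreover have "eventually (\<lambda>Y. \<delta> Y = dF Y / Y^2) (at 0)"
      using Fev(1)[OF b0] unfolding eventually_at_filter
      by eventually_elim (simp add: eq_divide_eq mult.commute)
    ultimately show "((\<lambda>Y. dF Y / Y^2) \<longlongrightarrow> d2) (at 0)" by (rule Lim_transform_eventually)
    show "wF 0 = 1" "cF 0 = 1" using Fa[OF b0] init by auto
    obtain D where D: "(\<omega> has_real_derivative D) (at 0)" using reg[of 0] r by (auto simp: reg_ode_def Let_def)
    have "((\<lambda>y. 1 + y * \<omega> y) has_real_derivative w1) (at 0)"
      by (rule derivative_eq_intros D refl | simp add: init)+
    then show "(wF has_real_derivative w1) (at 0)"
      by (subst (asm) DERIV_cong_ev[OF refl Fev(2)[OF b0] refl])
    show "eventually (ext_ode \<epsilon> dF wF cF) (at 0)"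
    proof -
      have "ext_ode \<epsilon> dF wF cF Y" if Y: "\<bar>Y\<bar> < b" "Y \<noteq> 0" for Y
        by (rule ext_ode_cong[OF reg_imp_ext_ode[OF \<epsilon>(1) \<epsilon>1 Y(2) reg amu[OF Y(1)] spos(1)[OF Y(1)] spos(3)[OF Y(1)] spos(4)[OF Y(1)]] Fev[OF Y(1)]])
          (use Y b in auto)
      then show ?thesis using evb[OF b0] unfolding eventually_at_filter by (auto elim: eventually_mono)
    qed
    fix Y assume Y: "Y \<in> {-T<..<0}"
    then have t: "0 \<le> - Y" "- Y < T" "0 < - Y" "Y < 0" "Y \<noteq> 0" by auto
    have "reg_ode \<epsilon> (comp1 x) (comp2 x) (comp3 x) (comp4 x) Y"
      using solves_imp_reg[OF sol t(3,2)] by simp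
    then have "ext_ode \<epsilon> (\<lambda>Y. Y^2 * comp1 x Y) (\<lambda>Y. 1 + Y * comp2 x Y) (comp4 x) Y"
      using props[OF t(1,2)] mu[OF t(1,2)] by (intro reg_imp_ext_ode[OF \<epsilon>(1) \<epsilon>1 t(5), where \<mu> = "comp3 x"]) simp_all
    then show "ext_ode \<epsilon> dF wF cF Y" by (rule ext_ode_cong[OF _ Fneg[OF t(4)]])
  qed
  have uniq: "d' Y = dF Y \<and> w' Y = wF Y \<and> c' Y = cF Y"
    if Y0: "Y0 < 0" and S': "ext_solution \<epsilon> d2 w1 Y0 d' w' c'" and Y: "Y \<in> {max (- T) Y0<..0}" for Y0 d' w' c' Y
  proof -
    have ode': "ext_ode \<epsilon> d' w' c' Y" if "Y0 < Y" "Y < 0" for Y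
      using S' that by (simp add: ext_solution_def)
    have lim': "((\<lambda>Y. d' Y / Y^2) \<longlongrightarrow> d2) (at 0)" "w' 0 = 1" "(w' has_real_derivative w1) (at 0)" "c' 0 = 1"
      using S' by (simp_all add: ext_solution_def)
    obtain G1 G4 where G: "d' has_fps_expansion G1" "c' has_fps_expansion G4" using S' by (auto simp: ext_solution_def)
    have cc: "isCont c' 0" and dc: "isCont d' 0" using G by (auto intro: has_fps_expansion_imp_continuous)
    define \<delta>' where "\<delta>' Y = (if Y = 0 then d2 else d' Y / Y^2)" for Y
    define \<omega>' where "\<omega>' Y = (if Y = 0 then w1 else (w' Y - 1) / Y)" for Y
    define \<mu>' where "\<mu>' Y = \<delta>' Y powr (- eta \<epsilon>) / (c' Y)^2" for Y
    have "((\<lambda>Y. d' Y / Y^2) \<longlongrightarrow> \<delta>' 0) (at 0) = (\<delta>' \<longlongrightarrow> \<delta>' 0) (at 0)"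
      by (rule filterlim_cong) (auto simp: \<delta>'_def eventually_at_filter)
    then have id: "isCont \<delta>' 0" using lim'(1) by (simp add: isCont_def \<delta>'_def)
    have "((\<lambda>Y. (w' Y - w' 0) / (Y - 0)) \<longlongrightarrow> w1) (at 0)" using lim'(3) by (simp add: has_field_derivative_iff)
    moreover have "((\<lambda>Y. (w' Y - w' 0) / (Y - 0)) \<longlongrightarrow> w1) (at 0) = (\<omega>' \<longlongrightarrow> w1) (at 0)"
      by (rule filterlim_cong) (auto simp: \<omega>'_def eventually_at_filter lim'(2))
    ultimately have iw: "isCont \<omega>' 0" by (simp add: isCont_def \<omega>'_def)
    have "((\<lambda>Y. \<delta>' Y powr (- eta \<epsilon>) / (c' Y)^2) \<longlongrightarrow> \<delta>' 0 powr (- eta \<epsilon>) / (c' 0)^2) (at 0)"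
    proof -
      have "\<delta>' 0 \<noteq> 0" using d2 by (simp add: \<delta>'_def)
      then show ?thesis using id cc lim'(4) unfolding isCont_def by (intro tendsto_intros) simp_all
    qed
    then have im: "isCont \<mu>' 0" by (simp add: isCont_def \<mu>'_def[abs_def])
    define y where "y t = (- t, \<delta>' (- t), \<omega>' (- t), \<mu>' (- t), c' (- t))" for t
    define B where "B = min T (- Y0)"
    have B: "0 < B" "B \<le> T" "B \<le> - Y0" using T Y0 by (auto simp: B_def)
    have y0: "y 0 = x 0" by (simp add: y_def x0 \<delta>'_def \<omega>'_def \<mu>'_def lim'(4) m0_def)
    have yder: "(y has_vector_derivative ext_field \<epsilon> (y t)) (at t)" if t: "0 < t" "t < B" and p: "0 < c' (- t)" for t
    proof -
      have n: "- t \<noteq> 0" using t by simp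
      have "reg_ode \<epsilon> \<delta>' \<omega>' \<mu>' c' (- t)"
        by (rule ext_ode_imp_reg[OF \<epsilon>(1) \<epsilon>1 n ode' p \<delta>'_def \<omega>'_def \<mu>'_def]) (use t B in auto)
      from reg_ode_imp_vector[OF this] show ?thesis unfolding y_def .
    qed
    have y0c: "isCont y 0"
    proof -
      have m: "isCont (\<lambda>t. f (- t)) 0" if "isCont f 0" for f :: "real \<Rightarrow> real"
        by (rule isCont_neg_arg) (simp add: that)
      show ?thesis unfolding y_def by (intro continuous_Pair m id iw im cc continuous_minus continuous_ident)
    qed
    have agr: "x t = y t" if cB: "0 < k" "k \<le> B" and p: "\<And>t. 0 \<le> t \<Longrightarrow> t < k \<Longrightarrow> 0 < c' (- t)" and t: "t \<in> {0..<k}" for k t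
    proof (rule ode_unique[OF lip _ _ _ _ _ _ t, of x y])
      show "continuous_on {0..<k} x" by (rule continuous_on_subset[OF xcont]) (use cB B in auto)
      show "continuous_on {0..<k} y"
      proof (intro continuous_at_imp_continuous_on ballI)
        fix t assume "t \<in> {0..<k}"
        then show "isCont y t"
          using y0c has_vector_derivative_continuous[OF yder[of t]] p[of t] cB by (cases "t = 0") auto
      qed
      show "x 0 = y 0" by (simp add: y0)
      show "x t \<in> ext_dom \<epsilon>" if "t \<in> {0..<k}" for t using xdom[of t] that cB B by auto
      show "(x has_vector_derivative ext_field \<epsilon> (x t)) (at t)" if "t \<in> {0<..<k}" for t using xder[of t] that cB B by auto
      show "(y has_vector_derivative ext_field \<epsilon> (y t)) (at t)" if "t \<in> {0<..<k}" for t using yder[of t] p[of t] that cB by auto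
    qed
    \<comment> \<open>Positivity of \<open>chi\<close> is not part of \<open>ext_solution\<close>.
      Up to the first zero of its \<open>chi\<close> the competitor agrees with the trajectory,
      whose \<open>chi\<close> is positive there as well, so no zero occurs.\<close>
    have cpos: "0 < c' (- t)" if t: "0 \<le> t" "t < B" for t
    proof (rule ccontr)
      assume neg: "\<not> 0 < c' (- t)"
      define N where "N = {u. 0 \<le> u \<and> u \<le> t \<and> c' (- u) \<le> 0}"
      have tN: "t \<in> N" using neg t by (simp add: N_def)
      have ccont: "continuous_on {0..t} (\<lambda>u. c' (- u))"
      proof (intro continuous_at_imp_continuous_on ballI)
        fix u assume u: "u \<in> {0..t}"
        have "isCont c' (- u)"
        proof (cases "u = 0")
          case False
          then have "ext_ode \<epsilon> d' w' c' (- u)" using u t B by (intro ode') auto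
          then show ?thesis unfolding ext_ode_def by (blast intro: DERIV_isCont)
        qed (use cc in simp)
        then show "isCont (\<lambda>u. c' (- u)) u" by (rule isCont_neg_arg)
      qed
      have "closed N"
      proof -
        have "N = {0..t} \<inter> (\<lambda>u. c' (- u)) -` {..0}" by (auto simp: N_def)
        then show ?thesis using continuous_closed_preimage[OF ccont] by simp
      qed
      have bdd: "bdd_below N" unfolding N_def by (rule bdd_belowI[of _ 0]) simp
      define k where "k = Inf N"
      have kN: "k \<in> N" unfolding k_def by (rule closed_contains_Inf) (use tN bdd \<open>closed N\<close> in auto)
      have before: "0 < c' (- u)" if "0 \<le> u" "u < k" for u
      proof (rule ccontr)
        assume "\<not> 0 < c' (- u)"
        then have "u \<in> N" using that kN by (auto simp: N_def)
        then have "k \<le> u" unfolding k_def by (rule cInf_lower[OF _ bdd])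
        with that show False by simp
      qed
      have "k \<noteq> 0"
      proof
        assume "k = 0"
        with kN lim'(4) show False by (simp add: N_def)
      qed
      with kN have k: "0 < k" "k \<le> t" "c' (- k) \<le> 0" by (auto simp: N_def)
      have kB: "k \<le> B" "k < T" using k t B by auto
      have eq: "c' (- u) = comp4 x (- u)" if "u \<in> {0..<k}" for u
        using agr[OF k(1) kB(1) before that] by (simp add: y_def comp_defs)
      have cl: "((\<lambda>u. c' (- u)) \<longlongrightarrow> c' (- k)) (at_left k)"
      proof -
        have "ext_ode \<epsilon> d' w' c' (- k)" using k t B by (intro ode') auto
        then have "isCont c' (- k)" unfolding ext_ode_def by (blast intro: DERIV_isCont)
        then have "isCont (\<lambda>u. c' (- u)) k" by (rule isCont_neg_arg)
        then show ?thesis unfolding isCont_def by (simp add: filterlim_at_split)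
      qed
      have xl: "((\<lambda>u. comp4 x (- u)) \<longlongrightarrow> comp4 x (- k)) (at_left k)"
      proof -
        have "isCont x k" using has_vector_derivative_continuous[OF xder[of k]] k kB by simp
        then have "isCont (\<lambda>u. comp4 x (- u)) k" unfolding comp_defs minus_minus by (intro continuous_intros)
        then show ?thesis unfolding isCont_def by (simp add: filterlim_at_split)
      qed
      have "((\<lambda>u. c' (- u)) \<longlongrightarrow> comp4 x (- k)) (at_left k)"
        by (rule Lim_transform_eventually[OF xl eventually_mono[OF eventually_at_left_real[OF k(1)]]]) (simp add: eq)
      then have "c' (- k) = comp4 x (- k)" using cl by (intro tendsto_unique[of "at_left k"]) auto
      with k(3) props(3)[of k] k kB show False by simp
    qed
    define t where "t = - Y"
    have t: "t \<in> {0..<B}" using Y by (auto simp: t_def B_def)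
    have eq: "x t = y t" by (rule agr[OF B(1) order_refl cpos t])
    show ?thesis
    proof (cases "Y = 0")
      case True
      \<comment> \<open>The value \<open>d' 0\<close> is not prescribed directly; continuity and the
        limit of \<open>d' Y / Y\<^sup>2\<close> force it to be 0.\<close>
      have "((\<lambda>Y. d' Y / Y^2 * Y^2) \<longlongrightarrow> d2 * 0^2) (at 0)" by (intro tendsto_intros lim')
      moreover have "((\<lambda>Y. d' Y / Y^2 * Y^2) \<longlongrightarrow> d2 * 0^2) (at 0) = (d' \<longlongrightarrow> d2 * 0^2) (at 0)"
        by (rule filterlim_cong) (auto simp: eventually_at_filter)
      ultimately have "(d' \<longlongrightarrow> 0) (at 0)" by simp
      moreover have "(d' \<longlongrightarrow> d' 0) (at 0)" using dc by (simp add: isCont_def)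
      ultimately have "d' 0 = 0" by (intro tendsto_unique[of "at (0::real)"]) auto
      then show ?thesis using True lim' Fa[OF b0] init by simp
    next
      case False
      then have "Y < 0" using Y by auto
      then show ?thesis
        using eq by (auto simp: dF_def wF_def cF_def comp_defs y_def t_def \<delta>'_def \<omega>'_def)
    qed
  qed
  have mirror: "filterlim f F (at_right (- T))" if "filterlim (\<lambda>t. f (- t)) F (at_left T)" for f :: "real \<Rightarrow> real" and F
    using that by (simp add: filterlim_at_left_to_right)
  have evT: "eventually (\<lambda>t. t \<in> {0<..<T}) (at_left T)" using T by (rule eventually_at_left_real)
  have W: "filterlim wF at_top (at_right (- T))"
  proof (rule mirror)
    show "filterlim (\<lambda>t. wF (- t)) at_top (at_left T)"
      using lw by (rule filterlim_cong[OF refl refl, THEN iffD1, rotated])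
        (rule eventually_mono[OF evT], simp add: wF_def)
  qed
  have D: "filterlim dF at_top (at_right (- T))"
  proof (rule mirror)
    show "filterlim (\<lambda>t. dF (- t)) at_top (at_left T)"
      using ld by (rule filterlim_cong[OF refl refl, THEN iffD1, rotated])
        (rule eventually_mono[OF evT], simp add: dF_def)
  qed
  have C: "(cF \<longlongrightarrow> 0) (at_right (- T))"
  proof (rule mirror)
    show "((\<lambda>t. cF (- t)) \<longlongrightarrow> 0) (at_left T)"
      using lc by (rule filterlim_cong[OF refl refl, THEN iffD1, rotated])
        (rule eventually_mono[OF evT], simp add: cF_def)
  qed
  have cp: "0 < cF Y" if "Y \<in> {-T<..0}" for Y
    using props(3)[of "- Y"] that init by (auto simp: cF_def)
  show ?thesis
    by (intro exI[of _ "- T"] conjI exI[of _ dF] exI[of _ wF] exI[of _ cF] allI impI ballI S W D C cp)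
      (use T uniq in auto)
qed

section \<open>The flow beyond the sonic point\<close>

text \<open>Instantiated with \<open>v = D\<^sup>-\<^sup>\<eta> / x\<^sup>2\<close> and \<open>K = - ss_B / x\<^sup>2\<close>.\<close>

locale outer_flow =
  fixes \<epsilon> x0 \<omega> Q0 M0 :: real and D W v K :: "real \<Rightarrow> real"
  assumes \<epsilon>: "0 < \<epsilon>" "\<epsilon> \<le> 1/10" and x0: "0 < x0"
    and K: "\<And>x. K x = (W x + \<epsilon>)^2 - \<epsilon> * (W x - 1)^2 + 4 * \<epsilon> * D x * W x - v x"
    and pos: "\<And>x. x0 < x \<Longrightarrow> 0 < D x" "\<And>x. x0 < x \<Longrightarrow> 0 < v x" "\<And>x. x0 < x \<Longrightarrow> 0 < K x"
    and dD: "\<And>x. x0 < x \<Longrightarrow> (D has_real_derivative - (2 * (1 - \<epsilon>) * D x * (W x + \<epsilon>) * ((W x - D x) / K x)) / x) (at x)"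
    and dW: "\<And>x. x0 < x \<Longrightarrow> (W has_real_derivative (1 - 3 * W x + 2 * (1 + \<epsilon>) * W x * (W x + \<epsilon>) * ((W x - D x) / K x)) / x) (at x)"
    and dv: "\<And>x. x0 < x \<Longrightarrow> (v has_real_derivative v x * (4 * \<epsilon> * (W x + \<epsilon>) * ((W x - D x) / K x) - 2) / x) (at x)"
    and start: "eventually (\<lambda>x. 0 < D x * ((1 + 4 * \<epsilon>) * (W x)^2 + 2 * \<epsilon> * W x + \<epsilon>^2) - W x * (v x + \<epsilon> * (1 - W x)^2)) (at_right x0)"
    and lim: "((\<lambda>x. (1 - W x) / sqrt (v x)) \<longlongrightarrow> Q0) (at_right x0)" "((\<lambda>x. W x * D x / v x) \<longlongrightarrow> M0) (at_right x0)"
      "(W \<longlongrightarrow> \<omega>) (at_right x0)"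
    and Q0: "0 < Q0" and \<omega>: "0 < \<omega>" and M0: "0 < M0"
begin

definition N where "N x = D x * ((1 + 4 * \<epsilon>) * (W x)^2 + 2 * \<epsilon> * W x + \<epsilon>^2) - W x * (v x + \<epsilon> * (1 - W x)^2)"

lemma N_eq: "N x = W x * K x - (W x + \<epsilon>)^2 * (W x - D x)"
  unfolding N_def K by algebra

text \<open>Where \<open>W\<close> vanishes, its derivative is \<open>1 / x\<close>.\<close>

lemma W_pos: assumes "x0 < x" shows "0 < W x"
proof (rule first_zero_barrier[of x0 "x + 1" W "\<lambda>x. (1 - 3 * W x + 2 * (1 + \<epsilon>) * W x * (W x + \<epsilon>) * ((W x - D x) / K x)) / x"])
  show "eventually (\<lambda>x. 0 < W x) (at_right x0)" using lim(3) \<omega> by (rule order_tendstoD)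
  fix c assume "x0 < c" "W c = 0"
  then show "0 < (1 - 3 * W c + 2 * (1 + \<epsilon>) * W c * (W c + \<epsilon>) * ((W c - D c) / K c)) / c" using x0 by simp
qed (use assms dW in auto)

lemma has_derivative_Q:
  assumes x: "x0 < x"
  shows "((\<lambda>x. (1 - W x) / sqrt (v x)) has_real_derivative 2 * N x / (K x * sqrt (v x) * x)) (at x)"
proof -
  define y where "y = sqrt (v x)"
  define l where "l = (W x - D x) / K x"
  have y: "0 < y" "v x = y^2" "0 < x" "0 < K x" using pos[OF x] x x0 by (auto simp: y_def)
  have lK: "W x - D x = l * K x" using y by (simp add: l_def)
  have "((\<lambda>x. (1 - W x) / sqrt (v x)) has_real_derivative
     ((0 - (1 - 3 * W x + 2 * (1 + \<epsilon>) * W x * (W x + \<epsilon>) * l) / x) * sqrt (v x)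
      - (1 - W x) * (inverse (sqrt (v x)) / 2 * (v x * (4 * \<epsilon> * (W x + \<epsilon>) * l - 2) / x))) / (sqrt (v x) * sqrt (v x))) (at x)"
    using pos[OF x] unfolding l_def
    by (intro DERIV_divide DERIV_diff DERIV_const dW[OF x] DERIV_chain2[OF DERIV_real_sqrt dv[OF x]]) auto
  also have "((0 - (1 - 3 * W x + 2 * (1 + \<epsilon>) * W x * (W x + \<epsilon>) * l) / x) * sqrt (v x)
      - (1 - W x) * (inverse (sqrt (v x)) / 2 * (v x * (4 * \<epsilon> * (W x + \<epsilon>) * l - 2) / x))) / (sqrt (v x) * sqrt (v x))
    = (2 * W x - 2 * (W x + \<epsilon>)^2 * l) / (y * x)"
    unfolding y_def[symmetric] unfolding y(2) using y by (simp add: field_simps power2_eq_square)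
  also have "\<dots> = 2 * N x / (K x * y * x)"
    unfolding N_eq lK using y by (simp add: field_simps)
  finally show ?thesis by (simp add: y_def)
qed

lemma has_derivative_M:
  assumes x: "x0 < x"
  shows "((\<lambda>x. W x * D x / v x) has_real_derivative D x / v x * (1 - W x) / x) (at x)"
proof -
  define l where "l = (W x - D x) / K x"
  have y: "0 < v x" "0 < x" using pos[OF x] x x0 by auto
  have "((\<lambda>x. W x * D x / v x) has_real_derivative
     (((1 - 3 * W x + 2 * (1 + \<epsilon>) * W x * (W x + \<epsilon>) * l) / x * D x + - (2 * (1 - \<epsilon>) * D x * (W x + \<epsilon>) * l) / x * W x) * v x
       - W x * D x * (v x * (4 * \<epsilon> * (W x + \<epsilon>) * l - 2) / x)) / (v x * v x)) (at x)"
    using pos[OF x] unfolding l_def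
    by (intro DERIV_divide DERIV_mult dW[OF x] dD[OF x] dv[OF x]) auto
  also have "(((1 - 3 * W x + 2 * (1 + \<epsilon>) * W x * (W x + \<epsilon>) * l) / x * D x + - (2 * (1 - \<epsilon>) * D x * (W x + \<epsilon>) * l) / x * W x) * v x
       - W x * D x * (v x * (4 * \<epsilon> * (W x + \<epsilon>) * l - 2) / x)) / (v x * v x) = D x / v x * (1 - W x) / x"
    using y by (simp add: divide_simps) algebra
  finally show ?thesis .
qed

text \<open>At a first zero \<open>c\<close> the ratio \<open>Q\<close> has only increased, so
  \<open>W < 1\<close>. The equation \<open>N = 0\<close> expresses \<open>(W - D) / K\<close> as
  \<open>W / (W + \<epsilon>)\<^sup>2\<close> and eliminates \<open>v\<close>; with these the
  derivative becomes \<open>D (1 - W) ((1 + 4 \<epsilon>) W\<^sup>2 + 4 \<epsilon>\<^sup>2 W -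
  \<epsilon>\<^sup>2)\<close> up to a positive factor, which is positive once
  \<open>W > \<epsilon>\<close>.\<close>

lemma N_pos: assumes "x0 < x" shows "0 < N x"
proof -
  define l where "l x = (W x - D x) / K x" for x
  define WW where "WW x = 1 - 3 * W x + 2 * (1 + \<epsilon>) * W x * (W x + \<epsilon>) * l x" for x
  define DD where "DD x = - (2 * (1 - \<epsilon>) * D x * (W x + \<epsilon>) * l x)" for x
  define VV where "VV x = v x * (4 * \<epsilon> * (W x + \<epsilon>) * l x - 2)" for x
  define N' where "N' x = (DD x * ((1 + 4 * \<epsilon>) * (W x)^2 + 2 * \<epsilon> * W x + \<epsilon>^2) + D x * (2 * (1 + 4 * \<epsilon>) * W x * WW x + 2 * \<epsilon> * WW x)
      - WW x * (v x + \<epsilon> * (1 - W x)^2) - W x * (VV x - 2 * \<epsilon> * (1 - W x) * WW x)) / x" for x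
  show ?thesis
  proof (rule first_zero_barrier[of x0 "x + 1" N N'])
    fix u assume u: "x0 < u" "u < x + 1"
    note d = dD[OF u(1), folded l_def, folded DD_def] dW[OF u(1), folded l_def, folded WW_def] dv[OF u(1), folded l_def, folded VV_def]
    show "(N has_real_derivative N' u) (at u)"
      unfolding N_def[abs_def] N'_def using u x0
      by (auto intro!: derivative_eq_intros d simp: field_simps)
  next
    show "eventually (\<lambda>x. 0 < N x) (at_right x0)" unfolding N_def by (rule start)
    show "x0 < x" "x < x + 1" using assms by auto
  next
    fix c assume c: "x0 < c" "N c = 0" and before: "\<And>t. x0 < t \<Longrightarrow> t < c \<Longrightarrow> 0 < N t"
    have pc: "0 < D c" "0 < v c" "0 < K c" "0 < W c" "0 < c" using pos W_pos c x0 by auto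
    have "Q0 \<le> (1 - W t) / sqrt (v t)" if t: "x0 < t" "t < c" for t
    proof (rule DERIV_ge0_limit_le[OF has_derivative_Q _ lim(1), of c])
      fix u assume u: "x0 < u" "u < c"
      have "0 < K u" "0 < v u" "0 < u" using pos u x0 by auto
      then show "0 \<le> 2 * N u / (K u * sqrt (v u) * u)" using before[OF u] by simp
    qed (use t in auto)
    moreover have "isCont (\<lambda>x. (1 - W x) / sqrt (v x)) c" by (rule DERIV_isCont[OF has_derivative_Q[OF c(1)]])
    then have "((\<lambda>x. (1 - W x) / sqrt (v x)) \<longlongrightarrow> (1 - W c) / sqrt (v c)) (at_left c)"
      unfolding isCont_def by (simp add: filterlim_at_split)
    ultimately have "Q0 \<le> (1 - W c) / sqrt (v c)"
      by (intro tendsto_lowerbound[of _ _ "at_left c" Q0]) (auto intro!: eventually_mono[OF eventually_at_left_real[OF c(1)]])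
    with Q0 have "0 < (1 - W c) / sqrt (v c)" by simp
    then have p: "0 < 1 - W c" using pc by (simp add: zero_less_divide_iff)
    define a where "a = W c + \<epsilon>"
    have a: "0 < a" using pc \<epsilon> by (simp add: a_def)
    have WD: "a^2 * (W c - D c) = W c * K c" using c(2) unfolding N_eq a_def by simp
    have "0 < a^2 * (W c - D c)" unfolding WD using pc by simp
    then have DW: "D c < W c" by (simp add: zero_less_mult_iff)
    have lc: "l c = W c / a^2" using WD a pc by (simp add: l_def field_simps)
    \<comment> \<open>For \<open>W c \<le> \<epsilon>\<close> the term
      \<open>- \<epsilon> (W - 1)\<^sup>2\<close> outweighs the positive terms of \<open>K\<close>,
      which are of order \<open>\<epsilon>\<^sup>2\<close> or smaller; this is where
      \<open>\<epsilon> \<le> 1/10\<close> enters.\<close>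
    have We: "\<epsilon> < W c"
    proof (rule ccontr)
      assume "\<not> \<epsilon> < W c"
      then have le: "W c \<le> \<epsilon>" by simp
      have "(W c + \<epsilon>)^2 \<le> (2 * \<epsilon>)^2" using le pc \<epsilon> by (intro power_mono) auto
      moreover have "4 * \<epsilon> * D c * W c \<le> 4 * \<epsilon> * \<epsilon> * \<epsilon>" using le DW pc \<epsilon> by (intro mult_mono) auto
      moreover have "\<epsilon> * (9/10)^2 \<le> \<epsilon> * (W c - 1)^2"
      proof -
        have "(9/10)^2 \<le> (1 - W c)^2" using le \<epsilon> by (intro power_mono) auto
        then show ?thesis using \<epsilon> by (intro mult_left_mono) (auto simp: power2_commute)
      qed
      ultimately have "K c \<le> (2 * \<epsilon>)^2 - \<epsilon> * (9/10)^2 + 4 * \<epsilon> * \<epsilon> * \<epsilon> - v c" unfolding K by linarith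
      also have "\<dots> \<le> \<epsilon> * (4 * \<epsilon> + 4 * \<epsilon> * \<epsilon> - (9/10)^2)" using pc by (simp add: power2_eq_square algebra_simps)
      also have "\<dots> \<le> 0"
      proof -
        have "\<epsilon> * \<epsilon> \<le> (1/10) * (1/10)" using \<epsilon> by (intro mult_mono) auto
        then have "4 * \<epsilon> + 4 * (\<epsilon> * \<epsilon>) - (9/10)^2 \<le> 0" using \<epsilon> by (simp add: power2_eq_square)
        then show ?thesis using \<epsilon> by (intro mult_nonneg_nonpos) auto
      qed
      finally show False using pc by simp
    qed
    \<comment> \<open>With \<open>l = W / a\<^sup>2\<close> at the zero, multiplication by
      \<open>a = W + \<epsilon>\<close> clears the denominators of all three derivatives.\<close>
    have WWc: "a * WW c = (1 - W c) * (a - 2 * \<epsilon> * W c)"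
      unfolding WW_def lc a_def[symmetric] using a unfolding power2_eq_square
      by (simp add: field_simps) (simp add: a_def algebra_simps)
    have DDc: "a * DD c = - (2 * (1 - \<epsilon>) * D c * W c)"
      unfolding DD_def lc a_def[symmetric] using a by (simp add: power2_eq_square)
    have VVc: "a * VV c = v c * (4 * \<epsilon> * W c - 2 * a)"
      unfolding VV_def lc a_def[symmetric] using a by (simp add: power2_eq_square field_simps)
    have vW: "W c * v c = D c * ((1 + 4 * \<epsilon>) * (W c)^2 + 2 * \<epsilon> * W c + \<epsilon>^2) - W c * (\<epsilon> * (1 - W c)^2)"
      using c(2) unfolding N_def by (simp add: algebra_simps)
    have "a * W c * (N' c * c) = W c * ((a * DD c) * ((1 + 4 * \<epsilon>) * (W c)^2 + 2 * \<epsilon> * W c + \<epsilon>^2) + D c * (2 * (1 + 4 * \<epsilon>) * W c * (a * WW c) + 2 * \<epsilon> * (a * WW c))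
      - (a * WW c) * (v c + \<epsilon> * (1 - W c)^2) - W c * (a * VV c - 2 * \<epsilon> * (1 - W c) * (a * WW c)))"
    proof -
      define R where "R = DD c * ((1 + 4 * \<epsilon>) * (W c)^2 + 2 * \<epsilon> * W c + \<epsilon>^2) + D c * (2 * (1 + 4 * \<epsilon>) * W c * WW c + 2 * \<epsilon> * WW c)
        - WW c * (v c + \<epsilon> * (1 - W c)^2) - W c * (VV c - 2 * \<epsilon> * (1 - W c) * WW c)"
      have "N' c * c = R" using pc by (simp add: N'_def R_def)
      then show ?thesis unfolding R_def by algebra
    qed
    also have "\<dots> = W c * (- (2 * (1 - \<epsilon>) * D c * W c) * ((1 + 4 * \<epsilon>) * (W c)^2 + 2 * \<epsilon> * W c + \<epsilon>^2) + D c * (2 * (1 + 4 * \<epsilon>) * W c * ((1 - W c) * (a - 2 * \<epsilon> * W c)) + 2 * \<epsilon> * ((1 - W c) * (a - 2 * \<epsilon> * W c)))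
      - W c * (- 2 * \<epsilon> * (1 - W c) * ((1 - W c) * (a - 2 * \<epsilon> * W c))))
      - (1 - W c) * (a - 2 * \<epsilon> * W c) * (W c * v c + W c * \<epsilon> * (1 - W c)^2) - W c * (W c * v c) * (4 * \<epsilon> * W c - 2 * a)"
      unfolding WWc DDc VVc by algebra
    also have "\<dots> = a * D c * (1 - W c) * ((1 + 4 * \<epsilon>) * (W c)^2 + 4 * \<epsilon>^2 * W c - \<epsilon>^2)"
      unfolding vW a_def by algebra
    finally have "a * W c * (N' c * c) = a * D c * (1 - W c) * ((1 + 4 * \<epsilon>) * (W c)^2 + 4 * \<epsilon>^2 * W c - \<epsilon>^2)" .
    moreover have Xp: "0 < (1 + 4 * \<epsilon>) * (W c)^2 + 4 * \<epsilon>^2 * W c - \<epsilon>^2"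
    proof -
      have "\<epsilon>^2 < (W c)^2" using We \<epsilon> by (intro power_strict_mono) auto
      moreover have "0 \<le> 4 * \<epsilon> * (W c)^2" "0 \<le> 4 * \<epsilon>^2 * W c" using \<epsilon> pc by auto
      ultimately show ?thesis by (simp add: algebra_simps)
    qed
    moreover have "0 < a * D c * (1 - W c) * ((1 + 4 * \<epsilon>) * (W c)^2 + 4 * \<epsilon>^2 * W c - \<epsilon>^2)"
      by (intro mult_pos_pos a p pc Xp)
    ultimately have "0 < a * W c * (N' c * c)" by (simp only:)
    moreover have "0 < a * W c" by (intro mult_pos_pos a pc)
    ultimately have "0 < N' c * c" by (rule zero_less_mult_pos)
    then show "0 < N' c" using pc(5) by (rule zero_less_mult_pos2)
  qed
qed

lemma Q_ge: assumes "x0 < x" shows "Q0 \<le> (1 - W x) / sqrt (v x)"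
proof (rule DERIV_ge0_limit_le[OF has_derivative_Q _ lim(1), of "x + 1"])
  fix u assume u: "x0 < u"
  have "0 < K u" "0 < v u" "0 < u" using pos u x0 by auto
  then show "0 \<le> 2 * N u / (K u * sqrt (v u) * u)" using N_pos[OF u] by simp
qed (use assms in auto)

lemma W_less_1: assumes "x0 < x" shows "W x < 1"
proof -
  have "0 < (1 - W x) / sqrt (v x)" using Q_ge[OF assms] Q0 by simp
  then show ?thesis using pos(2)[OF assms] by (simp add: zero_less_divide_iff)
qed

text \<open>The derivative of \<open>x (1 - W)\<close> is
  \<open>2 W - 2 (1 + \<epsilon>) W (W + \<epsilon>) l\<close> with \<open>l = (W - D) / K\<close>.
  It is nonnegative for \<open>l \<le> 0\<close>; for \<open>l > 0\<close> it equals
  \<open>2 N / K + 2 \<epsilon> (1 - W) (W + \<epsilon>) l\<close>, a sum of nonnegative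
  terms.\<close>

lemma V_ge: assumes "x0 < x" shows "x0 * (1 - \<omega>) \<le> x * (1 - W x)"
proof (rule DERIV_ge0_limit_le[of x0 "x + 1" "\<lambda>x. x * (1 - W x)"
      "\<lambda>x. (1 - W x) - (1 - 3 * W x + 2 * (1 + \<epsilon>) * W x * (W x + \<epsilon>) * ((W x - D x) / K x))"])
  fix u assume u: "x0 < u" "u < x + 1"
  show "((\<lambda>x. x * (1 - W x)) has_real_derivative (1 - W u) - (1 - 3 * W u + 2 * (1 + \<epsilon>) * W u * (W u + \<epsilon>) * ((W u - D u) / K u))) (at u)"
    using u x0 by (auto intro!: derivative_eq_intros dW[OF u(1)] simp: field_simps)
  have p: "0 < K u" "0 < W u" "W u < 1" using pos W_pos W_less_1 u by auto
  define l where "l = (W u - D u) / K u"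
  have lK: "W u - D u = l * K u" using p by (simp add: l_def)
  have e: "(1 - W u) - (1 - 3 * W u + 2 * (1 + \<epsilon>) * W u * (W u + \<epsilon>) * l) = 2 * W u - 2 * (1 + \<epsilon>) * W u * (W u + \<epsilon>) * l" by simp
  show "0 \<le> (1 - W u) - (1 - 3 * W u + 2 * (1 + \<epsilon>) * W u * (W u + \<epsilon>) * ((W u - D u) / K u))"
  proof (cases "l \<le> 0")
    case True
    then have "2 * (1 + \<epsilon>) * W u * (W u + \<epsilon>) * l \<le> 0" using p \<epsilon> by (intro mult_nonneg_nonpos) auto
    then show ?thesis using p e unfolding l_def by linarith
  next
    case False
    have "0 < K u * (W u - (W u + \<epsilon>)^2 * l)"
      using N_pos[OF u(1)] unfolding N_eq lK by (simp add: algebra_simps)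
    then have "0 < W u - (W u + \<epsilon>)^2 * l" using p by (simp add: zero_less_mult_iff)
    moreover have "0 \<le> 2 * \<epsilon> * (1 - W u) * (W u + \<epsilon>) * l" using p \<epsilon> False by simp
    ultimately have "0 \<le> 2 * (W u - (W u + \<epsilon>)^2 * l) + 2 * \<epsilon> * (1 - W u) * (W u + \<epsilon>) * l" by (intro add_nonneg_nonneg) simp_all
    also have "\<dots> = 2 * W u - 2 * (1 + \<epsilon>) * W u * (W u + \<epsilon>) * l" by algebra
    finally have "0 \<le> 2 * W u - 2 * (1 + \<epsilon>) * W u * (W u + \<epsilon>) * l" .
    then show ?thesis unfolding l_def[symmetric] e .
  qed
next
  show "((\<lambda>x. x * (1 - W x)) \<longlongrightarrow> x0 * (1 - \<omega>)) (at_right x0)" by (intro tendsto_intros lim)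
qed (use assms in auto)

text \<open>The logarithmic derivative of \<open>W D / v\<close> is
  \<open>(1 - W) / (W x) \<ge> (1 - W) / x\<close>, and \<open>V_ge\<close> bounds this below by
  \<open>x0 (1 - \<omega>) / x\<^sup>2\<close>. The integral from \<open>x0\<close> to infinity
  supplies the factor \<open>exp (1 - \<omega>)\<close> that lifts the ratio above 1.\<close>

lemma M_ge: assumes "x0 < x" shows "ln M0 + (1 - \<omega>) * (1 - x0 / x) \<le> ln (W x * D x / v x)"
proof -
  have "ln M0 + x0 * (1 - \<omega>) / x0 \<le> ln (W x * D x / v x) + x0 * (1 - \<omega>) / x"
  proof (rule DERIV_ge0_limit_le[of x0 "x + 1" "\<lambda>x. ln (W x * D x / v x) + x0 * (1 - \<omega>) / x"
      "\<lambda>x. (1 - W x) / (W x * x) - x0 * (1 - \<omega>) / x^2"])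
    fix u assume u: "x0 < u" "u < x + 1"
    have p: "0 < D u" "0 < v u" "0 < W u" "W u < 1" "0 < u" using pos W_pos W_less_1 u x0 by auto
    then have M: "0 < W u * D u / v u" by simp
    have "((\<lambda>x. ln (W x * D x / v x) + x0 * (1 - \<omega>) / x) has_real_derivative
       1 / (W u * D u / v u) * (D u / v u * (1 - W u) / u) + (0 * u - x0 * (1 - \<omega>) * 1) / (u * u)) (at u)"
      by (rule DERIV_add[OF DERIV_chain2[OF DERIV_ln_divide[OF M] has_derivative_M[OF u(1)]] DERIV_divide[OF DERIV_const DERIV_ident]]) (use p in simp)
    also have "1 / (W u * D u / v u) * (D u / v u * (1 - W u) / u) + (0 * u - x0 * (1 - \<omega>) * 1) / (u * u)
       = (1 - W u) / (W u * u) - x0 * (1 - \<omega>) / u^2"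
      using p by (simp add: field_simps power2_eq_square)
    finally show "((\<lambda>x. ln (W x * D x / v x) + x0 * (1 - \<omega>) / x) has_real_derivative (1 - W u) / (W u * u) - x0 * (1 - \<omega>) / u^2) (at u)" .
    have "x0 * (1 - \<omega>) / u^2 \<le> u * (1 - W u) / u^2" using V_ge[OF u(1)] by (intro divide_right_mono) auto
    also have "\<dots> = (1 - W u) / u" using p by (simp add: power2_eq_square)
    also have "\<dots> \<le> (1 - W u) / (W u * u)" using p by (intro divide_left_mono) auto
    finally show "0 \<le> (1 - W u) / (W u * u) - x0 * (1 - \<omega>) / u^2" by simp
  next
    show "((\<lambda>x. ln (W x * D x / v x) + x0 * (1 - \<omega>) / x) \<longlongrightarrow> ln M0 + x0 * (1 - \<omega>) / x0) (at_right x0)"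
      by (intro tendsto_intros lim) (use M0 x0 in auto)
  qed (use assms in auto)
  moreover have "x0 * (1 - \<omega>) / x0 = 1 - \<omega>" using x0 by simp
  moreover have "(1 - \<omega>) * (1 - x0 / x) = 1 - \<omega> - x0 * (1 - \<omega>) / x" by (simp add: algebra_simps diff_divide_distrib)
  ultimately show ?thesis by linarith
qed

lemma limits_at_infinity:
  assumes "((\<lambda>x. (1 - W x) / sqrt (v x)) \<longlongrightarrow> Q) at_top" "((\<lambda>x. W x * D x / v x) \<longlongrightarrow> M) at_top" "0 < M"
  shows "Q0 \<le> Q" "M0 * exp (1 - \<omega>) \<le> M"
proof -
  show "Q0 \<le> Q"
    by (rule tendsto_lowerbound[OF assms(1)]) (auto intro!: eventually_mono[OF eventually_gt_at_top[of x0]] Q_ge)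
  have "((\<lambda>x. x0 / x) \<longlongrightarrow> 0) at_top" by (intro tendsto_divide_0[OF tendsto_const] filterlim_at_top_imp_at_infinity filterlim_ident)
  then have "((\<lambda>x. ln M0 + (1 - \<omega>) * (1 - x0 / x)) \<longlongrightarrow> ln M0 + (1 - \<omega>) * (1 - 0)) at_top" by (intro tendsto_intros)
  note low = this
  have "((\<lambda>x. ln (W x * D x / v x)) \<longlongrightarrow> ln M) at_top" using assms(2,3) by (intro tendsto_intros) auto
  from tendsto_le[OF trivial_limit_at_top_linorder this low]
  have "ln M0 + (1 - \<omega>) * (1 - 0) \<le> ln M"
    by (auto intro!: eventually_mono[OF eventually_gt_at_top[of x0]] M_ge)
  then have "exp (ln M0 + (1 - \<omega>)) \<le> exp (ln M)" by simp
  then show "M0 * exp (1 - \<omega>) \<le> M" using M0 assms(3) by (simp add: exp_add)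
qed

end

section \<open>Taylor series at the sonic point\<close>

lemma fps_mean_const [simp]: "fps_mean (fps_const c) = fps_const c"
  by (rule fps_ext) simp

lemma fps_mean_add: "fps_mean (F + G) = fps_mean F + fps_mean G"
  and fps_mean_cmult: "fps_mean (fps_const c * F) = fps_const c * fps_mean F"
  by (rule fps_ext, simp add: add_divide_distrib)+

text \<open>\<open>Z\<close> stands for \<open>F\<close> divided by \<open>1 + X\<close>. The
  constant part and the part linear in the algebraic unknown, \<open>A\<close>, are separated from a
  remainder in which \<open>X Z\<close> counts as a term of weight 2.\<close>

lemma isolate_X_term:
  fixes Z F X A B C :: "'a::comm_ring_1"
  assumes "Z = F - X * Z"
  shows "F = A - B \<Longrightarrow> Z = A + (- B - X * Z)"
    "F = A - B + C \<Longrightarrow> Z = A + (- B + C - X * Z)"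
    "F = A + B + C \<Longrightarrow> Z = A + (B + C - X * Z)"
  using assms by (simp_all add: algebra_simps)

lemma regroup_difference:
  fixes a b c d e f :: "'a::comm_ring_1"
  shows "a + b + c - (d + e + f) = (a - d) + (b - e) + (c - f)"
  by simp

lemma regroup_sonic_source:
  fixes bL b0 y L cK Y E cW cD p q :: "'a::comm_ring_1"
  shows "bL + b0 * y + L * cK * Y + cK * (y * Y) + L * E + E * y - (bL + (cW * Y - cD * Y) + (p - q))
    = b0 * y + (L * cK - cW + cD) * Y - (p - q - L * E - cK * (y * Y) - E * y)"
  by (simp add: algebra_simps)

text \<open>The unknown \<open>l\<close> stands for \<open>(W - D) / K\<close>, a quotient of two series that both vanish at the sonic point. Its
  coefficient of order \<open>n\<close> is multiplied by \<open>b0 + (l0 * cK - 4 * a) / (n + 1)\<close>.\<close>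

lemma sonic_series:
  fixes \<epsilon> \<omega> l0 v0 m :: real
  defines "a \<equiv> \<omega> * (\<omega> + \<epsilon>)"
  defines "W1 \<equiv> 1 - 3 * \<omega> + 2 * (1 + \<epsilon>) * a * l0" and "R1 \<equiv> - 2 * (1 - \<epsilon>) * a * l0"
    and "V1 \<equiv> v0 * (4 * \<epsilon> * (\<omega> + \<epsilon>) * l0 - 2)"
  defines "kW \<equiv> 2 * (1 - \<epsilon>) * \<omega> + 4 * \<epsilon> + 4 * \<epsilon> * \<omega>" and "kD \<equiv> 4 * \<epsilon> * \<omega>"
  defines "cK \<equiv> kW * (2 * (1 + \<epsilon>) * a) - kD * (2 * (1 - \<epsilon>) * a) - 4 * \<epsilon> * v0 * (\<omega> + \<epsilon>)"
  defines "b0 \<equiv> kW * W1 + kD * R1 - V1"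
  assumes v0: "(\<omega> + \<epsilon>)^2 - \<epsilon> * (\<omega> - 1)^2 + 4 * \<epsilon> * \<omega> * \<omega> = v0"
    and first: "b0 * l0 = W1 - R1"
    and nonres: "0 < m" "\<And>n. n \<ge> 1 \<Longrightarrow> m \<le> \<bar>b0 + (l0 * cK - 4 * a) / (real n + 1)\<bar>"
  obtains D W v l :: "real fps" where
    "fps_conv_radius D > 0" "fps_conv_radius W > 0" "fps_conv_radius v > 0" "fps_conv_radius l > 0"
    "fps_nth D 0 = \<omega>" "fps_nth W 0 = \<omega>" "fps_nth v 0 = v0" "fps_nth l 0 = l0"
    "(1 + fps_X) * fps_deriv D = - (fps_const (2 * (1 - \<epsilon>)) * D * (W + fps_const \<epsilon>) * l)"
    "(1 + fps_X) * fps_deriv W = 1 - 3 * W + fps_const (2 * (1 + \<epsilon>)) * W * (W + fps_const \<epsilon>) * l"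
    "(1 + fps_X) * fps_deriv v = v * (fps_const (4 * \<epsilon>) * (W + fps_const \<epsilon>) * l - 2)"
    "l * ((W + fps_const \<epsilon>)^2 - fps_const \<epsilon> * (W - 1)^2 + fps_const (4 * \<epsilon>) * D * W - v) = W - D"
proof -
  define e where "e = fps_const \<epsilon>"
  define o' where "o' = fps_const \<omega>"
  define L where "L = fps_const l0"
  define P where "P = inverse (fps_const 1 + (fps_X :: real fps))"
  have P: "P = 1 - fps_X * P"
  proof -
    have "(fps_const 1 + fps_X) * P = 1" unfolding P_def by (rule inverse_mult_eq_1') simp
    then show ?thesis by (simp add: algebra_simps)
  qed
  define Dy where "Dy y = o' + y 1" for y :: "nat \<Rightarrow> real fps"
  define Wy where "Wy y = o' + y 2" for y :: "nat \<Rightarrow> real fps"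
  define vy where "vy y = fps_const v0 + y 3" for y :: "nat \<Rightarrow> real fps"
  define ly where "ly y = L + y 0" for y :: "nat \<Rightarrow> real fps"
  define FD where "FD y = - (2 * (1 - e) * Dy y * (Wy y + e) * ly y)" for y
  define FW where "FW y = 1 - 3 * Wy y + 2 * (1 + e) * Wy y * (Wy y + e) * ly y" for y
  define Fv where "Fv y = vy y * (4 * e * (Wy y + e) * ly y - 2)" for y
  \<comment> \<open>\<open>eD\<close>, \<open>eW\<close> and \<open>ev\<close> are what is left of
    the three derivatives once the constant term and the term linear in \<open>y 0\<close> are split
    off; all have weight 2.\<close>
  define eD where "eD y = - (2 * (1 - e) * ((y 1 * (Wy y + e) + o' * y 2) * ly y)) - fps_X * (P * FD y)" for y
  define eW where "eW y = - (3 * y 2) + 2 * (1 + e) * (y 2 * ((Wy y + o' + e) * ly y)) - fps_X * (P * FW y)" for y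
  define ev where "ev y = y 3 * (4 * e * (Wy y + e) * ly y - 2) + 4 * e * fps_const v0 * (y 2 * ly y) - fps_X * (P * Fv y)" for y
  have gD: "P * FD y = fps_const R1 + fps_const (- 2 * (1 - \<epsilon>) * a) * y 0 + eD y" for y
  proof -
    have "P * FD y = FD y - fps_X * (P * FD y)" by (subst P) (simp add: algebra_simps)
    moreover have "FD y = fps_const R1 + fps_const (- 2 * (1 - \<epsilon>) * a) * y 0 - (2 * (1 - e) * ((y 1 * (Wy y + e) + o' * y 2) * ly y))"
    proof -
      have c: "fps_const R1 = - (2 * (1 - e) * (o' * (o' + e)) * L)" "fps_const (- 2 * (1 - \<epsilon>) * a) = - (2 * (1 - e) * (o' * (o' + e)))"
        unfolding R1_def a_def e_def o'_def L_def by (simp_all add: numeral_fps_const) (simp_all add: algebra_simps)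
      show ?thesis unfolding c FD_def Dy_def Wy_def ly_def by (simp add: algebra_simps)
    qed
    ultimately show ?thesis unfolding eD_def by (rule isolate_X_term(1))
  qed
  have gW: "P * FW y = fps_const W1 + fps_const (2 * (1 + \<epsilon>) * a) * y 0 + eW y" for y
  proof -
    have "P * FW y = FW y - fps_X * (P * FW y)" by (subst P) (simp add: algebra_simps)
    moreover have "FW y = fps_const W1 + fps_const (2 * (1 + \<epsilon>) * a) * y 0 - (3 * y 2) + 2 * (1 + e) * (y 2 * ((Wy y + o' + e) * ly y))"
    proof -
      have "fps_const W1 = 1 - 3 * o' + 2 * (1 + e) * (o' * (o' + e)) * L" "fps_const (2 * (1 + \<epsilon>) * a) = 2 * (1 + e) * (o' * (o' + e))"
        unfolding W1_def a_def e_def o'_def L_def by (simp_all add: numeral_fps_const)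
      then show ?thesis unfolding FW_def Wy_def ly_def by (simp add: algebra_simps)
    qed
    ultimately show ?thesis unfolding eW_def by (rule isolate_X_term(2))
  qed
  have gv: "P * Fv y = fps_const V1 + fps_const (4 * \<epsilon> * v0 * (\<omega> + \<epsilon>)) * y 0 + ev y" for y
  proof -
    have "P * Fv y = Fv y - fps_X * (P * Fv y)" by (subst P) (simp add: algebra_simps)
    moreover have "Fv y = fps_const V1 + fps_const (4 * \<epsilon> * v0 * (\<omega> + \<epsilon>)) * y 0
        + y 3 * (4 * e * (Wy y + e) * ly y - 2) + 4 * e * fps_const v0 * (y 2 * ly y)"
    proof -
      have "fps_const V1 = fps_const v0 * (4 * e * (o' + e) * L - 2)" "fps_const (4 * \<epsilon> * v0 * (\<omega> + \<epsilon>)) = 4 * e * fps_const v0 * (o' + e)"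
        unfolding V1_def e_def o'_def L_def by (simp_all add: numeral_fps_const)
      then show ?thesis unfolding Fv_def vy_def Wy_def ly_def by (simp add: algebra_simps)
    qed
    ultimately show ?thesis unfolding ev_def by (rule isolate_X_term(3))
  qed
  \<comment> \<open>Remainder in \<open>K / fps_X = b0 + cK * fps_mean (y 0) + E\<close>. Then
    \<open>Q\<close> collects what has weight 2 in the cancelled equation for \<open>l\<close>, and
    \<open>\<tau>\<close> what multiplies the coefficient of order \<open>n\<close> of
    \<open>y 0\<close>; the division by \<open>n + 1\<close> comes from
    \<open>fps_mean\<close>.\<close>
  define E where "E y = fps_const kW * fps_mean (eW y) + fps_const kD * fps_mean (eD y) - fps_mean (ev y)
    + y 2 * (fps_const (1 - \<epsilon>) * fps_mean (P * FW y)) + y 1 * (fps_const (4 * \<epsilon>) * fps_mean (P * FW y))" for y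
  define Q where "Q y = fps_mean (eW y) - fps_mean (eD y) - L * E y - fps_const cK * (y 0 * fps_mean (y 0)) - E y * y 0" for y
  define \<tau> where "\<tau> n = b0 + (l0 * cK - 4 * a) / (real n + 1)" for n
  have nc: "nice 0 (\<lambda>y. e)" "nice 0 (\<lambda>y. o')" "nice 0 (\<lambda>y. L)" unfolding e_def o'_def L_def by (rule nice_const)+
  have nP: "nice 0 (\<lambda>y. P)" unfolding P_def by (rule nice_inverse) (use nice_mono[OF nice_X, of 1] in simp_all)
  have nY: "nice 0 Dy" "nice 0 Wy" "nice 0 vy" "nice 0 ly"
    unfolding Dy_def[abs_def] Wy_def[abs_def] vy_def[abs_def] ly_def[abs_def] by (intro nice0_intros nc)+
  have nF: "nice 0 FD" "nice 0 FW" "nice 0 Fv"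
    unfolding FD_def[abs_def] FW_def[abs_def] Fv_def[abs_def] by (intro nice0_intros nc nY)+
  have v1: "nice 2 (\<lambda>y. y 1)" "nice 2 (\<lambda>y. y 2)" "nice 2 (\<lambda>y. y 3)" by (rule nice_var, simp)+
  have left: "nice 2 (\<lambda>y. F y * G y)" if "nice 0 F" "nice 2 G" for F G
    using nice_mult[OF that] by (simp add: numeral_2_eq_2)
  have neD: "nice 2 eD" unfolding eD_def[abs_def]
    by (intro nice_diff nice_minus left nice_add nice_mult_left v1 nice_X nice0_intros nc nY nF nP)
  have neW: "nice 2 eW" unfolding eW_def[abs_def]
    by (intro nice_diff nice_minus left nice_add nice_mult_left v1 nice_X nice0_intros nc nY nF nP)
  have nev: "nice 2 ev" unfolding ev_def[abs_def]
    by (intro nice_diff nice_minus left nice_add nice_mult_left v1 nice_X nice0_intros nc nY nF nP)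
  have nPF: "nice 0 (\<lambda>y. P * FD y)" "nice 0 (\<lambda>y. P * FW y)" "nice 0 (\<lambda>y. P * Fv y)" by (intro nice0_intros nF nP)+
  have nE: "nice 2 E" unfolding E_def[abs_def]
    by (intro nice_diff nice_add left[OF nice_const] nice_mult_left v1 nice0_mult nice_const nice_mean neD neW nev nPF)
  have yy: "nice 2 (\<lambda>y. y 0 * fps_mean (y 0))"
    using nice_mult[OF nice_var0 nice_mean[OF nice_var0]] by (simp add: numeral_2_eq_2)
  have Ey: "nice 2 (\<lambda>y. E y * y 0)" by (rule nice_mult_left[OF nE nice0_var])
  have nQ: "nice 2 Q" unfolding Q_def[abs_def]
    by (intro nice_diff left[OF nice_const] left[OF nc(3)] nice_mean neD neW nE yy Ey)
  define G where "G i = (if i = 1 then (\<lambda>y. P * FD y) else if i = 2 then (\<lambda>y. P * FW y) else if i = 3 then (\<lambda>y. P * Fv y) else (\<lambda>y. 0))" for i :: nat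
  have nG: "nice 0 (G i)" for i
    using nPF nice_const[of 0] by (simp add: G_def)
  obtain y where y: "y \<in> null_states" "\<And>i. fps_conv_radius (y i) > 0"
    "\<And>i. i > 0 \<Longrightarrow> y i = fps_integral0 (G i y)" "\<And>n. n \<ge> 1 \<Longrightarrow> \<tau> n * fps_nth (y 0) n = fps_nth (Q y) n"
  proof (rule fps_fixed_point[of G 3 Q m \<tau>])
    show "G i = (\<lambda>_. 0)" if "i > 3" for i using that by (simp add: G_def)
    show "m \<le> \<bar>\<tau> n\<bar>" if "n \<ge> 1" for n unfolding \<tau>_def by (rule nonres(2)[OF that])
  qed (auto intro: nG nQ nonres(1))
  have y1: "y 1 = fps_X * fps_mean (P * FD y)" and y2: "y 2 = fps_X * fps_mean (P * FW y)" and y3: "y 3 = fps_X * fps_mean (P * Fv y)"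
    using y(3)[of 1] y(3)[of 2] y(3)[of 3] by (simp_all add: G_def fps_integral0_eq_X_mean)
  have dy: "fps_deriv (y 1) = P * FD y" "fps_deriv (y 2) = P * FW y" "fps_deriv (y 3) = P * Fv y"
    using y(3)[of 1] y(3)[of 2] y(3)[of 3] by (simp_all add: G_def fps_deriv_fps_integral)
  define A where "A = fps_mean (P * FW y)"
  define B where "B = fps_mean (P * FD y)"
  define C where "C = fps_mean (P * Fv y)"
  define Y where "Y = fps_mean (y 0)"
  have A: "A = fps_const W1 + fps_const (2 * (1 + \<epsilon>) * a) * Y + fps_mean (eW y)"
    unfolding A_def gW Y_def by (simp add: fps_mean_add fps_mean_cmult)
  have B: "B = fps_const R1 + fps_const (- 2 * (1 - \<epsilon>) * a) * Y + fps_mean (eD y)"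
    unfolding B_def gD Y_def by (simp only: fps_mean_add fps_mean_cmult fps_mean_const)
  have C: "C = fps_const V1 + fps_const (4 * \<epsilon> * v0 * (\<omega> + \<epsilon>)) * Y + fps_mean (ev y)"
    unfolding C_def gv Y_def by (simp add: fps_mean_add fps_mean_cmult)
  \<comment> \<open>\<open>K\<close> divided by \<open>fps_X\<close>, expressed by \<open>A\<close>,
    \<open>B\<close> and \<open>C\<close>, the increments of \<open>W\<close>, \<open>D\<close> and
    \<open>v\<close> divided by \<open>fps_X\<close>.\<close>
  define \<beta> where "\<beta> = fps_const kW * A + fps_const kD * B - C + y 2 * (fps_const (1 - \<epsilon>) * A) + y 1 * (fps_const (4 * \<epsilon>) * A)"
  have \<beta>: "\<beta> = fps_const b0 + fps_const cK * Y + E y"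
  proof -
    have 1: "fps_const b0 = fps_const kW * fps_const W1 + fps_const kD * fps_const R1 - fps_const V1" unfolding b0_def by simp
    have 2: "fps_const cK = fps_const kW * fps_const (2 * (1 + \<epsilon>) * a) + fps_const kD * fps_const (- 2 * (1 - \<epsilon>) * a) - fps_const (4 * \<epsilon> * v0 * (\<omega> + \<epsilon>))"
      unfolding cK_def by (simp add: algebra_simps)
    have "\<beta> = fps_const kW * (fps_const W1 + fps_const (2 * (1 + \<epsilon>) * a) * Y + fps_mean (eW y))
       + fps_const kD * (fps_const R1 + fps_const (- 2 * (1 - \<epsilon>) * a) * Y + fps_mean (eD y))
       - (fps_const V1 + fps_const (4 * \<epsilon> * v0 * (\<omega> + \<epsilon>)) * Y + fps_mean (ev y))
       + y 2 * (fps_const (1 - \<epsilon>) * A) + y 1 * (fps_const (4 * \<epsilon>) * A)"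
      unfolding \<beta>_def A[symmetric] B[symmetric] C[symmetric] by (rule refl)
    also have "\<dots> = fps_const b0 + fps_const cK * Y + E y"
      unfolding 1 2 E_def A_def[symmetric] by (simp only: distrib_left distrib_right left_diff_distrib mult.assoc) (simp only: diff_conv_add_uminus minus_add_distrib minus_mult_left add_ac)
    finally show ?thesis .
  qed
  \<comment> \<open>The equation \<open>l K = W - D\<close> with one factor \<open>fps_X\<close>
    cancelled. Its part of order 0 is the hypothesis \<open>first\<close>; the higher orders are the
    equations solved by the fixed point.\<close>
  have "\<beta> * ly y - (A - B) = fps_const b0 * y 0 + fps_const (l0 * cK - 4 * a) * Y - Q y"
  proof -
    have 1: "fps_const b0 * L = fps_const W1 - fps_const R1" unfolding L_def using first by simp
    have 2: "fps_const (l0 * cK - 4 * a) = L * fps_const cK - fps_const (2 * (1 + \<epsilon>) * a) + fps_const (- 2 * (1 - \<epsilon>) * a)"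
      unfolding L_def by (simp add: algebra_simps)
    have "\<beta> * ly y = fps_const b0 * L + fps_const b0 * y 0 + L * fps_const cK * Y + fps_const cK * (y 0 * Y) + L * E y + E y * y 0"
      unfolding \<beta> ly_def by (simp add: algebra_simps)
    moreover have "A - B = fps_const b0 * L + (fps_const (2 * (1 + \<epsilon>) * a) * Y - fps_const (- 2 * (1 - \<epsilon>) * a) * Y) + (fps_mean (eW y) - fps_mean (eD y))"
      unfolding 1 A B by (rule regroup_difference)
    ultimately show ?thesis unfolding 2 Q_def Y_def[symmetric] by (simp only: regroup_sonic_source)
  qed
  also have "\<dots> = 0"
  proof (rule fps_ext)
    fix n
    show "fps_nth (fps_const b0 * y 0 + fps_const (l0 * cK - 4 * a) * Y - Q y) n = fps_nth 0 n"
    proof (cases "n = 0")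
      case True
      have "fps_nth (y 0) 0 = 0" using y(1) by (simp add: null_states_def)
      moreover have "fps_nth (Q y) 0 = 0" by (rule nice_nth_0[OF nQ _ y(1)]) simp
      ultimately show ?thesis using True by (simp add: Y_def)
    next
      case False
      then have "\<tau> n * fps_nth (y 0) n = fps_nth (Q y) n" by (intro y(4)) simp
      then have "fps_nth (Q y) n = b0 * fps_nth (y 0) n + (l0 * cK - 4 * a) / (real n + 1) * fps_nth (y 0) n"
        by (simp add: \<tau>_def distrib_right)
      then show ?thesis by (simp add: Y_def)
    qed
  qed
  finally have bl: "\<beta> * ly y = A - B" by simp
  define D where "D = Dy y"
  define W where "W = Wy y"
  define v where "v = vy y"
  define l where "l = ly y"
  have K: "(W + e)^2 - e * (W - 1)^2 + 4 * e * D * W - v = fps_X * \<beta>"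
  proof -
    have vc: "fps_const v0 = (o' + e)^2 - e * (o' - 1)^2 + 4 * e * o' * o'"
      unfolding v0[symmetric] e_def o'_def by (simp add: numeral_fps_const power2_eq_square)
    have kc: "fps_const kW = 2 * (1 - e) * o' + 4 * e + 4 * e * o'" "fps_const kD = 4 * e * o'" "fps_const (1 - \<epsilon>) = 1 - e" "fps_const (4 * \<epsilon>) = 4 * e"
      unfolding kW_def kD_def e_def o'_def by (simp_all add: numeral_fps_const)
    have "fps_X * \<beta> = fps_const kW * y 2 + fps_const kD * y 1 - y 3 + y 2 * (fps_const (1 - \<epsilon>) * y 2) + y 1 * (fps_const (4 * \<epsilon>) * y 2)"
      unfolding \<beta>_def y1[folded B_def] y2[folded A_def] y3[folded C_def] by (simp add: algebra_simps)
    then show ?thesis unfolding kc D_def W_def v_def Dy_def Wy_def vy_def vc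
      by (simp add: power2_eq_square algebra_simps)
  qed
  have XP: "(1 + fps_X) * (P * F) = F" for F
  proof -
    have "(fps_const 1 + fps_X) * P = 1" unfolding P_def by (rule inverse_mult_eq_1') simp
    then have "((fps_const 1 + fps_X) * P) * F = F" by simp
    then show ?thesis by (simp add: mult.assoc)
  qed
  have nums: "fps_const (2 * (1 - \<epsilon>)) = 2 * (1 - e)" "fps_const (2 * (1 + \<epsilon>)) = 2 * (1 + e)" "fps_const (4 * \<epsilon>) = 4 * e"
    unfolding e_def by (simp_all add: numeral_fps_const)
  have n0: "fps_nth (y i) 0 = 0" for i using y(1) by (simp add: null_states_def)
  show ?thesis
  proof (rule that[of D W v l])
    show "fps_conv_radius D > 0" "fps_conv_radius W > 0" "fps_conv_radius v > 0" "fps_conv_radius l > 0"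
      using y(2)[of 0] y(2)[of 1] y(2)[of 2] y(2)[of 3]
      unfolding D_def W_def v_def l_def Dy_def Wy_def vy_def ly_def o'_def L_def
      by (auto intro!: less_le_trans[OF _ fps_conv_radius_add])
    show "fps_nth D 0 = \<omega>" "fps_nth W 0 = \<omega>" "fps_nth v 0 = v0" "fps_nth l 0 = l0"
      unfolding D_def W_def v_def l_def Dy_def Wy_def vy_def ly_def o'_def L_def by (simp_all add: n0)
    have "fps_deriv D = P * FD y" "fps_deriv W = P * FW y" "fps_deriv v = P * Fv y"
      unfolding D_def W_def v_def Dy_def Wy_def vy_def o'_def using dy by simp_all
    then show "(1 + fps_X) * fps_deriv D = - (fps_const (2 * (1 - \<epsilon>)) * D * (W + fps_const \<epsilon>) * l)"
      "(1 + fps_X) * fps_deriv W = 1 - 3 * W + fps_const (2 * (1 + \<epsilon>)) * W * (W + fps_const \<epsilon>) * l"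
      "(1 + fps_X) * fps_deriv v = v * (fps_const (4 * \<epsilon>) * (W + fps_const \<epsilon>) * l - 2)"
      unfolding nums e_def[symmetric] D_def W_def v_def l_def by (simp_all add: XP FD_def FW_def Fv_def)
    have "l * (fps_X * \<beta>) = fps_X * (\<beta> * ly y)" by (simp add: l_def mult_ac)
    also have "\<dots> = W - D" unfolding bl right_diff_distrib A_def B_def y1[symmetric] y2[symmetric]
      by (simp add: W_def D_def Wy_def Dy_def)
    finally show "l * ((W + fps_const \<epsilon>)^2 - fps_const \<epsilon> * (W - 1)^2 + fps_const (4 * \<epsilon>) * D * W - v) = W - D"
      unfolding nums e_def[symmetric] K .
  qed
qed

lemma fps_rpow_nth_0: "0 < fps_nth F 0 \<Longrightarrow> fps_nth (fps_rpow F p) 0 = fps_nth F 0 powr p"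
  by (simp add: fps_rpow_def)

lemma fps_binomial_deriv_mult: "(1 + fps_X) * fps_deriv (fps_binomial (p::real)) = fps_const p * fps_binomial p"
proof -
  have "fps_deriv (fps_binomial p) = fps_const p * fps_binomial p / (1 + fps_X)" by (rule fps_binomial_deriv)
  moreover have "(fps_const p * fps_binomial p / (1 + fps_X)) * (1 + fps_X) = fps_const p * fps_binomial p"
    by (subst fps_divide_unit) (auto simp: mult.assoc inverse_mult_eq_1)
  ultimately show ?thesis by (simp add: mult.commute)
qed

text \<open>This logarithmic derivative and the constant term determine the power, by
  \<open>fps_linear_ode_unique\<close>; that is how a series of the sonic expansion is recognized as
  a real power.\<close>

lemma fps_rpow_deriv:
  assumes F0: "0 < fps_nth F 0"
  shows "F * fps_deriv (fps_rpow F p) = fps_const p * fps_deriv F * fps_rpow F p"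
proof -
  define k where "k = fps_nth F 0"
  define u where "u = fps_const (1 / k) * F - 1"
  have k: "0 < k" using F0 by (simp add: k_def)
  have u0: "fps_nth u 0 = 0" using k by (simp add: u_def k_def)
  have F: "F = fps_const k * (1 + u)" using k by (simp add: u_def mult.assoc[symmetric])
  have r: "fps_rpow F p = fps_const (k powr p) * (fps_binomial p oo u)" by (simp add: fps_rpow_def k_def u_def)
  have du: "fps_deriv F = fps_const k * fps_deriv u" by (subst F) simp
  have "((1 + fps_X) * fps_deriv (fps_binomial p)) oo u = (1 + u) * (fps_deriv (fps_binomial p) oo u)"
    by (simp add: fps_compose_mult_distrib[OF u0] fps_compose_add_distrib u0)
  moreover have "(fps_const p * fps_binomial p) oo u = fps_const p * (fps_binomial p oo u)"
    by (simp add: fps_compose_mult_distrib[OF u0])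
  ultimately have b: "(1 + u) * (fps_deriv (fps_binomial p) oo u) = fps_const p * (fps_binomial p oo u)"
    using fps_binomial_deriv_mult[of p] by simp
  have "F * fps_deriv (fps_rpow F p) = fps_const k * fps_const (k powr p) * fps_deriv u * ((1 + u) * (fps_deriv (fps_binomial p) oo u))"
    unfolding r by (subst F) (simp add: fps_compose_deriv[OF u0] mult_ac)
  also have "\<dots> = fps_const p * fps_deriv F * fps_rpow F p"
    unfolding b r du by (simp add: mult_ac)
  finally show ?thesis .
qed

text \<open>If the coefficients of the difference vanish up to order \<open>m\<close>, comparison at
  order \<open>m\<close> leaves only \<open>F\<close> at 0 times the next one.\<close>

lemma fps_linear_ode_unique:
  fixes F A :: "real fps"
  assumes F0: "fps_nth F 0 \<noteq> 0" and "F * fps_deriv Y = A * Y" "F * fps_deriv Z = A * Z" "fps_nth Y 0 = fps_nth Z 0"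
  shows "Y = Z"
proof -
  define D where "D = Y - Z"
  have D: "F * fps_deriv D = A * D" using assms by (simp add: D_def right_diff_distrib)
  have "fps_nth D n = 0" for n
  proof (induction n rule: less_induct)
    case (less n)
    show ?case
    proof (cases n)
      case 0
      then show ?thesis using assms(4) by (simp add: D_def)
    next
      case (Suc m)
      have lower: "fps_nth D k = 0" if "k \<le> m" for k using less that Suc by simp
      have "(\<Sum>i=0..m. fps_nth F i * fps_nth (fps_deriv D) (m - i)) = fps_nth F 0 * fps_nth (fps_deriv D) m"
      proof -
        have "(\<Sum>i=0..m. fps_nth F i * fps_nth (fps_deriv D) (m - i)) = (\<Sum>i\<in>{0}. fps_nth F i * fps_nth (fps_deriv D) (m - i))"
          by (rule sum.mono_neutral_right) (auto simp: lower)
        then show ?thesis by simp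
      qed
      moreover have "(\<Sum>i=0..m. fps_nth A i * fps_nth D (m - i)) = 0" by (simp add: lower)
      ultimately have "fps_nth F 0 * fps_nth (fps_deriv D) m = 0"
        using arg_cong[OF D, of "\<lambda>F. fps_nth F m"] by (simp add: fps_mult_nth)
      then show ?thesis using F0 Suc by simp
    qed
  qed
  then show ?thesis by (simp add: D_def fps_eq_iff)
qed

text \<open>\<open>b0\<close> is the derivative of \<open>K\<close> at the sonic point in the
  variable \<open>x / x\<^sub>* - 1\<close>, so \<open>b0 > 0\<close> makes \<open>K\<close>
  negative and \<open>ss_B\<close> positive just inside. The series \<open>v\<close>, an independent
  unknown of \<open>sonic_series\<close>, has to be identified with
  \<open>D\<^sup>-\<^sup>\<eta> / x\<^sup>2\<close> twice: formally for \<open>rlp_series\<close>,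
  and between the sums for \<open>ss_B\<close>.\<close>

lemma local_rlp_solution:
  fixes \<epsilon> x \<omega> g l0 v0 m :: real
  defines "a \<equiv> \<omega> * (\<omega> + \<epsilon>)"
  defines "W1 \<equiv> 1 - 3 * \<omega> + 2 * (1 + \<epsilon>) * a * l0" and "R1 \<equiv> - 2 * (1 - \<epsilon>) * a * l0"
    and "V1 \<equiv> v0 * (4 * \<epsilon> * (\<omega> + \<epsilon>) * l0 - 2)"
  defines "kW \<equiv> 2 * (1 - \<epsilon>) * \<omega> + 4 * \<epsilon> + 4 * \<epsilon> * \<omega>" and "kD \<equiv> 4 * \<epsilon> * \<omega>"
  defines "cK \<equiv> kW * (2 * (1 + \<epsilon>) * a) - kD * (2 * (1 - \<epsilon>) * a) - 4 * \<epsilon> * v0 * (\<omega> + \<epsilon>)"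
  defines "b0 \<equiv> kW * W1 + kD * R1 - V1"
  assumes \<epsilon>: "0 < \<epsilon>" "\<epsilon> < 1" and x: "0 < x" and \<omega>: "0 < \<omega>"
    and v0: "H0 \<epsilon> \<omega> = v0" and v0x: "v0 * x^2 = \<omega> powr (- eta \<epsilon>)"
    and first: "b0 * l0 = W1 - R1" and b0: "0 < b0"
    and nonres: "0 < m" "\<And>n. n \<ge> 1 \<Longrightarrow> m \<le> \<bar>b0 + (l0 * cK - 4 * a) / (real n + 1)\<bar>"
    and val: "omega_value \<epsilon> x \<omega>" "ghost_value \<epsilon> x g" "W1_coeff \<epsilon> \<omega> g = W1" "R1_coeff \<epsilon> \<omega> W1 = R1"
  shows "\<exists>y D W. 0 < y \<and> y < x \<and> rlp_extension \<epsilon> x y D W \<and> rlp_extension \<epsilon> x x D W \<and> W x = \<omega>"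
proof -
  have v0': "(\<omega> + \<epsilon>)^2 - \<epsilon> * (\<omega> - 1)^2 + 4 * \<epsilon> * \<omega> * \<omega> = v0"
    unfolding v0[symmetric] H0_def by (simp add: power2_eq_square algebra_simps)
  obtain D W v l :: "real fps" where rad:
    "fps_conv_radius D > 0" "fps_conv_radius W > 0" "fps_conv_radius v > 0" "fps_conv_radius l > 0"
    and n0: "fps_nth D 0 = \<omega>" "fps_nth W 0 = \<omega>" "fps_nth v 0 = v0" "fps_nth l 0 = l0"
    and eqs: "(1 + fps_X) * fps_deriv D = - (fps_const (2 * (1 - \<epsilon>)) * D * (W + fps_const \<epsilon>) * l)"
    "(1 + fps_X) * fps_deriv W = 1 - 3 * W + fps_const (2 * (1 + \<epsilon>)) * W * (W + fps_const \<epsilon>) * l"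
    "(1 + fps_X) * fps_deriv v = v * (fps_const (4 * \<epsilon>) * (W + fps_const \<epsilon>) * l - 2)"
    "l * ((W + fps_const \<epsilon>)^2 - fps_const \<epsilon> * (W - 1)^2 + fps_const (4 * \<epsilon>) * D * W - v) = W - D"
    by (rule sonic_series[OF v0' first[unfolded b0_def W1_def R1_def V1_def a_def kW_def kD_def] nonres(1)
          nonres(2)[unfolded b0_def W1_def R1_def V1_def a_def cK_def kW_def kD_def]]) (assumption, rule that)
  define X1 where "X1 = 1 + (fps_X :: real fps)"
  \<comment> \<open>The logarithmic derivatives of \<open>Z\<close> and \<open>D\<close> have the
    ratio \<open>- eta \<epsilon>\<close>, because
    \<open>4 \<epsilon> = eta \<epsilon> * (2 (1 - \<epsilon>))\<close>; the factor
    \<open>X1\<^sup>2\<close> absorbs the \<open>- 2\<close> in the equation for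
    \<open>v\<close>.\<close>
  define Z where "Z = v * fps_const (x^2) * X1^2"
  have Z: "Z = fps_rpow D (- eta \<epsilon>)"
  proof (rule fps_linear_ode_unique[of D _ "fps_const (- eta \<epsilon>) * fps_deriv D"])
    show "fps_nth D 0 \<noteq> 0" using n0 \<omega> by simp
    show "D * fps_deriv (fps_rpow D (- eta \<epsilon>)) = fps_const (- eta \<epsilon>) * fps_deriv D * fps_rpow D (- eta \<epsilon>)"
      by (rule fps_rpow_deriv) (use n0 \<omega> in simp)
    show "fps_nth Z 0 = fps_nth (fps_rpow D (- eta \<epsilon>)) 0"
      using fps_rpow_nth_0[of D "- eta \<epsilon>"] n0 \<omega> v0x by (simp add: Z_def X1_def power2_eq_square)
    have X0: "X1 \<noteq> 0"
    proof
      assume "X1 = 0"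
      then have "fps_nth X1 0 = 0" by simp
      then show False by (simp add: X1_def)
    qed
    have dX: "fps_deriv X1 = 1" by (simp add: X1_def)
    have "X1 * fps_deriv Z = fps_const (x^2) * (X1^2 * (X1 * fps_deriv v) + v * (2 * X1^2))"
      unfolding Z_def by (simp add: dX power2_eq_square algebra_simps)
    also have "\<dots> = Z * (fps_const (4 * \<epsilon>) * (W + fps_const \<epsilon>) * l)"
      unfolding X1_def[symmetric] eqs(3)[folded X1_def] Z_def by (simp add: algebra_simps)
    finally have dZ: "X1 * fps_deriv Z = Z * (fps_const (4 * \<epsilon>) * (W + fps_const \<epsilon>) * l)" .
    have "X1 * (D * fps_deriv Z) = D * (Z * (fps_const (4 * \<epsilon>) * (W + fps_const \<epsilon>) * l))"
      unfolding dZ[symmetric] by (simp add: mult_ac)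
    also have "\<dots> = fps_const (- eta \<epsilon>) * (- (fps_const (2 * (1 - \<epsilon>)) * D * (W + fps_const \<epsilon>) * l)) * Z"
    proof -
      have "4 * \<epsilon> = eta \<epsilon> * (2 * (1 - \<epsilon>))" using \<epsilon> by (simp add: eta_def field_simps)
      then have "fps_const (4 * \<epsilon>) = fps_const (eta \<epsilon>) * fps_const (2 * (1 - \<epsilon>))" by (simp only: fps_const_mult)
      then show ?thesis by (simp only: fps_const_neg[symmetric]) (simp only: mult_minus_left mult_minus_right minus_minus mult_ac)
    qed
    also have "\<dots> = X1 * (fps_const (- eta \<epsilon>) * fps_deriv D * Z)"
      unfolding eqs(1)[folded X1_def, symmetric] by (simp only: mult_ac)
    finally show "D * fps_deriv Z = fps_const (- eta \<epsilon>) * fps_deriv D * Z" using X0 by simp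
  qed
  define Kf where "Kf = (W + fps_const \<epsilon>)^2 - fps_const \<epsilon> * (W - 1)^2 + fps_const (4 * \<epsilon>) * D * W - v"
  have lK: "l * Kf = W - D" using eqs(4) by (simp add: Kf_def)
  have B: "fps_B \<epsilon> x D W = - (fps_const (x^2) * X1^2 * Kf)"
    unfolding fps_B_def Z[symmetric] Z_def Kf_def X1_def by (simp add: algebra_simps)
  have invX: "inverse X1 * X1 = 1" unfolding X1_def by (rule inverse_mult_eq_1) simp
  have series: "rlp_series \<epsilon> x D W"
    unfolding rlp_series_def
  proof (intro conjI)
    have "fps_nth (X1 * fps_deriv W) 0 = W1"
      unfolding eqs(2)[folded X1_def] by (simp add: n0 W1_def a_def algebra_simps)
    then have W1: "fps_nth W 1 = W1" by (simp add: X1_def)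
    have "fps_nth (X1 * fps_deriv D) 0 = R1"
      unfolding eqs(1)[folded X1_def] by (simp add: n0 R1_def a_def algebra_simps)
    then have R1: "fps_nth D 1 = R1" by (simp add: X1_def)
    show "\<exists>\<omega> g. omega_value \<epsilon> x \<omega> \<and> ghost_value \<epsilon> x g \<and> fps_nth D 0 = \<omega> \<and> fps_nth W 0 = \<omega> \<and>
        fps_nth W 1 = W1_coeff \<epsilon> \<omega> g \<and> fps_nth D 1 = R1_coeff \<epsilon> \<omega> (fps_nth W 1)"
      by (rule exI[of _ \<omega>], rule exI[of _ g]) (simp add: val n0 W1 R1 del: One_nat_def)
    have n: "fps_const (2 * x^2 * (1 - \<epsilon>)) = fps_const (x^2) * fps_const (2 * (1 - \<epsilon>))" "fps_const (2 * x^2 * (1 + \<epsilon>)) = fps_const (x^2) * fps_const (2 * (1 + \<epsilon>))" by simp_all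
    have "fps_B \<epsilon> x D W * fps_deriv D = - (fps_const (x^2) * X1 * Kf * (X1 * fps_deriv D))"
      unfolding B by (simp add: power2_eq_square mult_ac)
    also have "\<dots> = fps_const (x^2) * X1 * fps_const (2 * (1 - \<epsilon>)) * D * (W + fps_const \<epsilon>) * (l * Kf)"
      unfolding eqs(1)[folded X1_def] by (simp only: mult_minus_left mult_minus_right minus_minus mult_ac)
    finally have "fps_B \<epsilon> x D W * fps_deriv D = fps_const (x^2) * X1 * fps_const (2 * (1 - \<epsilon>)) * D * (W + fps_const \<epsilon>) * (W - D)"
      unfolding lK .
    then show "fps_B \<epsilon> x D W * fps_deriv D + fps_const (2 * x^2 * (1 - \<epsilon>)) * (1 + fps_X) * D * (W + fps_const \<epsilon>) * (D - W) = 0"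
      unfolding n X1_def[symmetric] by (simp add: algebra_simps del: fps_const_mult)
    have "fps_B \<epsilon> x D W * fps_deriv W = - (fps_const (x^2) * X1 * Kf * (X1 * fps_deriv W))"
      unfolding B by (simp add: power2_eq_square mult_ac)
    also have "\<dots> = - (fps_const (x^2) * X1 * Kf * (1 - 3 * W)) - fps_const (x^2) * X1 * fps_const (2 * (1 + \<epsilon>)) * W * (W + fps_const \<epsilon>) * (l * Kf)"
      unfolding eqs(2)[folded X1_def] by (simp add: algebra_simps del: fps_const_mult)
    finally have 1: "fps_B \<epsilon> x D W * fps_deriv W = - (fps_const (x^2) * X1 * Kf * (1 - 3 * W)) - fps_const (x^2) * X1 * fps_const (2 * (1 + \<epsilon>)) * W * (W + fps_const \<epsilon>) * (W - D)"
      unfolding lK .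
    have "(1 - 3 * W) * fps_B \<epsilon> x D W * inverse X1 = - (fps_const (x^2) * X1 * Kf * (1 - 3 * W)) * (inverse X1 * X1)"
      unfolding B by (simp add: power2_eq_square mult_ac)
    then have 2: "(1 - 3 * W) * fps_B \<epsilon> x D W * inverse X1 = - (fps_const (x^2) * X1 * Kf * (1 - 3 * W))"
      unfolding invX by simp
    have 3: "(1 - fps_const 3 * W) = 1 - 3 * W" by (simp add: numeral_fps_const)
    show "fps_B \<epsilon> x D W * fps_deriv W - (1 - fps_const 3 * W) * fps_B \<epsilon> x D W * inverse (1 + fps_X)
       - fps_const (2 * x^2 * (1 + \<epsilon>)) * (1 + fps_X) * W * (W + fps_const \<epsilon>) * (D - W) = 0"
      unfolding n 3 X1_def[symmetric] 1 2 by (simp add: algebra_simps del: fps_const_mult)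
  qed
  define d where "d = eval_fps D"
  define w where "w = eval_fps W"
  define vf where "vf = eval_fps v"
  define lf where "lf = eval_fps l"
  have ex: "d has_fps_expansion D" "w has_fps_expansion W" "vf has_fps_expansion v" "lf has_fps_expansion l"
    unfolding d_def w_def vf_def lf_def by (intro eval_fps_has_fps_expansion rad)+
  have i0: "d 0 = \<omega>" "w 0 = \<omega>" "vf 0 = v0" "lf 0 = l0"
    unfolding d_def w_def vf_def lf_def by (simp_all add: eval_fps_at_0 n0)
  have X1i: "fps_deriv F = inverse X1 * (X1 * fps_deriv F)" for F :: "real fps"
    by (simp add: mult.assoc[symmetric] invX)
  have exX: "(\<lambda>t. inverse (1 + t)) has_fps_expansion inverse X1"
    unfolding X1_def by (rule has_fps_expansion_inverse) (intro fps_expansion_intros, simp)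
  have exc: "(\<lambda>_. c) has_fps_expansion fps_const c" for c :: real by (rule has_fps_expansion_const)
  have "eventually (\<lambda>t. (d has_real_derivative inverse (1 + t) * (- (2 * (1 - \<epsilon>) * d t * (w t + \<epsilon>) * lf t))) (at t)) (nhds 0)"
    by (rule has_fps_expansion_ode[OF ex(1)], subst X1i, unfold eqs(1)[folded X1_def]) (intro fps_expansion_intros ex exX exc)
  moreover have "eventually (\<lambda>t. (w has_real_derivative inverse (1 + t) * (1 - 3 * w t + 2 * (1 + \<epsilon>) * w t * (w t + \<epsilon>) * lf t)) (at t)) (nhds 0)"
    by (rule has_fps_expansion_ode[OF ex(2)], subst X1i, unfold eqs(2)[folded X1_def]) (intro fps_expansion_intros ex exX exc)
  moreover have "eventually (\<lambda>t. (vf has_real_derivative inverse (1 + t) * (vf t * (4 * \<epsilon> * (w t + \<epsilon>) * lf t - 2))) (at t)) (nhds 0)"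
    by (rule has_fps_expansion_ode[OF ex(3)], subst X1i, unfold eqs(3)[folded X1_def]) (intro fps_expansion_intros ex exX exc)
  moreover have "eventually (\<lambda>t. lf t * ((w t + \<epsilon>)^2 - \<epsilon> * (w t - 1)^2 + 4 * \<epsilon> * d t * w t - vf t) = w t - d t) (nhds 0)"
  proof (rule has_fps_expansion_unique_ev)
    show "(\<lambda>t. lf t * ((w t + \<epsilon>)^2 - \<epsilon> * (w t - 1)^2 + 4 * \<epsilon> * d t * w t - vf t)) has_fps_expansion W - D"
      unfolding eqs(4)[symmetric] by (intro fps_expansion_intros ex exc)
    show "(\<lambda>t. w t - d t) has_fps_expansion W - D" by (intro fps_expansion_intros ex)
  qed
  moreover have "eventually (\<lambda>t. 0 < d t) (nhds 0)"
  proof -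
    have "isCont d 0" using ex(1) by (rule has_fps_expansion_imp_continuous)
    then show ?thesis by (rule isCont_eventually_gt) (simp add: i0 \<omega>)
  qed
  ultimately have "eventually (\<lambda>t. (d has_real_derivative inverse (1 + t) * (- (2 * (1 - \<epsilon>) * d t * (w t + \<epsilon>) * lf t))) (at t) \<and>
     (w has_real_derivative inverse (1 + t) * (1 - 3 * w t + 2 * (1 + \<epsilon>) * w t * (w t + \<epsilon>) * lf t)) (at t) \<and>
     (vf has_real_derivative inverse (1 + t) * (vf t * (4 * \<epsilon> * (w t + \<epsilon>) * lf t - 2))) (at t) \<and>
     lf t * ((w t + \<epsilon>)^2 - \<epsilon> * (w t - 1)^2 + 4 * \<epsilon> * d t * w t - vf t) = w t - d t \<and> 0 < d t) (nhds 0)"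
    by eventually_elim simp
  then obtain s where s: "0 < s" and loc: "\<And>t. dist t 0 < s \<Longrightarrow> (d has_real_derivative inverse (1 + t) * (- (2 * (1 - \<epsilon>) * d t * (w t + \<epsilon>) * lf t))) (at t) \<and>
     (w has_real_derivative inverse (1 + t) * (1 - 3 * w t + 2 * (1 + \<epsilon>) * w t * (w t + \<epsilon>) * lf t)) (at t) \<and>
     (vf has_real_derivative inverse (1 + t) * (vf t * (4 * \<epsilon> * (w t + \<epsilon>) * lf t - 2))) (at t) \<and>
     lf t * ((w t + \<epsilon>)^2 - \<epsilon> * (w t - 1)^2 + 4 * \<epsilon> * d t * w t - vf t) = w t - d t \<and> 0 < d t"
    unfolding eventually_nhds_metric by blast
  define k where "k t = (w t + \<epsilon>)^2 - \<epsilon> * (w t - 1)^2 + 4 * \<epsilon> * d t * w t - vf t" for t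
  have "(k has_real_derivative b0) (at 0)"
  proof -
    note L0 = loc[of 0, unfolded dist_self, OF s]
    have e: "inverse (1 + 0) * (- (2 * (1 - \<epsilon>) * \<omega> * (\<omega> + \<epsilon>) * l0)) = R1"
      "inverse (1 + 0) * (1 - 3 * \<omega> + 2 * (1 + \<epsilon>) * \<omega> * (\<omega> + \<epsilon>) * l0) = W1"
      "inverse (1 + 0) * (v0 * (4 * \<epsilon> * (\<omega> + \<epsilon>) * l0 - 2)) = V1"
      by (simp_all add: R1_def W1_def V1_def a_def algebra_simps)
    have dd: "(d has_real_derivative R1) (at 0)" and dw: "(w has_real_derivative W1) (at 0)" and dv: "(vf has_real_derivative V1) (at 0)"
      using L0 unfolding i0 e by blast+
    have "(k has_real_derivative 2 * (\<omega> + \<epsilon>) * W1 - \<epsilon> * (2 * (\<omega> - 1) * W1) + (4 * \<epsilon> * R1 * \<omega> + 4 * \<epsilon> * \<omega> * W1) - V1) (at 0)"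
      unfolding k_def[abs_def] by (rule derivative_eq_intros dd dw dv refl | simp add: i0 algebra_simps)+
    moreover have "2 * (\<omega> + \<epsilon>) * W1 - \<epsilon> * (2 * (\<omega> - 1) * W1) + (4 * \<epsilon> * R1 * \<omega> + 4 * \<epsilon> * \<omega> * W1) - V1 = b0"
      unfolding b0_def kW_def kD_def by (simp add: algebra_simps)
    ultimately show ?thesis by simp
  qed
  moreover have k0: "k 0 = 0" unfolding k_def i0 using v0' by simp
  ultimately obtain s' where s': "0 < s'" and kneg: "\<And>h. 0 < h \<Longrightarrow> h < s' \<Longrightarrow> k (- h) < 0"
    using DERIV_pos_inc_left[of k b0 0] b0 by auto
  \<comment> \<open>\<open>r < 1\<close> keeps the left end \<open>x * (1 - r)\<close>
    positive.\<close>
  define r where "r = min (min s s') 1 / 2"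
  have r: "0 < r" "r < s" "r < s'" "r < 1" using s s' by (auto simp: r_def min_def)
  \<comment> \<open>The counterpart of \<open>Z\<close> for the sums: \<open>G\<close> has
    derivative 0 and the value 1 at the sonic point.\<close>
  have zpow: "vf t * x^2 * (1 + t)^2 = d t powr (- eta \<epsilon>)" if t: "\<bar>t\<bar> < min s 1" for t
  proof -
    define G where "G t = vf t * x^2 * (1 + t)^2 * d t powr eta \<epsilon>" for t
    have "\<exists>c. \<forall>u\<in>{- min s 1<..<min s 1}. G u = c"
    proof (rule has_field_derivative_zero_constant)
      fix u assume "u \<in> {- min s 1<..<min s 1}"
      then have u: "dist u 0 < s" "\<bar>u\<bar> < 1" "1 + u \<noteq> 0" by (auto simp: dist_real_def)
      note L = loc[OF u(1)]
      have dp: "0 < d u" using L by simp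
      define q where "q = inverse (1 + u)"
      have q: "q * (1 + u) = 1" using u by (simp add: q_def)
      have p: "((\<lambda>u. d u powr eta \<epsilon>) has_real_derivative d u powr eta \<epsilon> * (0 * ln (d u) + q * (- (2 * (1 - \<epsilon>) * d u * (w u + \<epsilon>) * lf u)) * eta \<epsilon> / d u)) (at u)"
        by (rule DERIV_powr[where f = "\<lambda>_. eta \<epsilon>" and g = d and r = 0, OF _ dp DERIV_const]) (use L in \<open>simp add: q_def\<close>)
      have v1: "((\<lambda>t. vf t * x^2 * (1 + t)^2) has_real_derivative
         q * (vf u * (4 * \<epsilon> * (w u + \<epsilon>) * lf u - 2)) * x^2 * (1 + u)^2 + vf u * x^2 * (2 * (1 + u))) (at u)"
        using L by (auto intro!: derivative_eq_intros simp: q_def)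
      have "(G has_real_derivative
        (q * (vf u * (4 * \<epsilon> * (w u + \<epsilon>) * lf u - 2)) * x^2 * (1 + u)^2 + vf u * x^2 * (2 * (1 + u))) * d u powr eta \<epsilon>
        + d u powr eta \<epsilon> * (0 * ln (d u) + q * (- (2 * (1 - \<epsilon>) * d u * (w u + \<epsilon>) * lf u)) * eta \<epsilon> / d u) * (vf u * x^2 * (1 + u)^2)) (at u)"
        unfolding G_def by (rule DERIV_mult[OF v1 p])
      moreover have "(q * (vf u * (4 * \<epsilon> * (w u + \<epsilon>) * lf u - 2)) * x^2 * (1 + u)^2 + vf u * x^2 * (2 * (1 + u))) * d u powr eta \<epsilon>
        + d u powr eta \<epsilon> * (0 * ln (d u) + q * (- (2 * (1 - \<epsilon>) * d u * (w u + \<epsilon>) * lf u)) * eta \<epsilon> / d u) * (vf u * x^2 * (1 + u)^2) = 0"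
      proof -
        have e: "q * (- (2 * (1 - \<epsilon>) * d u * (w u + \<epsilon>) * lf u)) * eta \<epsilon> / d u = - (4 * \<epsilon> * q * (w u + \<epsilon>) * lf u)"
          using dp \<epsilon> by (simp add: eta_def field_simps)
        show ?thesis unfolding e using q by algebra
      qed
      ultimately have "(G has_real_derivative 0) (at u)" by (simp only:)
      then show "(G has_real_derivative 0) (at u within {- min s 1<..<min s 1})" by (rule has_field_derivative_at_within)
    qed simp
    then obtain c where c: "\<And>u. u \<in> {- min s 1<..<min s 1} \<Longrightarrow> G u = c" by blast
    have "t \<in> {- min s 1<..<min s 1}" "0 \<in> {- min s 1<..<min s 1}" using t s by (auto simp: abs_less_iff)
    then have "G t = G 0" using c by simp
    also have "G 0 = \<omega> powr (- eta \<epsilon>) * \<omega> powr eta \<epsilon>" unfolding G_def i0 using v0x by simp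
    also have "\<dots> = 1" using \<omega> by (simp add: powr_minus)
    finally have "vf t * x^2 * (1 + t)^2 * d t powr eta \<epsilon> = 1" by (simp add: G_def)
    moreover have "0 < d t" using loc[of t] t by (simp add: dist_real_def)
    ultimately show ?thesis by (simp add: powr_minus field_simps)
  qed
  define DD where "DD y = d (y / x - 1)" for y
  define WW where "WW y = w (y / x - 1)" for y
  have germ: "rlp_germ \<epsilon> x DD WW"
  proof -
    have e: "x * (1 + t) / x - 1 = t" for t using x by simp
    have "(\<lambda>t. DD (x * (1 + t))) has_fps_expansion D" unfolding DD_def e using ex(1) .
    moreover have "(\<lambda>t. WW (x * (1 + t))) has_fps_expansion W" unfolding WW_def e using ex(2) .
    ultimately show ?thesis unfolding rlp_germ_def using series by blast
  qed
  define y0 where "y0 = x * (1 - r)"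
  have y0: "0 < y0" "y0 < x" using x r by (auto simp: y0_def)
  have ode: "0 < DD y \<and> 0 < ss_B \<epsilon> y (DD y) (WW y) \<and> ss_ode \<epsilon> DD WW y {y0..<x}" if y: "y \<in> {y0..<x}" for y
  proof -
    define t where "t = y / x - 1"
    have yt: "y = x * (1 + t)" using x by (simp add: t_def)
    have "x * (1 - r) \<le> x * (1 + t)" "x * (1 + t) < x * 1" using y unfolding yt y0_def by auto
    then have "1 - r \<le> 1 + t" "1 + t < 1" using x by (simp_all only: mult_le_cancel_left_pos mult_less_cancel_left_pos)
    then have t: "- r \<le> t" "t < 0" by simp_all
    have DWt: "DD y = d t" "WW y = w t" by (simp_all add: DD_def WW_def t_def)
    have ts: "dist t 0 < s" "\<bar>t\<bar> < min s 1" "1 + t > 0" using t r by (auto simp: dist_real_def)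
    have kn: "k t < 0" using kneg[of "- t"] t r by simp
    note L = loc[OF ts(1)]
    have yp: "0 < y" using y y0 by auto
    have lft: "lf t = (w t - d t) / k t" using L kn by (simp add: k_def field_simps)
    have pw: "DD y powr (- eta \<epsilon>) = vf t * y^2"
    proof -
      have y2: "y^2 = x^2 * (1 + t)^2" by (subst yt) (rule power_mult_distrib)
      show ?thesis unfolding DWt y2 zpow[OF ts(2), symmetric] by (simp only: mult_ac)
    qed
    have Bk: "ss_B \<epsilon> y (DD y) (WW y) = - (k t * y^2)"
      unfolding ss_B_def pw unfolding DWt k_def by (simp add: algebra_simps)
    have dt: "((\<lambda>y. y / x - 1) has_real_derivative 1 / x) (at y)" using x by (auto intro!: derivative_eq_intros)
    have c1: "(DD has_real_derivative inverse (1 + t) * (- (2 * (1 - \<epsilon>) * d t * (w t + \<epsilon>) * lf t)) * (1 / x)) (at y)"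
      unfolding DD_def[abs_def] by (rule DERIV_chain2[OF _ dt]) (use L in \<open>simp add: t_def\<close>)
    have c2: "(WW has_real_derivative inverse (1 + t) * (1 - 3 * w t + 2 * (1 + \<epsilon>) * w t * (w t + \<epsilon>) * lf t) * (1 / x)) (at y)"
      unfolding WW_def[abs_def] by (rule DERIV_chain2[OF _ dt]) (use L in \<open>simp add: t_def\<close>)
    have iy: "inverse (1 + t) * z * (1 / x) = z / y" for z using ts x by (simp add: yt field_simps)
    have e1: "- (2 * (1 - \<epsilon>) * d t * (w t + \<epsilon>) * lf t) / y
       = - (2 * y * (1 - \<epsilon>) * DD y * (WW y + \<epsilon>) * (DD y - WW y) / ss_B \<epsilon> y (DD y) (WW y))"
      unfolding Bk lft unfolding DWt using yp kn by (simp add: divide_simps) algebra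
    have e2: "(1 - 3 * w t + 2 * (1 + \<epsilon>) * w t * (w t + \<epsilon>) * lf t) / y
       = (1 - 3 * WW y) / y + 2 * y * (1 + \<epsilon>) * WW y * (WW y + \<epsilon>) * (DD y - WW y) / ss_B \<epsilon> y (DD y) (WW y)"
      unfolding Bk lft unfolding DWt using yp kn by (simp add: divide_simps) algebra
    have "ss_ode \<epsilon> DD WW y {y0..<x}"
      unfolding ss_ode_def using c1[unfolded iy e1] c2[unfolded iy e2]
      by (auto intro: has_field_derivative_at_within)
    moreover have "0 < ss_B \<epsilon> y (DD y) (WW y)" unfolding Bk using kn yp by (simp add: mult_neg_pos)
    moreover have "0 < DD y" using L by (simp add: DWt)
    ultimately show ?thesis by simp
  qed
  have "WW x = \<omega>" using x by (simp add: WW_def i0)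
  moreover have "rlp_extension \<epsilon> x y0 DD WW" unfolding rlp_extension_def using germ ode by blast
  moreover have "rlp_extension \<epsilon> x x DD WW" unfolding rlp_extension_def using germ by simp
  ultimately show ?thesis using y0 by blast
qed

section \<open>Sonic value, ghost root and sonic window\<close>

text \<open>Monotonicity in \<open>y\<close> and opposite signs at the two ends give one root for
  every parameter of the interval, so the branch exists over a prescribed range and within
  prescribed bounds instead of on an unspecified neighbourhood.\<close>

lemma implicit_branch:
  fixes F Fe Fy :: "real \<Rightarrow> real \<Rightarrow> real" and a b c :: real
  assumes ab: "a < b"
    and de: "\<And>e y. \<bar>e\<bar> < c \<Longrightarrow> a \<le> y \<Longrightarrow> y \<le> b \<Longrightarrow> ((\<lambda>e. F e y) has_real_derivative Fe e y) (at e)"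
    and dy: "\<And>e y. \<bar>e\<bar> < c \<Longrightarrow> a \<le> y \<Longrightarrow> y \<le> b \<Longrightarrow> (F e has_real_derivative Fy e y) (at y)"
    and cFe: "continuous_on ({-c<..<c} \<times> {a..b}) (\<lambda>(e, y). Fe e y)"
    and cFy: "continuous_on ({-c<..<c} \<times> {a..b}) (\<lambda>(e, y). Fy e y)"
    and Fy: "\<And>e y. \<bar>e\<bar> < c \<Longrightarrow> a \<le> y \<Longrightarrow> y \<le> b \<Longrightarrow> 0 < Fy e y"
    and ends: "\<And>e. \<bar>e\<bar> < c \<Longrightarrow> F e a < 0" "\<And>e. \<bar>e\<bar> < c \<Longrightarrow> 0 < F e b"
  obtains \<Omega> where "\<Omega> C1_differentiable_on {-c<..<c}"
    "\<And>e. \<bar>e\<bar> < c \<Longrightarrow> a < \<Omega> e \<and> \<Omega> e < b \<and> F e (\<Omega> e) = 0"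
proof -
  have mono: "F e y < F e z" if "\<bar>e\<bar> < c" "a \<le> y" "y < z" "z \<le> b" for e y z
    by (rule DERIV_pos_imp_increasing[OF that(3)]) (use that dy Fy in \<open>meson order_trans\<close>)
  have "\<exists>y. a < y \<and> y < b \<and> F e y = 0" if e: "\<bar>e\<bar> < c" for e
  proof -
    have "\<exists>y\<ge>a. y \<le> b \<and> F e y = 0"
    proof (rule IVT')
      show "continuous_on {a..b} (F e)"
        by (rule DERIV_continuous_on[where D = "Fy e"]) (auto intro: has_field_derivative_at_within dy[OF e])
    qed (use ends[OF e] ab in auto)
    then obtain y where y: "a \<le> y" "y \<le> b" "F e y = 0" by blast
    with ends[OF e] show ?thesis by (intro exI[of _ y]) (auto simp: less_le)
  qed
  then obtain \<Omega> where \<Omega>: "\<And>e. \<bar>e\<bar> < c \<Longrightarrow> a < \<Omega> e \<and> \<Omega> e < b \<and> F e (\<Omega> e) = 0" by metis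
  have near: "eventually (\<lambda>e'. \<bar>e'\<bar> < c) (at e)" if "\<bar>e\<bar> < c" for e
  proof -
    have "open {-c<..<c}" "e \<in> {-c<..<c}" using that by auto
    then have "eventually (\<lambda>e'. e' \<in> {-c<..<c}) (at e)" by (rule eventually_at_in_open')
    then show ?thesis by eventually_elim auto
  qed
  have lim: "(\<Omega> \<longlongrightarrow> \<Omega> e) (at e)" if e: "\<bar>e\<bar> < c" for e
  proof (rule order_tendstoI)
    fix y assume "y < \<Omega> e"
    then have y: "a \<le> max y a" "max y a < \<Omega> e" "max y a \<le> b" using \<Omega>[OF e] by auto
    have "F e (max y a) < 0" using mono[OF e y(1,2)] \<Omega>[OF e] by auto
    moreover have "((\<lambda>e. F e (max y a)) \<longlongrightarrow> F e (max y a)) (at e)"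
      using DERIV_isCont[OF de[OF e y(1,3)]] by (simp add: isCont_def)
    ultimately have "eventually (\<lambda>e'. F e' (max y a) < 0) (at e)" by (rule order_tendstoD(2)[rotated])
    with near[OF e] show "eventually (\<lambda>e'. y < \<Omega> e') (at e)"
    proof eventually_elim
      case (elim e')
      show ?case
      proof (rule ccontr)
        assume "\<not> y < \<Omega> e'"
        then have "\<Omega> e' \<le> max y a" by auto
        moreover have "a \<le> \<Omega> e'" using \<Omega>[OF elim(1)] by simp
        ultimately have "F e' (\<Omega> e') \<le> F e' (max y a)"
          using mono[OF elim(1) _ _ y(3)] unfolding order.order_iff_strict[of "\<Omega> e'"] by fastforce
        then show False using elim \<Omega>[OF elim(1)] by auto
      qed
    qed
  next
    fix y assume "\<Omega> e < y"
    then have y: "a \<le> min y b" "\<Omega> e < min y b" "min y b \<le> b" using \<Omega>[OF e] by auto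
    have "0 < F e (min y b)" using mono[OF e _ y(2,3)] \<Omega>[OF e] by auto
    moreover have "((\<lambda>e. F e (min y b)) \<longlongrightarrow> F e (min y b)) (at e)"
      using DERIV_isCont[OF de[OF e y(1,3)]] by (simp add: isCont_def)
    ultimately have "eventually (\<lambda>e'. 0 < F e' (min y b)) (at e)" by (rule order_tendstoD(1)[rotated])
    with near[OF e] show "eventually (\<lambda>e'. \<Omega> e' < y) (at e)"
    proof eventually_elim
      case (elim e')
      show ?case
      proof (rule ccontr)
        assume "\<not> \<Omega> e' < y"
        then have "min y b \<le> \<Omega> e'" by auto
        moreover have "\<Omega> e' \<le> b" using \<Omega>[OF elim(1)] by simp
        ultimately have "F e' (min y b) \<le> F e' (\<Omega> e')"
          using mono[OF elim(1) y(1)] unfolding order.order_iff_strict[of "min y b"] by fastforce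
        then show False using elim \<Omega>[OF elim(1)] by auto
      qed
    qed
  qed
  have cont: "continuous_on {-c<..<c} \<Omega>"
    using lim by (auto simp: continuous_on_eq_continuous_at isCont_def abs_less_iff)
  have deriv: "(\<Omega> has_real_derivative - (Fe e (\<Omega> e)) / Fy e (\<Omega> e)) (at e)" if e: "\<bar>e\<bar> < c" for e
  proof -
    \<comment> \<open>The intermediate point is no farther from \<open>\<Omega> e\<close> than
      \<open>\<Omega> e'\<close> is, so it converges together with \<open>\<Omega>\<close>, and
      continuity of \<open>Fy\<close> yields the limit of the difference quotient.\<close>
    have "\<exists>\<xi>. a \<le> \<xi> \<and> \<xi> \<le> b \<and> \<bar>\<xi> - \<Omega> e\<bar> \<le> \<bar>\<Omega> e' - \<Omega> e\<bar> \<and> F e' (\<Omega> e') - F e' (\<Omega> e) = (\<Omega> e' - \<Omega> e) * Fy e' \<xi>"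
      if e': "\<bar>e'\<bar> < c" for e'
    proof -
      consider "\<Omega> e < \<Omega> e'" | "\<Omega> e' < \<Omega> e" | "\<Omega> e' = \<Omega> e" by linarith
      then show ?thesis
      proof cases
        case 1
        have "\<exists>z. \<Omega> e < z \<and> z < \<Omega> e' \<and> F e' (\<Omega> e') - F e' (\<Omega> e) = (\<Omega> e' - \<Omega> e) * Fy e' z"
          by (rule MVT2[OF 1]) (use dy[OF e'] \<Omega>[OF e] \<Omega>[OF e'] in auto)
        then obtain z where z: "\<Omega> e < z" "z < \<Omega> e'" "F e' (\<Omega> e') - F e' (\<Omega> e) = (\<Omega> e' - \<Omega> e) * Fy e' z" by blast
        show ?thesis by (rule exI[of _ z], intro conjI z(3)) (use z(1,2) \<Omega>[OF e] \<Omega>[OF e'] in auto)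
      next
        case 2
        have "\<exists>z. \<Omega> e' < z \<and> z < \<Omega> e \<and> F e' (\<Omega> e) - F e' (\<Omega> e') = (\<Omega> e - \<Omega> e') * Fy e' z"
          by (rule MVT2[OF 2]) (use dy[OF e'] \<Omega>[OF e] \<Omega>[OF e'] in auto)
        then obtain z where z: "\<Omega> e' < z" "z < \<Omega> e" "F e' (\<Omega> e) - F e' (\<Omega> e') = (\<Omega> e - \<Omega> e') * Fy e' z" by blast
        then have "F e' (\<Omega> e') - F e' (\<Omega> e) = (\<Omega> e' - \<Omega> e) * Fy e' z" by (simp add: algebra_simps)
        then show ?thesis by (intro exI[of _ z] conjI) (use z(1,2) \<Omega>[OF e] \<Omega>[OF e'] in auto)
      next
        case 3
        show ?thesis unfolding 3 by (rule exI[of _ "\<Omega> e"]) (use \<Omega>[OF e] in simp)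
      qed
    qed
    then obtain \<xi> where \<xi>0: "\<forall>e'\<in>{e'. \<bar>e'\<bar> < c}. a \<le> \<xi> e' \<and> \<xi> e' \<le> b \<and> \<bar>\<xi> e' - \<Omega> e\<bar> \<le> \<bar>\<Omega> e' - \<Omega> e\<bar>
        \<and> F e' (\<Omega> e') - F e' (\<Omega> e) = (\<Omega> e' - \<Omega> e) * Fy e' (\<xi> e')"
      using bchoice[of "{e'. \<bar>e'\<bar> < c}" "\<lambda>e' \<xi>. a \<le> \<xi> \<and> \<xi> \<le> b \<and> \<bar>\<xi> - \<Omega> e\<bar> \<le> \<bar>\<Omega> e' - \<Omega> e\<bar>
        \<and> F e' (\<Omega> e') - F e' (\<Omega> e) = (\<Omega> e' - \<Omega> e) * Fy e' \<xi>"] by auto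
    note \<xi> = \<xi>0[rule_format, OF CollectI]
    have "((\<lambda>e'. \<bar>\<Omega> e' - \<Omega> e\<bar>) \<longlongrightarrow> \<bar>\<Omega> e - \<Omega> e\<bar>) (at e)" by (intro tendsto_intros lim e)
    then have lim0: "((\<lambda>e'. \<bar>\<Omega> e' - \<Omega> e\<bar>) \<longlongrightarrow> 0) (at e)" by simp
    have "\<forall>\<^sub>F e' in at e. norm (\<xi> e' - \<Omega> e) \<le> \<bar>\<Omega> e' - \<Omega> e\<bar>"
      using near[OF e] by eventually_elim (simp add: \<xi>)
    then have "((\<lambda>e'. \<xi> e' - \<Omega> e) \<longlongrightarrow> 0) (at e)" using lim0 by (rule Lim_null_comparison)
    then have \<xi>lim: "(\<xi> \<longlongrightarrow> \<Omega> e) (at e)" by (simp add: LIM_zero_iff)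
    have "((\<lambda>e'. (\<lambda>(e, y). Fy e y) (e', \<xi> e')) \<longlongrightarrow> (\<lambda>(e, y). Fy e y) (e, \<Omega> e)) (at e)"
    proof (rule continuous_on_tendsto_compose[OF cFy])
      show "((\<lambda>e'. (e', \<xi> e')) \<longlongrightarrow> (e, \<Omega> e)) (at e)" by (intro tendsto_intros \<xi>lim)
      show "(e, \<Omega> e) \<in> {-c<..<c} \<times> {a..b}" using e \<Omega>[OF e] by (auto simp: abs_less_iff)
      show "\<forall>\<^sub>F e' in at e. (e', \<xi> e') \<in> {-c<..<c} \<times> {a..b}"
        using near[OF e] by eventually_elim (use \<xi> in \<open>auto simp: abs_less_iff\<close>)
    qed
    then have l1: "((\<lambda>e'. Fy e' (\<xi> e')) \<longlongrightarrow> Fy e (\<Omega> e)) (at e)" by simp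
    have ae: "a \<le> \<Omega> e" "\<Omega> e \<le> b" using \<Omega>[OF e] by auto
    have l2: "((\<lambda>e'. (F e' (\<Omega> e) - F e (\<Omega> e)) / (e' - e)) \<longlongrightarrow> Fe e (\<Omega> e)) (at e)"
      using de[OF e ae] by (simp add: has_field_derivative_iff)
    have "((\<lambda>e'. - ((F e' (\<Omega> e) - F e (\<Omega> e)) / (e' - e)) / Fy e' (\<xi> e')) \<longlongrightarrow> - (Fe e (\<Omega> e)) / Fy e (\<Omega> e)) (at e)"
      by (intro tendsto_intros l1 l2) (use Fy[OF e ae] in simp)
    moreover have "\<forall>\<^sub>F e' in at e. - ((F e' (\<Omega> e) - F e (\<Omega> e)) / (e' - e)) / Fy e' (\<xi> e') = (\<Omega> e' - \<Omega> e) / (e' - e)"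
      using near[OF e]
    proof eventually_elim
      case (elim e')
      have "0 < Fy e' (\<xi> e')" using Fy elim \<xi> by blast
      moreover have "- (F e' (\<Omega> e) - F e (\<Omega> e)) = (\<Omega> e' - \<Omega> e) * Fy e' (\<xi> e')" using \<xi>[OF elim] \<Omega>[OF e] \<Omega>[OF elim] by linarith
      then have "- ((F e' (\<Omega> e) - F e (\<Omega> e)) / (e' - e)) = (\<Omega> e' - \<Omega> e) * Fy e' (\<xi> e') / (e' - e)" by (metis minus_divide_left)
      ultimately show ?case by simp
    qed
    ultimately show ?thesis unfolding has_field_derivative_iff by (rule Lim_transform_eventually)
  qed
  have pair: "continuous_on {-c<..<c} (\<lambda>e. (e, \<Omega> e))" by (intro continuous_intros cont)
  have sub: "(\<lambda>e. (e, \<Omega> e)) ` {-c<..<c} \<subseteq> {-c<..<c} \<times> {a..b}" using \<Omega> by (auto simp: abs_less_iff less_imp_le)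
  have c1: "continuous_on {-c<..<c} (\<lambda>e. Fe e (\<Omega> e))" "continuous_on {-c<..<c} (\<lambda>e. Fy e (\<Omega> e))"
    using continuous_on_compose2[OF cFe pair sub] continuous_on_compose2[OF cFy pair sub] by simp_all
  have "\<Omega> C1_differentiable_on {-c<..<c}"
    unfolding C1_differentiable_on_def
  proof (intro exI[of _ "\<lambda>e. - (Fe e (\<Omega> e)) / Fy e (\<Omega> e)"] conjI ballI)
    show "continuous_on {-c<..<c} (\<lambda>e. - (Fe e (\<Omega> e)) / Fy e (\<Omega> e))"
    proof (intro continuous_intros c1 ballI)
      fix e assume "e \<in> {-c<..<c}"
      then have e: "\<bar>e\<bar> < c" by auto
      then show "Fy e (\<Omega> e) \<noteq> 0" using Fy[OF e, of "\<Omega> e"] \<Omega>[OF e] by simp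
    qed
    fix e assume "e \<in> {-c<..<c}"
    then have "\<bar>e\<bar> < c" by auto
    then show "(\<Omega> has_vector_derivative - (Fe e (\<Omega> e)) / Fy e (\<Omega> e)) (at e)"
      using deriv by (simp add: has_real_derivative_iff_has_vector_derivative)
  qed
  then show ?thesis using \<Omega> by (rule that)
qed

section \<open>Strict inequalities that persist for small parameters\<close>

lemma compact_tube:
  fixes F :: "real \<times> 'a::metric_space \<Rightarrow> real"
  assumes S: "compact S" and c: "0 < c" and F: "continuous_on ({-c..c} \<times> S) F" and pos: "\<And>y. y \<in> S \<Longrightarrow> 0 < F (0, y)"
  shows "\<exists>r>0. r \<le> c \<and> (\<forall>e y. \<bar>e\<bar> \<le> r \<longrightarrow> y \<in> S \<longrightarrow> 0 < F (e, y))"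
proof (cases "S = {}")
  case True
  then show ?thesis using c by auto
next
  case False
  have "continuous_on S (\<lambda>y. F (0, y))"
    by (rule continuous_on_compose2[OF F]) (use c in \<open>auto intro: continuous_intros\<close>)
  then obtain y0 where y0: "y0 \<in> S" "\<And>y. y \<in> S \<Longrightarrow> F (0, y0) \<le> F (0, y)"
    using continuous_attains_inf[OF S False] by blast
  have "uniformly_continuous_on ({-c..c} \<times> S) F"
    by (intro compact_uniformly_continuous F compact_Times S compact_Icc)
  then obtain d where d: "0 < d" "\<And>p p'. p \<in> {-c..c} \<times> S \<Longrightarrow> p' \<in> {-c..c} \<times> S \<Longrightarrow> dist p' p < d \<Longrightarrow> dist (F p') (F p) < F (0, y0)"
    using pos[OF y0(1)] unfolding uniformly_continuous_on_def by meson
  show ?thesis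
  proof (intro exI[of _ "min c (d / 2)"] conjI allI impI)
    fix e y assume e: "\<bar>e\<bar> \<le> min c (d / 2)" and y: "y \<in> S"
    have "dist (e, y) (0, y) < d" using e d(1) by (simp add: dist_Pair_Pair)
    then have "dist (F (e, y)) (F (0, y)) < F (0, y0)" by (intro d(2)) (use e y c in auto)
    then show "0 < F (e, y)" using y0(2)[OF y] by (simp add: dist_real_def)
  qed (use c d in auto)
qed

lemma eventually_tube:
  fixes F :: "real \<times> 'a::metric_space \<Rightarrow> real"
  assumes "compact S" "0 < c" "continuous_on ({-c..c} \<times> S) F" "\<And>y. y \<in> S \<Longrightarrow> 0 < F (0, y)"
  shows "eventually (\<lambda>r. \<forall>e y. \<bar>e\<bar> \<le> r \<longrightarrow> y \<in> S \<longrightarrow> 0 < F (e, y)) (at_right 0)"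
proof -
  obtain r where r: "0 < r" "\<And>e y. \<bar>e\<bar> \<le> r \<Longrightarrow> y \<in> S \<Longrightarrow> 0 < F (e, y)"
    using compact_tube[OF assms] by blast
  show ?thesis unfolding eventually_at_right_field
  proof (intro exI[of _ r] conjI allI impI r(1))
    fix r' e y assume "0 < r'" "r' < r" "\<bar>e\<bar> \<le> r'" "y \<in> S"
    then show "0 < F (e, y)" by (intro r(2)) auto
  qed
qed

section \<open>Values of the sonic branch\<close>

lemma omega_value_eq:
  assumes "omega_value \<epsilon> x \<omega>"
  shows "0 < x" "0 < \<omega>" "H0 \<epsilon> \<omega> * \<omega> powr eta \<epsilon> = 1 / x^2"
proof -
  have "(1 + 3 * \<epsilon>) * \<omega>^2 + 4 * \<epsilon> * \<omega> + \<epsilon> * (\<epsilon> - 1) = H0 \<epsilon> \<omega>"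
    by (simp add: H0_def power2_eq_square algebra_simps)
  then show "0 < x" "0 < \<omega>" "H0 \<epsilon> \<omega> * \<omega> powr eta \<epsilon> = 1 / x^2"
    using assms unfolding omega_value_def omega_branch_def by force+
qed

text \<open>Both factors increase with \<open>y\<close>, but \<open>H0\<close> is negative near 0,
  so the product is monotone only from where it is positive; hence the positivity condition at the
  smaller argument.\<close>

lemma sonic_product_less:
  assumes e: "0 \<le> e" "e < 1" and y: "0 < y" "y < z" and H: "0 < H0 e y * y powr eta e"
  shows "H0 e y * y powr eta e < H0 e z * z powr eta e"
proof -
  have "0 < H0 e y" using H y by (simp add: zero_less_mult_iff)
  moreover have "H0 e y < H0 e z"
  proof -
    have "y^2 < z^2" using y by (intro power_strict_mono) auto
    then have "(1 + 3 * e) * y^2 < (1 + 3 * e) * z^2" using e by (intro mult_strict_left_mono) auto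
    moreover have "4 * e * y \<le> 4 * e * z" using e y by (intro mult_left_mono) auto
    ultimately show ?thesis unfolding H0_def by linarith
  qed
  moreover have "y powr eta e \<le> z powr eta e" using y e by (intro powr_mono2) (auto simp: eta_def)
  ultimately show ?thesis using y by (intro mult_less_le_imp_less) auto
qed

lemma sonic_product_inj:
  assumes e: "0 \<le> e" "e < 1" and "0 < y" "0 < z" and "H0 e y * y powr eta e = k" "H0 e z * z powr eta e = k" "0 < k"
  shows "y = z"
  using sonic_product_less[OF e, of y z] sonic_product_less[OF e, of z y] assms by (cases y z rule: linorder_cases) auto

lemma H0_bounds:
  assumes e: "\<bar>e\<bar> < 1/100" and y: "1/5 \<le> y" "y \<le> 3/5"
  shows "y^2 - 1/40 \<le> H0 e y" "H0 e y < y^2 + 1/30" "0 < H0 e y"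
proof -
  have y2: "1/25 \<le> y^2" "y^2 \<le> 9/25"
    using power_mono[of "1/5" y 2] power_mono[of y "3/5" 2] y by (auto simp: power2_eq_square)
  have "\<bar>e * (3 * y^2 + 4 * y - 1)\<bar> \<le> 1/100 * (5/2)"
    unfolding abs_mult
  proof (rule mult_mono)
    show "\<bar>3 * y^2 + 4 * y - 1\<bar> \<le> 5/2" unfolding abs_le_iff using y y2 by linarith
  qed (use e in auto)
  moreover have "0 \<le> e^2" by simp
  moreover have "e^2 = \<bar>e\<bar> * \<bar>e\<bar>" by (simp add: power2_eq_square)
  moreover have "\<bar>e\<bar> * \<bar>e\<bar> \<le> 1/100 * (1/100)" using e by (intro mult_mono) auto
  moreover have "H0 e y = y^2 + e * (3 * y^2 + 4 * y - 1) + e^2" by (simp add: H0_def algebra_simps)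
  ultimately show "y^2 - 1/40 \<le> H0 e y" "H0 e y < y^2 + 1/30" "0 < H0 e y" 
    using y2 unfolding abs_le_iff by linarith+
qed

lemma eta_small: "\<bar>e\<bar> < 1/100 \<Longrightarrow> \<bar>eta e\<bar> \<le> 1/40"
  unfolding eta_def by (auto simp: abs_le_iff divide_simps)

text \<open>The logarithm of the sonic equation is increasing in \<open>y\<close>, so
  \<open>implicit_branch\<close> applies. At \<open>e = 0\<close> the root \<open>1 / x\<close> lies
  in \<open>[1/4, 1/2]\<close>, and the interval \<open>[1/5, 3/5]\<close> leaves room for the
  perturbation on both sides.\<close>

lemma omega_branch_exists:
  assumes x: "2 \<le> x" "x \<le> 4"
  obtains \<Omega> where "omega_branch x (1/100) \<Omega>" "\<And>e. \<bar>e\<bar> < 1/100 \<Longrightarrow> 1/5 < \<Omega> e \<and> \<Omega> e < 3/5"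
proof -
  define F where "F e y = ln (H0 e y) + eta e * ln y + 2 * ln x" for e y
  define Fe where "Fe e y = (3 * y^2 + 4 * y + 2 * e - 1) / H0 e y + 2 / (1 - e)^2 * ln y" for e y :: real
  define Fy where "Fy e y = (2 * (1 + 3 * e) * y + 4 * e) / H0 e y + eta e / y" for e y :: real
  have lnx: "ln x \<le> 2 * ln 2" "ln 2 \<le> ln x" using x ln_realpow[of 2 2, symmetric] by (auto simp: numeral_eq_Suc)
  have cH: "continuous_on S (\<lambda>p. H0 (fst p) (snd p))" for S unfolding H0_def by (intro continuous_intros)
  obtain \<Omega> where \<Omega>: "\<Omega> C1_differentiable_on {-(1/100)<..<1/100}"
    "\<And>e. \<bar>e\<bar> < 1/100 \<Longrightarrow> 1/5 < \<Omega> e \<and> \<Omega> e < 3/5 \<and> F e (\<Omega> e) = 0"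
  proof (rule implicit_branch[of "1/5" "3/5" "1/100" F Fe Fy])
    fix e y :: real assume e: "\<bar>e\<bar> < 1/100" and y: "1/5 \<le> y" "y \<le> 3/5"
    note H = H0_bounds[OF e y]
    have H1: "((\<lambda>e. H0 e y) has_real_derivative 3 * y^2 + 4 * y + 2 * e - 1) (at e)"
      unfolding H0_def by (auto intro!: derivative_eq_intros)
    have H2: "(H0 e has_real_derivative 2 * (1 + 3 * e) * y + 4 * e) (at y)"
      unfolding H0_def[abs_def] by (auto intro!: derivative_eq_intros)
    have E1: "(eta has_real_derivative 2 / (1 - e)^2) (at e)"
      unfolding eta_def[abs_def] using e by (auto intro!: derivative_eq_intros simp: power2_eq_square divide_simps)
    show "((\<lambda>e. F e y) has_real_derivative Fe e y) (at e)"
      unfolding F_def Fe_def using H by (auto intro!: derivative_eq_intros H1 E1)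
    show "(F e has_real_derivative Fy e y) (at y)"
      unfolding F_def[abs_def] Fy_def using H y by (auto intro!: derivative_eq_intros H2)
    have "1/2 \<le> (2 * (1 + 3 * e) * y + 4 * e) / H0 e y"
    proof -
      have "2 * (97/100) * (1/5) \<le> 2 * (1 + 3 * e) * y" using e y by (intro mult_mono) auto
      moreover have "H0 e y < 2/5" using H(2) power_mono[of y "3/5" 2] y by (simp add: power2_eq_square)
      ultimately show ?thesis using H(3) e by (simp add: pos_le_divide_eq)
    qed
    moreover have "\<bar>eta e / y\<bar> \<le> (1/40) / (1/5)" unfolding abs_divide by (rule frac_le) (use eta_small[OF e] y in auto)
    ultimately have "1/2 \<le> Fy e y - eta e / y" "\<bar>eta e / y\<bar> \<le> 1/8" by (simp_all add: Fy_def)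
    then show "0 < Fy e y" unfolding abs_le_iff by linarith
  next
    show "continuous_on ({-(1/100)<..<1/100} \<times> {1/5..3/5}) (\<lambda>(e, y). Fe e y)"
      unfolding Fe_def split_beta
      by (intro continuous_intros cH) (auto simp: H0_bounds(3)[THEN less_imp_neq, symmetric] abs_less_iff)
    show "continuous_on ({-(1/100)<..<1/100} \<times> {1/5..3/5}) (\<lambda>(e, y). Fy e y)"
      unfolding Fy_def split_beta eta_def
      by (intro continuous_intros cH) (auto simp: H0_bounds(3)[THEN less_imp_neq, symmetric] abs_less_iff)
  next
    fix e :: real assume e: "\<bar>e\<bar> < 1/100"
    note \<eta> = eta_small[OF e]
    have mul: "\<bar>eta e * l\<bar> \<le> 1/40 * k" if "\<bar>l\<bar> \<le> k" for l k :: real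
      unfolding abs_mult by (rule mult_mono) (use \<eta> that in auto)
    \<comment> \<open>Arranged around \<open>2 ln 2 \<le> 2 ln x \<le> 4 ln 2\<close>: apart from
      the small term with \<open>eta\<close>, the function is at most \<open>ln (4/5)\<close> at
      \<open>y = 1/5\<close> and at least \<open>ln (4/3)\<close> at \<open>y = 3/5\<close>.\<close>
    have l: "ln (1/20) = ln (4/5) - 4 * ln (2::real)" "ln (1/5) = - ln (5::real)"
      "ln (1/3) = ln (4/3) - 2 * ln (2::real)" "ln (3/5) = - ln (5/3::real)"
      using ln_realpow[of "2::real" 4] ln_realpow[of "2::real" 2] ln_mult[of 4 "5::real"] by (simp_all add: ln_div)
    have ll: "ln (4/5) \<le> 4/5 - (1::real)" "ln 5 \<le> 5 - (1::real)" "ln (5/3) \<le> 5/3 - (1::real)" "ln (3/4) \<le> 3/4 - (1::real)" "ln (4/3) = - ln (3/4::real)"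
      by (rule ln_le_minus_one; simp)+ (simp add: ln_div)
    have lp: "0 \<le> ln (5::real)" "0 \<le> ln (5/3::real)" by simp_all
    have "e * e \<le> 1/10000"
    proof -
      have "\<bar>e\<bar> * \<bar>e\<bar> \<le> 1/100 * (1/100)" using e by (intro mult_mono) auto
      then show ?thesis by simp
    qed
    moreover have "- 1/100 < e" "e < 1/100" using e by auto
    moreover have "H0 e (1/5) = 1/25 - 2/25 * e + e * e" by (simp add: H0_def power2_eq_square add_divide_distrib)
    ultimately have "H0 e (1/5) \<le> 1/20" by linarith
    then have "ln (H0 e (1/5)) \<le> ln (1/20)" using H0_bounds(3)[OF e, of "1/5"] by simp
    then show "F e (1/5) < 0"
      using mul[of "ln (1/5)" 4] lnx ll lp unfolding F_def l abs_le_iff by linarith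
    have "1/3 < H0 e (3/5)" using H0_bounds(1)[OF e, of "3/5"] by (simp add: power2_eq_square)
    then have "ln (1/3) < ln (H0 e (3/5))" by simp
    then show "0 < F e (3/5)"
      using mul[of "ln (3/5)" "2/3"] lnx ll lp unfolding F_def l abs_le_iff by linarith
  qed auto
  show ?thesis
  proof (rule that[of \<Omega>])
    have eq: "H0 e (\<Omega> e) * \<Omega> e powr eta e = 1 / x^2" if e: "\<bar>e\<bar> < 1/100" for e
    proof -
      have b: "1/5 \<le> \<Omega> e" "\<Omega> e \<le> 3/5" using \<Omega>(2)[OF e] by auto
      have "ln (H0 e (\<Omega> e) * \<Omega> e powr eta e) = ln (1 / x^2)"
        using \<Omega>(2)[OF e] H0_bounds(3)[OF e b] x b by (simp add: F_def ln_mult ln_div ln_powr ln_realpow)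
      then show ?thesis using H0_bounds(3)[OF e b] x b by (simp add: ln_inj_iff del: zero_less_divide_1_iff)
    qed
    have "\<Omega> 0 = 1 / x"
    proof -
      have "(\<Omega> 0)^2 = (1 / x)^2" using eq[of 0] \<Omega>(2)[of 0] by (simp add: H0_def eta_def power_divide)
      then show ?thesis using \<Omega>(2)[of 0] x by (simp add: power2_eq_iff_nonneg)
    qed
    moreover have "(1 + 3 * e) * y^2 + 4 * e * y + e * (e - 1) = H0 e y" for e y
      by (simp add: H0_def power2_eq_square algebra_simps)
    moreover have "0 < \<Omega> e" if "e \<in> {-(1/100)<..<1/100}" for e
    proof -
      have "\<bar>e\<bar> < 1/100" using that by auto
      then show ?thesis using \<Omega>(2)[of e] by simp
    qed
    ultimately show "omega_branch x (1/100) \<Omega>"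
      unfolding omega_branch_def using x \<Omega>(1) eq by (auto simp: abs_less_iff)
  qed (use \<Omega>(2) in auto)
qed

lemma omega_value_iff:
  assumes e: "0 < \<epsilon>" "\<epsilon> < 1/100" and x: "2 \<le> x" "x \<le> 4"
  shows "omega_value \<epsilon> x \<omega> \<longleftrightarrow> 0 < \<omega> \<and> H0 \<epsilon> \<omega> * \<omega> powr eta \<epsilon> = 1 / x^2"
proof
  assume \<omega>: "0 < \<omega> \<and> H0 \<epsilon> \<omega> * \<omega> powr eta \<epsilon> = 1 / x^2"
  obtain \<Omega> where \<Omega>: "omega_branch x (1/100) \<Omega>" "\<And>e. \<bar>e\<bar> < 1/100 \<Longrightarrow> 1/5 < \<Omega> e \<and> \<Omega> e < 3/5"
    using omega_branch_exists[OF x] by blast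
  then have v: "omega_value \<epsilon> x (\<Omega> \<epsilon>)" unfolding omega_value_def using e by (intro exI[of _ "1/100"] exI[of _ \<Omega>]) auto
  have "\<omega> = \<Omega> \<epsilon>"
    by (rule sonic_product_inj[of \<epsilon> \<omega> _ "1 / x^2"]) (use e x \<omega> omega_value_eq[OF v] in auto)
  with v show "omega_value \<epsilon> x \<omega>" by simp
qed (use omega_value_eq in blast)

lemma omega_branch_range:
  assumes e: "0 \<le> e" "e < 1/100" and x: "2 \<le> x" "x \<le> 4" and \<omega>: "0 < \<omega>" "H0 e \<omega> * \<omega> powr eta e = 1 / x^2"
  shows "1/5 < \<omega>" "\<omega> < 3/5"
proof -
  obtain \<Omega> where \<Omega>: "omega_branch x (1/100) \<Omega>" "\<And>e. \<bar>e\<bar> < 1/100 \<Longrightarrow> 1/5 < \<Omega> e \<and> \<Omega> e < 3/5"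
    using omega_branch_exists[OF x] by blast
  have v: "omega_value e x (\<Omega> e)" unfolding omega_value_def using e \<Omega> by (intro exI[of _ "1/100"] exI[of _ \<Omega>]) auto
  have "\<omega> = \<Omega> e"
    by (rule sonic_product_inj[of e \<omega> _ "1 / x^2"]) (use e x \<omega> omega_value_eq[OF v] in auto)
  then show "1/5 < \<omega>" "\<omega> < 3/5" using \<Omega>(2)[of e] e by auto
qed

section \<open>The cubic for the first coefficients and its ghost root\<close>

definition cubic :: "real \<Rightarrow> real \<Rightarrow> real \<Rightarrow> real" where
  "cubic e y X = a3 e y * X^3 + a2 e y * X^2 + a1 e y * X + a0 e y"

text \<open>The ghost root is rational in \<open>H0\<close> and \<open>\<omega>\<close>: it is the solution with equal slopes \<open>\<R>\<^sub>1 = \<W>\<^sub>1\<close>, for which the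
  numerator \<open>\<R> - \<W>\<close> vanishes to second order.\<close>

definition ghost :: "real \<Rightarrow> real \<Rightarrow> real" where
  "ghost e y = - (H0 e y / (cd e y + cb e y))"

text \<open>In the notation \<open>a\<close> to \<open>h\<close> this factorizes the condition of
  equal slopes, \<open>(d + b) X\<^sup>2 + (e + h) X + c H0 = ((d + b) X + H0) (X + c)\<close>; the
  first factor vanishes at \<open>ghost\<close>.\<close>

lemma ce_eq: "e < 1 \<Longrightarrow> y \<noteq> 0 \<Longrightarrow> ce e y = cc y * (cd e y + cb e y) + H0 e y - ch e y"
  by (simp add: ce_def cc_def cd_def ch_def ca_def H0_def power2_eq_square algebra_simps)

text \<open>Once \<open>ce\<close> is eliminated by \<open>ce_eq\<close> and \<open>H0\<close> by
  the definition of the root, the claim is a polynomial identity in the remaining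
  quantities.\<close>

lemma ghost_root:
  assumes "e < 1" "y \<noteq> 0" "cd e y + cb e y \<noteq> 0"
  shows "cubic e y (ghost e y) = 0"
proof -
  define H where "H = H0 e y"
  define X where "X = ghost e y"
  define A where "A = (1 - e) * ca e y"
  define b where "b = cb e y"
  define c where "c = cc y"
  define d where "d = cd e y"
  define h where "h = ch e y"
  have H: "H = - ((d + b) * X)" using assms(3) by (simp add: X_def ghost_def d_def b_def H_def)
  have E: "ce e y = c * (d + b) + H - h" using ce_eq[OF assms(1,2)] by (simp add: b_def c_def d_def h_def H_def)
  have f: "cf e y = A - H" by (simp add: cf_def A_def H_def)
  have "(d * (d * h - b * (c * (d + b) + H - h)) - b * ((A - H) * d + A * b)) * X^3 +
    - (b * c * d * H - (c * (d + b) + H - h) * (d * h - b * (c * (d + b) + H - h)) + h * ((A - H) * d + A * b)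
          + b * ((A - H) * (c * (d + b) + H - h) + A * h)) * X^2 +
    - (b * c * (c * (d + b) + H - h) * H - c * H * (d * h - b * (c * (d + b) + H - h)) + b * c * (A - H) * H
          + h * ((A - H) * (c * (d + b) + H - h) + A * h)) * X
    + - (c * H * (b * c * H + (A - H) * h)) = 0"
    unfolding H by algebra
  then show ?thesis
    unfolding cubic_def a3_def a2_def a1_def a0_def Let_def E f X_def[symmetric]
    by (simp only: A_def b_def c_def d_def h_def H_def)
qed

lemma continuous_on_coeffs:
  assumes "\<And>p. p \<in> S \<Longrightarrow> fst p \<noteq> 1" "\<And>p. p \<in> S \<Longrightarrow> snd p \<noteq> 0"
  shows "continuous_on S (\<lambda>p :: real \<times> real. H0 (fst p) (snd p))" "continuous_on S (\<lambda>p. cd (fst p) (snd p))"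
    "continuous_on S (\<lambda>p. cb (fst p) (snd p))" "continuous_on S (\<lambda>p. ca (fst p) (snd p))"
    "continuous_on S (\<lambda>p. ce (fst p) (snd p))" "continuous_on S (\<lambda>p. cc (snd p))"
  unfolding H0_def cd_def cb_def ca_def ce_def cc_def using assms by (auto intro!: continuous_intros)

lemma continuous_on_coeffs':
  assumes S: "\<And>p. p \<in> S \<Longrightarrow> fst p \<noteq> 1" "\<And>p. p \<in> S \<Longrightarrow> snd p \<noteq> 0"
  shows "continuous_on S (\<lambda>p :: real \<times> real. cf (fst p) (snd p))" "continuous_on S (\<lambda>p. ch (fst p) (snd p))"
  unfolding cf_def ch_def by (intro continuous_intros continuous_on_coeffs S; assumption)+

lemma continuous_on_cubic_coeffs:
  assumes S: "\<And>p. p \<in> S \<Longrightarrow> fst p \<noteq> 1" "\<And>p. p \<in> S \<Longrightarrow> snd p \<noteq> 0"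
  shows "continuous_on S (\<lambda>p :: real \<times> real. a3 (fst p) (snd p))" "continuous_on S (\<lambda>p. a2 (fst p) (snd p))"
    "continuous_on S (\<lambda>p. a1 (fst p) (snd p))" "continuous_on S (\<lambda>p. a0 (fst p) (snd p))"
  unfolding a3_def a2_def a1_def a0_def Let_def
  by (intro continuous_intros continuous_on_coeffs continuous_on_coeffs' S; assumption)+

lemma coeffs_0:
  assumes "y \<noteq> 0"
  shows "H0 0 y = y^2" "cd 0 y = y" "cb 0 y = 0" "ca 0 y = y^2" "ce 0 y = cc y * y" "cf 0 y = 0" "ch 0 y = y^2"
    "a3 0 y = y^4" "a2 0 y = y^4 * cc y" "a1 0 y = y^4 * (cc y * y - y^2)" "a0 0 y = 0"
proof -
  show *: "H0 0 y = y^2" "cd 0 y = y" "cb 0 y = 0" "ca 0 y = y^2" "ce 0 y = cc y * y"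
    by (simp_all add: H0_def cd_def cb_def ca_def ce_def cc_def power2_eq_square algebra_simps)
  show **: "cf 0 y = 0" "ch 0 y = y^2" by (simp_all add: cf_def ch_def *)
  show "a3 0 y = y^4" "a2 0 y = y^4 * cc y" "a1 0 y = y^4 * (cc y * y - y^2)" "a0 0 y = 0"
    unfolding a3_def a2_def a1_def a0_def Let_def * ** by algebra+
qed

lemma coeff_tube:
  fixes F :: "real \<times> real \<Rightarrow> real"
  assumes "continuous_on ({-1/100..1/100} \<times> {1/5..3/5}) F" "\<And>y. 1/5 \<le> y \<Longrightarrow> y \<le> 3/5 \<Longrightarrow> 0 < F (0, y)"
  shows "eventually (\<lambda>r. \<forall>e y. \<bar>e\<bar> \<le> r \<longrightarrow> 1/5 \<le> y \<longrightarrow> y \<le> 3/5 \<longrightarrow> 0 < F (e, y)) (at_right 0)"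
  using eventually_tube[of "{1/5..3/5}" "1/100" F] assms by (simp add: imp_conjL)

lemma a3_pos: "eventually (\<lambda>r. \<forall>e y. \<bar>e\<bar> \<le> r \<longrightarrow> 1/5 \<le> y \<longrightarrow> y \<le> 3/5 \<longrightarrow> 0 < a3 e y) (at_right 0)"
proof -
  have "continuous_on ({-1/100..1/100} \<times> {1/5..3/5}) (\<lambda>p. a3 (fst p) (snd p))"
    by (rule continuous_on_cubic_coeffs) auto
  then show ?thesis using coeff_tube[of "\<lambda>p. a3 (fst p) (snd p)"] by (simp add: coeffs_0)
qed

lemma ghost_denom_pos: "eventually (\<lambda>r. \<forall>e y. \<bar>e\<bar> \<le> r \<longrightarrow> 1/5 \<le> y \<longrightarrow> y \<le> 3/5 \<longrightarrow> 0 < cd e y + cb e y) (at_right 0)"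
proof -
  have "continuous_on ({-1/100..1/100} \<times> {1/5..3/5}) (\<lambda>p. cd (fst p) (snd p) + cb (fst p) (snd p))"
    by (intro continuous_intros continuous_on_coeffs) auto
  then show ?thesis using coeff_tube[of "\<lambda>p. cd (fst p) (snd p) + cb (fst p) (snd p)"] by (simp add: coeffs_0)
qed

lemma continuous_on_cubic:
  assumes S: "\<And>p. p \<in> S \<Longrightarrow> fst p \<noteq> 1" "\<And>p. p \<in> S \<Longrightarrow> snd p \<noteq> 0"
  shows "continuous_on S (\<lambda>p :: real \<times> real. cubic (fst p) (snd p) (t - snd p))"
  unfolding cubic_def by (intro continuous_intros continuous_on_cubic_coeffs S; assumption)

text \<open>The roots at \<open>e = 0\<close> are 0, the ghost root \<open>- y\<close> and
  \<open>1 - 2 y\<close>. The first and the last meet at \<open>y = 1/2\<close>, that is, at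
  \<open>x = 2\<close>; in the window \<open>y < 1/2\<close> the larger one, \<open>1 - 2 y\<close>,
  is the coefficient of the RLP type.\<close>

lemma cubic_0: "y \<noteq> 0 \<Longrightarrow> cubic 0 y X = y^4 * X * (X + y) * (X - (1 - 2 * y))"
  unfolding cubic_def coeffs_0 cc_def by algebra

text \<open>These signs confine a root that is continuous in \<open>e\<close> and starts at \<open>- y\<close> to the strip of width \<open>1/20\<close> around \<open>- \<Omega>\<close>.\<close>

lemma cubic_barrier:
  "eventually (\<lambda>r. \<forall>e y. \<bar>e\<bar> \<le> r \<longrightarrow> 1/5 \<le> y \<longrightarrow> y \<le> 3/5 \<longrightarrow> 0 < cubic e y (1/20 - y)) (at_right 0)"
  "eventually (\<lambda>r. \<forall>e y. \<bar>e\<bar> \<le> r \<longrightarrow> 1/5 \<le> y \<longrightarrow> y \<le> 3/5 \<longrightarrow> 0 < - cubic e y (- 1/20 - y)) (at_right 0)"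
proof -
  have c: "continuous_on ({-1/100..1/100} \<times> {1/5..3/5}) (\<lambda>p. cubic (fst p) (snd p) (t - snd p))" for t
    by (rule continuous_on_cubic) auto
  have "0 < cubic 0 y (1/20 - y)" if "1/5 \<le> y" "y \<le> 3/5" for y
  proof -
    have "cubic 0 y (1/20 - y) = (y^4 * (1/20)) * ((y - 1/20) * (19/20 - y))" using that by (simp add: cubic_0) algebra
    moreover have "0 < (y^4 * (1/20)) * ((y - 1/20) * (19/20 - y))" using that by (intro mult_pos_pos) auto
    ultimately show ?thesis by simp
  qed
  then show "eventually (\<lambda>r. \<forall>e y. \<bar>e\<bar> \<le> r \<longrightarrow> 1/5 \<le> y \<longrightarrow> y \<le> 3/5 \<longrightarrow> 0 < cubic e y (1/20 - y)) (at_right 0)"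
    using coeff_tube[OF c[of "1/20"]] by simp
  have "0 < - cubic 0 y (- 1/20 - y)" if "1/5 \<le> y" "y \<le> 3/5" for y
  proof -
    have "- cubic 0 y (- 1/20 - y) = (y^4 * (1/20)) * ((y + 1/20) * (21/20 - y))" using that by (simp add: cubic_0) algebra
    moreover have "0 < (y^4 * (1/20)) * ((y + 1/20) * (21/20 - y))" using that by (intro mult_pos_pos) auto
    ultimately show ?thesis by simp
  qed
  then show "eventually (\<lambda>r. \<forall>e y. \<bar>e\<bar> \<le> r \<longrightarrow> 1/5 \<le> y \<longrightarrow> y \<le> 3/5 \<longrightarrow> 0 < - cubic e y (- 1/20 - y)) (at_right 0)"
    using coeff_tube[of "\<lambda>p. - cubic (fst p) (snd p) (- 1/20 - snd p)"] continuous_on_minus[OF c[of "- 1/20"]] by simp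
qed

lemma omega_branch_subset:
  assumes "omega_branch x \<delta> \<Omega>" "0 < r" "r \<le> \<delta>"
  shows "omega_branch x r \<Omega>"
proof -
  have sub: "{-r<..<r} \<subseteq> {-\<delta><..<\<delta>}" using assms(3) by auto
  show ?thesis
    using assms(1,2) C1_differentiable_on_subset[OF _ sub, of \<Omega>] sub unfolding omega_branch_def by blast
qed

lemma omega_branch_continuous: "omega_branch x \<delta> \<Omega> \<Longrightarrow> continuous_on {-\<delta><..<\<delta>} \<Omega>"
  unfolding omega_branch_def by (blast intro: C1_differentiable_imp_continuous_on)

text \<open>Along a sonic branch \<open>ghost\<close> is continuous and starts at
  \<open>- 1 / x\<close>, so it satisfies the definition of a ghost value on a parameter interval
  common to all \<open>x\<close> in \<open>[2, 4]\<close>.\<close>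

lemma ghost_value_exists:
  "eventually (\<lambda>\<epsilon>. \<forall>x \<omega>. 2 \<le> x \<longrightarrow> x \<le> 4 \<longrightarrow> omega_value \<epsilon> x \<omega> \<longrightarrow> ghost_value \<epsilon> x (ghost \<epsilon> \<omega>) \<and>
     0 < a3 \<epsilon> \<omega> \<and> 0 < cd \<epsilon> \<omega> + cb \<epsilon> \<omega>) (at_right 0)"
proof -
  have "eventually (\<lambda>r. 0 < r \<and> r < (1/100::real)) (at_right 0)" unfolding eventually_at_right_field by (rule exI[of _ "1/100"]) auto
  with a3_pos ghost_denom_pos have "eventually (\<lambda>r. 0 < r \<and> r < 1/100 \<and> (\<forall>e y. \<bar>e\<bar> \<le> r \<longrightarrow> 1/5 \<le> y \<longrightarrow> y \<le> 3/5 \<longrightarrow> 0 < a3 e y \<and> 0 < cd e y + cb e y)) (at_right 0)"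
    by eventually_elim simp
  from eventually_happens[OF this] obtain r where r: "0 < r" "r < 1/100"
    and pos: "\<And>e y. \<bar>e\<bar> \<le> r \<Longrightarrow> 1/5 \<le> y \<Longrightarrow> y \<le> 3/5 \<Longrightarrow> 0 < a3 e y \<and> 0 < cd e y + cb e y" by auto
  show ?thesis
    unfolding eventually_at_right_field
  proof (intro exI[of _ r] conjI allI impI r(1), goal_cases)
    fix \<epsilon> x \<omega> assume \<epsilon>: "0 < \<epsilon>" "\<epsilon> < r" and x: "2 \<le> x" "x \<le> 4" and v: "omega_value \<epsilon> x \<omega>"
    obtain \<Omega> where \<Omega>: "omega_branch x (1/100) \<Omega>" "\<And>e. \<bar>e\<bar> < 1/100 \<Longrightarrow> 1/5 < \<Omega> e \<and> \<Omega> e < 3/5"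
      by (rule omega_branch_exists[OF x], rule that)
    have br: "omega_branch x r \<Omega>" by (rule omega_branch_subset[OF \<Omega>(1)]) (use r in auto)
    have \<Omega>v: "omega_value \<epsilon> x (\<Omega> \<epsilon>)" unfolding omega_value_def using \<epsilon> br by (intro exI[of _ r] exI[of _ \<Omega>]) auto
    have "\<omega> = \<Omega> \<epsilon>"
      by (rule sonic_product_inj[of \<epsilon> \<omega> _ "1 / x^2"]) (use \<epsilon> r x omega_value_eq[OF v] omega_value_eq[OF \<Omega>v] in auto)
    have rng: "1/5 \<le> \<Omega> e" "\<Omega> e \<le> 3/5" "e \<noteq> 1" "\<Omega> e \<noteq> 0" "0 < a3 e (\<Omega> e)" "0 < cd e (\<Omega> e) + cb e (\<Omega> e)" "e < 1" if "e \<in> {-r<..<r}" for e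
    proof -
      have e: "\<bar>e\<bar> \<le> r" "\<bar>e\<bar> < 1/100" using that r by auto
      then show "1/5 \<le> \<Omega> e" "\<Omega> e \<le> 3/5" "e \<noteq> 1" "\<Omega> e \<noteq> 0" "e < 1" using \<Omega>(2)[OF e(2)] by auto
      then show "0 < a3 e (\<Omega> e)" "0 < cd e (\<Omega> e) + cb e (\<Omega> e)" using pos[OF e(1)] by auto
    qed
    define S where "S = (\<lambda>e. (e, \<Omega> e)) ` {-r<..<r}"
    have S: "fst p \<noteq> 1" "snd p \<noteq> 0" if "p \<in> S" for p using that rng unfolding S_def by auto
    have pc: "continuous_on {-r<..<r} (\<lambda>e. (e, \<Omega> e))" by (intro continuous_intros omega_branch_continuous[OF br])
    have cc: "continuous_on {-r<..<r} (\<lambda>e. f (e, \<Omega> e))" if "continuous_on S f" for f :: "real \<times> real \<Rightarrow> real"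
      by (rule continuous_on_compose2[OF that pc]) (simp add: S_def)
    have cG: "continuous_on {-r<..<r} (\<lambda>e. ghost e (\<Omega> e))"
      unfolding ghost_def
    proof (intro continuous_intros ballI)
      show "continuous_on {-r<..<r} (\<lambda>e. H0 e (\<Omega> e))" "continuous_on {-r<..<r} (\<lambda>e. cd e (\<Omega> e))" "continuous_on {-r<..<r} (\<lambda>e. cb e (\<Omega> e))"
        using cc[OF continuous_on_coeffs(1)[of S, OF S]] cc[OF continuous_on_coeffs(2)[of S, OF S]] cc[OF continuous_on_coeffs(3)[of S, OF S]] by simp_all
      fix e assume "e \<in> {-r<..<r}"
      then show "cd e (\<Omega> e) + cb e (\<Omega> e) \<noteq> 0" using rng(6)[of e] by simp
    qed
    have "\<Omega> 0 \<noteq> 0" "\<Omega> 0 = 1 / x" using rng[of 0] r \<Omega>(1) by (auto simp: omega_branch_def)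
    then have g0: "ghost 0 (\<Omega> 0) = - 1 / x" by (simp add: ghost_def coeffs_0 power2_eq_square)
    have er: "\<epsilon> \<in> {-r<..<r}" using \<epsilon> by simp
    have root: "(ghost e (\<Omega> e))^3 + a2 e (\<Omega> e) / a3 e (\<Omega> e) * (ghost e (\<Omega> e))^2 + a1 e (\<Omega> e) / a3 e (\<Omega> e) * ghost e (\<Omega> e) + a0 e (\<Omega> e) / a3 e (\<Omega> e) = 0"
      if e: "e \<in> {-r<..<r}" for e
    proof -
      have "cubic e (\<Omega> e) (ghost e (\<Omega> e)) = 0" by (rule ghost_root) (use rng[OF e] in auto)
      moreover have "cubic e (\<Omega> e) X = a3 e (\<Omega> e) * (X^3 + a2 e (\<Omega> e) / a3 e (\<Omega> e) * X^2 + a1 e (\<Omega> e) / a3 e (\<Omega> e) * X + a0 e (\<Omega> e) / a3 e (\<Omega> e))" for X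
        using rng(5)[OF e] by (simp add: cubic_def field_simps)
      ultimately show ?thesis using rng(5)[OF e] by simp
    qed
    have "ghost_value \<epsilon> x (ghost \<epsilon> (\<Omega> \<epsilon>))"
      unfolding ghost_value_def
      by (rule exI[of _ r], rule exI[of _ \<Omega>], rule exI[of _ "\<lambda>e. ghost e (\<Omega> e)"]) (use br er cG g0 root in simp)
    then show "ghost_value \<epsilon> x (ghost \<epsilon> \<omega>)" "0 < a3 \<epsilon> \<omega>" "0 < cd \<epsilon> \<omega> + cb \<epsilon> \<omega>"
      using rng(5,6)[of \<epsilon>] \<epsilon> \<open>\<omega> = \<Omega> \<epsilon>\<close> by auto
  qed
qed

lemma ghost_value_near:
  "eventually (\<lambda>\<epsilon>. \<forall>x \<omega> g. 2 \<le> x \<longrightarrow> x \<le> 4 \<longrightarrow> omega_value \<epsilon> x \<omega> \<longrightarrow> ghost_value \<epsilon> x g \<longrightarrow> \<bar>g + \<omega>\<bar> < 1/20) (at_right 0)"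
proof -
  have "eventually (\<lambda>r. 0 < r \<and> r < (1/100::real)) (at_right 0)" unfolding eventually_at_right_field by (rule exI[of _ "1/100"]) auto
  with a3_pos cubic_barrier have "eventually (\<lambda>r. 0 < r \<and> r < 1/100 \<and> (\<forall>e y. \<bar>e\<bar> \<le> r \<longrightarrow> 1/5 \<le> y \<longrightarrow> y \<le> 3/5 \<longrightarrow>
      0 < a3 e y \<and> 0 < cubic e y (1/20 - y) \<and> 0 < - cubic e y (- 1/20 - y))) (at_right 0)"
    by eventually_elim simp
  from eventually_happens[OF this] obtain r where r: "0 < r" "r < 1/100"
    and pos: "\<And>e y. \<bar>e\<bar> \<le> r \<Longrightarrow> 1/5 \<le> y \<Longrightarrow> y \<le> 3/5 \<Longrightarrow> 0 < a3 e y \<and> 0 < cubic e y (1/20 - y) \<and> 0 < - cubic e y (- 1/20 - y)" by auto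
  show ?thesis
    unfolding eventually_at_right_field
  proof (intro exI[of _ r] conjI allI impI r(1), goal_cases)
    fix \<epsilon> x \<omega> g assume \<epsilon>: "0 < \<epsilon>" "\<epsilon> < r" and x: "2 \<le> x" "x \<le> 4" and v: "omega_value \<epsilon> x \<omega>" and g: "ghost_value \<epsilon> x g"
    obtain \<delta> \<Omega> G where G: "omega_branch x \<delta> \<Omega>" "\<epsilon> \<in> {-\<delta><..<\<delta>}" "continuous_on {-\<delta><..<\<delta>} G" "G 0 = - 1 / x"
      "\<And>e. e \<in> {-\<delta><..<\<delta>} \<Longrightarrow> (G e)^3 + a2 e (\<Omega> e) / a3 e (\<Omega> e) * (G e)^2
            + a1 e (\<Omega> e) / a3 e (\<Omega> e) * G e + a0 e (\<Omega> e) / a3 e (\<Omega> e) = 0" "G \<epsilon> = g"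
      using g unfolding ghost_value_def by blast
    have \<Omega>v: "omega_value \<epsilon> x (\<Omega> \<epsilon>)" unfolding omega_value_def using \<epsilon> G by (intro exI[of _ \<delta>] exI[of _ \<Omega>]) auto
    have \<omega>: "\<omega> = \<Omega> \<epsilon>"
      by (rule sonic_product_inj[of \<epsilon> \<omega> _ "1 / x^2"]) (use \<epsilon> r x omega_value_eq[OF v] omega_value_eq[OF \<Omega>v] in auto)
    have path: "\<bar>G e + \<Omega> e\<bar> \<noteq> 1/20" if e: "0 \<le> e" "e \<le> \<epsilon>" for e
    proof -
      have ed: "e \<in> {-\<delta><..<\<delta>}" "\<bar>e\<bar> \<le> r" "e < 1/100" using e \<epsilon> r G(2) by auto
      have "0 < \<Omega> e" "H0 e (\<Omega> e) * \<Omega> e powr eta e = 1 / x^2"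
      proof -
        have "(1 + 3 * e) * y^2 + 4 * e * y + e * (e - 1) = H0 e y" for y by (simp add: H0_def power2_eq_square algebra_simps)
        moreover have "0 < \<Omega> e \<and> ((1 + 3 * e) * (\<Omega> e)^2 + 4 * e * \<Omega> e + e * (e - 1)) * \<Omega> e powr eta e = 1 / x^2"
          using G(1) ed(1) unfolding omega_branch_def by blast
        ultimately show "0 < \<Omega> e" "H0 e (\<Omega> e) * \<Omega> e powr eta e = 1 / x^2" by simp_all
      qed
      from omega_branch_range[OF e(1) ed(3) x this] have rng: "1/5 \<le> \<Omega> e" "\<Omega> e \<le> 3/5" by auto
      note p = pos[OF ed(2) rng]
      have "cubic e (\<Omega> e) (G e) = a3 e (\<Omega> e) * ((G e)^3 + a2 e (\<Omega> e) / a3 e (\<Omega> e) * (G e)^2 + a1 e (\<Omega> e) / a3 e (\<Omega> e) * G e + a0 e (\<Omega> e) / a3 e (\<Omega> e))"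
        using p by (simp add: cubic_def field_simps)
      then have "cubic e (\<Omega> e) (G e) = 0" using G(5)[OF ed(1)] by simp
      then have "G e \<noteq> 1/20 - \<Omega> e" "G e \<noteq> - 1/20 - \<Omega> e" using p by auto
      then show ?thesis by (auto simp: abs_if)
    qed
    have c0: "\<bar>G 0 + \<Omega> 0\<bar> = 0" using G(1,4) by (simp add: omega_branch_def)
    have cont: "continuous_on {0..\<epsilon>} (\<lambda>e. \<bar>G e + \<Omega> e\<bar>)"
      by (intro continuous_intros continuous_on_subset[OF G(3)] continuous_on_subset[OF omega_branch_continuous[OF G(1)]]) (use G(2) in auto)
    show "\<bar>g + \<omega>\<bar> < 1/20"
    proof (rule ccontr)
      assume "\<not> \<bar>g + \<omega>\<bar> < 1/20"
      then have "1/20 \<le> \<bar>G \<epsilon> + \<Omega> \<epsilon>\<bar>" by (simp add: G(6) \<omega>)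
      then have "\<exists>e\<ge>0. e \<le> \<epsilon> \<and> \<bar>G e + \<Omega> e\<bar> = 1/20" using c0 cont \<epsilon> by (intro IVT') auto
      then show False using path by blast
    qed
  qed
qed

section \<open>The solution at the upper end of the sonic window\<close>

lemma third_coeffs:
  fixes \<epsilon> :: real
  defines "\<omega> \<equiv> 1/3 :: real"
  defines "a \<equiv> ca \<epsilon> \<omega>" and "H \<equiv> H0 \<epsilon> \<omega>" and "b \<equiv> cb \<epsilon> \<omega>" and "d \<equiv> cd \<epsilon> \<omega>"
  defines "h \<equiv> (1 + \<epsilon>) * a" and "A \<equiv> (1 - \<epsilon>) * a"
  defines "W \<equiv> h * (A - H + h) / (d * h - b * A)"
  assumes \<epsilon>: "0 < \<epsilon>" "\<epsilon> < 1/10"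
  shows "0 < a" "0 < d * h - b * A" "0 < W" "W1_coeff \<epsilon> \<omega> (ghost \<epsilon> \<omega>) = W" "R1_coeff \<epsilon> \<omega> W = - (A / h * W)"
proof -
  have a: "a = (1 + 3 * \<epsilon>) / 9" by (simp add: a_def ca_def \<omega>_def field_simps)
  have H: "H = a * (1 + 3 * \<epsilon>)" by (simp add: H_def H0_def \<omega>_def a power2_eq_square field_simps)
  show a0: "0 < a" using \<epsilon> by (simp add: a)
  have c0: "cc \<omega> = 0" by (simp add: cc_def \<omega>_def)
  have b: "b = \<epsilon> / (1 - \<epsilon>) * (3 * H) + 2 * \<epsilon> / 3" by (simp add: b_def cb_def \<omega>_def H_def)
  have bA: "b * A = \<epsilon> * a * (3 * H + 2 * (1 - \<epsilon>) / 3)"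
    unfolding b A_def using \<epsilon> by (simp add: field_simps)
  have d: "d = (1 + 7 * \<epsilon>) / 3" by (simp add: d_def cd_def \<omega>_def field_simps)
  have h0: "0 < h" "0 < d" "0 < b" using \<epsilon> a0 by (auto simp: h_def d b H intro!: add_pos_pos mult_pos_pos divide_pos_pos)
  have "d * h - b * A = a / 3 * ((1 + 7 * \<epsilon>) * (1 + \<epsilon>) - \<epsilon> * (1 + 3 * \<epsilon>)^2 - 2 * \<epsilon> * (1 - \<epsilon>))"
    unfolding bA unfolding H d h_def unfolding a by (simp add: field_simps power2_eq_square)
  moreover have "0 < (1 + 7 * \<epsilon>) * (1 + \<epsilon>) - \<epsilon> * (1 + 3 * \<epsilon>)^2 - 2 * \<epsilon> * (1 - \<epsilon>)"
  proof -
    have "(1 + 3 * \<epsilon>)^2 \<le> 2^2" using \<epsilon> by (intro power_mono) auto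
    then have "\<epsilon> * (1 + 3 * \<epsilon>)^2 \<le> \<epsilon> * 4" using \<epsilon> by (intro mult_left_mono) auto
    moreover have "(1 + 7 * \<epsilon>) * (1 + \<epsilon>) = 1 + 8 * \<epsilon> + 7 * (\<epsilon> * \<epsilon>)" "2 * \<epsilon> * (1 - \<epsilon>) = 2 * \<epsilon> - 2 * (\<epsilon> * \<epsilon>)" by algebra+
    moreover have "0 \<le> \<epsilon> * \<epsilon>" by simp
    ultimately show ?thesis using \<epsilon> by linarith
  qed
  ultimately show D: "0 < d * h - b * A" using a0 by (simp only: mult_pos_pos divide_pos_pos zero_less_numeral)
  have "A - H + h = a * (1 - 3 * \<epsilon>)" unfolding A_def h_def H by algebra
  then show W: "0 < W" unfolding W_def using D h0 a0 \<epsilon> by (intro divide_pos_pos mult_pos_pos) auto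
  have chh: "ch \<epsilon> \<omega> = h" by (simp add: ch_def c0 h_def a_def)
  have ceh: "ce \<epsilon> \<omega> = H - h" 
  proof -
    have "\<omega> \<noteq> 0" by (simp add: \<omega>_def)
    then show ?thesis using ce_eq[of \<epsilon> \<omega>] \<epsilon> by (simp add: c0 chh H_def)
  qed
  have cfh: "cf \<epsilon> \<omega> = A - H" by (simp add: cf_def A_def a_def H_def)
  have g: "ghost \<epsilon> \<omega> = - (H / (d + b))" by (simp add: ghost_def H_def d_def b_def)
  have A3: "a3 \<epsilon> \<omega> = (d + b) * (d * h - b * A)"
    unfolding a3_def Let_def ceh cfh chh b_def[symmetric] d_def[symmetric] H_def[symmetric] a_def[symmetric] A_def[symmetric] by algebra
  have A2: "a2 \<epsilon> \<omega> = H * (d * h - b * A) - (d + b) * (h * (A - H + h))"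
    unfolding a2_def Let_def ceh cfh chh c0 b_def[symmetric] d_def[symmetric] H_def[symmetric] a_def[symmetric] A_def[symmetric] by algebra
  \<comment> \<open>With \<open>c = 0\<close> the constant coefficient vanishes, so
    \<open>Delta_Q\<close> is a perfect square and the square root in \<open>W1_coeff\<close>
    disappears.\<close>
  have A0: "a0 \<epsilon> \<omega> = 0" by (simp add: a0_def c0)
  define k where "k = d * h - b * A"
  define s where "s = d + b"
  have "0 < s" using h0 by (simp add: s_def)
  then have "a2 \<epsilon> \<omega> / a3 \<epsilon> \<omega> + ghost \<epsilon> \<omega> = - W"
    unfolding A3 A2 g W_def unfolding k_def[symmetric] s_def[symmetric] using D[folded k_def] by (simp add: diff_divide_distrib)
  then show "W1_coeff \<epsilon> \<omega> (ghost \<epsilon> \<omega>) = W" using W by (simp add: W1_coeff_def Delta_Q_def A0)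
  have Wk: "W * (d * h - b * A) = h * (A - H + h)" unfolding W_def using D by simp
  have "0 < h + b * W" using h0 W by (intro add_pos_pos mult_pos_pos) auto
  moreover have "(d * W^2 + (H - h) * W) * h = (A * W) * (h + b * W)" using Wk by algebra
  ultimately show "R1_coeff \<epsilon> \<omega> W = - (A / h * W)"
    unfolding R1_coeff_def ceh chh c0 b_def[symmetric] d_def[symmetric] using h0 by (simp add: field_simps)
qed

lemma xmax_omega_value:
  assumes \<epsilon>: "0 < \<epsilon>" "\<epsilon> < 1/100"
  shows "2 \<le> xmax \<epsilon>" "xmax \<epsilon> \<le> 4" "omega_value \<epsilon> (xmax \<epsilon>) (1/3)"
proof -
  define k where "k = H0 \<epsilon> (1/3) * (1/3) powr eta \<epsilon>"
  have H: "H0 \<epsilon> (1/3) = (1 + 3 * \<epsilon>)^2 / 9" by (simp add: H0_def power2_eq_square field_simps)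
  have H': "1^2 / 9 \<le> H0 \<epsilon> (1/3)" "H0 \<epsilon> (1/3) \<le> (3/2)^2 / 9"
    unfolding H using \<epsilon> by (intro divide_right_mono power_mono; simp)+
  \<comment> \<open>The crude bound \<open>eta \<epsilon> \<le> 1/2\<close> is enough: with
    \<open>H0\<close> between 1/9 and 1/4 it places \<open>k\<close> in \<open>[1/16, 1/4]\<close>,
    hence \<open>xm\<close> in \<open>[2, 4]\<close>, where \<open>omega_value_iff\<close>
    applies.\<close>
  have "9/16 \<le> (1/3::real) powr (1/2)"
  proof -
    have "(9/16::real)^2 \<le> 1/3" by (simp add: power2_eq_square)
    then have "(9/16::real) \<le> sqrt (1/3)" by (rule real_le_rsqrt)
    then show ?thesis by (simp add: powr_half_sqrt)
  qed
  also have "(1/3::real) powr (1/2) \<le> (1/3) powr eta \<epsilon>"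
    using eta_small[of \<epsilon>] \<epsilon> by (intro powr_mono') auto
  finally have p: "9/16 \<le> (1/3::real) powr eta \<epsilon>" .
  have p1: "(1/3::real) powr eta \<epsilon> \<le> 1" using \<epsilon> by (intro powr_le1) (auto simp: eta_def)
  have "1/9 * (9/16) \<le> k" unfolding k_def using H' p by (intro mult_mono) auto
  then have k1: "1/16 \<le> k" by simp
  have "k \<le> 1/4 * 1" unfolding k_def using H' p1 by (intro mult_mono) (auto simp: power2_eq_square)
  then have k2: "k \<le> 1/4" by simp
  define xm where "xm = 1 / sqrt k"
  have k0: "0 < k" using k1 by simp
  have s: "1/4 \<le> sqrt k" "sqrt k \<le> 1/2"
    using real_sqrt_le_mono[OF k1] real_sqrt_le_mono[OF k2] by (simp_all add: real_sqrt_divide)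
  have xm: "2 \<le> xm" "xm \<le> 4" 
  proof -
    have "0 < sqrt k" using k0 by simp
    then show "2 \<le> xm" "xm \<le> 4" unfolding xm_def using s by (simp_all add: le_divide_eq divide_le_eq)
  qed
  have v: "omega_value \<epsilon> xm (1/3)"
    unfolding omega_value_iff[OF \<epsilon> xm] k_def[symmetric] using k0 by (simp add: xm_def power_divide)
  have "x = xm" if "omega_value \<epsilon> x (1/3)" for x
  proof -
    have x: "0 < x" "k = 1 / x^2" using omega_value_eq[OF that] by (auto simp: k_def)
    then have "xm = x" unfolding xm_def by (simp add: real_sqrt_divide)
    then show ?thesis by simp
  qed
  then have "xmax \<epsilon> = xm" unfolding xmax_def using v by (intro the_equality)
  then show "2 \<le> xmax \<epsilon>" "xmax \<epsilon> \<le> 4" "omega_value \<epsilon> (xmax \<epsilon>) (1/3)" using xm v by simp_all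
qed

text \<open>At \<open>\<omega> = 1/3\<close> the data of \<open>local_rlp_solution\<close> become
  \<open>b0 = 4 a\<close> and \<open>l0 * cK = 4 l k > 0\<close>. The factor at order
  \<open>n\<close> is at least \<open>4 a - 4 a / (n + 1) \<ge> 2 a\<close>, so no order is
  resonant.\<close>

lemma rlp_third_solution:
  assumes \<epsilon>: "0 < \<epsilon>" "\<epsilon> < 1/100" and x: "0 < x" and val: "omega_value \<epsilon> x (1/3)" "ghost_value \<epsilon> x (ghost \<epsilon> (1/3))"
  shows "\<exists>y D W. 0 < y \<and> y < x \<and> rlp_extension \<epsilon> x y D W \<and> rlp_extension \<epsilon> x x D W \<and> W x = 1/3"
proof -
  define \<omega> where "\<omega> = (1/3::real)"
  define a where "a = ca \<epsilon> \<omega>"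
  define H where "H = H0 \<epsilon> \<omega>"
  define b where "b = cb \<epsilon> \<omega>"
  define d where "d = cd \<epsilon> \<omega>"
  define h where "h = (1 + \<epsilon>) * a"
  define A where "A = (1 - \<epsilon>) * a"
  define k where "k = d * h - b * A"
  define W where "W = h * (A - H + h) / k"
  define l where "l = W / (2 * h)"
  have t: "0 < a" "0 < k" "0 < W" "W1_coeff \<epsilon> \<omega> (ghost \<epsilon> \<omega>) = W" "R1_coeff \<epsilon> \<omega> W = - (A / h * W)"
    using third_coeffs[of \<epsilon>] \<epsilon>
    unfolding W_def k_def A_def h_def d_def b_def H_def a_def \<omega>_def by simp_all
  have h: "0 < h" using t \<epsilon> by (simp add: h_def)
  have l: "0 < l" using h t by (simp add: l_def)
  have Wl: "W = 2 * h * l" using h by (simp add: l_def)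
  have Rl: "- (A / h * W) = - 2 * A * l" using h by (simp add: Wl)
  have "W * k = h * (A - H + h)" unfolding W_def using t by simp
  then have "h * (2 * l * k) = h * (A - H + h)" unfolding Wl by algebra
  moreover have "h \<noteq> 0" using h by simp
  ultimately have lk: "2 * l * k = A - H + h" by (rule mult_left_cancel[THEN iffD1, rotated])
  have w3: "\<omega> = 1/3" by (simp add: \<omega>_def)
  have aw: "a = \<omega> * (\<omega> + \<epsilon>)" by (simp add: a_def ca_def)
  have w0: "0 < \<omega>" by (simp add: w3)
  have bA: "b * A = \<epsilon> * H * (\<omega> + \<epsilon>) + 2 * \<epsilon> * \<omega> * A"
  proof -
    have "b * A = (\<epsilon> / (1 - \<epsilon>) * (H / \<omega>)) * ((1 - \<epsilon>) * (\<omega> * (\<omega> + \<epsilon>))) + 2 * \<epsilon> * \<omega> * A"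
      by (simp add: b_def cb_def H_def A_def aw ring_distribs)
    also have "(\<epsilon> / (1 - \<epsilon>) * (H / \<omega>)) * ((1 - \<epsilon>) * (\<omega> * (\<omega> + \<epsilon>))) = \<epsilon> * H * (\<omega> + \<epsilon>)"
      using \<epsilon> w0 by simp
    finally show ?thesis .
  qed
  have dd: "2 * (1 - \<epsilon>) * \<omega> + 4 * \<epsilon> + 4 * \<epsilon> * \<omega> = 2 * d" by (simp add: d_def cd_def algebra_simps)
  have e1: "1 - 3 * \<omega> + 2 * (1 + \<epsilon>) * a * l = W" by (simp add: Wl h_def w3)
  have e2: "- 2 * (1 - \<epsilon>) * a * l = - (A / h * W)" unfolding Rl unfolding A_def by algebra
  have kk: "4 * k = 4 * d * h - 8 * \<epsilon> * \<omega> * A - 4 * \<epsilon> * H * (\<omega> + \<epsilon>)" unfolding k_def bA by algebra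
  have cK: "2 * d * (2 * (1 + \<epsilon>) * a) - 4 * \<epsilon> * \<omega> * (2 * (1 - \<epsilon>) * a) - 4 * \<epsilon> * H * (\<omega> + \<epsilon>) = 4 * k"
    unfolding kk h_def A_def by algebra
  have b0: "2 * d * W + 4 * \<epsilon> * \<omega> * (- (A / h * W)) - H * (4 * \<epsilon> * (\<omega> + \<epsilon>) * l - 2) = 4 * a"
  proof -
    have "2 * d * W + 4 * \<epsilon> * \<omega> * (- (A / h * W)) - H * (4 * \<epsilon> * (\<omega> + \<epsilon>) * l - 2) = l * (4 * k) + 2 * H"
      unfolding Rl unfolding kk Wl by algebra
    also have "\<dots> = 2 * (2 * l * k) + 2 * H" by algebra
    also have "\<dots> = 4 * a" unfolding lk A_def h_def by algebra
    finally show ?thesis .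
  qed
  have eq: "H * \<omega> powr eta \<epsilon> = 1 / x^2" using omega_value_eq(3)[OF val(1)] by (simp add: H_def w3)
  have "\<exists>y D W. 0 < y \<and> y < x \<and> rlp_extension \<epsilon> x y D W \<and> rlp_extension \<epsilon> x x D W \<and> W x = \<omega>"
  proof (rule local_rlp_solution[where g = "ghost \<epsilon> \<omega>" and ?l0.0 = l and ?v0.0 = H and m = "2 * a"], unfold aw[symmetric] e1 e2 dd b0 cK)
    show "H * x^2 = \<omega> powr (- eta \<epsilon>)"
    proof -
      have "H * \<omega> powr eta \<epsilon> * x^2 = 1" using eq x by simp
      then show ?thesis using w0 by (simp add: powr_minus field_simps)
    qed
    show "4 * a * l = W - - (A / h * W)" unfolding Rl unfolding Wl A_def h_def by algebra
    fix n :: nat assume n: "1 \<le> n"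
    have "4 * a / (real n + 1) \<le> 4 * a / 2" using n t by (intro divide_left_mono) auto
    moreover have "0 \<le> l * (4 * k) / (real n + 1)" using l t by (intro divide_nonneg_nonneg mult_nonneg_nonneg) auto
    ultimately have "2 * a \<le> 4 * a + (l * (4 * k) - 4 * a) / (real n + 1)" by (simp add: diff_divide_distrib)
    then show "2 * a \<le> \<bar>4 * a + (l * (4 * k) - 4 * a) / (real n + 1)\<bar>" by linarith
  qed (use \<epsilon> x t val w0 in \<open>auto simp: H_def w3\<close>)
  then show ?thesis by (simp add: w3)
qed

text \<open>At \<open>xmax\<close> the sonic value itself is 1/3, so the point
  \<open>x = xmax\<close> is a witness for \<open>X_third\<close>, provided the sonic time lies
  strictly below it; the extension of the local solution to some smaller \<open>y\<close> ensures
  that.\<close>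

lemma xbar_window:
  "eventually (\<lambda>\<epsilon>. \<forall>\<delta>0. 2 + \<delta>0 < xmax \<epsilon> \<longrightarrow> 2 + \<delta>0 \<le> xbar \<delta>0 \<epsilon> \<and> xbar \<delta>0 \<epsilon> \<le> xmax \<epsilon>) (at_right 0)"
proof -
  have "eventually (\<lambda>r. 0 < r \<and> r < (1/100::real)) (at_right 0)" unfolding eventually_at_right_field by (rule exI[of _ "1/100"]) auto
  with ghost_value_exists show ?thesis
  proof eventually_elim
    case (elim \<epsilon>)
    then have \<epsilon>: "0 < \<epsilon>" "\<epsilon> < 1/100" by auto
    note xm = xmax_omega_value[OF \<epsilon>]
    have g: "ghost_value \<epsilon> (xmax \<epsilon>) (ghost \<epsilon> (1/3))" using elim xm by blast
    show ?case
    proof (intro allI impI)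
      fix \<delta>0 assume \<delta>0: "2 + \<delta>0 < xmax \<epsilon>"
      have x0: "0 < xmax \<epsilon>" using xm by simp
      obtain y D W where y: "0 < y" "y < xmax \<epsilon>" "rlp_extension \<epsilon> (xmax \<epsilon>) y D W" "rlp_extension \<epsilon> (xmax \<epsilon>) (xmax \<epsilon>) D W" "W (xmax \<epsilon>) = 1/3"
        using rlp_third_solution[OF \<epsilon> x0 xm(3) g] by blast
      define S where "S = {x. 0 < x \<and> x \<le> xmax \<epsilon> \<and> (\<exists>D W. rlp_extension \<epsilon> (xmax \<epsilon>) x D W)}"
      have "y \<in> S" unfolding S_def using y(1,2) y(3) by auto
      moreover have "bdd_below S" by (rule bdd_belowI[of _ 0]) (simp add: S_def)
      ultimately have "sonic_time \<epsilon> (xmax \<epsilon>) \<le> y" unfolding sonic_time_def S_def[symmetric] by (rule cInf_lower)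
      then have "xmax \<epsilon> \<in> {sonic_time \<epsilon> (xmax \<epsilon>)<..xmax \<epsilon>}" using y(2) by simp
      moreover have "\<exists>D W. rlp_extension \<epsilon> (xmax \<epsilon>) (xmax \<epsilon>) D W \<and> W (xmax \<epsilon>) = 1/3" using y(4,5) by blast
      moreover have "xmax \<epsilon> \<in> {2 + \<delta>0..xmax \<epsilon>}" using \<delta>0 by simp
      ultimately have third: "xmax \<epsilon> \<in> X_third \<delta>0 \<epsilon>" unfolding X_third_def by blast
      have mem: "xmax \<epsilon> \<in> X_set \<delta>0 \<epsilon>" unfolding X_set_def using third \<delta>0 by auto
      have low: "2 + \<delta>0 \<le> x" if "x \<in> X_set \<delta>0 \<epsilon>" for x using that unfolding X_set_def by auto
      have "2 + \<delta>0 \<le> xbar \<delta>0 \<epsilon>" unfolding xbar_def by (rule cInf_greatest) (use mem low in auto)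
      moreover have "xbar \<delta>0 \<epsilon> \<le> xmax \<epsilon>" unfolding xbar_def
        by (rule cInf_lower[OF mem]) (rule bdd_belowI[of _ "2 + \<delta>0"], rule low)
      ultimately show "2 + \<delta>0 \<le> xbar \<delta>0 \<epsilon> \<and> xbar \<delta>0 \<epsilon> \<le> xmax \<epsilon>" by simp
    qed
  qed
qed

section \<open>From the sonic point to the far field\<close>

text \<open>The derivative of \<open>outer_flow.N\<close> at the sonic point, multiplied by \<open>x\<^sub>*\<close>, when \<open>W\<close> has first Taylor coefficient \<open>X\<close>.\<close>

definition slope :: "real \<Rightarrow> real \<Rightarrow> real \<Rightarrow> real" where
  "slope e y X = (let R = R1_coeff e y X; H = H0 e y in
     R * ((1 + 4 * e) * y^2 + 2 * e * y + e^2) + y * (2 * (1 + 4 * e) * y * X + 2 * e * X)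
     - X * (H + e * (1 - y)^2) - y * (H * (- eta e * R / y - 2) - 2 * e * (1 - y) * X))"

lemma has_fps_expansion_deriv_at:
  fixes f :: "real \<Rightarrow> real"
  assumes "(\<lambda>t. f (x * (1 + t))) has_fps_expansion F" "0 < x"
  shows "f x = fps_nth F 0" "(f has_real_derivative fps_nth F 1 / x) (at x)"
proof -
  have at0: "g 0 = fps_nth G 0" if "g has_fps_expansion G" for g :: "real \<Rightarrow> real" and G
    using that eventually_nhds_x_imp_x[of "\<lambda>z. eval_fps G z = g z" 0] by (auto simp: has_fps_expansion_def eval_fps_at_0)
  show "f x = fps_nth F 0" using at0[OF assms(1)] by simp
  have "((\<lambda>t. f (x * (1 + t))) has_real_derivative fps_nth F 1) (at 0)"
    using eventually_nhds_x_imp_x[OF has_fps_expansion_imp_DERIV[OF assms(1)]] at0[OF has_fps_expansion_deriv[OF assms(1)]] by simp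
  then have "((\<lambda>t. f (x * (1 + t))) has_real_derivative fps_nth F 1) (at (x / x - 1))" using assms(2) by simp
  moreover have "((\<lambda>y. y / x - 1) has_real_derivative 1 / x) (at x)" using assms(2) by (auto intro!: derivative_eq_intros)
  ultimately have "((\<lambda>y. f (x * (1 + (y / x - 1)))) has_real_derivative fps_nth F 1 * (1 / x)) (at x)"
    by (rule DERIV_chain2[where f = "\<lambda>t. f (x * (1 + t))" and g = "\<lambda>y. y / x - 1"])
  moreover have "x * (1 + (y / x - 1)) = y" for y using assms(2) by simp
  ultimately show "(f has_real_derivative fps_nth F 1 / x) (at x)" by simp
qed

text \<open>With \<open>y = x powr (1 / (1 + \<eta>))\<close> one has
  \<open>D = E / y\<^sup>2\<close>, \<open>W = 1 - V / y\<close> and \<open>D powr (- \<eta>) /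
  x\<^sup>2 = E powr (- \<eta>) / y\<^sup>2\<close>, where \<open>E\<close> and \<open>V\<close>
  converge. The powers of \<open>y\<close> cancel in both ratios.\<close>

lemma limits_far_field:
  fixes D W :: "real \<Rightarrow> real"
  assumes \<eta>: "0 < \<eta>" and D: "\<And>x. 0 < x \<Longrightarrow> 0 < D x"
    and d2: "((\<lambda>x. x powr (2 / (1 + \<eta>)) * D x) \<longlongrightarrow> d2) at_top" "0 < d2"
    and w1: "((\<lambda>x. - (x powr (1 / (1 + \<eta>)) * (1 - W x))) \<longlongrightarrow> w1) at_top"
  shows "(W \<longlongrightarrow> 1) at_top" "(D \<longlongrightarrow> 0) at_top" "((\<lambda>x. D x powr (- \<eta>) / x^2) \<longlongrightarrow> 0) at_top"
    "((\<lambda>x. (1 - W x) / sqrt (D x powr (- \<eta>) / x^2)) \<longlongrightarrow> - w1 * d2 powr (\<eta> / 2)) at_top"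
    "((\<lambda>x. W x * D x / (D x powr (- \<eta>) / x^2)) \<longlongrightarrow> d2 powr (1 + \<eta>)) at_top"
proof -
  define y where "y x = x powr (1 / (1 + \<eta>))" for x :: real
  define E where "E x = x powr (2 / (1 + \<eta>)) * D x" for x
  define V where "V x = y x * (1 - W x)" for x
  have E: "(E \<longlongrightarrow> d2) at_top" unfolding E_def[abs_def] by (rule d2(1))
  have V: "(V \<longlongrightarrow> - w1) at_top" using tendsto_minus[OF w1] by (simp add: V_def[abs_def] y_def)
  have ylim: "((\<lambda>x. 1 / y x) \<longlongrightarrow> 0) at_top"
  proof -
    have "((\<lambda>x::real. x powr (- (1 / (1 + \<eta>)))) \<longlongrightarrow> 0) at_top"
      by (rule tendsto_neg_powr[OF _ filterlim_ident]) (use \<eta> in simp)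
    then show ?thesis by (simp add: y_def powr_minus_divide)
  qed
  have rel: "0 < y x" "0 < E x" "D x = E x * (1 / y x)^2" "W x = 1 - V x * (1 / y x)"
    "D x powr (- \<eta>) / x^2 = E x powr (- \<eta>) * (1 / y x)^2" if x: "0 < x" for x
  proof -
    show y: "0 < y x" "0 < E x" using x D[OF x] by (simp_all add: y_def E_def)
    have y2: "x powr (2 / (1 + \<eta>)) = (y x)^2" using x by (simp add: y_def power2_eq_square powr_add[symmetric])
    show DE: "D x = E x * (1 / y x)^2" unfolding E_def y2 using y by (simp add: power2_eq_square)
    show "W x = 1 - V x * (1 / y x)" using y by (simp add: V_def)
    have xy: "x = y x powr (1 + \<eta>)" using x \<eta> by (simp add: y_def powr_powr)
    have "D x powr (- \<eta>) = E x powr (- \<eta>) * ((1 / y x)^2) powr (- \<eta>)" unfolding DE by (rule powr_mult)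
    also have "((1 / y x)^2) powr (- \<eta>) = y x powr (2 * \<eta>)"
      using y by (simp add: powr_divide powr_minus power_divide powr_powr powr_numeral[symmetric] del: powr_numeral)
    finally have Dp: "D x powr (- \<eta>) = E x powr (- \<eta>) * y x powr (2 * \<eta>)" .
    have x2: "x^2 = y x powr (2 + 2 * \<eta>)" by (subst xy) (simp add: power2_eq_square powr_add[symmetric])
    have "y x powr (2 * \<eta>) / y x powr (2 + 2 * \<eta>) = (1 / y x)^2"
      using y by (simp add: powr_add power_divide)
    then show "D x powr (- \<eta>) / x^2 = E x powr (- \<eta>) * (1 / y x)^2" unfolding Dp x2 by (metis times_divide_eq_right)
  qed
  have ev: "eventually (\<lambda>x. f x = g x) at_top" if "\<And>x. 0 < x \<Longrightarrow> f x = g x" for f g :: "real \<Rightarrow> real"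
    using eventually_gt_at_top[of 0] by eventually_elim (rule that)
  note lims = E V ylim
  have "((\<lambda>x. 1 - V x * (1 / y x)) \<longlongrightarrow> 1 - (- w1) * 0) at_top" by (intro tendsto_intros lims)
  moreover have "eventually (\<lambda>x. 1 - V x * (1 / y x) = W x) at_top" by (rule ev) (simp add: rel)
  ultimately show Wl: "(W \<longlongrightarrow> 1) at_top" by (simp add: Lim_transform_eventually)
  have "((\<lambda>x. E x * (1 / y x)^2) \<longlongrightarrow> d2 * 0^2) at_top" by (intro tendsto_intros lims)
  moreover have "eventually (\<lambda>x. E x * (1 / y x)^2 = D x) at_top" by (rule ev) (simp add: rel)
  ultimately show "(D \<longlongrightarrow> 0) at_top" by (simp add: Lim_transform_eventually)
  have "((\<lambda>x. E x powr (- \<eta>) * (1 / y x)^2) \<longlongrightarrow> d2 powr (- \<eta>) * 0^2) at_top" using d2(2) by (intro tendsto_intros lims) auto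
  moreover have "eventually (\<lambda>x. E x powr (- \<eta>) * (1 / y x)^2 = D x powr (- \<eta>) / x^2) at_top" by (rule ev) (rule rel(5)[symmetric])
  ultimately show "((\<lambda>x. D x powr (- \<eta>) / x^2) \<longlongrightarrow> 0) at_top" by (simp add: Lim_transform_eventually)
  have "((\<lambda>x. V x * E x powr (\<eta> / 2)) \<longlongrightarrow> - w1 * d2 powr (\<eta> / 2)) at_top" using d2(2) by (intro tendsto_intros lims) auto
  moreover have "eventually (\<lambda>x. V x * E x powr (\<eta> / 2) = (1 - W x) / sqrt (D x powr (- \<eta>) / x^2)) at_top"
  proof (rule ev)
    fix x :: real assume x: "0 < x"
    note r = rel[OF x]
    have sq: "sqrt (D x powr (- \<eta>) / x^2) = E x powr (- \<eta> / 2) * (1 / y x)"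
      unfolding r(5) using r(1,2) by (simp add: real_sqrt_mult powr_half_sqrt[symmetric] powr_powr)
    then show "V x * E x powr (\<eta> / 2) = (1 - W x) / sqrt (D x powr (- \<eta>) / x^2)"
      unfolding sq V_def using r(1,2) by (simp add: powr_minus field_simps)
  qed
  ultimately show "((\<lambda>x. (1 - W x) / sqrt (D x powr (- \<eta>) / x^2)) \<longlongrightarrow> - w1 * d2 powr (\<eta> / 2)) at_top"
    by (rule Lim_transform_eventually)
  have "((\<lambda>x. W x * E x powr (1 + \<eta>)) \<longlongrightarrow> 1 * d2 powr (1 + \<eta>)) at_top" using d2(2) by (intro tendsto_intros lims Wl) auto
  moreover have "eventually (\<lambda>x. W x * E x powr (1 + \<eta>) = W x * D x / (D x powr (- \<eta>) / x^2)) at_top"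
  proof (rule ev)
    fix x :: real assume x: "0 < x"
    note r = rel[OF x]
    show "W x * E x powr (1 + \<eta>) = W x * D x / (D x powr (- \<eta>) / x^2)"
      unfolding r(5) unfolding r(3) using r(1,2) by (simp add: powr_add powr_minus field_simps)
  qed
  ultimately show "((\<lambda>x. W x * D x / (D x powr (- \<eta>) / x^2)) \<longlongrightarrow> d2 powr (1 + \<eta>)) at_top"
    by (simp add: Lim_transform_eventually)
qed

text \<open>At the sonic point \<open>N\<close> vanishes by the definition of \<open>H0\<close>, and
  its derivative is \<open>slope\<close> divided by \<open>x\<^sub>*\<close>; a positive slope
  therefore starts the estimates of \<open>outer_flow\<close>. It is demanded for all admissible
  \<open>\<omega>\<close> and \<open>g\<close>, because a germ only asserts that some pair belongs
  to it.\<close>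

lemma rlp_global_limits:
  assumes \<epsilon>: "0 < \<epsilon>" "\<epsilon> \<le> 1/10" and sol: "rlp_global \<epsilon> xs D W"
    and d2: "((\<lambda>x. x powr (2 / (1 + eta \<epsilon>)) * D x) \<longlongrightarrow> d2) at_top" "0 < d2"
    and w1: "((\<lambda>x. - (x powr (1 / (1 + eta \<epsilon>)) * (1 - W x))) \<longlongrightarrow> w1) at_top"
    and slope: "\<And>\<omega> g. omega_value \<epsilon> xs \<omega> \<Longrightarrow> ghost_value \<epsilon> xs g \<Longrightarrow> \<omega> < 1 \<and> 0 < slope \<epsilon> \<omega> (W1_coeff \<epsilon> \<omega> g)"
  shows "\<exists>\<omega>. omega_value \<epsilon> xs \<omega> \<and> (1 - \<omega>) / sqrt (H0 \<epsilon> \<omega>) \<le> - w1 * d2 powr (eta \<epsilon> / 2) \<and>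
    \<omega>^2 / H0 \<epsilon> \<omega> * exp (1 - \<omega>) \<le> d2 powr (1 + eta \<epsilon>)"
proof -
  define \<eta> where "\<eta> = eta \<epsilon>"
  have \<eta>: "0 < \<eta>" "\<eta> * (1 - \<epsilon>) = 2 * \<epsilon>" using \<epsilon> by (auto simp: \<eta>_def eta_def)
  obtain R V \<omega> g where RV: "omega_value \<epsilon> xs \<omega>" "ghost_value \<epsilon> xs g"
    "fps_nth R 0 = \<omega>" "fps_nth V 0 = \<omega>" "fps_nth V 1 = W1_coeff \<epsilon> \<omega> g" "fps_nth R 1 = R1_coeff \<epsilon> \<omega> (fps_nth V 1)"
    "(\<lambda>t. D (xs * (1 + t))) has_fps_expansion R" "(\<lambda>t. W (xs * (1 + t))) has_fps_expansion V"
    using sol unfolding rlp_global_def rlp_germ_def rlp_series_def by blast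
  have xs: "0 < xs" "0 < \<omega>" "H0 \<epsilon> \<omega> * \<omega> powr \<eta> = 1 / xs^2" using omega_value_eq[OF RV(1)] by (simp_all add: \<eta>_def)
  define X where "X = W1_coeff \<epsilon> \<omega> g"
  define R1 where "R1 = R1_coeff \<epsilon> \<omega> X"
  define H where "H = H0 \<epsilon> \<omega>"
  have \<omega>1: "\<omega> < 1" and sl: "0 < slope \<epsilon> \<omega> X" using slope[OF RV(1,2)] by (auto simp: X_def)
  have D0: "D xs = \<omega>" "(D has_real_derivative R1 / xs) (at xs)"
    using has_fps_expansion_deriv_at[OF RV(7) xs(1)] RV(3,5,6) by (simp_all add: R1_def X_def)
  have W0: "W xs = \<omega>" "(W has_real_derivative X / xs) (at xs)"
    using has_fps_expansion_deriv_at[OF RV(8) xs(1)] RV(4,5) by (simp_all add: X_def)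
  have Hp: "0 < H" using xs by (simp add: H_def zero_less_mult_iff) (metis not_less powr_non_neg zero_less_divide_1_iff zero_less_mult_iff zero_less_power)
  define v where "v x = D x powr (- \<eta>) / x^2" for x
  define K where "K x = (W x + \<epsilon>)^2 - \<epsilon> * (W x - 1)^2 + 4 * \<epsilon> * D x * W x - v x" for x
  have vH: "v xs = H"
  proof -
    have "H * xs^2 * \<omega> powr \<eta> = 1" using xs(1,3) by (simp add: H_def field_simps)
    then show ?thesis using xs(1,2) by (simp add: v_def D0 powr_minus field_simps)
  qed
  have Dp: "0 < D x" if "0 < x" for x using sol that by (simp add: rlp_global_def)
  have Bn: "ss_B \<epsilon> x (D x) (W x) \<noteq> 0" and ode: "ss_ode \<epsilon> D W x UNIV" if "xs < x" for x
    using sol that xs(1) by (auto simp: rlp_global_def)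
  have vp: "0 < v x" if "0 < x" for x using Dp[OF that] that by (simp add: v_def)
  have BK: "ss_B \<epsilon> x (D x) (W x) = - (K x * x^2)" if "0 < x" for x
    using that by (simp add: ss_B_def K_def v_def \<eta>_def algebra_simps)
  have dv: "(v has_real_derivative v x * (- \<eta> * D' / D x - 2 / x)) (at x)" if "0 < x" "(D has_real_derivative D') (at x)" for x D'
  proof -
    have "((\<lambda>x. D x powr (- \<eta>)) has_real_derivative D x powr (- \<eta>) * (0 * ln (D x) + D' * (- \<eta>) / D x)) (at x)"
      by (rule DERIV_powr[where f = "\<lambda>_. - \<eta>" and g = D and r = 0, OF that(2) Dp[OF that(1)] DERIV_const])
    from DERIV_divide[OF this DERIV_pow[of 2]] that(1)
    show ?thesis unfolding v_def[abs_def] by (rule_tac DERIV_cong) (auto simp: field_simps power2_eq_square)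
  qed
  have K0: "K x \<noteq> 0" if "xs < x" for x using Bn[OF that] BK[of x] that xs(1) by auto
  have DW: "(D has_real_derivative - (2 * (1 - \<epsilon>) * D x * (W x + \<epsilon>) * ((W x - D x) / K x)) / x) (at x)"
    "(W has_real_derivative (1 - 3 * W x + 2 * (1 + \<epsilon>) * W x * (W x + \<epsilon>) * ((W x - D x) / K x)) / x) (at x)" if x: "xs < x" for x
  proof -
    have x0: "0 < x" using x xs(1) by simp
    note ode[OF x, unfolded ss_ode_def BK[OF x0]]
    moreover have "- (2 * x * (1 - \<epsilon>) * D x * (W x + \<epsilon>) * (D x - W x) / - (K x * x^2)) = - (2 * (1 - \<epsilon>) * D x * (W x + \<epsilon>) * ((W x - D x) / K x)) / x"
      using x0 K0[OF x] by (simp add: divide_simps) algebra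
    moreover have "(1 - 3 * W x) / x + 2 * x * (1 + \<epsilon>) * W x * (W x + \<epsilon>) * (D x - W x) / - (K x * x^2)
        = (1 - 3 * W x + 2 * (1 + \<epsilon>) * W x * (W x + \<epsilon>) * ((W x - D x) / K x)) / x"
      using x0 K0[OF x] by (simp add: divide_simps) algebra
    ultimately show "(D has_real_derivative - (2 * (1 - \<epsilon>) * D x * (W x + \<epsilon>) * ((W x - D x) / K x)) / x) (at x)"
      "(W has_real_derivative (1 - 3 * W x + 2 * (1 + \<epsilon>) * W x * (W x + \<epsilon>) * ((W x - D x) / K x)) / x) (at x)" by simp_all
  qed
  have dv': "(v has_real_derivative v x * (4 * \<epsilon> * (W x + \<epsilon>) * ((W x - D x) / K x) - 2) / x) (at x)" if x: "xs < x" for x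
  proof -
    have x0: "0 < x" using x xs(1) by simp
    define l where "l = (W x - D x) / K x"
    have "- \<eta> * (- (2 * (1 - \<epsilon>) * D x * (W x + \<epsilon>) * l) / x) / D x = 2 * (\<eta> * (1 - \<epsilon>)) * (W x + \<epsilon>) * l / x"
      using Dp[OF x0] x0 by (simp add: field_simps)
    then have "v x * (- \<eta> * (- (2 * (1 - \<epsilon>) * D x * (W x + \<epsilon>) * l) / x) / D x - 2 / x) = v x * (4 * \<epsilon> * (W x + \<epsilon>) * l - 2) / x"
      unfolding \<eta>(2) by (simp add: diff_divide_distrib right_diff_distrib)
    with dv[OF x0 DW(1)[OF x]] show ?thesis unfolding l_def[symmetric] by simp
  qed
  note far = limits_far_field[OF \<eta>(1) Dp, OF _ d2(1)[folded \<eta>_def] d2(2) w1[folded \<eta>_def]]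
  note far' = far(3-5)[folded v_def]
  have "((\<lambda>x. (W x + \<epsilon>)^2 - \<epsilon> * (W x - 1)^2 + 4 * \<epsilon> * D x * W x - v x) \<longlongrightarrow> (1 + \<epsilon>)^2 - \<epsilon> * (1 - 1)^2 + 4 * \<epsilon> * 0 * 1 - 0) at_top"
    by (intro tendsto_intros far far')
  then have "(K \<longlongrightarrow> (1 + \<epsilon>)^2) at_top" by (simp add: K_def[abs_def])
  moreover have "0 < (1 + \<epsilon>)^2" using \<epsilon> by simp
  ultimately have Kev: "eventually (\<lambda>x. 0 < K x) at_top" by (rule order_tendstoD)
  have Kc: "isCont K x" if "xs < x" for x
    unfolding K_def[abs_def] by (intro continuous_intros DERIV_isCont[OF DW(1)[OF that]] DERIV_isCont[OF DW(2)[OF that]] DERIV_isCont[OF dv'[OF that]])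
  \<comment> \<open>\<open>K\<close> has no zero beyond the sonic point and tends to
    \<open>(1 + \<epsilon>)\<^sup>2\<close> at infinity, which fixes its sign on the whole
    half-line.\<close>
  have Kp: "0 < K x" if x: "xs < x" for x
  proof (rule ccontr)
    assume "\<not> 0 < K x"
    obtain z where z: "x < z" "0 < K z"
      using eventually_happens[OF eventually_conj[OF Kev eventually_gt_at_top[of x]]] by auto
    have "\<exists>y\<ge>x. y \<le> z \<and> K y = 0"
      by (rule IVT) (use \<open>\<not> 0 < K x\<close> z x Kc in auto)
    then show False using K0 x by force
  qed
  have c: "isCont D xs" "isCont W xs" "isCont v xs"
    using DERIV_isCont[OF D0(2)] DERIV_isCont[OF W0(2)] DERIV_isCont[OF dv[OF xs(1) D0(2)]] by auto
  have right: "(f \<longlongrightarrow> f xs) (at_right xs)" if "isCont f xs" for f :: "real \<Rightarrow> real"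
    using that unfolding isCont_def by (rule tendsto_within_subset) simp
  interpret outer_flow \<epsilon> xs \<omega> "(1 - \<omega>) / sqrt H" "\<omega>^2 / H" D W v K
  proof
    let ?N = "\<lambda>x. D x * ((1 + 4 * \<epsilon>) * (W x)^2 + 2 * \<epsilon> * W x + \<epsilon>^2) - W x * (v x + \<epsilon> * (1 - W x)^2)"
    have "(?N has_real_derivative slope \<epsilon> \<omega> X / xs) (at xs)"
      by (rule derivative_eq_intros D0(2) W0(2) dv[OF xs(1) D0(2)] refl)+
        (use xs(1,2) in \<open>simp add: D0(1) W0(1) vH slope_def Let_def R1_def[symmetric] H_def[symmetric] \<eta>_def[symmetric] field_simps power2_eq_square\<close>)
    moreover have N0: "?N xs = 0"
      unfolding D0(1) W0(1) vH H_def H0_def by algebra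
    moreover have "0 < slope \<epsilon> \<omega> X / xs" using sl xs(1) by simp
    ultimately obtain \<delta> where "0 < \<delta>" "\<And>h. 0 < h \<Longrightarrow> h < \<delta> \<Longrightarrow> 0 < ?N (xs + h)"
      using DERIV_pos_inc_right[of ?N "slope \<epsilon> \<omega> X / xs" xs] unfolding N0 by blast
    then have "?N y > 0" if "xs < y" "y < xs + \<delta>" for y using that by (force dest: spec[of _ "y - xs"])
    then show "eventually (\<lambda>x. 0 < ?N x) (at_right xs)"
      unfolding eventually_at_right_field using \<open>0 < \<delta>\<close> by (intro exI[of _ "xs + \<delta>"]) auto
    have "((\<lambda>x. (1 - W x) / sqrt (v x)) \<longlongrightarrow> (1 - W xs) / sqrt (v xs)) (at_right xs)"
      by (intro tendsto_intros right c) (use vH Hp in simp)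
    then show "((\<lambda>x. (1 - W x) / sqrt (v x)) \<longlongrightarrow> (1 - \<omega>) / sqrt H) (at_right xs)" by (simp add: vH W0)
    have "((\<lambda>x. W x * D x / v x) \<longlongrightarrow> W xs * D xs / v xs) (at_right xs)"
      by (intro tendsto_intros right c) (use vH Hp in simp)
    then show "((\<lambda>x. W x * D x / v x) \<longlongrightarrow> \<omega>^2 / H) (at_right xs)" by (simp add: vH W0 D0 power2_eq_square)
    show "(W \<longlongrightarrow> \<omega>) (at_right xs)" using right[OF c(2)] by (simp add: W0)
  qed (use \<epsilon> xs Hp \<omega>1 Dp vp Kp DW dv' in \<open>auto simp: K_def\<close>)
  have "(1 - \<omega>) / sqrt H \<le> - w1 * d2 powr (\<eta> / 2)" "\<omega>^2 / H * exp (1 - \<omega>) \<le> d2 powr (1 + \<eta>)"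
    using limits_at_infinity[OF far'(2,3)] d2(2) by simp_all
  then show ?thesis using RV(1) by (auto simp: H_def \<eta>_def)
qed

text \<open>The factor \<open>X + y\<close> vanishes for the ghost slope \<open>- y\<close>.
  Selecting the other branch of the cubic is what makes \<open>N\<close> grow from the sonic
  point.\<close>

lemma slope_0: "0 < y \<Longrightarrow> slope 0 y X = y * (X + y) * (1 - y - X)"
proof -
  assume y: "0 < y"
  define R where "R = R1_coeff 0 y X"
  have "R * y^2 = - (y * X^2 + cc y * y * X + cc y * y^2)"
    using y by (simp add: R_def R1_coeff_def coeffs_0)
  moreover have "slope 0 y X = R * y^2 + y * (2 * y * X) - X * y^2 - y * (y^2 * (- 2))"
    using y unfolding slope_def Let_def R_def[symmetric] by (simp add: coeffs_0 eta_def)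
  ultimately show ?thesis unfolding cc_def by algebra
qed

text \<open>On this box the three factors in \<open>slope_0\<close> are at least 1/4, 3/20 and 1/20,
  and compactness carries the sign to small \<open>e\<close>. The denominator of
  \<open>R1_coeff\<close> is treated first, since continuity of \<open>slope\<close> depends on
  it.\<close>

lemma slope_pos:
  "eventually (\<lambda>r. \<forall>e y X. \<bar>e\<bar> \<le> r \<longrightarrow> 1/4 \<le> y \<longrightarrow> y \<le> 1/2 \<longrightarrow> - 1/10 \<le> X \<longrightarrow> X \<le> 9/20 \<longrightarrow> 0 < slope e y X) (at_right 0)"
proof -
  define S where "S = {1/4..1/2::real} \<times> {- 1/10..9/20::real}"
  have S: "compact S" unfolding S_def by (intro compact_Times compact_Icc)
  have pair: "continuous_on U (\<lambda>p. f (fst p) (fst (snd p)))"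
    if "\<And>T. (\<And>p. p \<in> T \<Longrightarrow> fst p \<noteq> 1) \<Longrightarrow> (\<And>p. p \<in> T \<Longrightarrow> snd p \<noteq> 0) \<Longrightarrow> continuous_on T (\<lambda>p. f (fst p) (snd p))"
      "U \<subseteq> {-1/100..1/100} \<times> S" for f :: "real \<Rightarrow> real \<Rightarrow> real" and U
  proof -
    define T where "T = {- 1/100..1/100::real} \<times> {1/4..1/2::real}"
    have "continuous_on T (\<lambda>p. f (fst p) (snd p))" by (rule that(1)) (auto simp: T_def)
    moreover have "continuous_on U (\<lambda>p. (fst p, fst (snd p)))" by (intro continuous_intros)
    moreover have "(\<lambda>p. (fst p, fst (snd p))) ` U \<subseteq> T" using that(2) unfolding T_def S_def by auto
    ultimately have "continuous_on U (\<lambda>p. (\<lambda>p. f (fst p) (snd p)) (fst p, fst (snd p)))" by (rule continuous_on_compose2)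
    then show ?thesis by simp
  qed
  note co = pair[where f = H0, OF continuous_on_coeffs(1)] pair[where f = cd, OF continuous_on_coeffs(2)]
    pair[where f = cb, OF continuous_on_coeffs(3)] pair[where f = ce, OF continuous_on_coeffs(5)]
    pair[where f = "\<lambda>e. cc", OF continuous_on_coeffs(6)] pair[where f = ch, OF continuous_on_coeffs'(2)]
  have "\<exists>r>0. r \<le> 1/100 \<and> (\<forall>e y. \<bar>e\<bar> \<le> r \<longrightarrow> y \<in> S \<longrightarrow> 0 < (\<lambda>p. ch (fst p) (fst (snd p)) + cb (fst p) (fst (snd p)) * snd (snd p)) (e, y))"
  proof (rule compact_tube[OF S])
    show "continuous_on ({- (1/100)..1/100} \<times> S) (\<lambda>p. ch (fst p) (fst (snd p)) + cb (fst p) (fst (snd p)) * snd (snd p))"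
      by (intro continuous_intros co; simp)
  qed (auto simp: S_def coeffs_0)
  then obtain c where c: "0 < c" "c \<le> 1/100"
    "\<And>e y. \<bar>e\<bar> \<le> c \<Longrightarrow> y \<in> S \<Longrightarrow> 0 < ch e (fst y) + cb e (fst y) * snd y" by auto
  have sub: "{-c..c} \<times> S \<subseteq> {-1/100..1/100} \<times> S" using c(2) by auto
  have R: "continuous_on ({-c..c} \<times> S) (\<lambda>p. R1_coeff (fst p) (fst (snd p)) (snd (snd p)))"
    unfolding R1_coeff_def
  proof (intro continuous_intros co sub ballI)
    fix p assume "p \<in> {-c..c} \<times> S"
    then show "ch (fst p) (fst (snd p)) + cb (fst p) (fst (snd p)) * snd (snd p) \<noteq> 0"
      using c(3)[of "fst p" "snd p"] by (auto simp: abs_le_iff)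
  qed
  have "eventually (\<lambda>r. \<forall>e y. \<bar>e\<bar> \<le> r \<longrightarrow> y \<in> S \<longrightarrow> 0 < (\<lambda>p. slope (fst p) (fst (snd p)) (snd (snd p))) (e, y)) (at_right 0)"
  proof (rule eventually_tube[OF S c(1)])
    have ne: "p \<in> {-c..c} \<times> S \<Longrightarrow> fst p \<noteq> 1 \<and> fst (snd p) \<noteq> 0" for p using c unfolding S_def by auto
    show "continuous_on ({-c..c} \<times> S) (\<lambda>p. slope (fst p) (fst (snd p)) (snd (snd p)))"
      unfolding slope_def Let_def eta_def by (intro continuous_intros co sub R ballI) (use ne in auto)
    fix y assume y: "y \<in> S"
    then have "slope 0 (fst y) (snd y) = fst y * (snd y + fst y) * (1 - fst y - snd y)" by (intro slope_0) (auto simp: S_def)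
    also have "0 < \<dots>" using y by (intro mult_pos_pos) (auto simp: S_def)
    finally show "0 < slope (fst (0, y)) (fst (snd (0, y))) (snd (snd (0, y)))" by simp
  qed
  then show ?thesis by eventually_elim (simp add: S_def)
qed

text \<open>At \<open>e = 0\<close> one has \<open>a2 = cc y * a3\<close> and \<open>a0 = 0\<close>.
  The tolerances are relative to \<open>a3\<close> because only the quotients by \<open>a3\<close>
  enter \<open>W1_coeff\<close>.\<close>

lemma cubic_coeff_near:
  "eventually (\<lambda>r. \<forall>e y. \<bar>e\<bar> \<le> r \<longrightarrow> 1/5 \<le> y \<longrightarrow> y \<le> 3/5 \<longrightarrow>
     0 < a3 e y \<and> \<bar>a2 e y - cc y * a3 e y\<bar> < 1/50 * a3 e y \<and> \<bar>a0 e y\<bar> < 1/50000 * a3 e y) (at_right 0)"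
proof -
  note c = continuous_on_cubic_coeffs continuous_on_coeffs(6)
  have "eventually (\<lambda>r. \<forall>e y. \<bar>e\<bar> \<le> r \<longrightarrow> 1/5 \<le> y \<longrightarrow> y \<le> 3/5 \<longrightarrow> 0 <
      (\<lambda>p. 1/50 * a3 (fst p) (snd p) - \<bar>a2 (fst p) (snd p) - cc (snd p) * a3 (fst p) (snd p)\<bar>) (e, y)) (at_right 0)"
    by (rule coeff_tube, intro continuous_intros c) (auto simp: coeffs_0)
  moreover have "eventually (\<lambda>r. \<forall>e y. \<bar>e\<bar> \<le> r \<longrightarrow> 1/5 \<le> y \<longrightarrow> y \<le> 3/5 \<longrightarrow> 0 <
      (\<lambda>p. 1/50000 * a3 (fst p) (snd p) - \<bar>a0 (fst p) (snd p)\<bar>) (e, y)) (at_right 0)"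
    by (rule coeff_tube, intro continuous_intros c) (auto simp: coeffs_0)
  ultimately show ?thesis using a3_pos by eventually_elim simp
qed

text \<open>Twice the coefficient is \<open>- s + sqrt (s\<^sup>2 + d)\<close> with \<open>s\<close>
  between \<open>- 41/100\<close> and \<open>7/100\<close> and
  \<open>\<bar>d\<bar> \<le> 1/2500 = (1/50)\<^sup>2\<close>. Near the collision of the two roots
  the radicand may be negative; \<open>sqrt\<close> is odd, so \<open>- 1/50\<close> is still a
  lower bound, and \<open>s\<^sup>2 + d \<le> (\<bar>s\<bar> + 1/50)\<^sup>2\<close> gives the upper
  one.\<close>

lemma W1_coeff_range:
  assumes g: "\<bar>g + y\<bar> < 1/20" and y: "1/3 \<le> y" "y \<le> 1/2" and A: "0 < a3 e y"
    and A2: "\<bar>a2 e y - cc y * a3 e y\<bar> < 1/50 * a3 e y" and A0: "\<bar>a0 e y\<bar> < 1/50000 * a3 e y"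
  shows "- 1/10 \<le> W1_coeff e y g" "W1_coeff e y g \<le> 9/20"
proof -
  define s where "s = a2 e y / a3 e y + g"
  define d where "d = 4 * a0 e y / (a3 e y * g)"
  have W: "W1_coeff e y g = 1/2 * (- s + sqrt (s^2 + d))" by (simp add: W1_coeff_def Delta_Q_def s_def d_def)
  have "a2 e y - cc y * a3 e y < 1/50 * a3 e y" "- (a2 e y - cc y * a3 e y) < 1/50 * a3 e y" using A2 by linarith+
  then have "a2 e y < (cc y + 1/50) * a3 e y" "(cc y - 1/50) * a3 e y < a2 e y" unfolding ring_distribs by linarith+
  then have "a2 e y / a3 e y < cc y + 1/50" "cc y - 1/50 < a2 e y / a3 e y" using A by (simp_all only: pos_divide_less_eq pos_less_divide_eq)
  then have s: "- 41/100 \<le> s" "s \<le> 7/100" unfolding s_def cc_def using g y by linarith+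
  have g': "1/5 \<le> \<bar>g\<bar>" using g y by linarith
  have "\<bar>d\<bar> = 4 * \<bar>a0 e y\<bar> / (a3 e y * \<bar>g\<bar>)" using A by (simp add: d_def abs_mult)
  also have "\<dots> \<le> 4 * (1/50000 * a3 e y) / (a3 e y * (1/5))"
    using A A0 g' by (intro frac_le mult_left_mono mult_pos_pos) auto
  also have "\<dots> = 1/2500" using A by simp
  finally have d: "- 1/2500 \<le> d" "d \<le> 1/2500" by (simp_all add: abs_le_iff)
  have "s^2 + d \<le> (\<bar>s\<bar> + 1/50)^2" using d by (simp add: power2_eq_square algebra_simps)
  from real_sqrt_le_mono[OF this] have u: "sqrt (s^2 + d) \<le> \<bar>s\<bar> + 1/50" by simp
  have "- ((1/50)^2) \<le> s^2 + d"
  proof -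
    have "(1/50)^2 = (1/2500::real)" by (simp add: power2_eq_square)
    then show ?thesis using d(1) zero_le_power2[of s] by linarith
  qed
  from real_sqrt_le_mono[OF this] have l: "- 1/50 \<le> sqrt (s^2 + d)" by (simp add: real_sqrt_minus)
  show "- 1/10 \<le> W1_coeff e y g" "W1_coeff e y g \<le> 9/20"
  proof -
    define r where "r = sqrt (s^2 + d)"
    have "- 1/50 \<le> r" "r \<le> \<bar>s\<bar> + 1/50" using u l by (simp_all add: r_def)
    moreover have "\<bar>s\<bar> \<le> 41/100" using s by (simp add: abs_le_iff)
    ultimately have "- 1/5 \<le> - s + r" "- s + r \<le> 9/10" using s by linarith+
    then show "- 1/10 \<le> W1_coeff e y g" "W1_coeff e y g \<le> 9/20" unfolding W r_def[symmetric] by simp_all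
  qed
qed

section \<open>Choice of the constants and conclusion\<close>

theorem theorem2p5:
  fixes \<delta>0 :: real
  assumes "admissible_delta0 \<delta>0"
  shows "\<exists>\<epsilon>0>0. \<forall>\<epsilon>\<in>{0<..\<epsilon>0}. \<forall>D W d2 w1.
    rlp_global \<epsilon> (xbar \<delta>0 \<epsilon>) D W \<longrightarrow>
    ((\<lambda>x. x powr (2 / (1 + eta \<epsilon>)) * D x) \<longlongrightarrow> d2) at_top \<longrightarrow> 0 < d2 \<longrightarrow>
    ((\<lambda>x. - (x powr (1 / (1 + eta \<epsilon>)) * (1 - W x))) \<longlongrightarrow> w1) at_top \<longrightarrow> w1 < 0 \<longrightarrow>
    (\<exists>Yms<0. \<exists>d w chi.
       ext_solution \<epsilon> d2 w1 Yms d w chi \<and>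
       (\<forall>Y0<0. \<forall>d' w' chi'. ext_solution \<epsilon> d2 w1 Y0 d' w' chi' \<longrightarrow>
          (\<forall>Y\<in>{max Yms Y0<..0}. d' Y = d Y \<and> w' Y = w Y \<and> chi' Y = chi Y)) \<and>
       filterlim w at_top (at_right Yms) \<and>
       filterlim d at_top (at_right Yms) \<and>
       (\<forall>Y\<in>{Yms<..0}. 0 < chi Y) \<and>
       (chi \<longlongrightarrow> 0) (at_right Yms))"
proof -
  have small: "eventually (\<lambda>\<epsilon>. 0 < \<epsilon> \<and> \<epsilon> < (1/100::real)) (at_right 0)"
    unfolding eventually_at_right_field by (rule exI[of _ "1/100"]) auto
  have \<delta>0: "0 < \<delta>0" and xm: "eventually (\<lambda>\<epsilon>. 2 + \<delta>0 < xmax \<epsilon>) (at_right 0)"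
    using assms unfolding admissible_delta0_def by (auto elim: eventually_mono)
  \<comment> \<open>The window lies below \<open>xmax\<close>, which is at most 4.\<close>
  have "\<delta>0 < 2"
    using eventually_happens[OF eventually_conj[OF small xm]] xmax_omega_value(2) by fastforce
  \<comment> \<open>\<open>(1 - \<omega>1) / \<omega>1 = 1 + \<delta>0 / 2\<close> exceeds
    \<open>q\<close>, and \<open>\<omega>1\<close> exceeds \<open>1 / (2 + \<delta>0)\<close>, the
    largest sonic value of the window at \<open>\<epsilon> = 0\<close>. Both gaps leave room for the
    perturbation in \<open>\<epsilon>\<close>.\<close>
  define q where "q = 1 + \<delta>0 / 4"
  define \<omega>1 where "\<omega>1 = 1 / (2 + \<delta>0 / 2)"
  have q: "1 < q" "q \<le> 3/2" using \<delta>0 \<open>\<delta>0 < 2\<close> by (auto simp: q_def)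
  have \<omega>1: "0 < \<omega>1" "\<omega>1 < 1/2" using \<delta>0 by (auto simp: \<omega>1_def field_simps)
  have etal: "(eta \<longlongrightarrow> 0) (at_right 0)"
  proof -
    have "((\<lambda>\<epsilon>. 2 * \<epsilon> / (1 - \<epsilon>)) \<longlongrightarrow> 2 * 0 / (1 - 0)) (at_right (0::real))" by (intro tendsto_intros) auto
    then show ?thesis by (simp add: eta_def[abs_def])
  qed
  have e1: "eventually (\<lambda>\<epsilon>. 1 / (2 + \<delta>0)^2 < H0 \<epsilon> \<omega>1 * \<omega>1 powr eta \<epsilon>) (at_right 0)"
  proof -
    have "((\<lambda>\<epsilon>. ((1 + 3 * \<epsilon>) * \<omega>1^2 + 4 * \<epsilon> * \<omega>1 + \<epsilon>^2 - \<epsilon>) * \<omega>1 powr eta \<epsilon>) \<longlongrightarrow>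
        ((1 + 3 * 0) * \<omega>1^2 + 4 * 0 * \<omega>1 + 0^2 - 0) * \<omega>1 powr 0) (at_right 0)"
      by (intro tendsto_intros etal) (use \<omega>1 in auto)
    then have "((\<lambda>\<epsilon>. H0 \<epsilon> \<omega>1 * \<omega>1 powr eta \<epsilon>) \<longlongrightarrow> \<omega>1^2) (at_right 0)"
      using \<omega>1 by (simp add: H0_def[abs_def])
    moreover have "1 / (2 + \<delta>0)^2 < \<omega>1^2"
      unfolding \<omega>1_def power_one_over[symmetric] using \<delta>0 by (intro power_strict_mono) (auto simp: field_simps)
    ultimately show ?thesis by (rule order_tendstoD)
  qed
  have cH: "continuous_on S (\<lambda>p. H0 (fst p) (snd p))" for S unfolding H0_def by (intro continuous_intros)
  have e2: "eventually (\<lambda>\<epsilon>. \<forall>e \<omega>. \<bar>e\<bar> \<le> \<epsilon> \<longrightarrow> \<omega> \<in> {1/3..\<omega>1} \<longrightarrow> 0 < (\<lambda>p. (1 - snd p)^2 - q^2 * H0 (fst p) (snd p)) (e, \<omega>)) (at_right 0)"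
  proof (rule eventually_tube)
    show "continuous_on ({- 1..1} \<times> {1/3..\<omega>1}) (\<lambda>p. (1 - snd p)^2 - q^2 * H0 (fst p) (snd p))"
      by (intro continuous_intros cH)
    fix \<omega> assume \<omega>: "\<omega> \<in> {1/3..\<omega>1}"
    have "q * \<omega> < 1 - \<omega>"
    proof -
      have "(2 + \<delta>0 / 2) * \<omega> \<le> (2 + \<delta>0 / 2) * \<omega>1" using \<omega> \<delta>0 by (intro mult_left_mono) auto
      also have "\<dots> = 1" using \<delta>0 by (simp add: \<omega>1_def)
      finally have "(q + 1) * \<omega> + \<delta>0 / 4 * \<omega> \<le> 1" by (simp add: q_def algebra_simps)
      moreover have "0 < \<delta>0 / 4 * \<omega>" using \<delta>0 \<omega> by (intro mult_pos_pos) auto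
      ultimately show ?thesis by (simp add: algebra_simps)
    qed
    then have "(q * \<omega>)^2 < (1 - \<omega>)^2" using q \<omega> by (intro power_strict_mono) auto
    then show "0 < (1 - snd (0, \<omega>))^2 - q^2 * H0 (fst (0, \<omega>)) (snd (0, \<omega>))"
      using \<omega> by (simp add: coeffs_0 power_mult_distrib)
  qed auto
  have e3: "eventually (\<lambda>\<epsilon>. \<forall>e \<omega>. \<bar>e\<bar> \<le> \<epsilon> \<longrightarrow> \<omega> \<in> {1/3..\<omega>1} \<longrightarrow> 0 < (\<lambda>p. 11/10 * (snd p)^2 - H0 (fst p) (snd p)) (e, \<omega>)) (at_right 0)"
    by (rule eventually_tube[where c = 1], simp, simp, intro continuous_intros cH) (auto simp: coeffs_0)
  have e4: "eventually (\<lambda>\<epsilon>. 8 * \<epsilon> < 1 - \<epsilon> - 1 / q^2) (at_right 0)"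
  proof -
    have "((\<lambda>\<epsilon>. 1 - \<epsilon> - 1 / q^2 - 8 * \<epsilon>) \<longlongrightarrow> 1 - 0 - 1 / q^2 - 8 * 0) (at_right (0::real))" by (intro tendsto_intros)
    moreover have "0 < 1 - 0 - 1 / q^2 - 8 * (0::real)" using q by (simp add: power_gt1_lemma one_less_power)
    ultimately have "eventually (\<lambda>\<epsilon>. 0 < 1 - \<epsilon> - 1 / q^2 - 8 * \<epsilon>) (at_right 0)" by (rule order_tendstoD)
    then show ?thesis by eventually_elim simp
  qed
  have "eventually (\<lambda>\<epsilon>. \<forall>D W d2 w1.
    rlp_global \<epsilon> (xbar \<delta>0 \<epsilon>) D W \<longrightarrow>
    ((\<lambda>x. x powr (2 / (1 + eta \<epsilon>)) * D x) \<longlongrightarrow> d2) at_top \<longrightarrow> 0 < d2 \<longrightarrow>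
    ((\<lambda>x. - (x powr (1 / (1 + eta \<epsilon>)) * (1 - W x))) \<longlongrightarrow> w1) at_top \<longrightarrow>
    0 < \<epsilon> \<and> \<epsilon> \<le> 1/4 \<and> 8 * \<epsilon> \<le> 1 - \<epsilon> - 1 / q^2 \<and> q < - w1 * d2 powr (eta \<epsilon> / 2) \<and>
    1 + \<epsilon> * q^2 < (1 + 4 * \<epsilon>) * d2 powr (1 + eta \<epsilon>)) (at_right 0)" (is "eventually ?Q _")
    using small xm xbar_window ghost_value_near slope_pos cubic_coeff_near e1 e2 e3 e4
  proof eventually_elim
    case (elim \<epsilon>)
    note \<epsilon> = elim(1)
    define xs where "xs = xbar \<delta>0 \<epsilon>"
    note xmv = xmax_omega_value[OF \<epsilon>[THEN conjunct1] \<epsilon>[THEN conjunct2]]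
    have xs: "2 + \<delta>0 \<le> xs" "xs \<le> xmax \<epsilon>" "2 \<le> xs" "xs \<le> 4" using elim(2,3) xmv \<delta>0 unfolding xs_def by force+
    \<comment> \<open>The sonic product increases with \<open>\<omega>\<close>. Its value at 1/3
      belongs to \<open>xmax\<close>, and by \<open>e1\<close> its value at \<open>\<omega>1\<close>
      is above the one belonging to \<open>2 + \<delta>0\<close>; this encloses
      \<open>\<omega>\<close>.\<close>
    have win: "1/3 \<le> \<omega>" "\<omega> \<le> \<omega>1" if v: "omega_value \<epsilon> xs \<omega>" for \<omega>
    proof -
      note o = omega_value_eq[OF v] and m = omega_value_eq[OF xmv(3)]
      have p: "0 < H0 \<epsilon> \<omega> * \<omega> powr eta \<epsilon>" "1 / (xmax \<epsilon>)^2 \<le> H0 \<epsilon> \<omega> * \<omega> powr eta \<epsilon>" "H0 \<epsilon> \<omega> * \<omega> powr eta \<epsilon> \<le> 1 / (2 + \<delta>0)^2"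
        unfolding o(3) using xs \<delta>0 by (auto intro!: divide_left_mono power_mono mult_pos_pos)
      show "1/3 \<le> \<omega>"
        using sonic_product_less[of \<epsilon> \<omega> "1/3"] p m \<epsilon> o by (cases "\<omega> < 1/3") auto
      show "\<omega> \<le> \<omega>1"
      proof (rule ccontr)
        assume "\<not> \<omega> \<le> \<omega>1"
        moreover have "0 < H0 \<epsilon> \<omega>1 * \<omega>1 powr eta \<epsilon>" using elim(7) \<delta>0 by (intro less_trans[OF _ elim(7)]) auto
        ultimately have "H0 \<epsilon> \<omega>1 * \<omega>1 powr eta \<epsilon> < H0 \<epsilon> \<omega> * \<omega> powr eta \<epsilon>" using \<epsilon> \<omega>1 by (intro sonic_product_less) auto
        then show False using p(3) elim(7) by simp
      qed
    qed
    show ?case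
    proof (intro allI impI)
      fix D W d2 w1
      assume sol: "rlp_global \<epsilon> (xbar \<delta>0 \<epsilon>) D W"
        and d2: "((\<lambda>x. x powr (2 / (1 + eta \<epsilon>)) * D x) \<longlongrightarrow> d2) at_top" "0 < d2"
        and w1: "((\<lambda>x. - (x powr (1 / (1 + eta \<epsilon>)) * (1 - W x))) \<longlongrightarrow> w1) at_top"
      have "\<exists>\<omega>. omega_value \<epsilon> xs \<omega> \<and> (1 - \<omega>) / sqrt (H0 \<epsilon> \<omega>) \<le> - w1 * d2 powr (eta \<epsilon> / 2) \<and>
        \<omega>^2 / H0 \<epsilon> \<omega> * exp (1 - \<omega>) \<le> d2 powr (1 + eta \<epsilon>)"
      proof (rule rlp_global_limits[OF _ _ sol[folded xs_def] d2 w1])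
        fix \<omega> g assume v: "omega_value \<epsilon> xs \<omega>" "ghost_value \<epsilon> xs g"
        note wr = win[OF v(1)]
        have g: "\<bar>g + \<omega>\<bar> < 1/20" using elim(4) xs v by blast
        have a: "0 < a3 \<epsilon> \<omega>" "\<bar>a2 \<epsilon> \<omega> - cc \<omega> * a3 \<epsilon> \<omega>\<bar> < 1/50 * a3 \<epsilon> \<omega>" "\<bar>a0 \<epsilon> \<omega>\<bar> < 1/50000 * a3 \<epsilon> \<omega>"
          using elim(6)[rule_format, of \<epsilon> \<omega>] wr \<omega>1 \<epsilon> by auto
        have "- 1/10 \<le> W1_coeff \<epsilon> \<omega> g" "W1_coeff \<epsilon> \<omega> g \<le> 9/20"
          using W1_coeff_range[OF g wr(1) _ a] wr \<omega>1 by auto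
        then have "0 < slope \<epsilon> \<omega> (W1_coeff \<epsilon> \<omega> g)" using elim(5)[rule_format, of \<epsilon> \<omega>] wr \<omega>1 \<epsilon> by auto
        then show "\<omega> < 1 \<and> 0 < slope \<epsilon> \<omega> (W1_coeff \<epsilon> \<omega> g)" using wr \<omega>1 by simp
      qed (use \<epsilon> in auto)
      then obtain \<omega> where v: "omega_value \<epsilon> xs \<omega>" and Q: "(1 - \<omega>) / sqrt (H0 \<epsilon> \<omega>) \<le> - w1 * d2 powr (eta \<epsilon> / 2)"
        and M: "\<omega>^2 / H0 \<epsilon> \<omega> * exp (1 - \<omega>) \<le> d2 powr (1 + eta \<epsilon>)" by blast
      note wr = win[OF v] and o = omega_value_eq[OF v]
      define H where "H = H0 \<epsilon> \<omega>"
      have "0 < H * \<omega> powr eta \<epsilon>" unfolding H_def o(3) using o(1) by simp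
      then have H: "0 < H" using o(2) by (simp add: zero_less_mult_iff)
      have H1: "q^2 * H < (1 - \<omega>)^2" "H < 11/10 * \<omega>^2" using elim(8)[rule_format, of \<epsilon> \<omega>] elim(9)[rule_format, of \<epsilon> \<omega>] \<epsilon> wr
        by (auto simp: H_def)
      have "q < (1 - \<omega>) / sqrt H"
      proof -
        have "sqrt (q^2 * H) < sqrt ((1 - \<omega>)^2)" by (rule real_sqrt_less_mono[OF H1(1)])
        then have "q * sqrt H < 1 - \<omega>" using q wr \<omega>1 by (simp add: real_sqrt_mult)
        then show ?thesis using H by (simp add: pos_less_divide_eq)
      qed
      then have Q': "q < - w1 * d2 powr (eta \<epsilon> / 2)" using Q by (simp add: H_def)
      \<comment> \<open>The bound 11/10 from \<open>e3\<close> and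
        \<open>exp (1 - \<omega>) \<ge> 2 - \<omega> \<ge> 3/2\<close> give 15/11, against
        \<open>1 + \<epsilon> q\<^sup>2 \<le> 1 + 9/400\<close>.\<close>
      have "10/11 * (3/2) \<le> \<omega>^2 / H * exp (1 - \<omega>)"
      proof (rule mult_mono)
        show "10/11 \<le> \<omega>^2 / H" using H1 H by (simp add: pos_le_divide_eq)
        show "3/2 \<le> exp (1 - \<omega>)" using exp_ge_add_one_self[of "1 - \<omega>"] wr \<omega>1 by simp
      qed (use H in auto)
      then have M': "15/11 \<le> d2 powr (1 + eta \<epsilon>)" using M[folded H_def] by (simp only: times_divide_times_eq)
      have "\<epsilon> * q^2 \<le> 1/100 * (3/2)^2" using \<epsilon> q by (intro mult_mono power_mono) auto
      then have "1 + \<epsilon> * q^2 < 1 * (15/11)" by (simp add: power2_eq_square)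
      also have "\<dots> \<le> (1 + 4 * \<epsilon>) * d2 powr (1 + eta \<epsilon>)" using M' \<epsilon> by (intro mult_mono) auto
      finally show "0 < \<epsilon> \<and> \<epsilon> \<le> 1/4 \<and> 8 * \<epsilon> \<le> 1 - \<epsilon> - 1 / q^2 \<and> q < - w1 * d2 powr (eta \<epsilon> / 2) \<and>
        1 + \<epsilon> * q^2 < (1 + 4 * \<epsilon>) * d2 powr (1 + eta \<epsilon>)" using \<epsilon> elim(10) Q' by simp
    qed
  qed
  then obtain b where b: "0 < b" and P: "\<forall>\<epsilon>>0. \<epsilon> < b \<longrightarrow> ?Q \<epsilon>"
    unfolding eventually_at_right_field by (elim exE conjE) (rule that)
  show ?thesis
  proof (rule exI[of _ "b / 2"], intro conjI ballI allI impI)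
    show "0 < b / 2" using b by simp
    fix \<epsilon> D W d2 w1
    assume \<epsilon>: "\<epsilon> \<in> {0<..b / 2}" and sol: "rlp_global \<epsilon> (xbar \<delta>0 \<epsilon>) D W"
      "((\<lambda>x. x powr (2 / (1 + eta \<epsilon>)) * D x) \<longlongrightarrow> d2) at_top" "0 < d2"
      "((\<lambda>x. - (x powr (1 / (1 + eta \<epsilon>)) * (1 - W x))) \<longlongrightarrow> w1) at_top"
    have "0 < \<epsilon>" "\<epsilon> < b" using \<epsilon> b by auto
    from P[rule_format, OF this sol] sol(3) q(1)
    show "\<exists>Yms<0. \<exists>d w chi.
       ext_solution \<epsilon> d2 w1 Yms d w chi \<and>
       (\<forall>Y0<0. \<forall>d' w' chi'. ext_solution \<epsilon> d2 w1 Y0 d' w' chi' \<longrightarrow>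
          (\<forall>Y\<in>{max Yms Y0<..0}. d' Y = d Y \<and> w' Y = w Y \<and> chi' Y = chi Y)) \<and>
       filterlim w at_top (at_right Yms) \<and>
       filterlim d at_top (at_right Yms) \<and>
       (\<forall>Y\<in>{Yms<..0}. 0 < chi Y) \<and>
       (chi \<longlongrightarrow> 0) (at_right Yms)"
      by (intro ext_problem_blowup) auto
  qed
qed

end
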